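(* Every cosheaf $\widehat F$ with finite-dimensional costalks that is constructible with respect to a Thom–Mather stratification $\{X_\alpha\}$ of $X$ determines a representation of the entrance path category $$\mathrm{Entr}(X,\{X_\alpha\})\to\mathbf{vect}.$$
   Context: $\mathbf{vect}$ is the category of finite-dimensional vector spaces over a field $k$; cosheaves take values in the category $\mathbf{Vect}$ of $k$-vector spaces. A representation of a category here is a functor from it to vector spaces. **Thom–Mather stratified space.** A Hausdorff, locally compact topological space $X$ with countable basis for its topology and with some smooth structure; a decomposition (locally finite partition into locally closed pieces satisfying the axiom of the frontier: if $\overline{X_\tau}\cap X_\sigma\neq\emptyset$ then $X_\sigma\subseteq\overline{X_\tau}$) into topological manifolds $\{X_\sigma\}$, called strata; and a family of control data $\{(T_\sigma,\pi_\sigma,d_\sigma)\}$, where $T_\sigma$ is an open tubular neighborhood of $X_\sigma$, $\pi_\sigma:T_\sigma\to X_\sigma$ is a continuous retraction and $d_\sigma:T_\sigma\to[0,\infty)$ is a continuous distance function. The following must hold: $X_\sigma=d_\sigma^{-1}(0)$ for all $\sigma$; for any pair of strata, with $T_{\sigma,\tau}=T_\sigma\cap X_\tau$ and $\pi_{\sigma,\tau},d_{\sigma,\tau}$ the restrictions of $\pi_\sigma,d_\sigma$ to $T_{\sigma,\tau}$, the map $(\pi_{\sigma,\tau},d_{\sigma,\tau}):T_{\sigma,\tau}\to X_\sigma\times(0,\infty)$ is a smooth submersion; and for any three strata $\pi_{\sigma,\tau}\circ\pi_{\tau,\lambda}=\pi_{\sigma,\lambda}$ and $d_{\sigma,\tau}\circ\pi_{\tau,\lambda}=d_{\sigma,\lambda}$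 whenever both sides are defined. **Entrance path category.** $\mathrm{Entr}(X,\{X_\alpha\})$ has the points of $X$ as objects, and its morphisms are homotopy classes (relative to endpoints) of entrance paths. An entrance path is a path $\gamma(t)$ such that the dimension of the stratum containing $\gamma(t)$ is non-increasing with $t$. Homotopies $h(s,t)$ are required to be entrance paths in $t$ for every fixed $s$. **Cosheaf.** A functor $\widehat F:\mathbf{Open}(X)\to\mathbf{Vect}$ on the poset of open sets such that for every open $U$ and every open cover $\mathcal U=\{U_i\}$ of $U$ the canonical map $\varinjlim_{I\in N(\mathcal U)}\widehat F(U_I)\to\widehat F(U)$ is an isomorphism. Here $N(\mathcal U)$ is the nerve: its objects are the finite sets $I$ of indices with $U_I=\bigcap_{i\in I}U_i\ne\emptyset$, with a unique arrow $I\to J$ when $J\subseteq I$. The costalk at $x$ is $\widehat F_x=\varprojlim_{U\ni x}\widehat F(U)$. **Constructible.** A sheaf is constructible with respect to a stratification if its restriction to each stratum is locally constant. A cosheaf with finite-dimensional costalks is constructible if its linear dual (the sheaf obtained by post-composing with $\mathrm{Hom}(-,k)$) is a constructible sheaf. *)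

theory Defs
  imports "HOL-Analysis.Analysis" "HOL-Algebra.Module" "HOL-Algebra.AbelCoset"
begin

section \<open>Vector spaces, limits and colimits\<close>

text \<open>A vector space over a field K is a module over K in the sense of HOL-Algebra. The ring
  multiplication and unit carried by the record type \<^type>\<open>module\<close> are irrelevant.\<close>

definition vspace :: "'k ring \<Rightarrow> ('k, 'v) module \<Rightarrow> bool" where
  "vspace K M \<longleftrightarrow> Ring.field K \<and> Module.module K M"

definition fin_dim :: "'k ring \<Rightarrow> ('k, 'v) module \<Rightarrow> bool" where
  "fin_dim K M \<longleftrightarrow> (\<exists>B. finite B \<and> B \<subseteq> carrier M \<and>
     (\<forall>v\<in>carrier M. \<exists>a \<in> B \<rightarrow> carrier K. v = finsum M (\<lambda>b. a b \<odot>\<^bsub>M\<^esub> b) B))"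

definition linear_map ::
    "'k ring \<Rightarrow> ('k, 'v) module \<Rightarrow> ('k, 'w) module \<Rightarrow> ('v \<Rightarrow> 'w) \<Rightarrow> bool" where
  "linear_map K M N f \<longleftrightarrow> f \<in> carrier M \<rightarrow> carrier N \<and>
     (\<forall>v\<in>carrier M. \<forall>w\<in>carrier M. f (v \<oplus>\<^bsub>M\<^esub> w) = f v \<oplus>\<^bsub>N\<^esub> f w) \<and>
     (\<forall>a\<in>carrier K. \<forall>v\<in>carrier M. f (a \<odot>\<^bsub>M\<^esub> v) = a \<odot>\<^bsub>N\<^esub> f v)"

definition linear_iso ::
    "'k ring \<Rightarrow> ('k, 'v) module \<Rightarrow> ('k, 'w) module \<Rightarrow> ('v \<Rightarrow> 'w) \<Rightarrow> bool" where
  "linear_iso K M N f \<longleftrightarrow> linear_map K M N f \<and> bij_betw f (carrier M) (carrier N)"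

definition prod_space :: "'i set \<Rightarrow> ('i \<Rightarrow> ('k, 'v) module) \<Rightarrow> ('k, 'i \<Rightarrow> 'v) module" where
  "prod_space A M =
     \<lparr>carrier = (\<Pi>\<^sub>E i\<in>A. carrier (M i)),
      monoid.mult = (\<lambda>f g. undefined),
      one = undefined,
      zero = (\<lambda>i\<in>A. \<zero>\<^bsub>M i\<^esub>),
      add = (\<lambda>f g. \<lambda>i\<in>A. f i \<oplus>\<^bsub>M i\<^esub> g i),
      smult = (\<lambda>a f. \<lambda>i\<in>A. a \<odot>\<^bsub>M i\<^esub> f i)\<rparr>"

definition direct_sum :: "'i set \<Rightarrow> ('i \<Rightarrow> ('k, 'v) module) \<Rightarrow> ('k, 'i \<Rightarrow> 'v) module" where
  "direct_sum A M = (prod_space A M)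
     \<lparr>carrier := {f \<in> carrier (prod_space A M). finite {i\<in>A. f i \<noteq> \<zero>\<^bsub>M i\<^esub>}}\<rparr>"

definition inj_sum :: "'i set \<Rightarrow> ('i \<Rightarrow> ('k, 'v) module) \<Rightarrow> 'i \<Rightarrow> 'v \<Rightarrow> 'i \<Rightarrow> 'v" where
  "inj_sum A M i v = (\<lambda>j\<in>A. if j = i then v else \<zero>\<^bsub>M j\<^esub>)"

definition gen_submodule :: "'k ring \<Rightarrow> ('k, 'v) module \<Rightarrow> 'v set \<Rightarrow> 'v set" where
  "gen_submodule K M B = \<Inter>{N. submodule N K M \<and> B \<subseteq> N}"

definition quot_space :: "('k, 'v) module \<Rightarrow> 'v set \<Rightarrow> ('k, 'v set) module" where
  "quot_space M N =
     \<lparr>carrier = a_rcosets\<^bsub>M\<^esub> N,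
      monoid.mult = (\<lambda>C D. undefined),
      one = undefined,
      zero = N,
      add = (\<lambda>C D. C <+>\<^bsub>M\<^esub> D),
      smult = (\<lambda>a C. \<Union>v\<in>C. N +>\<^bsub>M\<^esub> (a \<odot>\<^bsub>M\<^esub> v))\<rparr>"

text \<open>Diagrams indexed by a thin category: objects A, an arrow from i to j iff R i j, spaces
  D i and transition maps m i j. The colimit is the quotient of the direct sum by the
  subspace generated by the differences of v in D i and its image in D j.\<close>

definition colim_rels ::
    "'i set \<Rightarrow> ('i \<Rightarrow> 'i \<Rightarrow> bool) \<Rightarrow> ('i \<Rightarrow> ('k, 'v) module) \<Rightarrow> ('i \<Rightarrow> 'i \<Rightarrow> 'v \<Rightarrow> 'v)
      \<Rightarrow> ('i \<Rightarrow> 'v) set" where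
  "colim_rels A R D m =
     {inj_sum A D i v \<ominus>\<^bsub>direct_sum A D\<^esub> inj_sum A D j (m i j v) | i j v.
        i \<in> A \<and> j \<in> A \<and> R i j \<and> v \<in> carrier (D i)}"

definition colim_kernel ::
    "'k ring \<Rightarrow> 'i set \<Rightarrow> ('i \<Rightarrow> 'i \<Rightarrow> bool) \<Rightarrow> ('i \<Rightarrow> ('k, 'v) module)
      \<Rightarrow> ('i \<Rightarrow> 'i \<Rightarrow> 'v \<Rightarrow> 'v) \<Rightarrow> ('i \<Rightarrow> 'v) set" where
  "colim_kernel K A R D m = gen_submodule K (direct_sum A D) (colim_rels A R D m)"

definition colim ::
    "'k ring \<Rightarrow> 'i set \<Rightarrow> ('i \<Rightarrow> 'i \<Rightarrow> bool) \<Rightarrow> ('i \<Rightarrow> ('k, 'v) module)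
      \<Rightarrow> ('i \<Rightarrow> 'i \<Rightarrow> 'v \<Rightarrow> 'v) \<Rightarrow> ('k, ('i \<Rightarrow> 'v) set) module" where
  "colim K A R D m = quot_space (direct_sum A D) (colim_kernel K A R D m)"

definition colim_in ::
    "'k ring \<Rightarrow> 'i set \<Rightarrow> ('i \<Rightarrow> 'i \<Rightarrow> bool) \<Rightarrow> ('i \<Rightarrow> ('k, 'v) module)
      \<Rightarrow> ('i \<Rightarrow> 'i \<Rightarrow> 'v \<Rightarrow> 'v) \<Rightarrow> 'i \<Rightarrow> 'v \<Rightarrow> ('i \<Rightarrow> 'v) set" where
  "colim_in K A R D m i v = colim_kernel K A R D m +>\<^bsub>direct_sum A D\<^esub> inj_sum A D i v"

text \<open>The map out of the colimit induced by a cocone of linear maps c i from D i to N. The sum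
  runs over the support because \<^const>\<open>finsum\<close> over an infinite set is zero; all
  representatives of a coset give the same value when c is a cocone.\<close>

definition colim_out ::
    "'i set \<Rightarrow> ('i \<Rightarrow> ('k, 'v) module) \<Rightarrow> ('k, 'w) module \<Rightarrow> ('i \<Rightarrow> 'v \<Rightarrow> 'w)
      \<Rightarrow> ('i \<Rightarrow> 'v) set \<Rightarrow> 'w" where
  "colim_out A D N c C =
     the_elem ((\<lambda>f. finsum N (\<lambda>i. c i (f i)) {i\<in>A. f i \<noteq> \<zero>\<^bsub>D i\<^esub>}) ` C)"


section \<open>Presheaves and cosheaves of vector spaces\<close>

text \<open>A diagram on the poset of open sets. For a precosheaf, \<open>arrow F U V\<close> is the extension
  map from U to V when U is contained in V; for a presheaf, it is the restriction map from U
  to V when V is contained in U.\<close>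

record ('x, 'k, 'v) open_diagram =
  at_open :: "'x set \<Rightarrow> ('k, 'v) module"
  arrow :: "'x set \<Rightarrow> 'x set \<Rightarrow> 'v \<Rightarrow> 'v"

definition precosheaf :: "'x topology \<Rightarrow> 'k ring \<Rightarrow> ('x, 'k, 'v) open_diagram \<Rightarrow> bool" where
  "precosheaf X K F \<longleftrightarrow>
     (\<forall>U. openin X U \<longrightarrow> vspace K (at_open F U)) \<and>
     (\<forall>U V. openin X U \<and> openin X V \<and> U \<subseteq> V \<longrightarrow>
        linear_map K (at_open F U) (at_open F V) (arrow F U V)) \<and>
     (\<forall>U. openin X U \<longrightarrow> (\<forall>v\<in>carrier (at_open F U). arrow F U U v = v)) \<and>
     (\<forall>U V W. openin X U \<and> openin X V \<and> openin X W \<and> U \<subseteq> V \<and> V \<subseteq> W \<longrightarrow>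
        (\<forall>v\<in>carrier (at_open F U). arrow F V W (arrow F U V v) = arrow F U W v))"

text \<open>Covers are sets of open sets, indexed by themselves.\<close>

definition nerve :: "'x set set \<Rightarrow> 'x set set set" where
  "nerve \<U> = {I. I \<subseteq> \<U> \<and> finite I \<and> I \<noteq> {} \<and> \<Inter>I \<noteq> {}}"

definition cosheaf :: "'x topology \<Rightarrow> 'k ring \<Rightarrow> ('x, 'k, 'v) open_diagram \<Rightarrow> bool" where
  "cosheaf X K F \<longleftrightarrow> precosheaf X K F \<and>
     (\<forall>U \<U>. openin X U \<and> (\<forall>V\<in>\<U>. openin X V) \<and> \<Union>\<U> = U \<longrightarrow>
        linear_iso K
          (colim K (nerve \<U>) (\<lambda>I J. J \<subseteq> I) (\<lambda>I. at_open F (\<Inter>I)) (\<lambda>I J. arrow F (\<Inter>I) (\<Inter>J)))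
          (at_open F U)
          (colim_out (nerve \<U>) (\<lambda>I. at_open F (\<Inter>I)) (at_open F U) (\<lambda>I. arrow F (\<Inter>I) U)))"

abbreviation open_nbhds :: "'x topology \<Rightarrow> 'x \<Rightarrow> 'x set set" where
  "open_nbhds X x \<equiv> {U. openin X U \<and> x \<in> U}"

text \<open>The costalk is the limit over open neighbourhoods, realised as the space of compatible
  families; the projection to \<open>at_open F U\<close> is evaluation at U.\<close>

definition costalk :: "'x topology \<Rightarrow> ('x, 'k, 'v) open_diagram \<Rightarrow> 'x
    \<Rightarrow> ('k, 'x set \<Rightarrow> 'v) module" where
  "costalk X F x = (prod_space (open_nbhds X x) (at_open F))
     \<lparr>carrier := {s \<in> carrier (prod_space (open_nbhds X x) (at_open F)).
        \<forall>U\<in>open_nbhds X x. \<forall>V\<in>open_nbhds X x. U \<subseteq> V \<longrightarrow> arrow F U V (s U) = s V}\<rparr>"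

definition stalk :: "'x topology \<Rightarrow> 'k ring \<Rightarrow> ('x, 'k, 's) open_diagram \<Rightarrow> 'x
    \<Rightarrow> ('k, ('x set \<Rightarrow> 's) set) module" where
  "stalk X K G x = colim K (open_nbhds X x) (\<lambda>U V. V \<subseteq> U) (at_open G) (arrow G)"

definition germ :: "'x topology \<Rightarrow> 'k ring \<Rightarrow> ('x, 'k, 's) open_diagram \<Rightarrow> 'x \<Rightarrow> 'x set
    \<Rightarrow> 's \<Rightarrow> ('x set \<Rightarrow> 's) set" where
  "germ X K G x U t = colim_in K (open_nbhds X x) (\<lambda>U V. V \<subseteq> U) (at_open G) (arrow G) U t"

definition dual_space :: "'k ring \<Rightarrow> ('k, 'v) module \<Rightarrow> ('k, 'v \<Rightarrow> 'k) module" where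
  "dual_space K M =
     \<lparr>carrier = {\<phi> \<in> carrier M \<rightarrow>\<^sub>E carrier K.
        (\<forall>v\<in>carrier M. \<forall>w\<in>carrier M. \<phi> (v \<oplus>\<^bsub>M\<^esub> w) = \<phi> v \<oplus>\<^bsub>K\<^esub> \<phi> w) \<and>
        (\<forall>a\<in>carrier K. \<forall>v\<in>carrier M. \<phi> (a \<odot>\<^bsub>M\<^esub> v) = a \<otimes>\<^bsub>K\<^esub> \<phi> v)},
      monoid.mult = (\<lambda>\<phi> \<psi>. undefined),
      one = undefined,
      zero = (\<lambda>v\<in>carrier M. \<zero>\<^bsub>K\<^esub>),
      add = (\<lambda>\<phi> \<psi>. \<lambda>v\<in>carrier M. \<phi> v \<oplus>\<^bsub>K\<^esub> \<psi> v),
      smult = (\<lambda>a \<phi>. \<lambda>v\<in>carrier M. a \<otimes>\<^bsub>K\<^esub> \<phi> v)\<rparr>"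

definition dual_diagram ::
    "'k ring \<Rightarrow> ('x, 'k, 'v) open_diagram \<Rightarrow> ('x, 'k, 'v \<Rightarrow> 'k) open_diagram" where
  "dual_diagram K F =
     \<lparr>at_open = (\<lambda>U. dual_space K (at_open F U)),
      arrow = (\<lambda>U V \<phi>. \<lambda>v\<in>carrier (at_open F V). \<phi> (arrow F V U v))\<rparr>"

text \<open>Restriction (inverse image) of a sheaf G to a subspace Z: a section over W is a family
  of stalk elements that is locally induced by sections of G on open sets of X.\<close>

definition restrict_to :: "'x topology \<Rightarrow> 'k ring \<Rightarrow> ('x, 'k, 's) open_diagram
    \<Rightarrow> ('x, 'k, 'x \<Rightarrow> ('x set \<Rightarrow> 's) set) open_diagram" where
  "restrict_to X K G =
     \<lparr>at_open = (\<lambda>W. (prod_space W (stalk X K G))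
        \<lparr>carrier := {s \<in> carrier (prod_space W (stalk X K G)).
           \<forall>z\<in>W. \<exists>U t. openin X U \<and> z \<in> U \<and> t \<in> carrier (at_open G U) \<and>
              (\<forall>w\<in>U \<inter> W. s w = germ X K G w U t)}\<rparr>),
      arrow = (\<lambda>W V s. restrict s V)\<rparr>"

definition constant_sheaf ::
    "'x topology \<Rightarrow> ('k, 'l) module \<Rightarrow> ('x, 'k, 'x \<Rightarrow> 'l) open_diagram" where
  "constant_sheaf Z L =
     \<lparr>at_open = (\<lambda>W. (prod_space W (\<lambda>_. L))
        \<lparr>carrier := {s \<in> carrier (prod_space W (\<lambda>_. L)).
           continuous_map (subtopology Z W) (discrete_topology (carrier L)) s}\<rparr>),
      arrow = (\<lambda>W V s. restrict s V)\<rparr>"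

definition sheaf_iso :: "'x topology \<Rightarrow> 'k ring \<Rightarrow> ('x, 'k, 's) open_diagram
    \<Rightarrow> ('x, 'k, 't) open_diagram \<Rightarrow> ('x set \<Rightarrow> 's \<Rightarrow> 't) \<Rightarrow> bool" where
  "sheaf_iso Z K G H \<Phi> \<longleftrightarrow>
     (\<forall>V. openin Z V \<longrightarrow> linear_iso K (at_open G V) (at_open H V) (\<Phi> V)) \<and>
     (\<forall>V W. openin Z V \<and> openin Z W \<and> W \<subseteq> V \<longrightarrow>
        (\<forall>s\<in>carrier (at_open G V). \<Phi> W (arrow G V W s) = arrow H V W (\<Phi> V s)))"

text \<open>The restriction of G to Z is locally constant. The value of each local constant sheaf is
  sought in the type of the stalks of G; this is no loss of generality since the value is
  isomorphic to the stalk of G at any point of W.\<close>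

definition locally_constant_on ::
    "'x topology \<Rightarrow> 'k ring \<Rightarrow> ('x, 'k, 's) open_diagram \<Rightarrow> 'x set \<Rightarrow> bool" where
  "locally_constant_on X K G Z \<longleftrightarrow>
     (\<forall>z\<in>Z. \<exists>W (L :: ('k, ('x set \<Rightarrow> 's) set) module) \<Phi>.
        openin (subtopology X Z) W \<and> z \<in> W \<and> vspace K L \<and>
        sheaf_iso (subtopology X W) K
          (restrict_to X K G) (constant_sheaf (subtopology X W) L) \<Phi>)"


section \<open>Smooth manifolds and submersions\<close>

text \<open>The model spaces are \<^term>\<open>Euclidean_space n\<close>, whose points are the functions
  nat to real vanishing at all indices from n on.\<close>

definition partial :: "nat \<Rightarrow> ((nat \<Rightarrow> real) \<Rightarrow> real) \<Rightarrow> (nat \<Rightarrow> real) \<Rightarrow> real" where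
  "partial i f x = deriv (\<lambda>t. f (x(i := t))) (x i)"

primrec Ck_on :: "nat \<Rightarrow> nat \<Rightarrow> (nat \<Rightarrow> real) set \<Rightarrow> ((nat \<Rightarrow> real) \<Rightarrow> real) \<Rightarrow> bool" where
  "Ck_on 0 n W f \<longleftrightarrow> continuous_map (subtopology (Euclidean_space n) W) euclideanreal f"
| "Ck_on (Suc k) n W f \<longleftrightarrow>
     continuous_map (subtopology (Euclidean_space n) W) euclideanreal f \<and>
     (\<forall>i<n. (\<forall>x\<in>W. (\<lambda>t. f (x(i := t))) differentiable (at (x i))) \<and>
            Ck_on k n W (partial i f))"

definition smooth_on ::
    "nat \<Rightarrow> nat \<Rightarrow> (nat \<Rightarrow> real) set \<Rightarrow> ((nat \<Rightarrow> real) \<Rightarrow> nat \<Rightarrow> real) \<Rightarrow> bool" where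
  "smooth_on m n W g \<longleftrightarrow> (\<forall>j<n. \<forall>k. Ck_on k m W (\<lambda>x. g x j))"

type_synonym 'x chart = "'x set \<times> ('x \<Rightarrow> nat \<Rightarrow> real)"

definition smooth_manifold :: "nat \<Rightarrow> 'x topology \<Rightarrow> 'x chart set \<Rightarrow> bool" where
  "smooth_manifold n M A \<longleftrightarrow>
     Hausdorff_space M \<and> second_countable M \<and>
     (\<Union>(U, \<phi>)\<in>A. U) = topspace M \<and>
     (\<forall>(U, \<phi>)\<in>A. openin M U \<and> openin (Euclidean_space n) (\<phi> ` U) \<and>
        homeomorphic_map (subtopology M U) (subtopology (Euclidean_space n) (\<phi> ` U)) \<phi>) \<and>
     (\<forall>(U, \<phi>)\<in>A. \<forall>(V, \<psi>)\<in>A. smooth_on n n (\<phi> ` (U \<inter> V)) (\<psi> \<circ> inv_into U \<phi>))"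

definition open_submanifold_atlas :: "'x set \<Rightarrow> 'x chart set \<Rightarrow> 'x chart set" where
  "open_submanifold_atlas W A = (\<lambda>(U, \<phi>). (U \<inter> W, \<phi>)) ` A"

text \<open>Atlas of the product of an n-dimensional manifold with the open half-line: the
  half-line supplies the coordinate with index n.\<close>

definition times_halfline_atlas :: "nat \<Rightarrow> 'x chart set \<Rightarrow> ('x \<times> real) chart set" where
  "times_halfline_atlas n A = (\<lambda>(U, \<phi>). (U \<times> {0<..}, \<lambda>(x, r). (\<phi> x)(n := r))) ` A"

definition smooth_map :: "nat \<Rightarrow> 'x topology \<Rightarrow> 'x chart set \<Rightarrow> nat \<Rightarrow> 'y topology
    \<Rightarrow> 'y chart set \<Rightarrow> ('x \<Rightarrow> 'y) \<Rightarrow> bool" where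
  "smooth_map m M A n N B f \<longleftrightarrow> continuous_map M N f \<and>
     (\<forall>(U, \<phi>)\<in>A. \<forall>(V, \<psi>)\<in>B.
        smooth_on m n (\<phi> ` {u\<in>U. f u \<in> V}) (\<psi> \<circ> f \<circ> inv_into U \<phi>))"

definition smooth_submersion :: "nat \<Rightarrow> 'x topology \<Rightarrow> 'x chart set \<Rightarrow> nat \<Rightarrow> 'y topology
    \<Rightarrow> 'y chart set \<Rightarrow> ('x \<Rightarrow> 'y) \<Rightarrow> bool" where
  "smooth_submersion m M A n N B f \<longleftrightarrow> smooth_map m M A n N B f \<and>
     (\<forall>(U, \<phi>)\<in>A. \<forall>(V, \<psi>)\<in>B. \<forall>p\<in>U. f p \<in> V \<longrightarrow>
        (\<forall>w. \<exists>v. \<forall>j<n.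
           (\<Sum>i<m. partial i (\<lambda>x. (\<psi> \<circ> f \<circ> inv_into U \<phi>) x j) (\<phi> p) * v i) = w j))"


section \<open>Thom--Mather stratified spaces\<close>

record ('i, 'x) stratification =
  strata :: "'i set"
  stratum :: "'i \<Rightarrow> 'x set"
  sdim :: "'i \<Rightarrow> nat"
  satlas :: "'i \<Rightarrow> 'x chart set"
  tube :: "'i \<Rightarrow> 'x set"
  retr :: "'i \<Rightarrow> 'x \<Rightarrow> 'x"
  tdist :: "'i \<Rightarrow> 'x \<Rightarrow> real"

definition decomposition :: "'x topology \<Rightarrow> ('i, 'x) stratification \<Rightarrow> bool" where
  "decomposition X S \<longleftrightarrow>
     (\<Union>\<sigma>\<in>strata S. stratum S \<sigma>) = topspace X \<and>
     (\<forall>\<sigma>\<in>strata S. stratum S \<sigma> \<noteq> {}) \<and>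
     (\<forall>\<sigma>\<in>strata S. \<forall>\<tau>\<in>strata S. \<sigma> \<noteq> \<tau> \<longrightarrow> stratum S \<sigma> \<inter> stratum S \<tau> = {}) \<and>
     (\<forall>\<sigma>\<in>strata S. \<exists>U C. openin X U \<and> closedin X C \<and> stratum S \<sigma> = U \<inter> C) \<and>
     (\<forall>x\<in>topspace X. \<exists>U. openin X U \<and> x \<in> U \<and>
        finite {\<sigma>\<in>strata S. stratum S \<sigma> \<inter> U \<noteq> {}}) \<and>
     (\<forall>\<sigma>\<in>strata S. \<forall>\<tau>\<in>strata S.
        X closure_of stratum S \<tau> \<inter> stratum S \<sigma> \<noteq> {} \<longrightarrow>
        stratum S \<sigma> \<subseteq> X closure_of stratum S \<tau>)"

text \<open>As in Mather's definition, the smooth structure consists of a smooth structure on each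
  stratum. The submersion and compatibility conditions concern pairwise distinct strata: on
  \<open>stratum S \<sigma>\<close> itself the distance function is zero, so the former cannot hold for equal
  indices, and the latter compare maps with values in the open half-line.\<close>

definition thom_mather :: "'x topology \<Rightarrow> ('i, 'x) stratification \<Rightarrow> bool" where
  "thom_mather X S \<longleftrightarrow>
     Hausdorff_space X \<and> locally_compact_space X \<and> second_countable X \<and>
     decomposition X S \<and>
     (\<forall>\<sigma>\<in>strata S. smooth_manifold (sdim S \<sigma>) (subtopology X (stratum S \<sigma>)) (satlas S \<sigma>)) \<and>
     (\<forall>\<sigma>\<in>strata S.
        openin X (tube S \<sigma>) \<and> stratum S \<sigma> \<subseteq> tube S \<sigma> \<and>
        continuous_map (subtopology X (tube S \<sigma>)) (subtopology X (stratum S \<sigma>)) (retr S \<sigma>) \<and>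
        (\<forall>x\<in>stratum S \<sigma>. retr S \<sigma> x = x) \<and>
        continuous_map (subtopology X (tube S \<sigma>)) (top_of_set {0..}) (tdist S \<sigma>) \<and>
        {x \<in> tube S \<sigma>. tdist S \<sigma> x = 0} = stratum S \<sigma>) \<and>
     (\<forall>\<sigma>\<in>strata S. \<forall>\<tau>\<in>strata S. \<sigma> \<noteq> \<tau> \<longrightarrow>
        smooth_submersion
          (sdim S \<tau>) (subtopology X (tube S \<sigma> \<inter> stratum S \<tau>))
          (open_submanifold_atlas (tube S \<sigma>) (satlas S \<tau>))
          (Suc (sdim S \<sigma>)) (prod_topology (subtopology X (stratum S \<sigma>)) (top_of_set {0<..}))
          (times_halfline_atlas (sdim S \<sigma>) (satlas S \<sigma>))
          (\<lambda>x. (retr S \<sigma> x, tdist S \<sigma> x))) \<and>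
     (\<forall>\<sigma>\<in>strata S. \<forall>\<tau>\<in>strata S. \<forall>\<upsilon>\<in>strata S. \<sigma> \<noteq> \<tau> \<and> \<tau> \<noteq> \<upsilon> \<and> \<sigma> \<noteq> \<upsilon> \<longrightarrow>
        (\<forall>x \<in> tube S \<sigma> \<inter> tube S \<tau> \<inter> stratum S \<upsilon>. retr S \<tau> x \<in> tube S \<sigma> \<longrightarrow>
           retr S \<sigma> (retr S \<tau> x) = retr S \<sigma> x \<and> tdist S \<sigma> (retr S \<tau> x) = tdist S \<sigma> x))"

definition constructible_sheaf :: "'x topology \<Rightarrow> ('i, 'x) stratification \<Rightarrow> 'k ring
    \<Rightarrow> ('x, 'k, 's) open_diagram \<Rightarrow> bool" where
  "constructible_sheaf X S K G \<longleftrightarrow>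
     (\<forall>\<sigma>\<in>strata S. locally_constant_on X K G (stratum S \<sigma>))"

text \<open>The linear dual of a cosheaf is a sheaf. This notion is meant for cosheaves with
  finite-dimensional costalks; both properties are assumed separately.\<close>

definition constructible_cosheaf :: "'x topology \<Rightarrow> ('i, 'x) stratification \<Rightarrow> 'k ring
    \<Rightarrow> ('x, 'k, 'v) open_diagram \<Rightarrow> bool" where
  "constructible_cosheaf X S K F \<longleftrightarrow> constructible_sheaf X S K (dual_diagram K F)"


section \<open>The entrance path category and its representations\<close>

record ('o, 'a) category =
  Obj :: "'o set"
  Hom :: "'o \<Rightarrow> 'o \<Rightarrow> 'a set"
  Idn :: "'o \<Rightarrow> 'a"
  Cmp :: "'a \<Rightarrow> 'a \<Rightarrow> 'a"  \<comment> \<open>\<open>Cmp C f g\<close> is f followed by g\<close>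

definition is_category :: "('o, 'a) category \<Rightarrow> bool" where
  "is_category C \<longleftrightarrow>
     (\<forall>x\<in>Obj C. Idn C x \<in> Hom C x x) \<and>
     (\<forall>x\<in>Obj C. \<forall>y\<in>Obj C. \<forall>z\<in>Obj C. \<forall>f\<in>Hom C x y. \<forall>g\<in>Hom C y z.
        Cmp C f g \<in> Hom C x z) \<and>
     (\<forall>x\<in>Obj C. \<forall>y\<in>Obj C. \<forall>f\<in>Hom C x y.
        Cmp C (Idn C x) f = f \<and> Cmp C f (Idn C y) = f) \<and>
     (\<forall>w\<in>Obj C. \<forall>x\<in>Obj C. \<forall>y\<in>Obj C. \<forall>z\<in>Obj C.
        \<forall>f\<in>Hom C w x. \<forall>g\<in>Hom C x y. \<forall>h\<in>Hom C y z.
        Cmp C (Cmp C f g) h = Cmp C f (Cmp C g h))"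

definition vect_representation :: "('o, 'a) category \<Rightarrow> 'k ring \<Rightarrow> ('o \<Rightarrow> ('k, 'v) module)
    \<Rightarrow> ('o \<Rightarrow> 'o \<Rightarrow> 'a \<Rightarrow> 'v \<Rightarrow> 'v) \<Rightarrow> bool" where
  "vect_representation C K V \<rho> \<longleftrightarrow> is_category C \<and>
     (\<forall>x\<in>Obj C. vspace K (V x) \<and> fin_dim K (V x)) \<and>
     (\<forall>x\<in>Obj C. \<forall>y\<in>Obj C. \<forall>f\<in>Hom C x y. linear_map K (V x) (V y) (\<rho> x y f)) \<and>
     (\<forall>x\<in>Obj C. \<forall>v\<in>carrier (V x). \<rho> x x (Idn C x) v = v) \<and>
     (\<forall>x\<in>Obj C. \<forall>y\<in>Obj C. \<forall>z\<in>Obj C. \<forall>f\<in>Hom C x y. \<forall>g\<in>Hom C y z.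
        \<forall>v\<in>carrier (V x). \<rho> x z (Cmp C f g) v = \<rho> y z g (\<rho> x y f v))"

definition entrance_path ::
    "'x topology \<Rightarrow> ('i, 'x) stratification \<Rightarrow> 'x \<Rightarrow> 'x \<Rightarrow> (real \<Rightarrow> 'x) \<Rightarrow> bool" where
  "entrance_path X S x y \<gamma> \<longleftrightarrow> pathin X \<gamma> \<and> \<gamma> 0 = x \<and> \<gamma> 1 = y \<and>
     (\<forall>s\<in>{0..1}. \<forall>t\<in>{0..1}. \<forall>\<sigma>\<in>strata S. \<forall>\<tau>\<in>strata S.
        s \<le> t \<and> \<gamma> s \<in> stratum S \<sigma> \<and> \<gamma> t \<in> stratum S \<tau> \<longrightarrow> sdim S \<tau> \<le> sdim S \<sigma>)"

text \<open>Homotopies relative to the endpoints x and y through entrance paths. The condition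
  ignores the values of paths outside the unit interval.\<close>

definition entrance_homotopic :: "'x topology \<Rightarrow> ('i, 'x) stratification \<Rightarrow> 'x \<Rightarrow> 'x
    \<Rightarrow> (real \<Rightarrow> 'x) \<Rightarrow> (real \<Rightarrow> 'x) \<Rightarrow> bool" where
  "entrance_homotopic X S x y =
     homotopic_with (entrance_path X S x y) (top_of_set {0..1}) X"

definition entrance_class :: "'x topology \<Rightarrow> ('i, 'x) stratification \<Rightarrow> 'x \<Rightarrow> 'x
    \<Rightarrow> (real \<Rightarrow> 'x) \<Rightarrow> (real \<Rightarrow> 'x) set" where
  "entrance_class X S x y \<gamma> = {\<delta>. entrance_homotopic X S x y \<gamma> \<delta>}"

definition concat_path :: "(real \<Rightarrow> 'x) \<Rightarrow> (real \<Rightarrow> 'x) \<Rightarrow> real \<Rightarrow> 'x" where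
  "concat_path \<gamma> \<delta> t = (if t \<le> 1/2 then \<gamma> (2 * t) else \<delta> (2 * t - 1))"

definition entrance_category ::
    "'x topology \<Rightarrow> ('i, 'x) stratification \<Rightarrow> ('x, (real \<Rightarrow> 'x) set) category" where
  "entrance_category X S =
     \<lparr>Obj = topspace X,
      Hom = (\<lambda>x y. entrance_class X S x y ` {\<gamma>. entrance_path X S x y \<gamma>}),
      Idn = (\<lambda>x. entrance_class X S x x (\<lambda>t. x)),
      Cmp = (\<lambda>f g. \<Union>\<gamma>\<in>f. \<Union>\<delta>\<in>g. entrance_class X S (\<gamma> 0) (\<delta> 1) (concat_path \<gamma> \<delta>))\<rparr>"

text \<open>The requirement that ties a family of maps between costalks to the cosheaf: the map
  assigned to an entrance path from x to y inside an open set U commutes with the projections of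
  the costalks at x and y to \<open>at_open F U\<close>.\<close>

definition induced_by_cosheaf :: "'x topology \<Rightarrow> ('i, 'x) stratification
    \<Rightarrow> ('x, 'k, 'v) open_diagram
    \<Rightarrow> ('x \<Rightarrow> 'x \<Rightarrow> (real \<Rightarrow> 'x) set \<Rightarrow> ('x set \<Rightarrow> 'v) \<Rightarrow> 'x set \<Rightarrow> 'v) \<Rightarrow> bool" where
  "induced_by_cosheaf X S F \<rho> \<longleftrightarrow>
     (\<forall>x y \<gamma> U. entrance_path X S x y \<gamma> \<and> openin X U \<and> \<gamma> ` {0..1} \<subseteq> U \<longrightarrow>
        (\<forall>s\<in>carrier (costalk X F x). \<rho> x y (entrance_class X S x y \<gamma>) s U = s U))"

end

theory Submission
  imports Defs
begin

text \<open>
  The costalk at x is the limit of the spaces F U over the neighbourhoods U of x. The key point is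
  that this inverse system has the costalk as its stable image: for every U there is a smaller V
  such that F V and the costalk have the same image in F U. This is shown by downward induction on
  the dimension of the stratum. A functional on F W is determined by its germs, by the cosheaf
  condition, and by constructibility the zero set of the germs is open and closed in every stratum.
  If W is the part of a tube over a connected set B with distance less than e, the support of a
  functional in another stratum has an open and closed image in \<open>B \<times> (0, e)\<close>, since
  submersions are open and the tube map is proper over compact sets. Hence the behaviour of the
  functional off the stratum is governed by a single compact fibre. By the induction hypothesis the
  image of F of the punctured neighbourhood is finite-dimensional, and a Mittag-Leffler argument for
  cosets of finite-dimensional subspaces applies. No isotopy lemma is needed.

  Along an entrance path every element of the costalk at the start extends to a unique family of
  costalk elements that is locally constant in F U for every open U. Entrance paths stay in the
  current stratum for a short time, and nearby points of the same stratum have the same costalk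
  inside F U for small U. The end values of these families are invariant under homotopies of
  entrance paths and define the representation. For any other representation induced by F, the
  values along the initial segments of a path form such a family, hence uniqueness.
\<close>

section \<open>Linear algebra\<close>

text \<open>Constructibility is a condition on the dual sheaf, whose stalk at y is a colimit of
  duals of the spaces \<open>at_open F U\<close>, while the representation lives on costalks, which
  are limits of these spaces. Limits do not commute with taking images, so a functional may have a
  nonzero germ at y and still vanish on all costalk elements; only stability makes the two kinds of
  vanishing coincide (\<open>stable_zero_germ_iff\<close>). This gap is the obstacle of the first
  half. The spaces \<open>at_open F U\<close> may have infinite dimension, so finiteness has to be
  imported from costalks at other points: a fibre of the tube off the stratum meets only strata of
  strictly larger dimension, because a submersion to stratum times half-line needs one dimension
  more. This fixes the direction of the induction. An isotopy lemma would trivialise the whole tube;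
  here the support of one functional at a time is tracked, and for this it is enough that an open
  and closed subset of a connected cylinder is empty or everything.\<close>

lemma linear_map_closed: "linear_map K M N f \<Longrightarrow> v \<in> carrier M \<Longrightarrow> f v \<in> carrier N"
  and linear_map_add: "linear_map K M N f \<Longrightarrow> v \<in> carrier M \<Longrightarrow> w \<in> carrier M \<Longrightarrow>
    f (v \<oplus>\<^bsub>M\<^esub> w) = f v \<oplus>\<^bsub>N\<^esub> f w"
  and linear_map_smult: "linear_map K M N f \<Longrightarrow> a \<in> carrier K \<Longrightarrow> v \<in> carrier M \<Longrightarrow>
    f (a \<odot>\<^bsub>M\<^esub> v) = a \<odot>\<^bsub>N\<^esub> f v"
  by (auto simp: linear_map_def)

lemma linear_map_zero:
  assumes "Module.module K M" "Module.module K N" "linear_map K M N f"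
  shows "f \<zero>\<^bsub>M\<^esub> = \<zero>\<^bsub>N\<^esub>"
proof -
  interpret M: module K M by fact
  interpret N: module K N by fact
  have "f (\<zero>\<^bsub>K\<^esub> \<odot>\<^bsub>M\<^esub> \<zero>\<^bsub>M\<^esub>) = \<zero>\<^bsub>K\<^esub> \<odot>\<^bsub>N\<^esub> f \<zero>\<^bsub>M\<^esub>"
    using assms(3) by (intro linear_map_smult) auto
  then show ?thesis using linear_map_closed[OF assms(3)] by simp
qed

lemma (in module) minus_eq_smult:
  "v \<in> carrier M \<Longrightarrow> \<ominus>\<^bsub>M\<^esub> v = (\<ominus> \<one>) \<odot>\<^bsub>M\<^esub> v"
  by (simp add: smult_l_minus)

lemma linear_map_neg:
  assumes "Module.module K M" "Module.module K N" "linear_map K M N f" "v \<in> carrier M"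
  shows "f (\<ominus>\<^bsub>M\<^esub> v) = \<ominus>\<^bsub>N\<^esub> f v"
proof -
  interpret M: module K M by fact
  interpret N: module K N by fact
  show ?thesis
    using linear_map_smult[OF assms(3) _ assms(4), of "\<ominus>\<^bsub>K\<^esub> \<one>\<^bsub>K\<^esub>"] linear_map_closed[OF assms(3,4)] assms(4)
    by (simp add: M.minus_eq_smult N.minus_eq_smult)
qed

lemma linear_map_minus:
  assumes "Module.module K M" "Module.module K N" "linear_map K M N f" "v \<in> carrier M" "w \<in> carrier M"
  shows "f (v \<ominus>\<^bsub>M\<^esub> w) = f v \<ominus>\<^bsub>N\<^esub> f w"
proof -
  interpret M: module K M by fact
  interpret N: module K N by fact
  show ?thesis using assms
    by (simp add: a_minus_def linear_map_add linear_map_neg)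
qed

lemma linear_map_finsum:
  assumes "Module.module K M" "Module.module K N" "linear_map K M N f" "finite A" "g \<in> A \<rightarrow> carrier M"
  shows "f (finsum M g A) = finsum N (\<lambda>i. f (g i)) A"
proof -
  interpret M: module K M by fact
  interpret N: module K N by fact
  show ?thesis using assms(4,5)
  proof (induction A)
    case empty
    then show ?case using linear_map_zero[OF assms(1-3)] by simp
  next
    case (insert a A)
    then have "g a \<in> carrier M" "g \<in> A \<rightarrow> carrier M" by auto
    with insert show ?case
      using linear_map_closed[OF assms(3)] linear_map_add[OF assms(3)]
      by (simp add: Pi_iff)
  qed
qed

section \<open>Images, preimages, sums and chains of submodules\<close>

lemma submodule_image:
  assumes "Module.module K M" "Module.module K N" "linear_map K M N f" "submodule H K M"
  shows "submodule (f ` H) K N"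
proof -
  interpret M: module K M by fact
  interpret N: module K N by fact
  note H = M.submoduleE[OF assms(4)]
  have zero: "\<zero>\<^bsub>M\<^esub> \<in> H" using assms(4) unfolding submodule_def subgroup_def by simp
  show ?thesis
  proof (rule N.submoduleI)
    show "f ` H \<subseteq> carrier N" using H(1) linear_map_closed[OF assms(3)] by auto
    show "\<zero>\<^bsub>N\<^esub> \<in> f ` H" using linear_map_zero[OF assms(1-3)] zero by force
    fix a assume "a \<in> f ` H"
    then show "\<ominus>\<^bsub>N\<^esub> a \<in> f ` H"
    proof
      fix x assume "a = f x" "x \<in> H"
      then show ?thesis using H(1,3) by (auto simp: linear_map_neg[OF assms(1-3), symmetric] subset_iff)
    qed
  next
    fix a b assume "a \<in> f ` H" "b \<in> f ` H"
    then obtain x y where "x \<in> H" "y \<in> H" "a = f x" "b = f y" by auto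
    then show "a \<oplus>\<^bsub>N\<^esub> b \<in> f ` H"
      using H(1,5) by (auto simp: linear_map_add[OF assms(3), symmetric] subset_iff)
  next
    fix a x assume "a \<in> carrier K" "x \<in> f ` H"
    then obtain y where "y \<in> H" "x = f y" by auto
    then show "a \<odot>\<^bsub>N\<^esub> x \<in> f ` H"
      using H(1,4) \<open>a \<in> carrier K\<close> by (auto simp: linear_map_smult[OF assms(3), symmetric] subset_iff)
  qed
qed

text \<open>The preimage is taken inside a submodule \<open>L\<close> so that subspaces of the image
  of \<open>H\<close> can be pulled back into \<open>H\<close> itself, as
  \<open>artinian_image\<close> requires.\<close>

lemma submodule_vimage:
  assumes "Module.module K M" "Module.module K N" "linear_map K M N f" "submodule H K N" "submodule L K M"
  shows "submodule {v \<in> L. f v \<in> H} K M"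
proof -
  interpret M: module K M by fact
  interpret N: module K N by fact
  note H = N.submoduleE[OF assms(4)]
  note L = M.submoduleE[OF assms(5)]
  have zero: "\<zero>\<^bsub>N\<^esub> \<in> H" using assms(4) unfolding submodule_def subgroup_def by simp
  have zero': "\<zero>\<^bsub>M\<^esub> \<in> L" using assms(5) unfolding submodule_def subgroup_def by simp
  have cL: "v \<in> L \<Longrightarrow> v \<in> carrier M" for v using L(1) by auto
  show ?thesis
    by (rule M.submoduleI)
      (use cL L H zero zero' in \<open>auto simp: linear_map_zero[OF assms(1-3)] linear_map_neg[OF assms(1-3)]
        linear_map_add[OF assms(3)] linear_map_smult[OF assms(3)]\<close>)
qed

lemma (in module) submodule_zero_in: "submodule H R M \<Longrightarrow> \<zero>\<^bsub>M\<^esub> \<in> H"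
  unfolding submodule_def subgroup_def by simp

lemma (in module) submodule_minus:
  "submodule H R M \<Longrightarrow> v \<in> H \<Longrightarrow> w \<in> H \<Longrightarrow> v \<ominus>\<^bsub>M\<^esub> w \<in> H"
  by (simp add: a_minus_def submoduleE(3,5))

lemma (in module) submodule_Int:
  assumes "submodule H R M" "submodule L R M" shows "submodule (H \<inter> L) R M"
  by (rule submoduleI)
    (use submoduleE[OF assms(1)] submoduleE[OF assms(2)] submodule_zero_in assms in auto)

lemma set_addI: "x \<in> H \<Longrightarrow> y \<in> L \<Longrightarrow> x \<oplus>\<^bsub>M\<^esub> y \<in> H <+>\<^bsub>M\<^esub> L"
  by (auto simp: set_add_defs)

lemma set_addE:
  assumes "z \<in> H <+>\<^bsub>M\<^esub> L" obtains x y where "x \<in> H" "y \<in> L" "z = x \<oplus>\<^bsub>M\<^esub> y"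
  using assms by (auto simp: set_add_defs)

lemma (in module) submodule_set_add:
  assumes "submodule H R M" "submodule L R M" shows "submodule (H <+>\<^bsub>M\<^esub> L) R M"
proof (rule submoduleI)
  note H = submoduleE[OF assms(1)] and L = submoduleE[OF assms(2)]
  have c: "v \<in> H \<Longrightarrow> v \<in> carrier M" "v \<in> L \<Longrightarrow> v \<in> carrier M" for v using H(1) L(1) by auto
  show "H <+>\<^bsub>M\<^esub> L \<subseteq> carrier M" using c by (auto simp: set_add_defs)
  show "\<zero>\<^bsub>M\<^esub> \<in> H <+>\<^bsub>M\<^esub> L"
    using submodule_zero_in[OF assms(1)] submodule_zero_in[OF assms(2)] by (force simp: set_add_defs)
  show "\<ominus>\<^bsub>M\<^esub> a \<in> H <+>\<^bsub>M\<^esub> L" if "a \<in> H <+>\<^bsub>M\<^esub> L" for a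
  proof -
    from that obtain x y where "x \<in> H" "y \<in> L" "a = x \<oplus>\<^bsub>M\<^esub> y" by (rule set_addE)
    then have "\<ominus>\<^bsub>M\<^esub> a = \<ominus>\<^bsub>M\<^esub> x \<oplus>\<^bsub>M\<^esub> \<ominus>\<^bsub>M\<^esub> y" using c by (simp add: M.minus_add)
    then show ?thesis using H(3) L(3) \<open>x \<in> H\<close> \<open>y \<in> L\<close> by (simp add: set_addI)
  qed
  show "a \<oplus>\<^bsub>M\<^esub> b \<in> H <+>\<^bsub>M\<^esub> L" if "a \<in> H <+>\<^bsub>M\<^esub> L" "b \<in> H <+>\<^bsub>M\<^esub> L" for a b
  proof -
    from that obtain x y x' y' where *: "x \<in> H" "y \<in> L" "a = x \<oplus>\<^bsub>M\<^esub> y" "x' \<in> H" "y' \<in> L" "b = x' \<oplus>\<^bsub>M\<^esub> y'"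
      by (auto simp: set_add_defs)
    then have "a \<oplus>\<^bsub>M\<^esub> b = (x \<oplus>\<^bsub>M\<^esub> x') \<oplus>\<^bsub>M\<^esub> (y \<oplus>\<^bsub>M\<^esub> y')" using c by (simp add: M.a_ac)
    moreover have "x \<oplus>\<^bsub>M\<^esub> x' \<in> H" "y \<oplus>\<^bsub>M\<^esub> y' \<in> L" using * H(5) L(5) by auto
    ultimately show ?thesis by (simp add: set_addI)
  qed
  show "a \<odot>\<^bsub>M\<^esub> b \<in> H <+>\<^bsub>M\<^esub> L" if "a \<in> carrier R" "b \<in> H <+>\<^bsub>M\<^esub> L" for a b
  proof -
    from that obtain x y where *: "x \<in> H" "y \<in> L" "b = x \<oplus>\<^bsub>M\<^esub> y" by (auto simp: set_add_defs)
    then have "a \<odot>\<^bsub>M\<^esub> b = (a \<odot>\<^bsub>M\<^esub> x) \<oplus>\<^bsub>M\<^esub> (a \<odot>\<^bsub>M\<^esub> y)" using c that by (simp add: smult_r_distr)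
    then show ?thesis using H(4) L(4) * that by (simp add: set_addI)
  qed
qed

lemma (in module) subset_set_add:
  assumes "submodule H R M" "submodule L R M"
  shows "H \<subseteq> H <+>\<^bsub>M\<^esub> L" "L \<subseteq> H <+>\<^bsub>M\<^esub> L"
proof -
  have "x \<in> H <+>\<^bsub>M\<^esub> L" if "x \<in> H" for x
    using set_addI[OF that submodule_zero_in[OF assms(2)], of M] submoduleE(1)[OF assms(1)] that by auto
  then show "H \<subseteq> H <+>\<^bsub>M\<^esub> L" by auto
  have "x \<in> H <+>\<^bsub>M\<^esub> L" if "x \<in> L" for x
    using set_addI[OF submodule_zero_in[OF assms(1)] that, of M] submoduleE(1)[OF assms(2)] that by auto
  then show "L \<subseteq> H <+>\<^bsub>M\<^esub> L" by auto
qed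

lemma (in module) submodule_singleton_span:
  assumes "v \<in> carrier M" shows "submodule {a \<odot>\<^bsub>M\<^esub> v |a. a \<in> carrier R} R M"
proof (rule submoduleI)
  show "\<zero>\<^bsub>M\<^esub> \<in> {a \<odot>\<^bsub>M\<^esub> v |a. a \<in> carrier R}"
    using assms smult_l_null R.zero_closed by (metis (mono_tags, lifting) mem_Collect_eq)
  show "\<ominus>\<^bsub>M\<^esub> x \<in> {a \<odot>\<^bsub>M\<^esub> v |a. a \<in> carrier R}" if "x \<in> {a \<odot>\<^bsub>M\<^esub> v |a. a \<in> carrier R}" for x
  proof -
    from that obtain b where "b \<in> carrier R" "x = b \<odot>\<^bsub>M\<^esub> v" by blast
    then show ?thesis using smult_l_minus[OF _ assms, of b]
      by (intro CollectI exI[of _ "\<ominus> b"]) simp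
  qed
  show "x \<oplus>\<^bsub>M\<^esub> y \<in> {a \<odot>\<^bsub>M\<^esub> v |a. a \<in> carrier R}" if "x \<in> {a \<odot>\<^bsub>M\<^esub> v |a. a \<in> carrier R}"
    "y \<in> {a \<odot>\<^bsub>M\<^esub> v |a. a \<in> carrier R}" for x y
  proof -
    from that obtain b c where "b \<in> carrier R" "x = b \<odot>\<^bsub>M\<^esub> v" "c \<in> carrier R" "y = c \<odot>\<^bsub>M\<^esub> v" by blast
    then have "x \<oplus>\<^bsub>M\<^esub> y = (b \<oplus> c) \<odot>\<^bsub>M\<^esub> v \<and> b \<oplus> c \<in> carrier R" using smult_l_distr assms by simp
    then show ?thesis by blast
  qed
  show "b \<odot>\<^bsub>M\<^esub> x \<in> {a \<odot>\<^bsub>M\<^esub> v |a. a \<in> carrier R}" if "b \<in> carrier R"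
    "x \<in> {a \<odot>\<^bsub>M\<^esub> v |a. a \<in> carrier R}" for b x
  proof -
    from that obtain c where "c \<in> carrier R" "x = c \<odot>\<^bsub>M\<^esub> v" by blast
    then have "b \<odot>\<^bsub>M\<^esub> x = (b \<otimes> c) \<odot>\<^bsub>M\<^esub> v \<and> b \<otimes> c \<in> carrier R" using smult_assoc1 assms that by simp
    then show ?thesis by blast
  qed
qed (use assms in auto)

lemma (in module) submodule_Union_chain:
  assumes "\<C> \<noteq> {}" "\<And>H. H \<in> \<C> \<Longrightarrow> submodule H R M"
    and chain: "\<And>H L. H \<in> \<C> \<Longrightarrow> L \<in> \<C> \<Longrightarrow> H \<subseteq> L \<or> L \<subseteq> H"
  shows "submodule (\<Union>\<C>) R M"
proof (rule submoduleI)
  note E = submoduleE[OF assms(2)]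
  show "\<Union>\<C> \<subseteq> carrier M" using E(1) by blast
  show "\<zero>\<^bsub>M\<^esub> \<in> \<Union>\<C>" using assms(1,2) submodule_zero_in by blast
  show "\<ominus>\<^bsub>M\<^esub> a \<in> \<Union>\<C>" if "a \<in> \<Union>\<C>" for a using that E(3) by blast
  show "a \<oplus>\<^bsub>M\<^esub> b \<in> \<Union>\<C>" if "a \<in> \<Union>\<C>" "b \<in> \<Union>\<C>" for a b
  proof -
    from that obtain H L where HL: "H \<in> \<C>" "a \<in> H" "L \<in> \<C>" "b \<in> L" by blast
    from chain[OF HL(1,3)] show ?thesis
    proof
      assume "H \<subseteq> L"
      then have "a \<oplus>\<^bsub>M\<^esub> b \<in> L" using HL by (intro E(5)) auto
      then show ?thesis using HL(3) by blast
    next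
      assume "L \<subseteq> H"
      then have "a \<oplus>\<^bsub>M\<^esub> b \<in> H" using HL by (intro E(5)) auto
      then show ?thesis using HL(1) by blast
    qed
  qed
  show "a \<odot>\<^bsub>M\<^esub> b \<in> \<Union>\<C>" if "a \<in> carrier R" "b \<in> \<Union>\<C>" for a b using that E(4) by blast
qed

section \<open>Cancellation of differences and separation by functionals\<close>

lemma (in abelian_group) diff_diff_cancel:
  assumes "x \<in> carrier G" "y \<in> carrier G" "m \<in> carrier G"
  shows "(m \<ominus> y) \<ominus> (m \<ominus> x) = x \<ominus> y"
proof -
  have "(m \<ominus> y) \<ominus> (m \<ominus> x) = (m \<oplus> \<ominus> m) \<oplus> (x \<oplus> \<ominus> y)"
    using assms unfolding a_minus_def minus_add[OF assms(3) a_inv_closed[OF assms(1)]]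
    by (simp add: a_ac)
  then show ?thesis using assms by (simp add: r_neg a_minus_def)
qed

lemma (in abelian_group) diff_add_diff:
  assumes "x \<in> carrier G" "y \<in> carrier G" "z \<in> carrier G"
  shows "(x \<ominus> y) \<oplus> (y \<ominus> z) = x \<ominus> z"
proof -
  have "(x \<ominus> y) \<oplus> (y \<ominus> z) = (y \<oplus> \<ominus> y) \<oplus> (x \<oplus> \<ominus> z)"
    using assms unfolding a_minus_def by (simp add: a_ac)
  then show ?thesis using assms by (simp add: r_neg a_minus_def)
qed

lemma (in abelian_group) minus_eq_zeroD:
  assumes "x \<ominus> y = \<zero>" "x \<in> carrier G" "y \<in> carrier G" shows "x = y"
proof -
  have "x = (x \<ominus> y) \<oplus> (y \<ominus> \<zero>)" using assms(2,3) diff_add_diff[of x y \<zero>]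
    by (simp add: a_minus_def minus_equality)
  also have "\<dots> = y" using assms by (simp add: a_minus_def minus_equality)
  finally show ?thesis .
qed

text \<open>By Zorn's lemma there is a submodule H that is maximal among those containing
  \<open>N\<close> and missing \<open>v\<close>. It is a complement of the line through
  \<open>v\<close>, and the functional is the coefficient of \<open>v\<close> modulo H. Later
  comparisons of subspaces of \<open>at_open F U\<close> are made through such functionals, because
  the germs that constructibility speaks of are germs of functionals.\<close>

lemma dual_separates:
  assumes "vspace K M" "submodule N K M" "v \<in> carrier M" "v \<notin> N"
  obtains \<phi> where "\<phi> \<in> carrier (dual_space K M)" "\<forall>n\<in>N. \<phi> n = \<zero>\<^bsub>K\<^esub>" "\<phi> v = \<one>\<^bsub>K\<^esub>"
proof -
  interpret field K using assms(1) by (simp add: vspace_def)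
  interpret M: module K M using assms(1) by (simp add: vspace_def)
  let ?A = "{H. submodule H K M \<and> N \<subseteq> H \<and> v \<notin> H}"
  have "\<exists>H\<in>?A. \<forall>L\<in>?A. H \<subseteq> L \<longrightarrow> L = H"
  proof (rule subset_Zorn_nonempty)
    show "?A \<noteq> {}" using assms by auto
    fix \<C> assume "\<C> \<noteq> {}" "subset.chain ?A \<C>"
    then show "\<Union>\<C> \<in> ?A"
      using M.submodule_Union_chain[of \<C>] unfolding subset.chain_def by blast
  qed
  then obtain H where HA: "H \<in> ?A" and max': "\<forall>L\<in>?A. H \<subseteq> L \<longrightarrow> L = H" by (rule bexE)
  have H: "submodule H K M" "N \<subseteq> H" "v \<notin> H" using HA by simp_all
  have max: "\<And>L. submodule L K M \<Longrightarrow> N \<subseteq> L \<Longrightarrow> v \<notin> L \<Longrightarrow> H \<subseteq> L \<Longrightarrow> L = H"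
    using max' by simp
  note HE = M.submoduleE[OF H(1)]
  \<comment> \<open>If m is outside H, maximality puts \<open>v\<close> into H plus the line through
    m. The coefficient b of m there is nonzero, since otherwise \<open>v\<close> would lie in H, so
    the equation can be solved for m modulo H.\<close>
  have ex: "\<exists>a\<in>carrier K. m \<ominus>\<^bsub>M\<^esub> (a \<odot>\<^bsub>M\<^esub> v) \<in> H" if m: "m \<in> carrier M" for m
  proof (cases "m \<in> H")
    case True
    then have "m \<ominus>\<^bsub>M\<^esub> (\<zero>\<^bsub>K\<^esub> \<odot>\<^bsub>M\<^esub> v) \<in> H"
      using m assms(3) M.submodule_minus[OF H(1) True M.submodule_zero_in[OF H(1)]] by simp
    then show ?thesis by blast
  next
    case False
    define S where "S = {a \<odot>\<^bsub>M\<^esub> m |a. a \<in> carrier K}"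
    have S: "submodule S K M" unfolding S_def by (rule M.submodule_singleton_span[OF m])
    define L where "L = H <+>\<^bsub>M\<^esub> S"
    have L: "submodule L K M" unfolding L_def by (rule M.submodule_set_add[OF H(1) S])
    have HL: "H \<subseteq> L" "S \<subseteq> L" unfolding L_def using M.subset_set_add[OF H(1) S] by auto
    have "m = \<one>\<^bsub>K\<^esub> \<odot>\<^bsub>M\<^esub> m" using m by simp
    then have "m \<in> S" unfolding S_def using one_closed by blast
    then have "m \<in> L" using HL(2) by auto
    then have "v \<in> L" using max[OF L _ _ HL(1)] H(2) HL(1) False by auto
    then obtain h b where hb: "h \<in> H" "b \<in> carrier K" "v = h \<oplus>\<^bsub>M\<^esub> (b \<odot>\<^bsub>M\<^esub> m)"
      by (auto simp: L_def set_add_defs S_def)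
    have hM: "h \<in> carrier M" using hb HE(1) by auto
    have "b \<noteq> \<zero>\<^bsub>K\<^esub>" using hb H(3) m hM by auto
    then have inv: "inv\<^bsub>K\<^esub> b \<in> carrier K" "inv\<^bsub>K\<^esub> b \<otimes>\<^bsub>K\<^esub> b = \<one>\<^bsub>K\<^esub>"
      using hb(2) field_Units by auto
    have "inv\<^bsub>K\<^esub> b \<odot>\<^bsub>M\<^esub> v = inv\<^bsub>K\<^esub> b \<odot>\<^bsub>M\<^esub> h \<oplus>\<^bsub>M\<^esub> m"
      using hb(3) hM m inv hb(2) by (simp add: M.smult_r_distr M.smult_assoc1[symmetric])
    then have "m \<ominus>\<^bsub>M\<^esub> (inv\<^bsub>K\<^esub> b \<odot>\<^bsub>M\<^esub> v) = \<ominus>\<^bsub>M\<^esub> (inv\<^bsub>K\<^esub> b \<odot>\<^bsub>M\<^esub> h)"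
      using inv hM m by (simp add: a_minus_def M.minus_add M.a_ac M.r_neg2 M.r_neg1 M.r_neg M.l_neg)
    then show ?thesis using inv(1) HE(3)[OF HE(4)[OF inv(1) hb(1)]]
      by (intro bexI[of _ "inv\<^bsub>K\<^esub> b"]) simp_all
  qed
  \<comment> \<open>Two different coefficients would put a nonzero multiple of \<open>v\<close>,
    hence \<open>v\<close>, into H.\<close>
  have uniq: "a = b" if ab: "a \<in> carrier K" "b \<in> carrier K" "m \<in> carrier M"
    "m \<ominus>\<^bsub>M\<^esub> (a \<odot>\<^bsub>M\<^esub> v) \<in> H" "m \<ominus>\<^bsub>M\<^esub> (b \<odot>\<^bsub>M\<^esub> v) \<in> H" for a b m
  proof (rule ccontr)
    assume ne: "a \<noteq> b"
    define c where "c = a \<ominus>\<^bsub>K\<^esub> b"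
    have c: "c \<in> carrier K" "c \<noteq> \<zero>\<^bsub>K\<^esub>" using ab(1,2) ne abelian_group.minus_eq_zeroD[OF abelian_group_axioms, of a b]
      unfolding c_def by auto
    have "(m \<ominus>\<^bsub>M\<^esub> (b \<odot>\<^bsub>M\<^esub> v)) \<ominus>\<^bsub>M\<^esub> (m \<ominus>\<^bsub>M\<^esub> (a \<odot>\<^bsub>M\<^esub> v)) \<in> H"
      using M.submodule_minus[OF H(1) ab(5,4)] .
    moreover have "(m \<ominus>\<^bsub>M\<^esub> (b \<odot>\<^bsub>M\<^esub> v)) \<ominus>\<^bsub>M\<^esub> (m \<ominus>\<^bsub>M\<^esub> (a \<odot>\<^bsub>M\<^esub> v)) = c \<odot>\<^bsub>M\<^esub> v"
      using ab assms(3) M.diff_diff_cancel[of "a \<odot>\<^bsub>M\<^esub> v" "b \<odot>\<^bsub>M\<^esub> v" m] unfolding c_def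
      by (simp add: a_minus_def M.smult_l_distr M.smult_l_minus)
    ultimately have "c \<odot>\<^bsub>M\<^esub> v \<in> H" by simp
    then have "inv\<^bsub>K\<^esub> c \<odot>\<^bsub>M\<^esub> (c \<odot>\<^bsub>M\<^esub> v) \<in> H" using c field_Units HE(4) by simp
    moreover have "inv\<^bsub>K\<^esub> c \<odot>\<^bsub>M\<^esub> (c \<odot>\<^bsub>M\<^esub> v) = v"
      using c field_Units assms(3) by (simp add: M.smult_assoc1[symmetric])
    ultimately show False using H(3) by simp
  qed
  define f where "f m = (THE a. a \<in> carrier K \<and> m \<ominus>\<^bsub>M\<^esub> (a \<odot>\<^bsub>M\<^esub> v) \<in> H)" for m
  have f: "f m \<in> carrier K \<and> m \<ominus>\<^bsub>M\<^esub> (f m \<odot>\<^bsub>M\<^esub> v) \<in> H" if m: "m \<in> carrier M" for m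
  proof -
    have "\<exists>a. a \<in> carrier K \<and> m \<ominus>\<^bsub>M\<^esub> (a \<odot>\<^bsub>M\<^esub> v) \<in> H" using ex[OF m] by (simp only: Bex_def)
    then have "\<exists>!a. a \<in> carrier K \<and> m \<ominus>\<^bsub>M\<^esub> (a \<odot>\<^bsub>M\<^esub> v) \<in> H"
      by (rule ex_ex1I) (rule uniq[OF _ _ m]; simp)
    from theI'[OF this] show ?thesis by (simp only: f_def)
  qed
  note f = conjunct1[OF f] conjunct2[OF f]
  have feq: "f m = a" if "m \<in> carrier M" "a \<in> carrier K" "m \<ominus>\<^bsub>M\<^esub> (a \<odot>\<^bsub>M\<^esub> v) \<in> H" for m a
    using uniq[OF f(1)[OF that(1)] that(2,1) f(2)[OF that(1)] that(3)] .
  have fadd: "f (x \<oplus>\<^bsub>M\<^esub> y) = f x \<oplus>\<^bsub>K\<^esub> f y" if xy: "x \<in> carrier M" "y \<in> carrier M" for x y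
  proof (rule feq)
    have "(x \<ominus>\<^bsub>M\<^esub> (f x \<odot>\<^bsub>M\<^esub> v)) \<oplus>\<^bsub>M\<^esub> (y \<ominus>\<^bsub>M\<^esub> (f y \<odot>\<^bsub>M\<^esub> v)) \<in> H" by (intro HE(5) f(2) xy)
    moreover have "(x \<ominus>\<^bsub>M\<^esub> (f x \<odot>\<^bsub>M\<^esub> v)) \<oplus>\<^bsub>M\<^esub> (y \<ominus>\<^bsub>M\<^esub> (f y \<odot>\<^bsub>M\<^esub> v)) =
      x \<oplus>\<^bsub>M\<^esub> y \<ominus>\<^bsub>M\<^esub> ((f x \<oplus>\<^bsub>K\<^esub> f y) \<odot>\<^bsub>M\<^esub> v)"
      using f xy assms(3) by (simp add: a_minus_def M.minus_add M.a_ac M.smult_l_distr)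
    ultimately show "x \<oplus>\<^bsub>M\<^esub> y \<ominus>\<^bsub>M\<^esub> ((f x \<oplus>\<^bsub>K\<^esub> f y) \<odot>\<^bsub>M\<^esub> v) \<in> H" by simp
  qed (use xy f in auto)
  have fsm: "f (c \<odot>\<^bsub>M\<^esub> x) = c \<otimes>\<^bsub>K\<^esub> f x" if xy: "x \<in> carrier M" "c \<in> carrier K" for x c
  proof (rule feq)
    have "c \<odot>\<^bsub>M\<^esub> (x \<ominus>\<^bsub>M\<^esub> (f x \<odot>\<^bsub>M\<^esub> v)) \<in> H" by (intro HE(4) f(2) xy)
    moreover have "c \<odot>\<^bsub>M\<^esub> (x \<ominus>\<^bsub>M\<^esub> (f x \<odot>\<^bsub>M\<^esub> v)) = c \<odot>\<^bsub>M\<^esub> x \<ominus>\<^bsub>M\<^esub> ((c \<otimes>\<^bsub>K\<^esub> f x) \<odot>\<^bsub>M\<^esub> v)"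
      using f xy assms(3) by (simp add: a_minus_def M.smult_r_distr M.smult_r_minus M.smult_assoc1)
    ultimately show "c \<odot>\<^bsub>M\<^esub> x \<ominus>\<^bsub>M\<^esub> ((c \<otimes>\<^bsub>K\<^esub> f x) \<odot>\<^bsub>M\<^esub> v) \<in> H" by simp
  qed (use xy f in auto)
  show thesis
  proof (rule that)
    show "restrict f (carrier M) \<in> carrier (dual_space K M)"
      using f fadd fsm by (simp add: dual_space_def)
    show "\<forall>n\<in>N. restrict f (carrier M) n = \<zero>\<^bsub>K\<^esub>"
    proof
      fix n assume "n \<in> N"
      then have n: "n \<in> H" "n \<in> carrier M" using H(2) HE(1) by auto
      have "n \<ominus>\<^bsub>M\<^esub> (\<zero>\<^bsub>K\<^esub> \<odot>\<^bsub>M\<^esub> v) \<in> H"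
        using assms(3) M.submodule_minus[OF H(1) n(1) M.submodule_zero_in[OF H(1)]] by simp
      then have "f n = \<zero>\<^bsub>K\<^esub>" by (rule feq[OF n(2) zero_closed])
      then show "restrict f (carrier M) n = \<zero>\<^bsub>K\<^esub>" using n(2) by simp
    qed
    have "v \<ominus>\<^bsub>M\<^esub> (\<one>\<^bsub>K\<^esub> \<odot>\<^bsub>M\<^esub> v) \<in> H"
      using assms(3) M.submodule_zero_in[OF H(1)] by (simp add: a_minus_def M.r_neg)
    then have "f v = \<one>\<^bsub>K\<^esub>" by (rule feq[OF assms(3) one_closed])
    then show "restrict f (carrier M) v = \<one>\<^bsub>K\<^esub>" using assms(3) by simp
  qed
qed

text \<open>Finite dimensionality enters only through the descending chain condition for subspaces.\<close>

definition artinian :: "('k, 'b) ring_scheme \<Rightarrow> ('k, 'v, 'c) module_scheme \<Rightarrow> 'v set \<Rightarrow> bool" where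
  "artinian K M H \<longleftrightarrow> (\<forall>\<N>. \<N> \<noteq> {} \<and> (\<forall>N\<in>\<N>. submodule N K M \<and> N \<subseteq> H) \<longrightarrow>
     (\<exists>N0\<in>\<N>. \<forall>N\<in>\<N>. N \<subseteq> N0 \<longrightarrow> N = N0))"

lemma artinianD:
  assumes "artinian K M H" "\<N> \<noteq> {}" "\<And>N. N \<in> \<N> \<Longrightarrow> submodule N K M" "\<And>N. N \<in> \<N> \<Longrightarrow> N \<subseteq> H"
  obtains N0 where "N0 \<in> \<N>" "\<And>N. N \<in> \<N> \<Longrightarrow> N \<subseteq> N0 \<Longrightarrow> N = N0"
  using assms unfolding artinian_def by meson

lemma artinian_subset: "artinian K M H \<Longrightarrow> L \<subseteq> H \<Longrightarrow> artinian K M L"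
  unfolding artinian_def by (meson order_trans)

text \<open>A subspace of the image is recovered from its preimage in \<open>H\<close>, so a minimal
  preimage comes from a minimal subspace.\<close>

lemma artinian_image:
  assumes "Module.module K M" "Module.module K N" "linear_map K M N f" "submodule H K M" "artinian K M H"
  shows "artinian K N (f ` H)"
  unfolding artinian_def
proof (intro allI impI, elim conjE)
  fix \<N> assume ne: "\<N> \<noteq> {}" and \<N>: "\<forall>L\<in>\<N>. submodule L K N \<and> L \<subseteq> f ` H"
  let ?g = "\<lambda>L. {v \<in> H. f v \<in> L}"
  have gf: "f ` ?g L = L" if "L \<in> \<N>" for L using \<N> that by fast
  obtain G0 where G0: "G0 \<in> ?g ` \<N>" "\<And>G. G \<in> ?g ` \<N> \<Longrightarrow> G \<subseteq> G0 \<Longrightarrow> G = G0"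
  proof (rule artinianD[OF assms(5)])
    show "?g ` \<N> \<noteq> {}" using ne by simp
    show "submodule G K M" if "G \<in> ?g ` \<N>" for G
      using that \<N> submodule_vimage[OF assms(1-3) _ assms(4)] by fast
    show "G \<subseteq> H" if "G \<in> ?g ` \<N>" for G using that by fast
  qed (rule that)
  then obtain L0 where L0: "L0 \<in> \<N>" "G0 = ?g L0" by fast
  show "\<exists>N0\<in>\<N>. \<forall>N\<in>\<N>. N \<subseteq> N0 \<longrightarrow> N = N0"
  proof (intro bexI[OF _ L0(1)] ballI impI)
    fix L assume L: "L \<in> \<N>" "L \<subseteq> L0"
    then have "?g L = ?g L0" using G0(2)[of "?g L"] L0(2) by fast
    then show "L = L0" using gf[OF L(1)] gf[OF L0(1)] by metis
  qed
qed

text \<open>Minimise twice: first the trace on \<open>L\<close>, then, among the members below that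
  minimiser, the trace on \<open>H\<close> of the sum with \<open>L\<close>. Nested subspaces of the
  sum that have equal traces of both kinds coincide, by a modular-law argument.\<close>

lemma (in module) artinian_set_add:
  assumes H: "submodule H R M" "artinian R M H" and L: "submodule L R M" "artinian R M L"
  shows "artinian R M (H <+>\<^bsub>M\<^esub> L)"
  unfolding artinian_def
proof (intro allI impI, elim conjE)
  fix \<N> assume ne: "\<N> \<noteq> {}" and \<N>: "\<forall>N\<in>\<N>. submodule N R M \<and> N \<subseteq> H <+>\<^bsub>M\<^esub> L"
  obtain T where T: "T \<in> (\<lambda>N. N \<inter> L) ` \<N>" "\<And>N. N \<in> (\<lambda>N. N \<inter> L) ` \<N> \<Longrightarrow> N \<subseteq> T \<Longrightarrow> N = T"
  proof (rule artinianD[OF L(2), of "(\<lambda>N. N \<inter> L) ` \<N>"])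
    show "submodule G R M" if "G \<in> (\<lambda>N. N \<inter> L) ` \<N>" for G
      using that \<N> submodule_Int[OF _ L(1)] by fast
  qed (use ne in \<open>auto intro: that\<close>)
  obtain N1 where N1: "N1 \<in> \<N>" "T = N1 \<inter> L" using T(1) by fast
  \<comment> \<open>Below \<open>N1\<close> the intersection with \<open>L\<close> cannot shrink any
    further, so it is \<open>T\<close> throughout.\<close>
  define \<M> where "\<M> = {N \<in> \<N>. N \<subseteq> N1}"
  have \<M>T: "N \<inter> L = T" if "N \<in> \<M>" for N
    using that N1 T(2)[of "N \<inter> L"] unfolding \<M>_def by fast
  obtain B where B: "B \<in> (\<lambda>N. (N <+>\<^bsub>M\<^esub> L) \<inter> H) ` \<M>"
    "\<And>N. N \<in> (\<lambda>N. (N <+>\<^bsub>M\<^esub> L) \<inter> H) ` \<M> \<Longrightarrow> N \<subseteq> B \<Longrightarrow> N = B"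
  proof (rule artinianD[OF H(2), of "(\<lambda>N. (N <+>\<^bsub>M\<^esub> L) \<inter> H) ` \<M>"])
    show "submodule G R M" if "G \<in> (\<lambda>N. (N <+>\<^bsub>M\<^esub> L) \<inter> H) ` \<M>" for G
      using that \<N> submodule_Int[OF submodule_set_add[OF _ L(1)] H(1)] unfolding \<M>_def by fast
  qed (use N1 in \<open>auto simp: \<M>_def intro: that\<close>)
  obtain N2 where N2: "N2 \<in> \<M>" "B = (N2 <+>\<^bsub>M\<^esub> L) \<inter> H" using B(1) by fast
  have "N = N2" if N: "N \<in> \<N>" "N \<subseteq> N2" for N
  proof
    have NM: "N \<in> \<M>" using N N2 unfolding \<M>_def by fast
    have sN: "submodule N R M" "submodule N2 R M" and N2s: "N2 \<subseteq> H <+>\<^bsub>M\<^esub> L" 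
      using \<N> N N2(1) unfolding \<M>_def by auto
    have "N <+>\<^bsub>M\<^esub> L \<subseteq> N2 <+>\<^bsub>M\<^esub> L"
    proof
      fix z assume "z \<in> N <+>\<^bsub>M\<^esub> L"
      then obtain n l where "n \<in> N" "l \<in> L" "z = n \<oplus>\<^bsub>M\<^esub> l" by (rule set_addE)
      then show "z \<in> N2 <+>\<^bsub>M\<^esub> L" using subsetD[OF N(2)] by (simp add: set_addI)
    qed
    then have "(N <+>\<^bsub>M\<^esub> L) \<inter> H \<subseteq> B" unfolding N2(2) by (rule Int_mono) simp
    then have eq: "(N <+>\<^bsub>M\<^esub> L) \<inter> H = B" by (rule B(2)[OF imageI[OF NM]])
    \<comment> \<open>Write x = h + l. Then h lies in N2 + L, hence in N + L, say h = n + l', and x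
      - n = l' + l is in both \<open>N2\<close> and \<open>L\<close>. As \<open>N\<close> and
      \<open>N2\<close> meet \<open>L\<close> in the same set, x - n is in \<open>N\<close>.\<close>
    show "N2 \<subseteq> N"
    proof
      fix x assume x: "x \<in> N2"
      then obtain h l where hl: "h \<in> H" "l \<in> L" "x = h \<oplus>\<^bsub>M\<^esub> l"
        using N2s by (auto simp: set_add_defs)
      have c: "x \<in> carrier M" "h \<in> carrier M" "l \<in> carrier M"
        using x hl submoduleE(1)[OF sN(2)] submoduleE(1)[OF H(1)] submoduleE(1)[OF L(1)] by auto
      have "h = x \<oplus>\<^bsub>M\<^esub> (\<ominus>\<^bsub>M\<^esub> l)" using hl(3) c by (simp add: M.a_assoc M.r_neg)
      then have "h \<in> B" unfolding N2(2)
        using set_addI[OF x submoduleE(3)[OF L(1) hl(2)], of M] hl(1) by simp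
      then have "h \<in> N <+>\<^bsub>M\<^esub> L" using eq by fast
      then obtain n l' where nl: "n \<in> N" "l' \<in> L" "h = n \<oplus>\<^bsub>M\<^esub> l'" by (auto simp: set_add_defs)
      have c': "n \<in> carrier M" "l' \<in> carrier M"
        using nl submoduleE(1)[OF sN(1)] submoduleE(1)[OF L(1)] by auto
      have d: "x \<ominus>\<^bsub>M\<^esub> n = l' \<oplus>\<^bsub>M\<^esub> l"
      proof -
        have "x = (l' \<oplus>\<^bsub>M\<^esub> l) \<oplus>\<^bsub>M\<^esub> n" unfolding hl(3) nl(3) using c c' by (simp add: M.a_ac)
        then show ?thesis using c c' by (simp add: a_minus_def M.a_assoc M.r_neg)
      qed
      have "x \<ominus>\<^bsub>M\<^esub> n \<in> N2" using submodule_minus[OF sN(2) x] nl(1) N(2) by fast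
      moreover have "x \<ominus>\<^bsub>M\<^esub> n \<in> L" unfolding d using submoduleE(5)[OF L(1)] nl(2) hl(2) by fast
      ultimately have "x \<ominus>\<^bsub>M\<^esub> n \<in> N" using \<M>T[OF NM] \<M>T[OF N2(1)] by fast
      then have "(x \<ominus>\<^bsub>M\<^esub> n) \<oplus>\<^bsub>M\<^esub> n \<in> N" using submoduleE(5)[OF sN(1)] nl(1) by fast
      then show "x \<in> N" using c c' by (simp add: a_minus_def M.a_assoc M.l_neg)
    qed
  qed (rule N(2))
  moreover have "N2 \<in> \<N>" using N2(1) unfolding \<M>_def by simp
  ultimately show "\<exists>N0\<in>\<N>. \<forall>N\<in>\<N>. N \<subseteq> N0 \<longrightarrow> N = N0" by (intro bexI ballI impI)
qed

text \<open>The only subspaces of a line are zero and the line, since a nonzero element can be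
  rescaled to any other.\<close>

lemma artinian_singleton_span:
  assumes "vspace K M" "v \<in> carrier M"
  shows "artinian K M {a \<odot>\<^bsub>M\<^esub> v |a. a \<in> carrier K}"
  unfolding artinian_def
proof (intro allI impI, elim conjE)
  interpret field K using assms(1) by (simp add: vspace_def)
  interpret M: module K M using assms(1) by (simp add: vspace_def)
  let ?S = "{a \<odot>\<^bsub>M\<^esub> v |a. a \<in> carrier K}"
  fix \<N> assume ne: "\<N> \<noteq> {}" and \<N>: "\<forall>N\<in>\<N>. submodule N K M \<and> N \<subseteq> ?S"
  have full: "?S \<subseteq> N" if N: "N \<in> \<N>" and n: "n \<in> N" "n \<noteq> \<zero>\<^bsub>M\<^esub>" for N n
  proof
    obtain a where a: "a \<in> carrier K" "n = a \<odot>\<^bsub>M\<^esub> v" using \<N> N n by blast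
    then have "a \<noteq> \<zero>\<^bsub>K\<^esub>" using n assms(2) by force
    then have i: "inv\<^bsub>K\<^esub> a \<in> carrier K" "inv\<^bsub>K\<^esub> a \<otimes>\<^bsub>K\<^esub> a = \<one>\<^bsub>K\<^esub>" using a field_Units by auto
    have sN: "submodule N K M" using \<N> N by fast
    fix x assume "x \<in> ?S"
    then obtain b where b: "b \<in> carrier K" "x = b \<odot>\<^bsub>M\<^esub> v" by blast
    have "(b \<otimes>\<^bsub>K\<^esub> inv\<^bsub>K\<^esub> a) \<odot>\<^bsub>M\<^esub> n \<in> N" using M.submoduleE(4)[OF sN _ n(1)] b i by simp
    moreover have "(b \<otimes>\<^bsub>K\<^esub> inv\<^bsub>K\<^esub> a) \<odot>\<^bsub>M\<^esub> n = x"
      using a b i assms(2) by (simp add: M.smult_assoc1[symmetric] m_assoc)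
    ultimately show "x \<in> N" by simp
  qed
  show "\<exists>N0\<in>\<N>. \<forall>N\<in>\<N>. N \<subseteq> N0 \<longrightarrow> N = N0"
  proof (cases "\<exists>N\<in>\<N>. N \<subseteq> {\<zero>\<^bsub>M\<^esub>}")
    case True
    then obtain N where N: "N \<in> \<N>" "N \<subseteq> {\<zero>\<^bsub>M\<^esub>}" by (rule bexE)
    have "L = N" if L: "L \<in> \<N>" "L \<subseteq> N" for L
      using M.submodule_zero_in[of L] M.submodule_zero_in[of N] \<N> L N by fast
    then show ?thesis by (intro bexI[OF _ N(1)] ballI impI)
  next
    case False
    have all: "N = ?S" if N: "N \<in> \<N>" for N
    proof -
      have "\<not> N \<subseteq> {\<zero>\<^bsub>M\<^esub>}" using False N by (rule_tac notI) (erule notE, rule bexI)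
      then obtain n where n: "n \<in> N" "n \<noteq> \<zero>\<^bsub>M\<^esub>" by auto
      have "N \<subseteq> ?S" using \<N> N by (rule_tac conjunct2) (rule bspec)
      then show ?thesis using full[OF N n] by (rule equalityI)
    qed
    obtain N where N: "N \<in> \<N>" using ne by (metis ex_in_conv)
    show ?thesis by (intro bexI[OF _ N] ballI impI) (rule trans[OF all all[OF N, symmetric]])
  qed
qed

text \<open>The spanning vectors are added one line at a time with \<open>artinian_set_add\<close>.
  The induction carries some artinian submodule containing all combinations rather than the span
  itself.\<close>

lemma fin_dim_imp_artinian:
  assumes "vspace K M" "fin_dim K M"
  shows "artinian K M (carrier M)"
proof -
  interpret field K using assms(1) by (simp add: vspace_def)
  interpret M: module K M using assms(1) by (simp add: vspace_def)
  have *: "\<exists>H. submodule H K M \<and> artinian K M H \<and> (\<forall>a\<in>B \<rightarrow> carrier K. finsum M (\<lambda>b. a b \<odot>\<^bsub>M\<^esub> b) B \<in> H)"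
    if "finite B" "B \<subseteq> carrier M" for B
    using that
  proof (induction B)
    case empty
    have s: "{a \<odot>\<^bsub>M\<^esub> \<zero>\<^bsub>M\<^esub> |a. a \<in> carrier K} = {\<zero>\<^bsub>M\<^esub>}"
      using zero_closed by (auto intro!: exI[of _ "\<zero>\<^bsub>K\<^esub>"])
    show ?case using M.submodule_singleton_span[OF M.zero_closed] artinian_singleton_span[OF assms(1) M.zero_closed]
      unfolding s by (intro exI[of _ "{\<zero>\<^bsub>M\<^esub>}"]) simp
  next
    case (insert b B)
    then have bM: "b \<in> carrier M" and BM: "B \<subseteq> carrier M" by auto
    obtain H where H: "submodule H K M" "artinian K M H"
      "\<forall>a\<in>B \<rightarrow> carrier K. finsum M (\<lambda>b. a b \<odot>\<^bsub>M\<^esub> b) B \<in> H"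
      using insert.IH[OF BM] by (elim exE conjE) (rule that)
    let ?S = "{a \<odot>\<^bsub>M\<^esub> b |a. a \<in> carrier K}"
    have S: "submodule ?S K M" "artinian K M ?S"
      using M.submodule_singleton_span[OF bM] artinian_singleton_span[OF assms(1) bM] by auto
    show ?case
    proof (intro exI conjI ballI)
      show "submodule (?S <+>\<^bsub>M\<^esub> H) K M" by (rule M.submodule_set_add[OF S(1) H(1)])
      show "artinian K M (?S <+>\<^bsub>M\<^esub> H)" by (rule M.artinian_set_add[OF S H(1,2)])
      fix a assume a: "a \<in> insert b B \<rightarrow> carrier K"
      have "(\<lambda>b. a b \<odot>\<^bsub>M\<^esub> b) \<in> B \<rightarrow> carrier M" using a BM by (auto simp: Pi_iff)
      then have "finsum M (\<lambda>b. a b \<odot>\<^bsub>M\<^esub> b) (insert b B) = a b \<odot>\<^bsub>M\<^esub> b \<oplus>\<^bsub>M\<^esub> finsum M (\<lambda>b. a b \<odot>\<^bsub>M\<^esub> b) B"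
        using insert(1,2) a bM by (intro M.finsum_insert) auto
      moreover have "a b \<odot>\<^bsub>M\<^esub> b \<in> ?S" using a by fast
      moreover have "finsum M (\<lambda>b. a b \<odot>\<^bsub>M\<^esub> b) B \<in> H" using a by (intro bspec[OF H(3)]) auto
      ultimately show "finsum M (\<lambda>b. a b \<odot>\<^bsub>M\<^esub> b) (insert b B) \<in> ?S <+>\<^bsub>M\<^esub> H"
        by (simp only: set_addI)
    qed
  qed
  obtain B where B: "finite B" "B \<subseteq> carrier M"
    "\<forall>v\<in>carrier M. \<exists>a \<in> B \<rightarrow> carrier K. v = finsum M (\<lambda>b. a b \<odot>\<^bsub>M\<^esub> b) B"
    using assms(2) unfolding fin_dim_def by (elim exE conjE) (rule that)
  obtain H where H: "artinian K M H" "\<forall>a\<in>B \<rightarrow> carrier K. finsum M (\<lambda>b. a b \<odot>\<^bsub>M\<^esub> b) B \<in> H"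
    using *[OF B(1,2)] by (elim exE conjE) (rule that)
  have "v \<in> H" if v: "v \<in> carrier M" for v
  proof -
    obtain a where "a \<in> B \<rightarrow> carrier K" "v = finsum M (\<lambda>b. a b \<odot>\<^bsub>M\<^esub> b) B" using bspec[OF B(3) v] by (elim bexE)
    then show ?thesis using bspec[OF H(2), of a] by simp
  qed
  then show ?thesis using artinian_subset[OF H(1)] by blast
qed

text \<open>The Mittag-Leffler argument.\<close>

lemma inverse_sequence_cosets:
  fixes M :: "nat \<Rightarrow> ('k, 'v) module"
  assumes M: "\<And>n. Module.module K (M n)"
    and e: "\<And>m n. n \<le> m \<Longrightarrow> linear_map K (M m) (M n) (e m n)"
    and e_id: "\<And>n v. v \<in> carrier (M n) \<Longrightarrow> e n n v = v"
    and e_comp: "\<And>l m n v. n \<le> m \<Longrightarrow> m \<le> l \<Longrightarrow> v \<in> carrier (M l) \<Longrightarrow> e m n (e l m v) = e l n v"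
    and P: "\<And>n. submodule (P n) K (M n)" and art: "\<And>n. artinian K (M n) (P n)"
    and eP: "\<And>m n p. n \<le> m \<Longrightarrow> p \<in> P m \<Longrightarrow> e m n p \<in> P n"
    and v: "\<And>n. v n \<in> carrier (M n)"
    and ev: "\<And>n. e (Suc n) n (v (Suc n)) \<ominus>\<^bsub>M n\<^esub> v n \<in> P n"
  obtains u where "\<And>n. u n \<in> carrier (M n)" "\<And>n. e (Suc n) n (u (Suc n)) = u n"
    "\<And>n. u n \<ominus>\<^bsub>M n\<^esub> v n \<in> P n"
proof -
  have PM: "p \<in> carrier (M n)" if "p \<in> P n" for p n
    using module.submoduleE(1)[OF M P] that by (rule subsetD)
  have ec: "x \<in> carrier (M m) \<Longrightarrow> n \<le> m \<Longrightarrow> e m n x \<in> carrier (M n)" for m n x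
    using linear_map_closed[OF e] .
  have ag: "abelian_group (M n)" for n using M unfolding module_def by (rule_tac conjunct1[OF conjunct2])
  \<comment> \<open>The hypothesis \<open>ev\<close> compares neighbouring terms; telescoping
    extends it to all m \<ge> n.\<close>
  have evm: "e m n (v m) \<ominus>\<^bsub>M n\<^esub> v n \<in> P n" if "n \<le> m" for m n
    using that
  proof (induction m rule: dec_induct)
    case base
    show ?case using module.submodule_zero_in[OF M P] v
      by (simp add: e_id a_minus_def abelian_group.r_neg[OF ag])
  next
    case (step m)
    interpret Mn: module K "M n" by (rule M)
    let ?d = "e (Suc m) m (v (Suc m)) \<ominus>\<^bsub>M m\<^esub> v m"
    have "e m n ?d = e (Suc m) n (v (Suc m)) \<ominus>\<^bsub>M n\<^esub> e m n (v m)"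
      using step(1) v ec by (simp add: linear_map_minus[OF M M e] e_comp)
    then have "e (Suc m) n (v (Suc m)) \<ominus>\<^bsub>M n\<^esub> e m n (v m) \<in> P n"
      using eP[OF step(1) ev[of m]] by simp
    then have "(e (Suc m) n (v (Suc m)) \<ominus>\<^bsub>M n\<^esub> e m n (v m)) \<oplus>\<^bsub>M n\<^esub> (e m n (v m) \<ominus>\<^bsub>M n\<^esub> v n) \<in> P n"
      using step.IH by (rule Mn.submoduleE(5)[OF P])
    then show ?case using Mn.diff_add_diff v ec step(1) by simp
  qed
  \<comment> \<open>The coset of \<open>P m\<close> through \<open>v m\<close>; a compatible
    sequence of elements of the \<open>A m\<close> is sought.\<close>
  define A where "A m = {x \<in> carrier (M m). x \<ominus>\<^bsub>M m\<^esub> v m \<in> P m}" for m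
  have A_alt: "x \<in> A m \<longleftrightarrow> (\<exists>p\<in>P m. x = v m \<oplus>\<^bsub>M m\<^esub> p)" for x m
  proof -
    interpret Mm: module K "M m" by (rule M)
    show ?thesis
    proof
      assume x: "x \<in> A m"
      then have "x = v m \<oplus>\<^bsub>M m\<^esub> (x \<ominus>\<^bsub>M m\<^esub> v m)" using v[of m]
        by (simp add: A_def a_minus_def Mm.a_ac Mm.r_neg Mm.r_neg1 Mm.r_neg2)
      then show "\<exists>p\<in>P m. x = v m \<oplus>\<^bsub>M m\<^esub> p" using x unfolding A_def
        by (intro bexI[of _ "x \<ominus>\<^bsub>M m\<^esub> v m"]) simp_all
    next
      assume "\<exists>p\<in>P m. x = v m \<oplus>\<^bsub>M m\<^esub> p"
      then obtain p where p: "p \<in> P m" "x = v m \<oplus>\<^bsub>M m\<^esub> p" by (elim bexE)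
      have "x = p \<oplus>\<^bsub>M m\<^esub> v m" using p v[of m] PM[OF p(1)] by (simp add: Mm.a_comm)
      then have "x \<ominus>\<^bsub>M m\<^esub> v m = p" using PM[OF p(1)] v[of m]
        by (simp add: a_minus_def Mm.a_assoc Mm.r_neg)
      then show "x \<in> A m" using p v[of m] PM[OF p(1)] by (simp add: A_def)
    qed
  qed
  have eA: "e m n x \<in> A n" if x: "x \<in> A m" "n \<le> m" for m n x
  proof -
    interpret Mn: module K "M n" by (rule M)
    have xm: "x \<in> carrier (M m)" using x by (simp add: A_def)
    have "e m n (x \<ominus>\<^bsub>M m\<^esub> v m) \<oplus>\<^bsub>M n\<^esub> (e m n (v m) \<ominus>\<^bsub>M n\<^esub> v n) \<in> P n"
      by (rule Mn.submoduleE(5)[OF P eP[OF x(2)] evm[OF x(2)]]) (use x in \<open>simp add: A_def\<close>)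
    moreover have "e m n (x \<ominus>\<^bsub>M m\<^esub> v m) \<oplus>\<^bsub>M n\<^esub> (e m n (v m) \<ominus>\<^bsub>M n\<^esub> v n) = e m n x \<ominus>\<^bsub>M n\<^esub> v n"
      using Mn.diff_add_diff[OF ec[OF xm x(2)] ec[OF v x(2)] v]
      by (simp add: linear_map_minus[OF M M e[OF x(2)] xm v])
    ultimately show ?thesis using ec[OF xm x(2)] by (simp add: A_def)
  qed
  \<comment> \<open>The images of the \<open>P m\<close> in \<open>P n\<close> decrease, so by the
    chain condition they stabilise at some k. The images of the \<open>A m\<close> are nested cosets
    of these subspaces, and nested cosets of one subspace are equal.\<close>
  have stab: "\<exists>k\<ge>n. \<forall>m\<ge>k. e m n ` A m = e k n ` A k" for n
  proof -
    interpret Mn: module K "M n" by (rule M)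
    have "\<exists>L0\<in>(\<lambda>m. e m n ` P m) ` {n..}. \<forall>L\<in>(\<lambda>m. e m n ` P m) ` {n..}. L \<subseteq> L0 \<longrightarrow> L = L0"
    proof (rule artinianD[OF art[of n], of "(\<lambda>m. e m n ` P m) ` {n..}"])
      show "submodule L K (M n)" if "L \<in> (\<lambda>m. e m n ` P m) ` {n..}" for L
        using that by (elim imageE) (simp add: submodule_image[OF M M e P])
      show "L \<subseteq> P n" if "L \<in> (\<lambda>m. e m n ` P m) ` {n..}" for L
        using that by (elim imageE) (simp add: image_subset_iff eP)
    next
      fix L0 assume "L0 \<in> (\<lambda>m. e m n ` P m) ` {n..}"
        "\<And>L. L \<in> (\<lambda>m. e m n ` P m) ` {n..} \<Longrightarrow> L \<subseteq> L0 \<Longrightarrow> L = L0"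
      then show ?thesis by (intro bexI[of _ L0] ballI impI)
    qed simp
    then obtain k where k: "n \<le> k"
      and min: "\<And>m. n \<le> m \<Longrightarrow> e m n ` P m \<subseteq> e k n ` P k \<Longrightarrow> e m n ` P m = e k n ` P k" by auto
    have "e m n ` A m = e k n ` A k" if km: "k \<le> m" for m
    proof
      have nm: "n \<le> m" using k km by simp
      have 1: "e m n x = e k n (e m k x)" if "x \<in> carrier (M m)" for x
        using e_comp[OF k km that] by simp
      show "e m n ` A m \<subseteq> e k n ` A k"
      proof
        fix y assume "y \<in> e m n ` A m"
        then obtain x where x: "x \<in> A m" "y = e m n x" by (elim imageE)
        then have "y = e k n (e m k x)" using 1[of x] by (simp add: A_def)
        then show "y \<in> e k n ` A k" using eA[OF x(1) km] by simp
      qed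
      have "e m n ` P m \<subseteq> e k n ` P k"
      proof
        fix y assume "y \<in> e m n ` P m"
        then obtain x where x: "x \<in> P m" "y = e m n x" by (elim imageE)
        then have "y = e k n (e m k x)" using 1[OF PM[OF x(1)]] by simp
        then show "y \<in> e k n ` P k" using eP[OF km x(1)] by simp
      qed
      then have PP: "e m n ` P m = e k n ` P k" by (rule min[OF nm])
      \<comment> \<open>x differs from the image of \<open>v m\<close> by an element of
        \<open>P k\<close>, whose image at level n comes from some p in \<open>P m\<close>; then v m
        + p is the required preimage.\<close>
      show "e k n ` A k \<subseteq> e m n ` A m"
      proof
        fix y assume "y \<in> e k n ` A k"
        then obtain x where x: "x \<in> A k" "y = e k n x" by (elim imageE)
        have xk: "x \<in> carrier (M k)" using x by (simp add: A_def)
        interpret Mk: module K "M k" by (rule M)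
        have emk: "e m k (v m) \<in> carrier (M k)" using ec[OF v km] .
        have "(x \<ominus>\<^bsub>M k\<^esub> v k) \<ominus>\<^bsub>M k\<^esub> (e m k (v m) \<ominus>\<^bsub>M k\<^esub> v k) \<in> P k"
          by (rule Mk.submodule_minus[OF P _ evm[OF km]]) (use x in \<open>simp add: A_def\<close>)
        also have "(x \<ominus>\<^bsub>M k\<^esub> v k) \<ominus>\<^bsub>M k\<^esub> (e m k (v m) \<ominus>\<^bsub>M k\<^esub> v k) = x \<ominus>\<^bsub>M k\<^esub> e m k (v m)"
        proof -
          have "(x \<ominus>\<^bsub>M k\<^esub> v k) \<ominus>\<^bsub>M k\<^esub> (e m k (v m) \<ominus>\<^bsub>M k\<^esub> v k)
            = (v k \<oplus>\<^bsub>M k\<^esub> \<ominus>\<^bsub>M k\<^esub> v k) \<oplus>\<^bsub>M k\<^esub> (x \<oplus>\<^bsub>M k\<^esub> \<ominus>\<^bsub>M k\<^esub> e m k (v m))"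
            using xk v[of k] emk unfolding a_minus_def Mk.minus_add[OF emk Mk.a_inv_closed[OF v]]
            by (simp add: Mk.a_ac)
          then show ?thesis using xk v[of k] emk by (simp add: a_minus_def Mk.r_neg)
        qed
        finally have "e k n (x \<ominus>\<^bsub>M k\<^esub> e m k (v m)) \<in> e m n ` P m" unfolding PP by (rule imageI)
        then obtain p where p: "p \<in> P m" "e k n (x \<ominus>\<^bsub>M k\<^esub> e m k (v m)) = e m n p" by (elim imageE)
        have "e k n x \<ominus>\<^bsub>M n\<^esub> e m n (v m) = e m n p"
          using p(2) 1[OF v] by (simp add: linear_map_minus[OF M M e[OF k] xk emk])
        moreover have "e m n (v m \<oplus>\<^bsub>M m\<^esub> p) = e m n (v m) \<oplus>\<^bsub>M n\<^esub> e m n p"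
          using linear_map_add[OF e[OF nm] v PM[OF p(1)]] .
        moreover have "e m n (v m) \<oplus>\<^bsub>M n\<^esub> (e k n x \<ominus>\<^bsub>M n\<^esub> e m n (v m)) = e k n x"
          using ec[OF v[of m] nm] ec[OF xk k] by (simp add: a_minus_def Mn.a_ac Mn.r_neg Mn.r_neg1 Mn.r_neg2)
        ultimately have "y = e m n (v m \<oplus>\<^bsub>M m\<^esub> p)" using x(2) by simp
        moreover have "v m \<oplus>\<^bsub>M m\<^esub> p \<in> A m" unfolding A_alt by (rule bexI[OF refl p(1)])
        ultimately show "y \<in> e m n ` A m" by simp
      qed
    qed
    then show ?thesis using k by (intro exI[of _ k] conjI allI impI)
  qed
  have vA: "v n \<in> A n" for n
    using v[of n] module.submodule_zero_in[OF M P, of n] by (simp add: A_def a_minus_def abelian_group.r_neg[OF ag])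
  \<comment> \<open>Stable images. Each \<open>S n\<close> is already the image of a single late
    \<open>A k\<close>, which makes it nonempty and makes the maps between consecutive ones
    surjective.\<close>
  define S where "S n = (\<Inter>m\<in>{n..}. e m n ` A m)" for n
  have S_eq: "\<exists>k\<ge>l. S n = e k n ` A k" if "n \<le> l" for n l
  proof -
    obtain k where k: "k \<ge> n" "\<And>m. m \<ge> k \<Longrightarrow> e m n ` A m = e k n ` A k" using stab[of n] by auto
    have sub: "e m' n ` A m' \<subseteq> e m n ` A m" if "n \<le> m" "m \<le> m'" for m m'
    proof
      fix y assume "y \<in> e m' n ` A m'"
      then obtain x where x: "x \<in> A m'" "y = e m' n x" by (elim imageE)
      then have "y = e m n (e m' m x)" using e_comp[OF that, of x] by (simp add: A_def)
      then show "y \<in> e m n ` A m" using eA[OF x(1) that(2)] by simp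
    qed
    let ?k = "max k l"
    have "S n = e ?k n ` A ?k"
    proof
      show "S n \<subseteq> e ?k n ` A ?k" unfolding S_def using k(1) by (intro INF_lower) simp
      have "e ?k n ` A ?k \<subseteq> e m n ` A m" if "n \<le> m" for m
      proof -
        have "e ?k n ` A ?k = e (max ?k m) n ` A (max ?k m)"
          using k(2)[of ?k] k(2)[of "max ?k m"] by simp
        then show ?thesis using sub[OF that, of "max ?k m"] by simp
      qed
      then show "e ?k n ` A ?k \<subseteq> S n" unfolding S_def by (intro INF_greatest) simp
    qed
    then show ?thesis by (intro exI[of _ ?k]) simp
  qed
  have "\<exists>u. \<forall>n. u n \<in> S n \<and> e (Suc n) n (u (Suc n)) = u n"
  proof (rule dependent_nat_choice)
    obtain k where "S 0 = e k 0 ` A k" using S_eq[of 0 0] by auto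
    then show "\<exists>x. x \<in> S 0" using vA[of k] by auto
    fix x n assume x: "x \<in> S n"
    obtain k where k: "k \<ge> Suc n" "S (Suc n) = e k (Suc n) ` A k" using S_eq[of "Suc n" "Suc n"] by auto
    have "x \<in> e k n ` A k" using x k(1) unfolding S_def by simp
    then obtain a where a: "a \<in> A k" "x = e k n a" by (elim imageE)
    have "x = e (Suc n) n (e k (Suc n) a)" using a e_comp[OF _ k(1), of n a] by (simp add: A_def)
    then show "\<exists>y. y \<in> S (Suc n) \<and> e (Suc n) n y = x"
      using k(2) a(1) by (intro exI[of _ "e k (Suc n) a"]) simp
  qed
  then obtain u where u: "\<And>n. u n \<in> S n" "\<And>n. e (Suc n) n (u (Suc n)) = u n" by auto
  have uA: "u n \<in> A n" for n
  proof -
    have "u n \<in> e n n ` A n" using u(1)[of n] unfolding S_def by simp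
    then obtain x where "x \<in> A n" "u n = e n n x" by (elim imageE)
    then show ?thesis by (simp add: A_def e_id)
  qed
  show thesis
    by (rule that[of u]) (use uA u(2) in \<open>simp_all add: A_def\<close>)
qed

section \<open>Direct sums, colimits and germs\<close>

lemma vspace_module: "vspace K M \<Longrightarrow> Module.module K M"
  by (simp add: vspace_def)

lemma module_prod_space:
  assumes "cring K" "\<And>i. i \<in> A \<Longrightarrow> Module.module K (M i)"
  shows "Module.module K (prod_space A M)"
proof -
  interpret K: cring K by fact
  have ab: "abelian_group (M i)" if "i \<in> A" for i
    using assms(2)[OF that] unfolding module_def by (rule_tac conjunct1[OF conjunct2])
  have am: "abelian_monoid (M i)" if "i \<in> A" for i
    using ab[OF that] by (rule abelian_group.axioms(1))
  note cl = abelian_monoid.a_closed[OF am] abelian_monoid.zero_closed[OF am]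
    abelian_monoid.a_assoc[OF am] abelian_monoid.l_zero[OF am]
    abelian_group.a_inv_closed[OF ab] abelian_group.l_neg[OF ab]
    module.smult_closed[OF assms(2)] module.smult_l_distr[OF assms(2)] module.smult_r_distr[OF assms(2)]
    module.smult_assoc1[OF assms(2)] module.smult_one[OF assms(2)]
  show ?thesis
  proof (rule moduleI)
    show "abelian_group (prod_space A M)"
    proof (rule abelian_groupI)
      fix x y assume xy: "x \<in> carrier (prod_space A M)" "y \<in> carrier (prod_space A M)"
      have "(x i) \<oplus>\<^bsub>M i\<^esub> (y i) = (y i) \<oplus>\<^bsub>M i\<^esub> (x i)" if "i \<in> A" for i
        using xy abelian_monoid.a_comm[OF am[OF that], of "x i" "y i"] that by (auto simp: prod_space_def)
      then show "x \<oplus>\<^bsub>prod_space A M\<^esub> y = y \<oplus>\<^bsub>prod_space A M\<^esub> x"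
        by (simp add: prod_space_def cong: restrict_cong)
    next
      fix x assume x: "x \<in> carrier (prod_space A M)"
      show "\<exists>y\<in>carrier (prod_space A M). y \<oplus>\<^bsub>prod_space A M\<^esub> x = \<zero>\<^bsub>prod_space A M\<^esub>"
      proof
        show "(\<lambda>i\<in>A. \<ominus>\<^bsub>M i\<^esub> x i) \<in> carrier (prod_space A M)"
          using x by (auto simp: prod_space_def cl PiE_iff)
        show "(\<lambda>i\<in>A. \<ominus>\<^bsub>M i\<^esub> x i) \<oplus>\<^bsub>prod_space A M\<^esub> x = \<zero>\<^bsub>prod_space A M\<^esub>"
          using x by (auto simp: prod_space_def cl PiE_iff fun_eq_iff)
      qed
    qed (auto simp: prod_space_def cl PiE_iff fun_eq_iff extensional_def)
  qed (auto simp: prod_space_def cl PiE_iff fun_eq_iff extensional_def intro: assms(1))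
qed

lemma submodule_direct_sum:
  assumes "cring K" "\<And>i. i \<in> A \<Longrightarrow> Module.module K (M i)"
  shows "submodule (carrier (direct_sum A M)) K (prod_space A M)"
proof -
  interpret P: module K "prod_space A M" by (rule module_prod_space[OF assms])
  have ab: "abelian_group (M i)" if "i \<in> A" for i
    using assms(2)[OF that] unfolding module_def by (rule_tac conjunct1[OF conjunct2])
  have am: "abelian_monoid (M i)" if "i \<in> A" for i
    using ab[OF that] by (rule abelian_group.axioms(1))
  let ?s = "\<lambda>f. {i \<in> A. f i \<noteq> \<zero>\<^bsub>M i\<^esub>}"
  have in_iff: "f \<in> carrier (direct_sum A M) \<longleftrightarrow> f \<in> carrier (prod_space A M) \<and> finite (?s f)" for f
    by (simp add: direct_sum_def)
  have add: "f \<oplus>\<^bsub>prod_space A M\<^esub> g \<in> carrier (direct_sum A M)"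
    if "f \<in> carrier (direct_sum A M)" "g \<in> carrier (direct_sum A M)" for f g
  proof -
    have "?s (f \<oplus>\<^bsub>prod_space A M\<^esub> g) \<subseteq> ?s f \<union> ?s g"
      using abelian_monoid.l_zero[OF am] abelian_monoid.zero_closed[OF am] by (auto simp: prod_space_def)
    then show ?thesis using that finite_subset unfolding in_iff by (auto intro: P.M.a_closed)
  qed
  have smult: "a \<odot>\<^bsub>prod_space A M\<^esub> f \<in> carrier (direct_sum A M)"
    if "a \<in> carrier K" "f \<in> carrier (direct_sum A M)" for f a
  proof -
    have "?s (a \<odot>\<^bsub>prod_space A M\<^esub> f) \<subseteq> ?s f"
      using that(1) module.smult_r_null[OF assms(2)] by (auto simp: prod_space_def)
    then show ?thesis using that finite_subset unfolding in_iff by (auto intro: P.smult_closed)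
  qed
  show ?thesis
  proof (rule P.submoduleI)
    show "\<zero>\<^bsub>prod_space A M\<^esub> \<in> carrier (direct_sum A M)"
      unfolding in_iff using P.M.zero_closed by (simp add: prod_space_def)
    fix f assume f: "f \<in> carrier (direct_sum A M)"
    then show "\<ominus>\<^bsub>prod_space A M\<^esub> f \<in> carrier (direct_sum A M)"
      using smult[of "\<ominus>\<^bsub>K\<^esub> \<one>\<^bsub>K\<^esub>" f] by (simp add: in_iff P.minus_eq_smult)
  qed (use add smult in \<open>auto simp: in_iff\<close>)
qed

lemma module_direct_sum:
  assumes "cring K" "\<And>i. i \<in> A \<Longrightarrow> Module.module K (M i)"
  shows "Module.module K (direct_sum A M)"
  using submodule.submodule_is_module[OF submodule_direct_sum[OF assms] module_prod_space[OF assms]]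
  by (simp add: direct_sum_def)

lemma direct_sum_simps:
  "f \<in> carrier (direct_sum A M) \<longleftrightarrow> f \<in> carrier (prod_space A M) \<and> finite {i \<in> A. f i \<noteq> \<zero>\<^bsub>M i\<^esub>}"
  "i \<in> A \<Longrightarrow> (f \<oplus>\<^bsub>direct_sum A M\<^esub> g) i = f i \<oplus>\<^bsub>M i\<^esub> g i"
  "i \<in> A \<Longrightarrow> (a \<odot>\<^bsub>direct_sum A M\<^esub> f) i = a \<odot>\<^bsub>M i\<^esub> f i"
  "i \<in> A \<Longrightarrow> \<zero>\<^bsub>direct_sum A M\<^esub> i = \<zero>\<^bsub>M i\<^esub>"
  "f \<in> carrier (prod_space A M) \<Longrightarrow> i \<in> A \<Longrightarrow> f i \<in> carrier (M i)"
  by (auto simp: direct_sum_def prod_space_def)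

lemma inj_sum_closed:
  assumes "\<And>i. i \<in> A \<Longrightarrow> Module.module K (D i)" "i \<in> A" "v \<in> carrier (D i)"
  shows "inj_sum A D i v \<in> carrier (direct_sum A D)"
proof -
  have "\<zero>\<^bsub>D j\<^esub> \<in> carrier (D j)" if "j \<in> A" for j
    using assms(1)[OF that] abelian_group.axioms(1) abelian_monoid.zero_closed unfolding module_def by blast
  moreover have "finite {j \<in> A. inj_sum A D i v j \<noteq> \<zero>\<^bsub>D j\<^esub>}"
    by (rule finite_subset[of _ "{i}"]) (auto simp: inj_sum_def)
  ultimately show ?thesis
    using assms(2,3) by (auto simp: direct_sum_simps(1) prod_space_def inj_sum_def)
qed

text \<open>The function that \<open>colim_out\<close> applies to the representatives of a coset,
  isolated so that linearity can be proved before any quotient is taken.\<close>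

definition sum_map :: "'i set \<Rightarrow> ('i \<Rightarrow> ('k, 'v) module) \<Rightarrow> ('k, 'w) module \<Rightarrow> ('i \<Rightarrow> 'v \<Rightarrow> 'w)
    \<Rightarrow> ('i \<Rightarrow> 'v) \<Rightarrow> 'w" where
  "sum_map A D N c f = finsum N (\<lambda>i. c i (f i)) {i\<in>A. f i \<noteq> \<zero>\<^bsub>D i\<^esub>}"

text \<open>The maps c i need not be linear for indices outside of B. This matters for directed
  colimits, where restriction to a fixed open set makes sense only for some of the indices.\<close>

lemma sum_map_superset:
  assumes "Module.module K N" "finite B" "B \<subseteq> A" "{i\<in>A. f i \<noteq> \<zero>\<^bsub>D i\<^esub>} \<subseteq> B"
    and "\<And>i. i \<in> B \<Longrightarrow> Module.module K (D i)"
    and "\<And>i. i \<in> B \<Longrightarrow> linear_map K (D i) N (c i)" "\<And>i. i \<in> B \<Longrightarrow> f i \<in> carrier (D i)"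
  shows "sum_map A D N c f = finsum N (\<lambda>i. c i (f i)) B"
proof -
  interpret N: module K N by fact
  have cl: "c i (f i) \<in> carrier N" if "i \<in> B" for i
    using linear_map_closed[OF assms(6,7)[OF that]] .
  have z: "c i (f i) = \<zero>\<^bsub>N\<^esub>" if "i \<in> B - {i\<in>A. f i \<noteq> \<zero>\<^bsub>D i\<^esub>}" for i
    using that assms(3) linear_map_zero[OF assms(5) assms(1) assms(6), of i] by auto
  show ?thesis unfolding sum_map_def
    by (rule N.add.finprod_mono_neutral_cong_left[OF assms(2,4)]) (use z cl in auto)
qed

text \<open>The supports of f, g and their sum differ, so all three sums are first extended by zero
  terms to the common finite set \<open>B\<close>.\<close>

lemma sum_map_add:
  assumes "Module.module K N" "finite B" "B \<subseteq> A"
    and D: "\<And>i. i \<in> A \<Longrightarrow> Module.module K (D i)"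
    and c: "\<And>i. i \<in> B \<Longrightarrow> linear_map K (D i) N (c i)"
    and f: "f \<in> carrier (direct_sum A D)" "{i\<in>A. f i \<noteq> \<zero>\<^bsub>D i\<^esub>} \<subseteq> B"
    and g: "g \<in> carrier (direct_sum A D)" "{i\<in>A. g i \<noteq> \<zero>\<^bsub>D i\<^esub>} \<subseteq> B"
  shows "sum_map A D N c (f \<oplus>\<^bsub>direct_sum A D\<^esub> g) = sum_map A D N c f \<oplus>\<^bsub>N\<^esub> sum_map A D N c g"
proof -
  interpret N: module K N by fact
  have am: "abelian_monoid (D i)" if "i \<in> A" for i
    using D[OF that] abelian_group.axioms(1) unfolding module_def by blast
  have fc: "f i \<in> carrier (D i)" "g i \<in> carrier (D i)" if "i \<in> B" for i
    using f(1) g(1) that assms(3) by (auto simp: direct_sum_simps)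
  have fgs: "(f \<oplus>\<^bsub>direct_sum A D\<^esub> g) i = f i \<oplus>\<^bsub>D i\<^esub> g i" if "i \<in> B" for i
    using that assms(3) by (intro direct_sum_simps) auto
  have sub: "{i\<in>A. (f \<oplus>\<^bsub>direct_sum A D\<^esub> g) i \<noteq> \<zero>\<^bsub>D i\<^esub>} \<subseteq> B"
  proof
    fix i assume "i \<in> {i\<in>A. (f \<oplus>\<^bsub>direct_sum A D\<^esub> g) i \<noteq> \<zero>\<^bsub>D i\<^esub>}"
    then have i: "i \<in> A" "f i \<oplus>\<^bsub>D i\<^esub> g i \<noteq> \<zero>\<^bsub>D i\<^esub>" by (auto simp: direct_sum_simps)
    show "i \<in> B"
    proof (rule ccontr)
      assume "i \<notin> B"
      then have "f i = \<zero>\<^bsub>D i\<^esub>" "g i = \<zero>\<^bsub>D i\<^esub>" using i f(2) g(2) by auto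
      then show False using i abelian_monoid.l_zero[OF am[OF i(1)] abelian_monoid.zero_closed[OF am[OF i(1)]]] by simp
    qed
  qed
  have DB: "Module.module K (D i)" if "i \<in> B" for i using that assms(3) D by auto
  have "sum_map A D N c (f \<oplus>\<^bsub>direct_sum A D\<^esub> g) = finsum N (\<lambda>i. c i ((f \<oplus>\<^bsub>direct_sum A D\<^esub> g) i)) B"
    by (rule sum_map_superset[OF assms(1-3) sub DB c])
      (use fgs fc am assms(3) in \<open>auto intro!: abelian_monoid.a_closed\<close>)
  also have "\<dots> = finsum N (\<lambda>i. c i (f i) \<oplus>\<^bsub>N\<^esub> c i (g i)) B"
    using linear_map_closed[OF c] fc by (intro N.finsum_cong') (auto simp: fgs linear_map_add[OF c])
  also have "\<dots> = finsum N (\<lambda>i. c i (f i)) B \<oplus>\<^bsub>N\<^esub> finsum N (\<lambda>i. c i (g i)) B"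
    using linear_map_closed[OF c] fc by (intro N.finsum_addf) auto
  also have "\<dots> = sum_map A D N c f \<oplus>\<^bsub>N\<^esub> sum_map A D N c g"
    using sum_map_superset[OF assms(1-3) f(2) DB c fc(1)] sum_map_superset[OF assms(1-3) g(2) DB c fc(2)]
    by simp
  finally show ?thesis .
qed

lemma sum_map_smult:
  assumes "Module.module K N" "finite B" "B \<subseteq> A"
    and D: "\<And>i. i \<in> A \<Longrightarrow> Module.module K (D i)"
    and c: "\<And>i. i \<in> B \<Longrightarrow> linear_map K (D i) N (c i)"
    and f: "f \<in> carrier (direct_sum A D)" "{i\<in>A. f i \<noteq> \<zero>\<^bsub>D i\<^esub>} \<subseteq> B" and a: "a \<in> carrier K"
  shows "sum_map A D N c (a \<odot>\<^bsub>direct_sum A D\<^esub> f) = a \<odot>\<^bsub>N\<^esub> sum_map A D N c f"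
proof -
  interpret N: module K N by fact
  have fc: "f i \<in> carrier (D i)" if "i \<in> B" for i
    using f(1) that assms(3) by (auto simp: direct_sum_simps)
  have fgs: "(a \<odot>\<^bsub>direct_sum A D\<^esub> f) i = a \<odot>\<^bsub>D i\<^esub> f i" if "i \<in> B" for i
    using that assms(3) by (intro direct_sum_simps) auto
  have sub: "{i\<in>A. (a \<odot>\<^bsub>direct_sum A D\<^esub> f) i \<noteq> \<zero>\<^bsub>D i\<^esub>} \<subseteq> B"
  proof
    fix i assume "i \<in> {i\<in>A. (a \<odot>\<^bsub>direct_sum A D\<^esub> f) i \<noteq> \<zero>\<^bsub>D i\<^esub>}"
    then have i: "i \<in> A" "a \<odot>\<^bsub>D i\<^esub> f i \<noteq> \<zero>\<^bsub>D i\<^esub>" by (auto simp: direct_sum_simps)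
    then show "i \<in> B" using f(2) module.smult_r_null[OF D[OF i(1)] a] by auto
  qed
  have DB: "Module.module K (D i)" if "i \<in> B" for i using that assms(3) D by auto
  have "sum_map A D N c (a \<odot>\<^bsub>direct_sum A D\<^esub> f) = finsum N (\<lambda>i. c i ((a \<odot>\<^bsub>direct_sum A D\<^esub> f) i)) B"
    by (rule sum_map_superset[OF assms(1-3) sub DB c])
      (use fgs fc a module.smult_closed[OF DB] in auto)
  also have "\<dots> = finsum N (\<lambda>i. a \<odot>\<^bsub>N\<^esub> c i (f i)) B"
    using linear_map_closed[OF c] fc a by (intro N.finsum_cong') (auto simp: fgs linear_map_smult[OF c])
  also have "\<dots> = a \<odot>\<^bsub>N\<^esub> finsum N (\<lambda>i. c i (f i)) B"
    using linear_map_closed[OF c] fc by (intro N.finsum_smult_ldistr[symmetric] assms(2) a) auto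
  also have "\<dots> = a \<odot>\<^bsub>N\<^esub> sum_map A D N c f"
    using sum_map_superset[OF assms(1-3) f(2) DB c fc(1)] by simp
  finally show ?thesis .
qed

lemma sum_map_closed:
  assumes "Module.module K N" "\<And>i. i \<in> A \<Longrightarrow> f i \<noteq> \<zero>\<^bsub>D i\<^esub> \<Longrightarrow> linear_map K (D i) N (c i)"
    "f \<in> carrier (direct_sum A D)"
  shows "sum_map A D N c f \<in> carrier N"
proof -
  interpret N: module K N by fact
  show ?thesis unfolding sum_map_def
    by (rule N.finsum_closed) (use assms linear_map_closed[OF assms(2)] in \<open>auto simp: direct_sum_simps\<close>)
qed

lemma sum_map_inj_sum:
  assumes "Module.module K N" "i \<in> A" "Module.module K (D i)" "linear_map K (D i) N (c i)" "v \<in> carrier (D i)"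
  shows "sum_map A D N c (inj_sum A D i v) = c i v"
proof -
  interpret N: module K N by fact
  have "sum_map A D N c (inj_sum A D i v) = finsum N (\<lambda>j. c j (inj_sum A D i v j)) {i}"
    by (rule sum_map_superset[OF assms(1)]) (use assms in \<open>auto simp: inj_sum_def\<close>)
  also have "\<dots> = c i v"
    using assms linear_map_closed[OF assms(4,5)] N.finsum_insert[of "{}" i "\<lambda>j. c j (inj_sum A D i v j)"]
    by (simp add: inj_sum_def)
  finally show ?thesis .
qed

lemma linear_map_sum_map:
  assumes N: "Module.module K N"
    and D: "\<And>i. i \<in> A \<Longrightarrow> Module.module K (D i)" and c: "\<And>i. i \<in> A \<Longrightarrow> linear_map K (D i) N (c i)"
  shows "linear_map K (direct_sum A D) N (sum_map A D N c)"
  unfolding linear_map_def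
proof (intro conjI ballI)
  show "sum_map A D N c \<in> carrier (direct_sum A D) \<rightarrow> carrier N"
    using sum_map_closed[OF N c] by auto
next
  fix f g assume fg: "f \<in> carrier (direct_sum A D)" "g \<in> carrier (direct_sum A D)"
  let ?B = "{i\<in>A. f i \<noteq> \<zero>\<^bsub>D i\<^esub>} \<union> {i\<in>A. g i \<noteq> \<zero>\<^bsub>D i\<^esub>}"
  show "sum_map A D N c (f \<oplus>\<^bsub>direct_sum A D\<^esub> g) = sum_map A D N c f \<oplus>\<^bsub>N\<^esub> sum_map A D N c g"
    by (rule sum_map_add[OF N, of ?B]) (use fg D c in \<open>auto simp: direct_sum_simps(1)\<close>)
next
  fix f a assume fg: "a \<in> carrier K" "f \<in> carrier (direct_sum A D)"
  let ?B = "{i\<in>A. f i \<noteq> \<zero>\<^bsub>D i\<^esub>}"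
  show "sum_map A D N c (a \<odot>\<^bsub>direct_sum A D\<^esub> f) = a \<odot>\<^bsub>N\<^esub> sum_map A D N c f"
    by (rule sum_map_smult[OF N, of ?B]) (use fg D c in \<open>auto simp: direct_sum_simps(1)\<close>)
qed

section \<open>Generated submodules and maps out of a colimit\<close>

lemma (in module) submodule_Inter:
  assumes "\<N> \<noteq> {}" "\<And>N. N \<in> \<N> \<Longrightarrow> submodule N R M"
  shows "submodule (\<Inter>\<N>) R M"
proof (rule submoduleI)
  note E = submoduleE[OF assms(2)]
  show "\<Inter>\<N> \<subseteq> carrier M" using assms(1) E(1) by auto
  show "\<zero>\<^bsub>M\<^esub> \<in> \<Inter>\<N>" using submodule_zero_in assms(2) by auto
qed (use submoduleE[OF assms(2)] in auto)

lemma submodule_gen_submodule: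
  assumes "Module.module K M" "B \<subseteq> carrier M"
  shows "submodule (gen_submodule K M B) K M" "B \<subseteq> gen_submodule K M B"
proof -
  interpret module K M by fact
  show "submodule (gen_submodule K M B) K M" unfolding gen_submodule_def
    using carrier_is_submodule assms(2) by (intro submodule_Inter) auto
  show "B \<subseteq> gen_submodule K M B" unfolding gen_submodule_def by auto
qed

lemma gen_submodule_least: "submodule N K M \<Longrightarrow> B \<subseteq> N \<Longrightarrow> gen_submodule K M B \<subseteq> N"
  unfolding gen_submodule_def by auto

lemma (in module) coset_eq_iff:
  assumes "submodule H R M" "a \<in> carrier M" "b \<in> carrier M"
  shows "H +>\<^bsub>M\<^esub> a = H +>\<^bsub>M\<^esub> b \<longleftrightarrow> a \<ominus>\<^bsub>M\<^esub> b \<in> H"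
proof
  have HM: "h \<in> carrier M" if "h \<in> H" for h using submoduleE(1)[OF assms(1)] that by auto
  have coset: "H +>\<^bsub>M\<^esub> x = {h \<oplus>\<^bsub>M\<^esub> x |h. h \<in> H}" for x by (auto simp: a_r_coset_def')
  assume "H +>\<^bsub>M\<^esub> a = H +>\<^bsub>M\<^esub> b"
  moreover have "\<zero>\<^bsub>M\<^esub> \<oplus>\<^bsub>M\<^esub> a \<in> H +>\<^bsub>M\<^esub> a" unfolding coset using submodule_zero_in[OF assms(1)] by blast
  ultimately have "a \<in> H +>\<^bsub>M\<^esub> b" using assms by simp
  then obtain h where h: "h \<in> H" "a = h \<oplus>\<^bsub>M\<^esub> b" unfolding coset by auto
  then have "a \<ominus>\<^bsub>M\<^esub> b = h" using HM[OF h(1)] assms by (simp add: a_minus_def M.a_assoc M.r_neg)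
  then show "a \<ominus>\<^bsub>M\<^esub> b \<in> H" using h by simp
next
  have HM: "h \<in> carrier M" if "h \<in> H" for h using submoduleE(1)[OF assms(1)] that by auto
  have coset: "H +>\<^bsub>M\<^esub> x = {h \<oplus>\<^bsub>M\<^esub> x |h. h \<in> H}" for x by (auto simp: a_r_coset_def')
  have sub: "H +>\<^bsub>M\<^esub> x \<subseteq> H +>\<^bsub>M\<^esub> y"
    if xy: "x \<in> carrier M" "y \<in> carrier M" "x \<ominus>\<^bsub>M\<^esub> y \<in> H" for x y
  proof
    fix z assume "z \<in> H +>\<^bsub>M\<^esub> x"
    then obtain h where h: "h \<in> H" "z = h \<oplus>\<^bsub>M\<^esub> x" unfolding coset by auto
    have "z = (h \<oplus>\<^bsub>M\<^esub> (x \<ominus>\<^bsub>M\<^esub> y)) \<oplus>\<^bsub>M\<^esub> y"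
      using xy HM[OF h(1)] h(2) by (simp add: a_minus_def M.a_assoc M.l_neg)
    moreover have "h \<oplus>\<^bsub>M\<^esub> (x \<ominus>\<^bsub>M\<^esub> y) \<in> H" using submoduleE(5)[OF assms(1) h(1) xy(3)] .
    ultimately show "z \<in> H +>\<^bsub>M\<^esub> y" unfolding coset by blast
  qed
  assume ab: "a \<ominus>\<^bsub>M\<^esub> b \<in> H"
  have "\<ominus>\<^bsub>M\<^esub> (a \<ominus>\<^bsub>M\<^esub> b) = b \<ominus>\<^bsub>M\<^esub> a" using assms by (simp add: a_minus_def M.minus_add M.a_comm)
  then have "b \<ominus>\<^bsub>M\<^esub> a \<in> H" using submoduleE(3)[OF assms(1) ab] by simp
  then show "H +>\<^bsub>M\<^esub> a = H +>\<^bsub>M\<^esub> b" using sub assms ab by (intro equalityI)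
qed

lemma colim_kernel_submodule:
  assumes "cring K" "\<And>i. i \<in> A \<Longrightarrow> Module.module K (D i)"
    and m: "\<And>i j. i \<in> A \<Longrightarrow> j \<in> A \<Longrightarrow> R i j \<Longrightarrow> linear_map K (D i) (D j) (m i j)"
  shows "submodule (colim_kernel K A R D m) K (direct_sum A D)"
    and "colim_rels A R D m \<subseteq> colim_kernel K A R D m"
proof -
  interpret S: module K "direct_sum A D" by (rule module_direct_sum[OF assms(1,2)])
  have "inj_sum A D i v \<ominus>\<^bsub>direct_sum A D\<^esub> inj_sum A D j (m i j v) \<in> carrier (direct_sum A D)"
    if "i \<in> A" "j \<in> A" "R i j" "v \<in> carrier (D i)" for i j v
    using inj_sum_closed[where A=A and D=D, OF assms(2)] linear_map_closed[OF m[OF that(1-3)]] that by simp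
  then have "colim_rels A R D m \<subseteq> carrier (direct_sum A D)" unfolding colim_rels_def by auto
  then show "submodule (colim_kernel K A R D m) K (direct_sum A D)"
    "colim_rels A R D m \<subseteq> colim_kernel K A R D m"
    unfolding colim_kernel_def using submodule_gen_submodule[OF S.module_axioms] by auto
qed

lemma (in module) submodule_zero: "submodule {\<zero>\<^bsub>M\<^esub>} R M"
  by (rule submoduleI) auto

lemma (in module) M_minus_self: "x \<in> carrier M \<Longrightarrow> x \<ominus>\<^bsub>M\<^esub> x = \<zero>\<^bsub>M\<^esub>"
  by (simp add: a_minus_def M.r_neg)

text \<open>The cocone condition makes every generating relation vanish under
  \<open>sum_map\<close>, hence all of \<open>colim_kernel\<close>. So \<open>sum_map\<close> is
  constant on cosets and \<open>the_elem\<close> picks its value.\<close>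

lemma colim_out_coset:
  assumes K: "cring K" and D: "\<And>i. i \<in> A \<Longrightarrow> Module.module K (D i)"
    and m: "\<And>i j. i \<in> A \<Longrightarrow> j \<in> A \<Longrightarrow> R i j \<Longrightarrow> linear_map K (D i) (D j) (m i j)"
    and N: "Module.module K N" and c: "\<And>i. i \<in> A \<Longrightarrow> linear_map K (D i) N (c i)"
    and cocone: "\<And>i j v. i \<in> A \<Longrightarrow> j \<in> A \<Longrightarrow> R i j \<Longrightarrow> v \<in> carrier (D i) \<Longrightarrow> c j (m i j v) = c i v"
    and f: "f \<in> carrier (direct_sum A D)"
  shows "colim_out A D N c (colim_kernel K A R D m +>\<^bsub>direct_sum A D\<^esub> f) = sum_map A D N c f"
proof -
  interpret S: module K "direct_sum A D" by (rule module_direct_sum[OF K D])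
  interpret N: module K N by (rule N)
  let ?N = "colim_kernel K A R D m"
  note lin = linear_map_sum_map[OF N D c]
  have sub: "submodule ?N K (direct_sum A D)" by (rule colim_kernel_submodule[OF K D m])
  let ?Z = "{g \<in> carrier (direct_sum A D). sum_map A D N c g \<in> {\<zero>\<^bsub>N\<^esub>}}"
  have "?N \<subseteq> ?Z" unfolding colim_kernel_def
  proof (rule gen_submodule_least)
    show "submodule ?Z K (direct_sum A D)"
      by (rule submodule_vimage[OF S.module_axioms N lin N.submodule_zero S.carrier_is_submodule])
    have "inj_sum A D i v \<ominus>\<^bsub>direct_sum A D\<^esub> inj_sum A D j (m i j v) \<in> ?Z"
      if ij: "i \<in> A" "j \<in> A" "R i j" "v \<in> carrier (D i)" for i j v
    proof -
      have mv: "m i j v \<in> carrier (D j)" using linear_map_closed[OF m[OF ij(1-3)] ij(4)] .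
      have cl: "inj_sum A D i v \<in> carrier (direct_sum A D)" "inj_sum A D j (m i j v) \<in> carrier (direct_sum A D)"
        using inj_sum_closed[where A=A and D=D, OF D] ij mv by auto
      show ?thesis using cl linear_map_closed[OF c[OF ij(1)] ij(4)]
        by (simp add: linear_map_minus[OF S.module_axioms N lin] sum_map_inj_sum[OF N] D c ij mv cocone[OF ij]
            N.M_minus_self)
    qed
    then show "colim_rels A R D m \<subseteq> ?Z" unfolding colim_rels_def by auto
  qed
  then have nz: "n \<in> carrier (direct_sum A D)" "sum_map A D N c n = \<zero>\<^bsub>N\<^esub>" if "n \<in> ?N" for n
    using that by auto
  have coset: "?N +>\<^bsub>direct_sum A D\<^esub> f = {h \<oplus>\<^bsub>direct_sum A D\<^esub> f |h. h \<in> ?N}" by (auto simp: a_r_coset_def')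
  have val: "sum_map A D N c (h \<oplus>\<^bsub>direct_sum A D\<^esub> f) = sum_map A D N c f" if "h \<in> ?N" for h
    using linear_map_add[OF lin nz(1)[OF that] f] nz(2)[OF that] linear_map_closed[OF lin f] by simp
  have "sum_map A D N c ` (?N +>\<^bsub>direct_sum A D\<^esub> f) = {sum_map A D N c f}"
  proof -
    have "\<zero>\<^bsub>direct_sum A D\<^esub> \<oplus>\<^bsub>direct_sum A D\<^esub> f \<in> ?N +>\<^bsub>direct_sum A D\<^esub> f"
      unfolding coset using S.submodule_zero_in[OF sub] by blast
    then show ?thesis using f val unfolding coset by auto
  qed
  then show ?thesis unfolding colim_out_def sum_map_def[symmetric] by simp
qed

section \<open>Cosheaves and their dual sheaves\<close>

lemma precosheafD:
  assumes "precosheaf X K F"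
  shows "openin X U \<Longrightarrow> vspace K (at_open F U)"
    and "openin X U \<Longrightarrow> openin X V \<Longrightarrow> U \<subseteq> V \<Longrightarrow> linear_map K (at_open F U) (at_open F V) (arrow F U V)"
    and "openin X U \<Longrightarrow> v \<in> carrier (at_open F U) \<Longrightarrow> arrow F U U v = v"
    and "openin X U \<Longrightarrow> openin X V \<Longrightarrow> openin X W \<Longrightarrow> U \<subseteq> V \<Longrightarrow> V \<subseteq> W \<Longrightarrow> v \<in> carrier (at_open F U) \<Longrightarrow>
      arrow F V W (arrow F U V v) = arrow F U W v"
  using assms unfolding precosheaf_def by (elim conjE; simp)+

lemma (in module) submodule_finsum:
  assumes "submodule H R M" "finite B" "\<And>i. i \<in> B \<Longrightarrow> g i \<in> H"
  shows "finsum M g B \<in> H"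
  using assms(2,3)
proof (induction B)
  case empty
  then show ?case using submodule_zero_in[OF assms(1)] by simp
next
  case (insert b B)
  have HM: "h \<in> H \<Longrightarrow> h \<in> carrier M" for h using submoduleE(1)[OF assms(1)] by auto
  have "finsum M g (insert b B) = g b \<oplus>\<^bsub>M\<^esub> finsum M g B"
    using insert(1,2,4) HM by (intro M.finsum_insert) auto
  moreover have "finsum M g B \<in> H" using insert.IH insert.prems by simp
  moreover have "g b \<in> H" using insert.prems by simp
  ultimately show ?case using submoduleE(5)[OF assms(1)] by simp
qed

text \<open>This is the surjectivity of the canonical map from the colimit: every element over
  \<open>U\<close> is a finite sum of images from intersections of members of the cover, and each
  such image factors through a single member.\<close>

lemma cosheaf_generated:
  assumes "cosheaf X K F" "openin X U" "\<And>V. V \<in> \<U> \<Longrightarrow> openin X V" "\<Union>\<U> = U"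
    and N: "submodule N K (at_open F U)"
    and gen: "\<And>V v. V \<in> \<U> \<Longrightarrow> v \<in> carrier (at_open F V) \<Longrightarrow> arrow F V U v \<in> N"
  shows "carrier (at_open F U) \<subseteq> N"
proof
  have pre: "precosheaf X K F" using assms(1) unfolding cosheaf_def by simp
  note F = precosheafD[OF pre]
  fix v assume v: "v \<in> carrier (at_open F U)"
  have vs: "vspace K (at_open F U)" using F(1)[OF assms(2)] .
  interpret FU: module K "at_open F U" using vs by (rule vspace_module)
  have cr: "cring K" using vspace_module[OF vs] unfolding module_def by simp
  let ?A = "nerve \<U>" and ?D = "\<lambda>I. at_open F (\<Inter>I)" and ?m = "\<lambda>I J. arrow F (\<Inter>I) (\<Inter>J)"
    and ?c = "\<lambda>I. arrow F (\<Inter>I) U"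
  have op: "openin X (\<Inter>I)" if "I \<in> ?A" for I
    using that assms(3) unfolding nerve_def by (intro openin_Inter) auto
  have sub: "\<Inter>I \<subseteq> U" if "I \<in> ?A" for I
    using that assms(4) unfolding nerve_def by auto
  have D: "Module.module K (?D I)" if "I \<in> ?A" for I
    using F(1)[OF op[OF that]] by (rule vspace_module)
  have c: "linear_map K (?D I) (at_open F U) (?c I)" if "I \<in> ?A" for I
    by (rule F(2)[OF op[OF that] assms(2) sub[OF that]])
  have "linear_iso K (colim K ?A (\<lambda>I J. J \<subseteq> I) ?D ?m) (at_open F U) (colim_out ?A ?D (at_open F U) ?c)"
    using assms(1-4) unfolding cosheaf_def by blast
  then have "v \<in> colim_out ?A ?D (at_open F U) ?c ` carrier (colim K ?A (\<lambda>I J. J \<subseteq> I) ?D ?m)"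
    using v unfolding linear_iso_def bij_betw_def by simp
  then obtain C where C: "C \<in> carrier (colim K ?A (\<lambda>I J. J \<subseteq> I) ?D ?m)"
    "v = colim_out ?A ?D (at_open F U) ?c C" by auto
  then obtain f where f: "f \<in> carrier (direct_sum ?A ?D)"
    "C = colim_kernel K ?A (\<lambda>I J. J \<subseteq> I) ?D ?m +>\<^bsub>direct_sum ?A ?D\<^esub> f"
    unfolding colim_def quot_space_def A_RCOSETS_def' by auto
  have "v = sum_map ?A ?D (at_open F U) ?c f" unfolding C(2) f(2)
  proof (rule colim_out_coset[OF cr D _ FU.module_axioms c _ f(1)])
    fix I J assume IJ: "I \<in> ?A" "J \<in> ?A" "J \<subseteq> I"
    then have s: "\<Inter>I \<subseteq> \<Inter>J" by auto
    show "linear_map K (?D I) (?D J) (?m I J)" by (rule F(2)[OF op[OF IJ(1)] op[OF IJ(2)] s])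
    fix w assume "w \<in> carrier (?D I)"
    then show "?c J (?m I J w) = ?c I w" by (rule F(4)[OF op[OF IJ(1)] op[OF IJ(2)] assms(2) s sub[OF IJ(2)]])
  qed
  also have "\<dots> \<in> N" unfolding sum_map_def
  proof (rule FU.submodule_finsum[OF N])
    show "finite {I \<in> ?A. f I \<noteq> \<zero>\<^bsub>?D I\<^esub>}" using f(1) by (simp add: direct_sum_simps(1))
    fix I assume "I \<in> {I \<in> ?A. f I \<noteq> \<zero>\<^bsub>?D I\<^esub>}"
    then have I: "I \<in> ?A" by simp
    have fI: "f I \<in> carrier (?D I)" using f(1) direct_sum_simps(5)[where f=f and A="?A" and M="?D", OF _ I] by (simp add: direct_sum_simps(1))
    \<comment> \<open>Index sets of the nerve are nonempty, so the intersection lies in some member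
      of the cover.\<close>
    obtain V where V: "V \<in> I" using I unfolding nerve_def by auto
    have V': "V \<in> \<U>" "\<Inter>I \<subseteq> V" using V I unfolding nerve_def by auto
    have "?c I (f I) = arrow F V U (arrow F (\<Inter>I) V (f I))"
      by (rule F(4)[OF op[OF I] assms(3)[OF V'(1)] assms(2) V'(2) _ fI, symmetric]) (use V'(1) assms(4) in auto)
    also have "\<dots> \<in> N"
      by (rule gen[OF V'(1) linear_map_closed[OF F(2)[OF op[OF I] assms(3)[OF V'(1)] V'(2)] fI]])
    finally show "?c I (f I) \<in> N" .
  qed
  finally show "v \<in> N" .
qed

section \<open>Dual spaces and the dual presheaf\<close>

lemma dual_iff: "\<phi> \<in> carrier (dual_space K M) \<longleftrightarrow> \<phi> \<in> carrier M \<rightarrow>\<^sub>E carrier K \<and>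
        (\<forall>v\<in>carrier M. \<forall>w\<in>carrier M. \<phi> (v \<oplus>\<^bsub>M\<^esub> w) = \<phi> v \<oplus>\<^bsub>K\<^esub> \<phi> w) \<and>
        (\<forall>a\<in>carrier K. \<forall>v\<in>carrier M. \<phi> (a \<odot>\<^bsub>M\<^esub> v) = a \<otimes>\<^bsub>K\<^esub> \<phi> v)"
  by (simp add: dual_space_def)

lemma dualD:
  assumes "\<phi> \<in> carrier (dual_space K M)"
  shows "v \<in> carrier M \<Longrightarrow> \<phi> v \<in> carrier K"
    and "v \<in> carrier M \<Longrightarrow> w \<in> carrier M \<Longrightarrow> \<phi> (v \<oplus>\<^bsub>M\<^esub> w) = \<phi> v \<oplus>\<^bsub>K\<^esub> \<phi> w"
    and "a \<in> carrier K \<Longrightarrow> v \<in> carrier M \<Longrightarrow> \<phi> (a \<odot>\<^bsub>M\<^esub> v) = a \<otimes>\<^bsub>K\<^esub> \<phi> v"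
  using assms unfolding dual_iff by (auto simp: PiE_iff)

lemma dual_ops:
  "v \<in> carrier M \<Longrightarrow> (\<phi> \<oplus>\<^bsub>dual_space K M\<^esub> \<psi>) v = \<phi> v \<oplus>\<^bsub>K\<^esub> \<psi> v"
  "v \<in> carrier M \<Longrightarrow> (a \<odot>\<^bsub>dual_space K M\<^esub> \<phi>) v = a \<otimes>\<^bsub>K\<^esub> \<phi> v"
  "v \<in> carrier M \<Longrightarrow> \<zero>\<^bsub>dual_space K M\<^esub> v = \<zero>\<^bsub>K\<^esub>"
  by (simp_all add: dual_space_def)

lemma dual_eqI:
  assumes "\<phi> \<in> carrier (dual_space K M)" "\<psi> \<in> carrier (dual_space K M)" "\<And>v. v \<in> carrier M \<Longrightarrow> \<phi> v = \<psi> v"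
  shows "\<phi> = \<psi>"
  using assms unfolding dual_iff by (auto intro: PiE_ext)

lemma vspace_dual_space:
  assumes "vspace K M"
  shows "vspace K (dual_space K M)"
proof -
  interpret field K using assms by (simp add: vspace_def)
  interpret M: module K M using assms by (simp add: vspace_def)
  let ?D = "dual_space K M"
  note D = dualD(1) dualD(2) dualD(3)
  have add: "x \<oplus>\<^bsub>?D\<^esub> y \<in> carrier ?D" if "x \<in> carrier ?D" "y \<in> carrier ?D" for x y
    unfolding dual_iff
  proof (intro conjI ballI)
    show "x \<oplus>\<^bsub>?D\<^esub> y \<in> carrier M \<rightarrow>\<^sub>E carrier K"
      using dualD(1)[OF that(1)] dualD(1)[OF that(2)] by (simp add: dual_space_def)
  qed (use dualD[OF that(1)] dualD[OF that(2)] in \<open>simp_all add: dual_ops a_ac r_distr\<close>)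
  have sm: "c \<odot>\<^bsub>?D\<^esub> x \<in> carrier ?D" if "c \<in> carrier K" "x \<in> carrier ?D" for c x
    unfolding dual_iff
  proof (intro conjI ballI)
    show "c \<odot>\<^bsub>?D\<^esub> x \<in> carrier M \<rightarrow>\<^sub>E carrier K"
      using dualD(1)[OF that(2)] that(1) by (simp add: dual_space_def)
  qed (use dualD[OF that(2)] that(1) in \<open>simp_all add: dual_ops m_lcomm r_distr\<close>)
  have z: "\<zero>\<^bsub>?D\<^esub> \<in> carrier ?D"
    unfolding dual_iff
  proof (intro conjI ballI)
    show "\<zero>\<^bsub>?D\<^esub> \<in> carrier M \<rightarrow>\<^sub>E carrier K" by (simp add: dual_space_def)
  qed (simp_all add: dual_ops)
  have "Module.module K ?D"
  proof (rule moduleI)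
    show "abelian_group ?D"
    proof (rule abelian_groupI)
      fix x y w assume xy: "x \<in> carrier ?D" "y \<in> carrier ?D"
      show "x \<oplus>\<^bsub>?D\<^esub> y \<in> carrier ?D" by (rule add[OF xy])
      show "x \<oplus>\<^bsub>?D\<^esub> y = y \<oplus>\<^bsub>?D\<^esub> x"
        by (rule dual_eqI[OF add[OF xy] add[OF xy(2,1)]])
          (use dualD(1)[OF xy(1)] dualD(1)[OF xy(2)] in \<open>simp add: dual_ops a_comm\<close>)
      show "\<zero>\<^bsub>?D\<^esub> \<oplus>\<^bsub>?D\<^esub> x = x"
        by (rule dual_eqI[OF add[OF z xy(1)] xy(1)]) (use dualD(1)[OF xy(1)] in \<open>simp add: dual_ops\<close>)
      show "\<exists>y\<in>carrier ?D. y \<oplus>\<^bsub>?D\<^esub> x = \<zero>\<^bsub>?D\<^esub>"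
      proof (rule bexI)
        have mc: "\<ominus>\<^bsub>K\<^esub> \<one>\<^bsub>K\<^esub> \<in> carrier K" by simp
        show "(\<ominus>\<^bsub>K\<^esub> \<one>\<^bsub>K\<^esub>) \<odot>\<^bsub>?D\<^esub> x \<in> carrier ?D" by (rule sm[OF mc xy(1)])
        show "((\<ominus>\<^bsub>K\<^esub> \<one>\<^bsub>K\<^esub>) \<odot>\<^bsub>?D\<^esub> x) \<oplus>\<^bsub>?D\<^esub> x = \<zero>\<^bsub>?D\<^esub>"
          by (rule dual_eqI[OF add[OF sm[OF mc xy(1)] xy(1)] z])
            (use dualD(1)[OF xy(1)] in \<open>simp add: dual_ops l_minus l_neg\<close>)
      qed
      assume w: "w \<in> carrier ?D"
      show "(x \<oplus>\<^bsub>?D\<^esub> y) \<oplus>\<^bsub>?D\<^esub> w = x \<oplus>\<^bsub>?D\<^esub> (y \<oplus>\<^bsub>?D\<^esub> w)"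
        by (rule dual_eqI[OF add[OF add[OF xy] w] add[OF xy(1) add[OF xy(2) w]]])
          (use dualD(1)[OF xy(1)] dualD(1)[OF xy(2)] dualD(1)[OF w] in \<open>simp add: dual_ops a_assoc\<close>)
    qed (rule z)
    fix x assume x: "x \<in> carrier ?D"
    show "\<one>\<^bsub>K\<^esub> \<odot>\<^bsub>?D\<^esub> x = x"
      by (rule dual_eqI[OF sm[OF one_closed x] x]) (use dualD(1)[OF x] in \<open>simp add: dual_ops\<close>)
    fix a b y assume ab: "a \<in> carrier K"
    show "a \<odot>\<^bsub>?D\<^esub> x \<in> carrier ?D" by (rule sm[OF ab x])
    { assume y: "y \<in> carrier ?D"
      show "a \<odot>\<^bsub>?D\<^esub> (x \<oplus>\<^bsub>?D\<^esub> y) = a \<odot>\<^bsub>?D\<^esub> x \<oplus>\<^bsub>?D\<^esub> a \<odot>\<^bsub>?D\<^esub> y"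
        by (rule dual_eqI[OF sm[OF ab add[OF x y]] add[OF sm[OF ab x] sm[OF ab y]]])
          (use dualD(1)[OF x] dualD(1)[OF y] ab in \<open>simp add: dual_ops r_distr\<close>) }
    assume b: "b \<in> carrier K"
    have abc: "a \<oplus>\<^bsub>K\<^esub> b \<in> carrier K" "a \<otimes>\<^bsub>K\<^esub> b \<in> carrier K" using ab b by auto
    show "(a \<oplus>\<^bsub>K\<^esub> b) \<odot>\<^bsub>?D\<^esub> x = a \<odot>\<^bsub>?D\<^esub> x \<oplus>\<^bsub>?D\<^esub> b \<odot>\<^bsub>?D\<^esub> x"
      by (rule dual_eqI[OF sm[OF abc(1) x] add[OF sm[OF ab x] sm[OF b x]]])
        (use dualD(1)[OF x] ab b in \<open>simp add: dual_ops l_distr\<close>)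
    show "(a \<otimes>\<^bsub>K\<^esub> b) \<odot>\<^bsub>?D\<^esub> x = a \<odot>\<^bsub>?D\<^esub> (b \<odot>\<^bsub>?D\<^esub> x)"
      by (rule dual_eqI[OF sm[OF abc(2) x] sm[OF ab sm[OF b x]]])
        (use dualD(1)[OF x] ab b in \<open>simp add: dual_ops m_assoc\<close>)
  qed (rule is_cring)
  then show ?thesis using assms by (simp add: vspace_def)
qed

lemma dual_zero_neg:
  assumes "vspace K M" "\<phi> \<in> carrier (dual_space K M)"
  shows "\<phi> \<zero>\<^bsub>M\<^esub> = \<zero>\<^bsub>K\<^esub>" "v \<in> carrier M \<Longrightarrow> \<phi> (\<ominus>\<^bsub>M\<^esub> v) = \<ominus>\<^bsub>K\<^esub> \<phi> v"
    "v \<in> carrier M \<Longrightarrow> w \<in> carrier M \<Longrightarrow> \<phi> (v \<ominus>\<^bsub>M\<^esub> w) = \<phi> v \<ominus>\<^bsub>K\<^esub> \<phi> w"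
proof -
  interpret field K using assms by (simp add: vspace_def)
  interpret M: module K M using assms by (simp add: vspace_def)
  show "\<phi> \<zero>\<^bsub>M\<^esub> = \<zero>\<^bsub>K\<^esub>"
    using dualD(3)[OF assms(2) zero_closed M.M.zero_closed] dualD(1)[OF assms(2) M.M.zero_closed] by simp
  show neg: "\<phi> (\<ominus>\<^bsub>M\<^esub> v) = \<ominus>\<^bsub>K\<^esub> \<phi> v" if "v \<in> carrier M" for v
    using dualD(3)[OF assms(2) a_inv_closed[OF one_closed] that] dualD(1)[OF assms(2) that] that
    by (simp add: M.minus_eq_smult l_minus)
  show "v \<in> carrier M \<Longrightarrow> w \<in> carrier M \<Longrightarrow> \<phi> (v \<ominus>\<^bsub>M\<^esub> w) = \<phi> v \<ominus>\<^bsub>K\<^esub> \<phi> w"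
    using dualD(2)[OF assms(2)] neg by (simp add: a_minus_def)
qed

lemma dual_kernel:
  assumes "vspace K M" "\<phi> \<in> carrier (dual_space K M)"
  shows "submodule {v \<in> carrier M. \<phi> v = \<zero>\<^bsub>K\<^esub>} K M"
proof -
  interpret field K using assms by (simp add: vspace_def)
  interpret M: module K M using assms by (simp add: vspace_def)
  show ?thesis
    by (rule M.submoduleI) (auto simp: dual_zero_neg[OF assms] dualD[OF assms(2)])
qed

text \<open>The contravariant counterpart of \<open>precosheaf\<close>. Germs and restrictions are
  developed for any such diagram and applied to \<open>dual_diagram K F\<close>, which is one by
  \<open>presheaf_dual\<close>.\<close>

definition presheaf :: "'x topology \<Rightarrow> 'k ring \<Rightarrow> ('x, 'k, 's) open_diagram \<Rightarrow> bool" where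
  "presheaf X K G \<longleftrightarrow>
     (\<forall>U. openin X U \<longrightarrow> vspace K (at_open G U)) \<and>
     (\<forall>U V. openin X U \<and> openin X V \<and> V \<subseteq> U \<longrightarrow>
        linear_map K (at_open G U) (at_open G V) (arrow G U V)) \<and>
     (\<forall>U. openin X U \<longrightarrow> (\<forall>t\<in>carrier (at_open G U). arrow G U U t = t)) \<and>
     (\<forall>U V W. openin X U \<and> openin X V \<and> openin X W \<and> V \<subseteq> U \<and> W \<subseteq> V \<longrightarrow>
        (\<forall>t\<in>carrier (at_open G U). arrow G V W (arrow G U V t) = arrow G U W t))"

lemma presheafD:
  assumes "presheaf X K G"
  shows "openin X U \<Longrightarrow> vspace K (at_open G U)"
    and "openin X U \<Longrightarrow> openin X V \<Longrightarrow> V \<subseteq> U \<Longrightarrow> linear_map K (at_open G U) (at_open G V) (arrow G U V)"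
    and "openin X U \<Longrightarrow> t \<in> carrier (at_open G U) \<Longrightarrow> arrow G U U t = t"
    and "openin X U \<Longrightarrow> openin X V \<Longrightarrow> openin X W \<Longrightarrow> V \<subseteq> U \<Longrightarrow> W \<subseteq> V \<Longrightarrow> t \<in> carrier (at_open G U) \<Longrightarrow>
      arrow G V W (arrow G U V t) = arrow G U W t"
  using assms unfolding presheaf_def by (elim conjE; simp)+

lemma linear_map_dual:
  assumes "Module.module K M" "Module.module K N" "linear_map K M N e"
  shows "linear_map K (dual_space K N) (dual_space K M) (\<lambda>\<phi>. \<lambda>v\<in>carrier M. \<phi> (e v))"
proof -
  interpret M: module K M by fact
  interpret N: module K N by fact
  have "(\<lambda>v\<in>carrier M. \<phi> (e v)) \<in> carrier (dual_space K M)" if "\<phi> \<in> carrier (dual_space K N)" for \<phi>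
    unfolding dual_iff
  proof (intro conjI ballI)
    show "(\<lambda>v\<in>carrier M. \<phi> (e v)) \<in> carrier M \<rightarrow>\<^sub>E carrier K"
      using dualD(1)[OF that] linear_map_closed[OF assms(3)] by simp
  qed (use dualD[OF that] linear_map_closed[OF assms(3)] linear_map_add[OF assms(3)]
        linear_map_smult[OF assms(3)] in simp_all)
  then show ?thesis unfolding linear_map_def
    using linear_map_closed[OF assms(3)]
    by (auto simp: fun_eq_iff dual_space_def)
qed

lemma presheaf_dual:
  assumes "precosheaf X K F"
  shows "presheaf X K (dual_diagram K F)"
  unfolding presheaf_def
proof (intro conjI allI impI ballI; (elim conjE)?)
  note F = precosheafD[OF assms]
  show "vspace K (at_open (dual_diagram K F) U)" if "openin X U" for U
    using vspace_dual_space[OF F(1)[OF that]] by (simp add: dual_diagram_def)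
  show "linear_map K (at_open (dual_diagram K F) U) (at_open (dual_diagram K F) V) (arrow (dual_diagram K F) U V)"
    if "openin X U" "openin X V" "V \<subseteq> U" for U V
    using linear_map_dual[OF vspace_module[OF F(1)] vspace_module[OF F(1)] F(2)] that
    by (simp add: dual_diagram_def)
  show "arrow (dual_diagram K F) U U t = t" if "openin X U" "t \<in> carrier (at_open (dual_diagram K F) U)" for U t
  proof -
    have "t \<in> carrier (at_open F U) \<rightarrow>\<^sub>E carrier K" using that(2) by (simp add: dual_diagram_def dual_iff)
    then show ?thesis using F(3)[OF that(1)] by (auto simp: dual_diagram_def fun_eq_iff PiE_iff extensional_def)
  qed
  show "arrow (dual_diagram K F) V W (arrow (dual_diagram K F) U V t) = arrow (dual_diagram K F) U W t"
    if "openin X U" "openin X V" "openin X W" "V \<subseteq> U" "W \<subseteq> V" "t \<in> carrier (at_open (dual_diagram K F) U)"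
    for U V W t
    using F(4)[OF that(3,2,1,5,4)] linear_map_closed[OF F(2)[OF that(3,2,5)]]
    by (auto simp: dual_diagram_def fun_eq_iff restrict_def)
qed

section \<open>Germs and locally constant sheaves\<close>

text \<open>Functoriality, applied to each summand; by \<open>sup\<close> every arrow in the sum is
  a genuine restriction. The lemma allows a neighbourhood on which a sum vanishes to be
  shrunk.\<close>

lemma linear_map_arrow_sum_map:
  assumes G: "presheaf X K G" and V: "openin X V" "openin X V'" "V' \<subseteq> V"
    and f: "f \<in> carrier (direct_sum (open_nbhds X x) (at_open G))"
    and sup: "\<And>U. U \<in> open_nbhds X x \<Longrightarrow> f U \<noteq> \<zero>\<^bsub>at_open G U\<^esub> \<Longrightarrow> V \<subseteq> U"
  shows "sum_map (open_nbhds X x) (at_open G) (at_open G V') (\<lambda>U. arrow G U V') f =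
    arrow G V V' (sum_map (open_nbhds X x) (at_open G) (at_open G V) (\<lambda>U. arrow G U V) f)"
proof -
  note P = presheafD[OF G]
  let ?B = "{U \<in> open_nbhds X x. f U \<noteq> \<zero>\<^bsub>at_open G U\<^esub>}"
  interpret V': module K "at_open G V'" by (rule vspace_module[OF P(1)[OF V(2)]])
  have fin: "finite ?B" using f by (simp add: direct_sum_simps(1))
  have fU: "f U \<in> carrier (at_open G U)" if "U \<in> open_nbhds X x" for U
    using f that direct_sum_simps(5)[of f "open_nbhds X x" "at_open G" U] by (simp add: direct_sum_simps(1))
  have cl: "arrow G U V (f U) \<in> carrier (at_open G V)" if "U \<in> ?B" for U
    using that linear_map_closed[OF P(2) fU] V sup by auto
  have "arrow G V V' (sum_map (open_nbhds X x) (at_open G) (at_open G V) (\<lambda>U. arrow G U V) f) =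
    finsum (at_open G V') (\<lambda>U. arrow G V V' (arrow G U V (f U))) ?B"
    unfolding sum_map_def
    by (rule linear_map_finsum[OF vspace_module[OF P(1)[OF V(1)]] V'.module_axioms P(2)[OF V] fin]) (use cl in auto)
  also have "\<dots> = finsum (at_open G V') (\<lambda>U. arrow G U V' (f U)) ?B"
  proof (rule V'.finsum_cong')
    show "arrow G V V' (arrow G U V (f U)) = arrow G U V' (f U)" if "U \<in> ?B" for U
      using that P(4)[OF _ V(1,2) _ V(3) fU] sup by auto
    show "(\<lambda>U. arrow G U V' (f U)) \<in> ?B \<rightarrow> carrier (at_open G V')"
    proof
      fix U assume U: "U \<in> ?B"
      then have "V' \<subseteq> U" using sup V(3) by blast
      then show "arrow G U V' (f U) \<in> carrier (at_open G V')"
        using linear_map_closed[OF P(2) fU] V(2) U by auto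
    qed
  qed simp
  finally show ?thesis by (simp add: sum_map_def)
qed

text \<open>Neighbourhoods of x are directed downwards, so a family that dies in the colimit has
  restrictions to one small V that already sum to zero. Indeed the families with this property form
  a submodule that contains the generating relations, hence the kernel.\<close>

lemma colim_kernel_germs:
  assumes G: "presheaf X K G" and x: "x \<in> topspace X"
    and f: "f \<in> colim_kernel K (open_nbhds X x) (\<lambda>U V. V \<subseteq> U) (at_open G) (arrow G)"
  obtains V where "V \<in> open_nbhds X x" "\<And>U. U \<in> open_nbhds X x \<Longrightarrow> f U \<noteq> \<zero>\<^bsub>at_open G U\<^esub> \<Longrightarrow> V \<subseteq> U"
    "sum_map (open_nbhds X x) (at_open G) (at_open G V) (\<lambda>U. arrow G U V) f = \<zero>\<^bsub>at_open G V\<^esub>"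
proof -
  note P = presheafD[OF G]
  let ?A = "open_nbhds X x"
  let ?S = "direct_sum ?A (at_open G)"
  let ?s = "\<lambda>V. sum_map ?A (at_open G) (at_open G V) (\<lambda>U. arrow G U V)"
  define good where "good f V \<longleftrightarrow> V \<in> ?A \<and> (\<forall>U\<in>?A. f U \<noteq> \<zero>\<^bsub>at_open G U\<^esub> \<longrightarrow> V \<subseteq> U) \<and> ?s V f = \<zero>\<^bsub>at_open G V\<^esub>" for f V
  define T where "T = {f \<in> carrier ?S. \<exists>V. good f V}"
  have D: "Module.module K (at_open G U)" if "U \<in> ?A" for U
    using that P(1) vspace_module by auto
  have cr: "cring K" using D[of "topspace X"] x unfolding module_def by simp
  interpret S: module K ?S by (rule module_direct_sum[OF cr D])
  have shrink: "good f V'" if "good f V" "f \<in> carrier ?S" "V' \<in> ?A" "V' \<subseteq> V" for f V V'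
  proof -
    have "?s V' f = arrow G V V' (?s V f)"
      by (rule linear_map_arrow_sum_map[OF G]) (use that in \<open>auto simp: good_def\<close>)
    also have "\<dots> = \<zero>\<^bsub>at_open G V'\<^esub>"
      using that linear_map_zero[OF D D P(2), of V V'] by (simp add: good_def)
    finally show ?thesis using that unfolding good_def by blast
  qed
  have zero_add: "\<zero>\<^bsub>at_open G U\<^esub> \<oplus>\<^bsub>at_open G U\<^esub> \<zero>\<^bsub>at_open G U\<^esub> = \<zero>\<^bsub>at_open G U\<^esub>" if "U \<in> ?A" for U
  proof -
    interpret U: module K "at_open G U" by (rule D[OF that])
    show ?thesis by simp
  qed
  have lin: "linear_map K (at_open G U) (at_open G V) (arrow G U V)" if "U \<in> ?A" "V \<in> ?A" "V \<subseteq> U" for U V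
    using that P(2) by auto
  have add: "f \<oplus>\<^bsub>?S\<^esub> g \<in> T" if fg: "f \<in> T" "g \<in> T" for f g
  proof -
    obtain V1 V2 where V12: "good f V1" "good g V2" and S: "f \<in> carrier ?S" "g \<in> carrier ?S"
      using fg unfolding T_def by auto
    \<comment> \<open>Directedness: shrinking both witnesses to their intersection puts the two sums
      into the same space.\<close>
    define V where "V = V1 \<inter> V2"
    have VA: "V \<in> ?A" using V12 unfolding V_def good_def by auto
    have gf: "good f V" by (rule shrink[OF V12(1) S(1) VA]) (simp add: V_def)
    have gg: "good g V" by (rule shrink[OF V12(2) S(2) VA]) (simp add: V_def)
    let ?B = "{U\<in>?A. f U \<noteq> \<zero>\<^bsub>at_open G U\<^esub>} \<union> {U\<in>?A. g U \<noteq> \<zero>\<^bsub>at_open G U\<^esub>}"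
    have "?s V (f \<oplus>\<^bsub>?S\<^esub> g) = ?s V f \<oplus>\<^bsub>at_open G V\<^esub> ?s V g"
      by (rule sum_map_add[OF D[OF VA], of ?B])
        (use S D VA lin gf gg in \<open>auto simp: direct_sum_simps(1) good_def\<close>)
    then have "?s V (f \<oplus>\<^bsub>?S\<^esub> g) = \<zero>\<^bsub>at_open G V\<^esub>"
      using gf gg zero_add[OF VA] unfolding good_def by simp
    moreover have "V \<subseteq> U" if U: "U \<in> ?A" "(f \<oplus>\<^bsub>?S\<^esub> g) U \<noteq> \<zero>\<^bsub>at_open G U\<^esub>" for U
    proof -
      have "f U \<noteq> \<zero>\<^bsub>at_open G U\<^esub> \<or> g U \<noteq> \<zero>\<^bsub>at_open G U\<^esub>"
        using U(2) zero_add[OF U(1)] direct_sum_simps(2)[OF U(1), of "at_open G" f g] by auto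
      then show ?thesis using gf gg U(1) unfolding good_def by blast
    qed
    ultimately have "good (f \<oplus>\<^bsub>?S\<^esub> g) V" using VA unfolding good_def by blast
    then show ?thesis using S unfolding T_def by auto
  qed
  have sm: "a \<odot>\<^bsub>?S\<^esub> f \<in> T" if a: "a \<in> carrier K" and f: "f \<in> T" for a f
  proof -
    obtain V where gf: "good f V" and S: "f \<in> carrier ?S" using f unfolding T_def by auto
    have VA: "V \<in> ?A" using gf unfolding good_def by auto
    interpret V: module K "at_open G V" by (rule D[OF VA])
    let ?B = "{U\<in>?A. f U \<noteq> \<zero>\<^bsub>at_open G U\<^esub>}"
    have "?s V (a \<odot>\<^bsub>?S\<^esub> f) = a \<odot>\<^bsub>at_open G V\<^esub> ?s V f"
      by (rule sum_map_smult[OF D[OF VA], of ?B])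
        (use S D VA lin gf a in \<open>auto simp: direct_sum_simps(1) good_def\<close>)
    then have "?s V (a \<odot>\<^bsub>?S\<^esub> f) = \<zero>\<^bsub>at_open G V\<^esub>"
      using gf a unfolding good_def by simp
    moreover have "V \<subseteq> U" if U: "U \<in> ?A" "(a \<odot>\<^bsub>?S\<^esub> f) U \<noteq> \<zero>\<^bsub>at_open G U\<^esub>" for U
    proof -
      have "f U \<noteq> \<zero>\<^bsub>at_open G U\<^esub>"
        using U(2) module.smult_r_null[OF D[OF U(1)] a] direct_sum_simps(3)[OF U(1), of "at_open G" a f] by auto
      then show ?thesis using gf U(1) unfolding good_def by blast
    qed
    ultimately have "good (a \<odot>\<^bsub>?S\<^esub> f) V" using VA unfolding good_def by blast
    then show ?thesis using S a unfolding T_def by auto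
  qed
  have XA: "topspace X \<in> ?A" using x by simp
  have zero: "\<zero>\<^bsub>?S\<^esub> \<in> T"
  proof -
    interpret V: module K "at_open G (topspace X)" by (rule D[OF XA])
    have e: "{U\<in>?A. \<zero>\<^bsub>?S\<^esub> U \<noteq> \<zero>\<^bsub>at_open G U\<^esub>} = {}" by (auto simp: direct_sum_simps(4))
    have "good \<zero>\<^bsub>?S\<^esub> (topspace X)"
      unfolding good_def sum_map_def e using XA e by auto
    then show ?thesis unfolding T_def by auto
  qed
  have inj: "inj_sum ?A (at_open G) U t \<in> carrier ?S" if "U \<in> ?A" "t \<in> carrier (at_open G U)" for U t
    by (rule inj_sum_closed[where A="?A" and D="at_open G", OF D that])
  have "colim_kernel K ?A (\<lambda>U V. V \<subseteq> U) (at_open G) (arrow G) \<subseteq> T"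
    unfolding colim_kernel_def
  proof (rule gen_submodule_least)
    show "submodule T K ?S"
    proof (rule S.submoduleI)
      fix f assume f: "f \<in> T"
      then have "f \<in> carrier ?S" by (simp add: T_def)
      then show "\<ominus>\<^bsub>?S\<^esub> f \<in> T" using sm[OF _ f, of "\<ominus>\<^bsub>K\<^esub> \<one>\<^bsub>K\<^esub>"] by (simp add: S.minus_eq_smult)
    qed (use add sm zero in \<open>auto simp: T_def\<close>)
    \<comment> \<open>For a generating relation the smaller set V is the witness: over it, t and its
      restriction cancel.\<close>
    have "inj_sum ?A (at_open G) U t \<ominus>\<^bsub>?S\<^esub> inj_sum ?A (at_open G) V (arrow G U V t) \<in> T"
      if U: "U \<in> ?A" "V \<in> ?A" "V \<subseteq> U" "t \<in> carrier (at_open G U)" for U V t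
    proof -
      let ?u = "inj_sum ?A (at_open G) U t" and ?v = "inj_sum ?A (at_open G) V (arrow G U V t)"
      let ?m = "\<ominus>\<^bsub>K\<^esub> \<one>\<^bsub>K\<^esub>"
      have tV: "arrow G U V t \<in> carrier (at_open G V)" using linear_map_closed[OF lin[OF U(1-3)] U(4)] .
      have cl: "?u \<in> carrier ?S" "?v \<in> carrier ?S" using inj U tV by auto
      have mm: "?m \<in> carrier K" by simp
      have eq: "?u \<ominus>\<^bsub>?S\<^esub> ?v = ?u \<oplus>\<^bsub>?S\<^esub> (?m \<odot>\<^bsub>?S\<^esub> ?v)" using cl by (simp add: a_minus_def S.minus_eq_smult)
      interpret V: module K "at_open G V" by (rule D[OF U(2)])
      have supu: "{W\<in>?A. ?u W \<noteq> \<zero>\<^bsub>at_open G W\<^esub>} \<subseteq> {U,V}" by (auto simp: inj_sum_def)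
      have supv: "{W\<in>?A. ?v W \<noteq> \<zero>\<^bsub>at_open G W\<^esub>} \<subseteq> {U,V}" by (auto simp: inj_sum_def)
      have supmv: "{W\<in>?A. (?m \<odot>\<^bsub>?S\<^esub> ?v) W \<noteq> \<zero>\<^bsub>at_open G W\<^esub>} \<subseteq> {U,V}"
      proof
        fix W assume "W \<in> {W\<in>?A. (?m \<odot>\<^bsub>?S\<^esub> ?v) W \<noteq> \<zero>\<^bsub>at_open G W\<^esub>}"
        then have W: "W \<in> ?A" "(?m \<odot>\<^bsub>?S\<^esub> ?v) W \<noteq> \<zero>\<^bsub>at_open G W\<^esub>" by auto
        then have "?v W \<noteq> \<zero>\<^bsub>at_open G W\<^esub>"
          using module.smult_r_null[OF D[OF W(1)] mm] direct_sum_simps(3)[OF W(1), of "at_open G" ?m ?v] by auto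
        then show "W \<in> {U,V}" using supv W(1) by auto
      qed
      have lUV: "linear_map K (at_open G W) (at_open G V) (arrow G W V)" if "W \<in> {U,V}" for W
        using that lin U by auto
      have UVA: "{U,V} \<subseteq> ?A" using U by auto
      have fUV: "finite {U,V}" by simp
      have mv: "?m \<odot>\<^bsub>?S\<^esub> ?v \<in> carrier ?S" using cl by simp
      have "?s V (?u \<ominus>\<^bsub>?S\<^esub> ?v) = ?s V ?u \<oplus>\<^bsub>at_open G V\<^esub> ?s V (?m \<odot>\<^bsub>?S\<^esub> ?v)"
        unfolding eq by (rule sum_map_add[OF V.module_axioms fUV UVA D lUV cl(1) supu mv supmv])
      also have "?s V (?m \<odot>\<^bsub>?S\<^esub> ?v) = ?m \<odot>\<^bsub>at_open G V\<^esub> ?s V ?v"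
        by (rule sum_map_smult[OF V.module_axioms fUV UVA D lUV cl(2) supv mm])
      also have "?s V ?u = arrow G U V t"
        by (rule sum_map_inj_sum[where A="?A" and D="at_open G" and c="\<lambda>U. arrow G U V", OF V.module_axioms U(1) D[OF U(1)] lin[OF U(1-3)] U(4)])
      also have "?s V ?v = arrow G V V (arrow G U V t)"
        by (rule sum_map_inj_sum[where A="?A" and D="at_open G" and c="\<lambda>U. arrow G U V", OF V.module_axioms U(2) D[OF U(2)] lin[OF U(2,2)] tV]) simp
      also have "arrow G V V (arrow G U V t) = arrow G U V t" using P(3) U(2) tV by simp
      also have "arrow G U V t \<oplus>\<^bsub>at_open G V\<^esub> ?m \<odot>\<^bsub>at_open G V\<^esub> arrow G U V t = \<zero>\<^bsub>at_open G V\<^esub>"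
        using tV by (simp add: V.minus_eq_smult[symmetric] V.M.r_neg)
      finally have z: "?s V (?u \<ominus>\<^bsub>?S\<^esub> ?v) = \<zero>\<^bsub>at_open G V\<^esub>" .
      have "V \<subseteq> W" if W: "W \<in> ?A" "(?u \<ominus>\<^bsub>?S\<^esub> ?v) W \<noteq> \<zero>\<^bsub>at_open G W\<^esub>" for W
      proof (rule ccontr)
        assume n: "\<not> V \<subseteq> W"
        then have "W \<noteq> U" "W \<noteq> V" using U by auto
        then have "?u W = \<zero>\<^bsub>at_open G W\<^esub>" "(?m \<odot>\<^bsub>?S\<^esub> ?v) W = \<zero>\<^bsub>at_open G W\<^esub>"
          using supu supmv W(1) by auto
        then show False using W(2) unfolding eq direct_sum_simps(2)[OF W(1)] using zero_add[OF W(1)] by simp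
      qed
      then have "good (?u \<ominus>\<^bsub>?S\<^esub> ?v) V" using z U(2) unfolding good_def by blast
      then show ?thesis using cl unfolding T_def by auto
    qed
    then show "colim_rels ?A (\<lambda>U V. V \<subseteq> U) (at_open G) (arrow G) \<subseteq> T"
      unfolding colim_rels_def by blast
  qed
  then obtain V where "good f V" using f unfolding T_def by auto
  then show thesis using that unfolding good_def by blast
qed

text \<open>Translates the quotient construction of stalks into the usual description of germs,
  which is the form in which germs are compared afterwards.\<close>

lemma germ_eq_iff:
  assumes G: "presheaf X K G"
    and U: "U \<in> open_nbhds X x" "t \<in> carrier (at_open G U)"
    and U': "U' \<in> open_nbhds X x" "t' \<in> carrier (at_open G U')"
  shows "germ X K G x U t = germ X K G x U' t' \<longleftrightarrow>
    (\<exists>V\<in>open_nbhds X x. V \<subseteq> U \<and> V \<subseteq> U' \<and> arrow G U V t = arrow G U' V t')"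
proof -
  note P = presheafD[OF G]
  let ?A = "open_nbhds X x"
  let ?S = "direct_sum ?A (at_open G)"
  let ?s = "\<lambda>V. sum_map ?A (at_open G) (at_open G V) (\<lambda>U. arrow G U V)"
  let ?N = "colim_kernel K ?A (\<lambda>U V. V \<subseteq> U) (at_open G) (arrow G)"
  have x: "x \<in> topspace X" using U(1) openin_subset by fastforce
  have D: "Module.module K (at_open G U)" if "U \<in> ?A" for U
    using that P(1) vspace_module by auto
  have lin: "linear_map K (at_open G U) (at_open G V) (arrow G U V)" if "U \<in> ?A" "V \<in> ?A" "V \<subseteq> U" for U V
    using that P(2) by auto
  have cr: "cring K" using D[of "topspace X"] x unfolding module_def by simp
  interpret S: module K ?S by (rule module_direct_sum[OF cr D])
  note ker = colim_kernel_submodule[where A="?A" and D="at_open G" and m="arrow G" and R="\<lambda>U V. V \<subseteq> U", OF cr D lin]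
  have N: "submodule ?N K ?S" by (rule ker)
  have inj: "inj_sum ?A (at_open G) U t \<in> carrier ?S" if "U \<in> ?A" "t \<in> carrier (at_open G U)" for U t
    by (rule inj_sum_closed[where A="?A" and D="at_open G", OF D that])
  have restr: "germ X K G x U t = germ X K G x V (arrow G U V t)"
    if U: "U \<in> ?A" "V \<in> ?A" "V \<subseteq> U" "t \<in> carrier (at_open G U)" for U V t
  proof -
    have "inj_sum ?A (at_open G) U t \<ominus>\<^bsub>?S\<^esub> inj_sum ?A (at_open G) V (arrow G U V t) \<in> ?N"
      using ker(2) U unfolding colim_rels_def by blast
    then show ?thesis unfolding germ_def colim_in_def
      using S.coset_eq_iff[OF N inj[OF U(1,4)] inj[OF U(2) linear_map_closed[OF lin[OF U(1-3)] U(4)]]] by simp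
  qed
  show ?thesis
  proof
    assume "\<exists>V\<in>?A. V \<subseteq> U \<and> V \<subseteq> U' \<and> arrow G U V t = arrow G U' V t'"
    then obtain V where V: "V \<in> ?A" "V \<subseteq> U" "V \<subseteq> U'" "arrow G U V t = arrow G U' V t'" by blast
    show "germ X K G x U t = germ X K G x U' t'"
      using restr[OF U(1) V(1,2) U(2)] restr[OF U'(1) V(1,3) U'(2)] V(4) by simp
  next
    assume eq: "germ X K G x U t = germ X K G x U' t'"
    let ?u = "inj_sum ?A (at_open G) U t" and ?v = "inj_sum ?A (at_open G) U' t'"
    have cl: "?u \<in> carrier ?S" "?v \<in> carrier ?S" using inj U U' by auto
    have mem: "?u \<ominus>\<^bsub>?S\<^esub> ?v \<in> ?N"
      using eq S.coset_eq_iff[OF N cl] unfolding germ_def colim_in_def by simp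
    obtain V where V: "V \<in> ?A" "\<And>W. W \<in> ?A \<Longrightarrow> (?u \<ominus>\<^bsub>?S\<^esub> ?v) W \<noteq> \<zero>\<^bsub>at_open G W\<^esub> \<Longrightarrow> V \<subseteq> W"
      "?s V (?u \<ominus>\<^bsub>?S\<^esub> ?v) = \<zero>\<^bsub>at_open G V\<^esub>" using colim_kernel_germs[OF G x mem] by blast
    \<comment> \<open>\<open>V\<close> is known to lie in those sets at which the difference is
      nonzero. These may fail to include \<open>U\<close> or \<open>U'\<close>, so both are
      intersected in.\<close>
    define V' where "V' = V \<inter> U \<inter> U'"
    have V': "V' \<in> ?A" "V' \<subseteq> V" "V' \<subseteq> U" "V' \<subseteq> U'" using V(1) U(1) U'(1) unfolding V'_def by auto
    interpret V': module K "at_open G V'" by (rule D[OF V'(1)])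
    let ?m = "\<ominus>\<^bsub>K\<^esub> \<one>\<^bsub>K\<^esub>"
    have mm: "?m \<in> carrier K" by simp
    have eq: "?u \<ominus>\<^bsub>?S\<^esub> ?v = ?u \<oplus>\<^bsub>?S\<^esub> (?m \<odot>\<^bsub>?S\<^esub> ?v)" using cl by (simp add: a_minus_def S.minus_eq_smult)
    have supu: "{W\<in>?A. ?u W \<noteq> \<zero>\<^bsub>at_open G W\<^esub>} \<subseteq> {U,U'}" by (auto simp: inj_sum_def)
    have supv: "{W\<in>?A. ?v W \<noteq> \<zero>\<^bsub>at_open G W\<^esub>} \<subseteq> {U,U'}" by (auto simp: inj_sum_def)
    have supmv: "{W\<in>?A. (?m \<odot>\<^bsub>?S\<^esub> ?v) W \<noteq> \<zero>\<^bsub>at_open G W\<^esub>} \<subseteq> {U,U'}"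
    proof
      fix W assume "W \<in> {W\<in>?A. (?m \<odot>\<^bsub>?S\<^esub> ?v) W \<noteq> \<zero>\<^bsub>at_open G W\<^esub>}"
      then have W: "W \<in> ?A" "(?m \<odot>\<^bsub>?S\<^esub> ?v) W \<noteq> \<zero>\<^bsub>at_open G W\<^esub>" by auto
      then have "?v W \<noteq> \<zero>\<^bsub>at_open G W\<^esub>"
        using module.smult_r_null[OF D[OF W(1)] mm] direct_sum_simps(3)[OF W(1), of "at_open G" ?m ?v] by auto
      then show "W \<in> {U,U'}" using supv W(1) by auto
    qed
    have lU: "linear_map K (at_open G W) (at_open G V') (arrow G W V')" if "W \<in> {U,U'}" for W
      using that lin U U' V' by auto
    have UA: "{U,U'} \<subseteq> ?A" using U U' by auto
    have fU: "finite {U,U'}" by simp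
    have mv: "?m \<odot>\<^bsub>?S\<^esub> ?v \<in> carrier ?S" using cl by simp
    have tt: "arrow G U V' t \<in> carrier (at_open G V')" "arrow G U' V' t' \<in> carrier (at_open G V')"
      using linear_map_closed[OF lin] U U' V' by auto
    have "?s V' (?u \<ominus>\<^bsub>?S\<^esub> ?v) = arrow G V V' (?s V (?u \<ominus>\<^bsub>?S\<^esub> ?v))"
      by (rule linear_map_arrow_sum_map[OF G]) (use V V' cl in auto)
    also have "\<dots> = \<zero>\<^bsub>at_open G V'\<^esub>"
      unfolding V(3) by (rule linear_map_zero[OF D D lin]) (use V(1) V' in auto)
    finally have "?s V' (?u \<ominus>\<^bsub>?S\<^esub> ?v) = \<zero>\<^bsub>at_open G V'\<^esub>" .
    moreover have "?s V' (?u \<ominus>\<^bsub>?S\<^esub> ?v) = ?s V' ?u \<oplus>\<^bsub>at_open G V'\<^esub> ?s V' (?m \<odot>\<^bsub>?S\<^esub> ?v)"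
      unfolding eq by (rule sum_map_add[OF V'.module_axioms fU UA D lU cl(1) supu mv supmv])
    moreover have "?s V' (?m \<odot>\<^bsub>?S\<^esub> ?v) = ?m \<odot>\<^bsub>at_open G V'\<^esub> ?s V' ?v"
      by (rule sum_map_smult[OF V'.module_axioms fU UA D lU cl(2) supv mm])
    moreover have "?s V' ?u = arrow G U V' t"
      by (rule sum_map_inj_sum[where A="?A" and D="at_open G" and c="\<lambda>U. arrow G U V'", OF V'.module_axioms U(1) D[OF U(1)] lin[OF U(1) V'(1,3)] U(2)])
    moreover have "?s V' ?v = arrow G U' V' t'"
      by (rule sum_map_inj_sum[where A="?A" and D="at_open G" and c="\<lambda>U. arrow G U V'", OF V'.module_axioms U'(1) D[OF U'(1)] lin[OF U'(1) V'(1,4)] U'(2)])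
    ultimately have "arrow G U V' t \<ominus>\<^bsub>at_open G V'\<^esub> arrow G U' V' t' = \<zero>\<^bsub>at_open G V'\<^esub>"
      using tt by (simp add: a_minus_def V'.minus_eq_smult)
    then have "arrow G U V' t = arrow G U' V' t'" using tt by (rule V'.M.minus_eq_zeroD)
    then show "\<exists>V\<in>?A. V \<subseteq> U \<and> V \<subseteq> U' \<and> arrow G U V t = arrow G U' V t'" using V' by blast
  qed
qed

lemma germ_closed:
  assumes G: "presheaf X K G" and U: "U \<in> open_nbhds X x" "t \<in> carrier (at_open G U)"
  shows "germ X K G x U t \<in> carrier (stalk X K G x)"
proof -
  have "inj_sum (open_nbhds X x) (at_open G) U t \<in> carrier (direct_sum (open_nbhds X x) (at_open G))"
    by (rule inj_sum_closed) (use U presheafD(1)[OF G] vspace_module in auto)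
  then show ?thesis unfolding germ_def colim_in_def stalk_def colim_def quot_space_def A_RCOSETS_def' by auto
qed

section \<open>Sections of the restriction to a subspace\<close>

abbreviation sections :: "'x topology \<Rightarrow> 'k ring \<Rightarrow> ('x, 'k, 's) open_diagram \<Rightarrow> 'x set
    \<Rightarrow> ('x \<Rightarrow> ('x set \<Rightarrow> 's) set) set" where
  "sections X K G W \<equiv> carrier (at_open (restrict_to X K G) W)"

lemma sections_iff:
  "s \<in> sections X K G W \<longleftrightarrow> s \<in> (\<Pi>\<^sub>E w\<in>W. carrier (stalk X K G w)) \<and>
     (\<forall>z\<in>W. \<exists>U t. openin X U \<and> z \<in> U \<and> t \<in> carrier (at_open G U) \<and> (\<forall>w\<in>U \<inter> W. s w = germ X K G w U t))"
  by (simp add: restrict_to_def prod_space_def)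

lemma germ_in_sections:
  assumes "presheaf X K G" "openin X U" "t \<in> carrier (at_open G U)" "W \<subseteq> U"
  shows "(\<lambda>w\<in>W. germ X K G w U t) \<in> sections X K G W"
  unfolding sections_iff
proof (intro conjI ballI)
  show "(\<lambda>w\<in>W. germ X K G w U t) \<in> (\<Pi>\<^sub>E w\<in>W. carrier (stalk X K G w))"
    using germ_closed[OF assms(1) _ assms(3)] assms(2,4) by auto
  show "\<exists>U' t'. openin X U' \<and> z \<in> U' \<and> t' \<in> carrier (at_open G U') \<and>
    (\<forall>w\<in>U' \<inter> W. (\<lambda>w\<in>W. germ X K G w U t) w = germ X K G w U' t')" if "z \<in> W" for z
    using assms that by (intro exI[of _ U] exI[of _ t]) auto
qed

lemma restrict_in_sections:
  assumes "s \<in> sections X K G W" "W' \<subseteq> W"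
  shows "restrict s W' \<in> sections X K G W'"
  unfolding sections_iff
proof (intro conjI ballI)
  note s = assms(1)[unfolded sections_iff]
  show "restrict s W' \<in> (\<Pi>\<^sub>E w\<in>W'. carrier (stalk X K G w))" using s assms(2) by (auto simp: PiE_iff)
  fix z assume z: "z \<in> W'"
  then obtain U t where "openin X U" "z \<in> U" "t \<in> carrier (at_open G U)" "\<forall>w\<in>U \<inter> W. s w = germ X K G w U t"
    using s assms(2) by blast
  then show "\<exists>U t. openin X U \<and> z \<in> U \<and> t \<in> carrier (at_open G U) \<and> (\<forall>w\<in>U \<inter> W'. restrict s W' w = germ X K G w U t)"
    using assms(2) by (intro exI[of _ U] exI[of _ t]) auto
qed

text \<open>Near a point both sections are given by elements over open sets of X, and equal germs
  there mean equal restrictions to a whole neighbourhood.\<close>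

lemma sections_agree_open:
  assumes G: "presheaf X K G" and Q: "openin (subtopology X Z) Q"
    and s: "s \<in> sections X K G Q" "s' \<in> sections X K G Q"
  shows "openin (subtopology X Z) {w \<in> Q. s w = s' w}"
proof (subst openin_subopen, intro ballI)
  fix z assume "z \<in> {w \<in> Q. s w = s' w}"
  then have z: "z \<in> Q" "s z = s' z" by auto
  obtain U t where U: "openin X U" "z \<in> U" "t \<in> carrier (at_open G U)" "\<forall>w\<in>U \<inter> Q. s w = germ X K G w U t"
    using s(1) z(1) unfolding sections_iff by blast
  obtain U' t' where U': "openin X U'" "z \<in> U'" "t' \<in> carrier (at_open G U')" "\<forall>w\<in>U' \<inter> Q. s' w = germ X K G w U' t'"
    using s(2) z(1) unfolding sections_iff by blast
  have "germ X K G z U t = germ X K G z U' t'" using z U U' by auto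
  then obtain V where V: "openin X V" "z \<in> V" "V \<subseteq> U" "V \<subseteq> U'" "arrow G U V t = arrow G U' V t'"
    using germ_eq_iff[OF G _ U(3) _ U'(3), of z] U(1,2) U'(1,2) by auto
  have "s w = s' w" if "w \<in> V \<inter> Q" for w
  proof -
    have "germ X K G w U t = germ X K G w U' t'"
      using germ_eq_iff[OF G _ U(3) _ U'(3), of w] U(1) U'(1) V that by blast
    moreover have "s w = germ X K G w U t" "s' w = germ X K G w U' t'" using U(4) U'(4) V(3,4) that by blast+
    ultimately show ?thesis by simp
  qed
  moreover have "openin (subtopology X Z) (V \<inter> Q)"
  proof -
    have "V \<inter> Q = Q \<inter> (V \<inter> Z)" using openin_subset[OF Q] by auto
    then show ?thesis using openin_Int[OF Q openin_subtopology_Int[OF V(1), of Z]] by simp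
  qed
  ultimately show "\<exists>T. openin (subtopology X Z) T \<and> z \<in> T \<and> T \<subseteq> {w \<in> Q. s w = s' w}"
    using V(2) z(1) by (intro exI[of _ "V \<inter> Q"]) auto
qed

lemma constant_sheafD:
  assumes "c \<in> carrier (at_open (constant_sheaf Z L) W)" "w \<in> W" "W \<subseteq> topspace Z"
  shows "c w \<in> carrier L" "openin (subtopology Z W) {v \<in> W. c v = c w}"
proof -
  have c: "continuous_map (subtopology Z W) (discrete_topology (carrier L)) c" "c \<in> (\<Pi>\<^sub>E w\<in>W. carrier L)"
    using assms(1) by (auto simp: constant_sheaf_def prod_space_def)
  show cw: "c w \<in> carrier L" using c(2) assms(2) by auto
  have "openin (subtopology Z W) {v \<in> topspace (subtopology Z W). c v \<in> {c w}}"
    using cw by (intro openin_continuous_map_preimage[OF c(1)]) simp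
  moreover have "{v \<in> topspace (subtopology Z W). c v \<in> {c w}} = {v \<in> W. c v = c w}" using assms(3) by auto
  ultimately show "openin (subtopology Z W) {v \<in> W. c v = c w}" by simp
qed

text \<open>For a general sheaf the locus where two sections differ need not be open. In a
  trivialisation the sections become locally constant functions. On the set \<open>N\<close> where
  both are constant, agreement at one point forces the constants to agree, hence agreement at
  z.\<close>

lemma sections_disagree_open:
  fixes X :: "'x topology" and K :: "'k ring" and G :: "('x, 'k, 's) open_diagram"
  assumes G: "presheaf X K G" and lc: "locally_constant_on X K G Z"
    and Q: "openin (subtopology X Z) Q"
    and s: "s \<in> sections X K G Q" "s' \<in> sections X K G Q"
  shows "openin (subtopology X Z) {w \<in> Q. s w \<noteq> s' w}"
proof (subst openin_subopen, intro ballI)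
  fix z assume "z \<in> {w \<in> Q. s w \<noteq> s' w}"
  then have z: "z \<in> Q" "s z \<noteq> s' z" by auto
  have OZ: "Q \<subseteq> Z" "Q \<subseteq> topspace X" using openin_subset[OF Q] by auto
  obtain W \<Phi> and L :: "('k, ('x set \<Rightarrow> 's) set) module" where W: "openin (subtopology X Z) W" "z \<in> W"
    and iso: "sheaf_iso (subtopology X W) K (restrict_to X K G) (constant_sheaf (subtopology X W) L) \<Phi>"
    using bspec[OF lc[unfolded locally_constant_on_def] subsetD[OF OZ(1) z(1)]]
    by (elim exE conjE) (rule that)
  have WZ: "W \<subseteq> Z" "W \<subseteq> topspace X" using openin_subset[OF W(1)] by auto
  have tr: "openin (subtopology X Z) T" if "openin (subtopology X W) T" for T
  proof -
    have "subtopology X W = subtopology (subtopology X Z) W"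
      using WZ by (simp add: subtopology_subtopology Int_absorb1)
    then show ?thesis using that W(1) by (simp add: openin_open_subtopology)
  qed
  have tr': "openin (subtopology X W) T" if "openin (subtopology X Z) T" "T \<subseteq> W" for T
  proof -
    have "subtopology X W = subtopology (subtopology X Z) W"
      using WZ by (simp add: subtopology_subtopology Int_absorb1)
    then show ?thesis using that W(1) by (simp add: openin_open_subtopology)
  qed
  let ?C = "\<lambda>T. carrier (at_open (constant_sheaf (subtopology X W) L) T)"
  have bij: "bij_betw (\<Phi> T) (sections X K G T) (?C T)" if "openin (subtopology X W) T" for T
    using iso that unfolding sheaf_iso_def linear_iso_def by blast
  have res: "\<Phi> T' (restrict r T') = restrict (\<Phi> T r) T'"
    if "openin (subtopology X W) T" "openin (subtopology X W) T'" "T' \<subseteq> T" "r \<in> sections X K G T" for T T' r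
    using iso that unfolding sheaf_iso_def by (simp add: restrict_to_def constant_sheaf_def)
  define O1 where "O1 = Q \<inter> W"
  have O1: "openin (subtopology X W) O1" unfolding O1_def using Q W(1) by (intro tr' openin_Int) auto
  define r where "r = restrict s O1"
  define r' where "r' = restrict s' O1"
  have rs: "r \<in> sections X K G O1" "r' \<in> sections X K G O1"
    unfolding r_def r'_def by (rule restrict_in_sections[OF s(1)] restrict_in_sections[OF s(2)], simp add: O1_def)+
  have c: "\<Phi> O1 r \<in> ?C O1" "\<Phi> O1 r' \<in> ?C O1" using bij_betwE[OF bij[OF O1]] rs by auto
  have O1W: "O1 \<subseteq> topspace (subtopology X W)" using openin_subset[OF O1] .
  have zO1: "z \<in> O1" using z W unfolding O1_def by auto
  define N where "N = {v \<in> O1. \<Phi> O1 r v = \<Phi> O1 r z} \<inter> {v \<in> O1. \<Phi> O1 r' v = \<Phi> O1 r' z}"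
  have op1: "openin (subtopology X W) T" if "openin (subtopology (subtopology X W) O1) T" for T
    using that O1 openin_open_subtopology[OF O1] by blast
  have N: "openin (subtopology X W) N" unfolding N_def
    using constant_sheafD(2)[OF c(1) zO1 O1W] constant_sheafD(2)[OF c(2) zO1 O1W] op1 by (intro openin_Int) auto
  have NO1: "N \<subseteq> O1" unfolding N_def by auto
  have "s w \<noteq> s' w" if w: "w \<in> N" for w
  proof
    assume eqw: "s w = s' w"
    \<comment> \<open>If the sections agree at w, they agree on the open set \<open>O2\<close>
      around w, and naturality of \<Phi> carries this over to the two constants.\<close>
    define O2 where "O2 = {v \<in> Q. s v = s' v} \<inter> N"
    have O2: "openin (subtopology X W) O2"
    proof (rule tr')
      show "openin (subtopology X Z) O2"
        unfolding O2_def by (rule openin_Int[OF sections_agree_open[OF G Q s] tr[OF N]])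
      show "O2 \<subseteq> W" using NO1 unfolding O2_def O1_def by auto
    qed
    have O21: "O2 \<subseteq> O1" using NO1 unfolding O2_def by auto
    have "restrict r O2 = restrict r' O2"
      using NO1 by (auto simp: r_def r'_def O2_def O1_def fun_eq_iff)
    then have "restrict (\<Phi> O1 r) O2 = restrict (\<Phi> O1 r') O2"
      using res[OF O1 O2 O21 rs(1)] res[OF O1 O2 O21 rs(2)] by simp
    moreover have "w \<in> O2" using w eqw NO1 unfolding O2_def O1_def by auto
    ultimately have "\<Phi> O1 r w = \<Phi> O1 r' w" by (auto dest: fun_cong[of _ _ w])
    then have "restrict (\<Phi> O1 r) N = restrict (\<Phi> O1 r') N"
      using w by (auto simp: N_def fun_eq_iff)
    then have "\<Phi> N (restrict r N) = \<Phi> N (restrict r' N)"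
      using res[OF O1 N NO1 rs(1)] res[OF O1 N NO1 rs(2)] by simp
    then have "restrict r N = restrict r' N"
      using bij_betw_imp_inj_on[OF bij[OF N]] restrict_in_sections[OF rs(1) NO1] restrict_in_sections[OF rs(2) NO1]
      by (auto dest: inj_onD)
    moreover have "z \<in> N" using zO1 unfolding N_def by auto
    ultimately have "r z = r' z" by (auto dest: fun_cong[of _ _ z])
    then show False using z zO1 by (simp add: r_def r'_def)
  qed
  then show "\<exists>T. openin (subtopology X Z) T \<and> z \<in> T \<and> T \<subseteq> {w \<in> Q. s w \<noteq> s' w}"
    using tr[OF N] zO1 NO1 by (intro exI[of _ N]) (auto simp: N_def O1_def)
qed

text \<open>The loci of agreement and of disagreement are both open and would separate
  \<open>C\<close>.\<close>

lemma sections_agree_connected: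
  assumes G: "presheaf X K G" and lc: "locally_constant_on X K G Z"
    and Q: "openin (subtopology X Z) Q"
    and s: "s \<in> sections X K G Q" "s' \<in> sections X K G Q"
    and conn: "connectedin X C" "C \<subseteq> Q" "y \<in> C" "y' \<in> C" "s y = s' y"
  shows "s y' = s' y'"
proof (rule ccontr)
  assume ne: "s y' \<noteq> s' y'"
  have CZ: "C \<subseteq> Z" using conn(2) openin_subset[OF Q] by auto
  have cz: "connectedin (subtopology X Z) C" using conn(1) CZ by (simp add: connectedin_subtopology)
  have "\<exists>E1 E2. openin (subtopology X Z) E1 \<and> openin (subtopology X Z) E2 \<and> C \<subseteq> E1 \<union> E2 \<and>
    E1 \<inter> E2 \<inter> C = {} \<and> E1 \<inter> C \<noteq> {} \<and> E2 \<inter> C \<noteq> {}"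
    by (rule exI[of _ "{w \<in> Q. s w = s' w}"], rule exI[of _ "{w \<in> Q. s w \<noteq> s' w}"])
      (use sections_agree_open[OF G Q s] sections_disagree_open[OF G lc Q s] conn ne in auto)
  then show False using cz unfolding connectedin by blast
qed

text \<open>In a trivialisation the value of s at y is some l, and the constant function l over all
  of W corresponds to a section s'. Injectivity of \<Phi> over the set where s has the value l gives
  equality at y. In this way a germ at one point of a stratum is moved to nearby points.\<close>

lemma sections_extend:
  fixes X :: "'x topology" and K :: "'k ring" and G :: "('x, 'k, 's) open_diagram"
  assumes lc: "locally_constant_on X K G Z" and z: "z \<in> Z" "z \<in> topspace X"
  obtains W where "openin (subtopology X Z) W" "z \<in> W"
    "\<And>y Q s. openin (subtopology X Z) Q \<Longrightarrow> y \<in> Q \<Longrightarrow> Q \<subseteq> W \<Longrightarrow> s \<in> sections X K G Q \<Longrightarrow>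
      \<exists>s'\<in>sections X K G W. s' y = s y"
proof -
  obtain W \<Phi> and L :: "('k, ('x set \<Rightarrow> 's) set) module" where W: "openin (subtopology X Z) W" "z \<in> W"
    and iso: "sheaf_iso (subtopology X W) K (restrict_to X K G) (constant_sheaf (subtopology X W) L) \<Phi>"
    using bspec[OF lc[unfolded locally_constant_on_def] z(1)] by (elim exE conjE) (rule that)
  have WZ: "W \<subseteq> Z" "W \<subseteq> topspace X" using openin_subset[OF W(1)] by auto
  have tr': "openin (subtopology X W) T" if "openin (subtopology X Z) T" "T \<subseteq> W" for T
  proof -
    have "subtopology X W = subtopology (subtopology X Z) W"
      using WZ by (simp add: subtopology_subtopology Int_absorb1)
    then show ?thesis using that W(1) by (simp add: openin_open_subtopology)
  qed
  let ?C = "\<lambda>T. carrier (at_open (constant_sheaf (subtopology X W) L) T)"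
  have bij: "bij_betw (\<Phi> T) (sections X K G T) (?C T)" if "openin (subtopology X W) T" for T
    using iso that unfolding sheaf_iso_def linear_iso_def by blast
  have res: "\<Phi> T' (restrict r T') = restrict (\<Phi> T r) T'"
    if "openin (subtopology X W) T" "openin (subtopology X W) T'" "T' \<subseteq> T" "r \<in> sections X K G T" for T T' r
    using iso that unfolding sheaf_iso_def by (simp add: restrict_to_def constant_sheaf_def)
  show thesis
  proof (rule that[OF W])
    fix y Q s assume Q: "openin (subtopology X Z) Q" "y \<in> Q" "Q \<subseteq> W" and s: "s \<in> sections X K G Q"
    have OW: "openin (subtopology X W) Q" and WW: "openin (subtopology X W) W" using Q W by (auto intro: tr')
    have c: "\<Phi> Q s \<in> ?C Q" using bij_betwE[OF bij[OF OW]] s by auto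
    define l where "l = \<Phi> Q s y"
    have cs: "l \<in> carrier L" "openin (subtopology (subtopology X W) Q) {v \<in> Q. \<Phi> Q s v = l}"
      using constant_sheafD[OF c Q(2) openin_subset[OF OW]] unfolding l_def by auto
    define N where "N = {v \<in> Q. \<Phi> Q s v = l}"
    have N: "openin (subtopology X W) N" using cs(2) openin_open_subtopology[OF OW] unfolding N_def by blast
    have NO: "N \<subseteq> Q" "N \<subseteq> W" unfolding N_def using Q by auto
    have "(\<lambda>w\<in>W. l) \<in> ?C W"
    proof -
      have "continuous_map (subtopology (subtopology X W) W) (discrete_topology (carrier L)) (\<lambda>w\<in>W. l)"
        by (rule continuous_map_eq[of _ _ "\<lambda>w. l"]) (use cs(1) in auto)
      then show ?thesis using cs(1) by (simp add: constant_sheaf_def prod_space_def)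
    qed
    then have "(\<lambda>w\<in>W. l) \<in> \<Phi> W ` sections X K G W" using bij[OF WW] unfolding bij_betw_def by simp
    then obtain s' where s': "s' \<in> sections X K G W" "\<Phi> W s' = (\<lambda>w\<in>W. l)" by (auto elim!: imageE)
    have "\<Phi> N (restrict s' N) = \<Phi> N (restrict s N)"
      using res[OF WW N NO(2) s'(1)] res[OF OW N NO(1) s] NO unfolding s'(2) by (auto simp: N_def fun_eq_iff)
    then have "restrict s' N = restrict s N"
      using bij_betw_imp_inj_on[OF bij[OF N]] restrict_in_sections[OF s'(1) NO(2)] restrict_in_sections[OF s NO(1)]
      by (auto dest: inj_onD)
    moreover have "y \<in> N" using Q(2) unfolding N_def l_def by auto
    ultimately have "s' y = s y" by (auto dest: fun_cong[of _ _ y])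
    then show "\<exists>s'\<in>sections X K G W. s' y = s y" using s'(1) by blast
  qed
qed

section \<open>Submersions are open\<close>

abbreviation box_at :: "nat \<Rightarrow> (nat \<Rightarrow> real) \<Rightarrow> real \<Rightarrow> (nat \<Rightarrow> real) set" where
  "box_at m a \<delta> \<equiv> {x. (\<forall>i\<ge>m. x i = 0) \<and> (\<forall>i<m. \<bar>x i - a i\<bar> < \<delta>)}"

lemma Euclidean_space_box:
  assumes "openin (Euclidean_space m) D" "a \<in> D"
  obtains \<delta> where "\<delta> > 0" "box_at m a \<delta> \<subseteq> D"
proof -
  obtain T where T: "openin (powertop_real UNIV) T" "D = T \<inter> {x. \<forall>i\<ge>m. x i = 0}"
    using assms(1) unfolding Euclidean_space_def openin_subtopology by blast
  have "a \<in> T" using assms(2) T(2) by simp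
  let ?P = "\<lambda>U. finite {i \<in> UNIV. U i \<noteq> topspace euclideanreal} \<and>
    (\<forall>i\<in>UNIV. openin euclideanreal (U i)) \<and> a \<in> PiE UNIV U \<and> PiE UNIV U \<subseteq> T"
  have "\<exists>U. ?P U" by (rule bspec[OF T(1)[unfolded openin_product_topology_alt] \<open>a \<in> T\<close>])
  then obtain U where "?P U" by (rule exE)
  then have U: "\<And>i. open (U i)" "a \<in> PiE UNIV U" "PiE UNIV U \<subseteq> T"
    by (auto simp: open_openin[symmetric])
  have "\<exists>d>0. \<forall>y. \<bar>y - a i\<bar> < d \<longrightarrow> y \<in> U i" for i
  proof -
    have "a i \<in> U i" using U(2) by auto
    then show ?thesis using U(1)[of i] unfolding open_dist by (metis dist_real_def)
  qed
  then obtain d where d: "\<And>i. d i > 0" "\<And>i y. \<bar>y - a i\<bar> < d i \<Longrightarrow> y \<in> U i" by metis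
  \<comment> \<open>The element 1 keeps the set nonempty when m = 0.\<close>
  define \<delta> where "\<delta> = Min (insert 1 (d ` {..<m}))"
  have "\<delta> > 0" unfolding \<delta>_def using d(1) by (subst Min_gr_iff) auto
  moreover have \<delta>: "\<delta> \<le> d i" if "i < m" for i unfolding \<delta>_def using that by (intro Min_le) auto
  have "x \<in> D" if x: "x \<in> box_at m a \<delta>" for x
  proof -
    have "x i \<in> U i" for i
    proof (cases "i < m")
      case True
      then have "\<bar>x i - a i\<bar> < d i" using x \<delta>[OF True] by fastforce
      then show ?thesis by (rule d(2))
    next
      case False
      then have "x i = a i" using x assms(2) T(2) by auto
      then show ?thesis using d by simp
    qed
    then show ?thesis using U(3) x T(2) by auto
  qed
  ultimately show thesis using that by blast
qed

text \<open>Along the coordinate edges from x to y, each edge costs at most \<epsilon> times its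
  length by the mean value inequality. This bypasses the total derivative, which suits
  \<open>Ck_on\<close>, a condition on partial derivatives.\<close>

lemma increment_bound:
  assumes diff: "\<And>x i. x \<in> box_at m a \<delta> \<Longrightarrow> i < m \<Longrightarrow> (\<lambda>t. g (x(i := t))) differentiable (at (x i))"
    and bd: "\<And>x i. x \<in> box_at m a \<delta> \<Longrightarrow> i < m \<Longrightarrow> \<bar>partial i g x - A i\<bar> \<le> \<epsilon>"
    and xy: "x \<in> box_at m a \<delta>" "y \<in> box_at m a \<delta>"
  shows "\<bar>g y - g x - (\<Sum>i<m. A i * (y i - x i))\<bar> \<le> \<epsilon> * (\<Sum>i<m. \<bar>y i - x i\<bar>)"
proof -
  \<comment> \<open>The corner reached after the first k coordinates have been replaced.\<close>
  define z where "z k = (\<lambda>i. if i < k then y i else x i)" for k :: nat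
  have step: "\<bar>g (z (Suc k)) - g (z k) - A k * (y k - x k)\<bar> \<le> \<epsilon> * \<bar>y k - x k\<bar>" if k: "k < m" for k
  proof -
    define h where "h t = g ((z k)(k := t)) - A k * t" for t
    define S where "S = closed_segment (x k) (y k)"
    have mem: "(z k)(k := t) \<in> box_at m a \<delta>" if "t \<in> S" for t
    proof -
      have "\<bar>t - a k\<bar> < \<delta>"
        using that xy k unfolding S_def closed_segment_eq_real_ivl by (auto split: if_splits simp: abs_less_iff)
      then show ?thesis using xy k by (auto simp: z_def)
    qed
    have der: "(h has_field_derivative (partial k g ((z k)(k := t)) - A k)) (at t within S)" if t: "t \<in> S" for t
    proof -
      have "(\<lambda>s. g ((z k)(k := s))) differentiable (at t)"
        using diff[OF mem[OF t] k] by simp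
      then have "((\<lambda>s. g ((z k)(k := s))) has_field_derivative deriv (\<lambda>s. g ((z k)(k := s))) t) (at t)"
        by (simp add: DERIV_deriv_iff_real_differentiable)
      then have "((\<lambda>s. g ((z k)(k := s))) has_field_derivative partial k g ((z k)(k := t))) (at t)"
        by (simp add: partial_def)
      then have "(h has_field_derivative (partial k g ((z k)(k := t)) - A k)) (at t)"
        unfolding h_def by (auto intro!: derivative_eq_intros)
      then show ?thesis by (rule has_field_derivative_at_within)
    qed
    have "norm (h (y k) - h (x k)) \<le> \<epsilon> * norm (y k - x k)"
    proof (rule field_differentiable_bound)
      show "convex S" unfolding S_def by (rule convex_closed_segment)
      show "norm (partial k g ((z k)(k := t)) - A k) \<le> \<epsilon>" if "t \<in> S" for t
        using bd[OF mem[OF that] k] by simp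
    qed (use der in \<open>auto simp: S_def\<close>)
    moreover have "(z k)(k := y k) = z (Suc k)" "(z k)(k := x k) = z k" by (auto simp: z_def fun_eq_iff)
    ultimately show ?thesis unfolding h_def by (simp add: algebra_simps)
  qed
  have z: "z 0 = x" "z m = y" using xy by (auto simp: z_def fun_eq_iff)
  have "g y - g x = (\<Sum>k<m. g (z (Suc k)) - g (z k))"
    using sum_lessThan_telescope[of "\<lambda>k. g (z k)" m] z by simp
  then have "g y - g x - (\<Sum>i<m. A i * (y i - x i)) = (\<Sum>k<m. g (z (Suc k)) - g (z k) - A k * (y k - x k))"
    by (simp add: sum_subtractf)
  also have "\<bar>\<dots>\<bar> \<le> (\<Sum>k<m. \<epsilon> * \<bar>y k - x k\<bar>)"
    by (rule order.trans[OF sum_abs sum_mono]) (use step in auto)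
  finally show ?thesis by (simp add: sum_distrib_left)
qed

lemma Ck_on_mono: "Ck_on k m W f \<Longrightarrow> W' \<subseteq> W \<Longrightarrow> Ck_on k m W' f"
  by (induction k arbitrary: f) (auto intro: continuous_map_from_subtopology_mono)

text \<open>Newton's iteration with a fixed right inverse of the derivative at p.\<close>

lemma submersion_covers_box:
  fixes g :: "(nat \<Rightarrow> real) \<Rightarrow> nat \<Rightarrow> real"
  assumes D: "openin (Euclidean_space m) D" and p: "p \<in> D"
    and C1: "\<And>j. j < n \<Longrightarrow> Ck_on (Suc 0) m D (\<lambda>x. g x j)"
    and surj: "\<And>w. \<exists>v. \<forall>j<n. (\<Sum>i<m. partial i (\<lambda>x. g x j) p * v i) = w j"
  obtains \<eta> where "\<eta> > 0" "\<And>w. (\<forall>j<n. \<bar>w j - g p j\<bar> < \<eta>) \<Longrightarrow> \<exists>x\<in>D. \<forall>j<n. g x j = w j"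
proof -
  define A where "A j i = partial i (\<lambda>x. g x j) p" for j i
  have "\<forall>k. \<exists>v. \<forall>j<n. (\<Sum>i<m. A j i * v i) = (if j = k then 1 else 0)"
    unfolding A_def by (intro allI surj)
  then have "\<exists>V. \<forall>k. \<forall>j<n. (\<Sum>i<m. A j i * V k i) = (if j = k then 1 else 0)" by (rule choice)
  \<comment> \<open>\<open>V k\<close> is a preimage of the k-th unit vector under the matrix
    \<open>A\<close>. Together they are the columns of a right inverse, which \<open>B\<close>
    applies.\<close>
  then obtain V where V: "\<And>k j. j < n \<Longrightarrow> (\<Sum>i<m. A j i * V k i) = (if j = k then 1 else 0)" by blast
  \<comment> \<open>A bound for all entries of \<open>V\<close>; the summand 1 allows division by
    it.\<close>
  define M where "M = (\<Sum>k<n. \<Sum>i<m. \<bar>V k i\<bar>) + 1"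
  have M1: "M \<ge> 1" unfolding M_def by (simp add: sum_nonneg)
  have VM: "\<bar>V k i\<bar> \<le> M" if "k < n" "i < m" for k i
  proof -
    have "\<bar>V k i\<bar> \<le> (\<Sum>i<m. \<bar>V k i\<bar>)" using that by (intro member_le_sum) auto
    also have "\<dots> \<le> (\<Sum>k<n. \<Sum>i<m. \<bar>V k i\<bar>)"
      using that by (intro member_le_sum[of k "{..<n}" "\<lambda>k. \<Sum>i<m. \<bar>V k i\<bar>"]) (auto intro: sum_nonneg)
    finally show ?thesis unfolding M_def by simp
  qed
  define B where "B w i = (if i < m then \<Sum>k<n. w k * V k i else 0)" for w :: "nat \<Rightarrow> real" and i
  define N where "N w = (\<Sum>j<n. \<bar>w j\<bar>)" for w :: "nat \<Rightarrow> real"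
  have N0: "N w \<ge> 0" for w unfolding N_def by (simp add: sum_nonneg)
  have AB: "(\<Sum>i<m. A j i * B w i) = w j" if "j < n" for j w
  proof -
    have "(\<Sum>i<m. A j i * B w i) = (\<Sum>i<m. \<Sum>k<n. w k * (A j i * V k i))"
      by (simp add: B_def sum_distrib_left mult_ac)
    also have "\<dots> = (\<Sum>k<n. \<Sum>i<m. w k * (A j i * V k i))" by (rule sum.swap)
    also have "\<dots> = (\<Sum>k<n. w k * (if j = k then 1 else 0))"
      using V[OF that] by (simp add: sum_distrib_left[symmetric])
    also have "\<dots> = w j" using that by (simp add: if_distrib cong: if_cong)
    finally show ?thesis .
  qed
  have BN: "\<bar>B w i\<bar> \<le> M * N w" if "i < m" for w i
  proof -
    have "\<bar>B w i\<bar> \<le> (\<Sum>k<n. \<bar>w k * V k i\<bar>)" using that by (simp add: B_def sum_abs)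
    also have "\<dots> \<le> (\<Sum>k<n. M * \<bar>w k\<bar>)"
    proof (rule sum_mono)
      fix k assume "k \<in> {..<n}"
      then have "\<bar>w k\<bar> * \<bar>V k i\<bar> \<le> \<bar>w k\<bar> * M" using VM[OF _ that] by (intro mult_left_mono) auto
      then show "\<bar>w k * V k i\<bar> \<le> M * \<bar>w k\<bar>" by (simp add: abs_mult mult.commute)
    qed
    finally show ?thesis by (simp add: N_def sum_distrib_left)
  qed
  \<comment> \<open>Chosen so that one step at least halves the residual: n * \<epsilon> * m * M is
    at most 1/2. The added ones keep the denominator nonzero when n = 0 or m = 0.\<close>
  define \<epsilon> where "\<epsilon> = 1 / (2 * (real n + 1) * (real m + 1) * M)"
  have \<epsilon>0: "\<epsilon> > 0" unfolding \<epsilon>_def using M1 by simp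
  have \<epsilon>n: "real n * (\<epsilon> * (real m * (M * r))) \<le> r / 2" if "r \<ge> 0" for r
  proof -
    have "real n * (\<epsilon> * (real m * (M * r))) = (real n / (real n + 1)) * (real m / (real m + 1)) * (r / 2)"
      using M1 unfolding \<epsilon>_def by (simp add: divide_simps)
    also have "\<dots> \<le> 1 * 1 * (r / 2)"
      using that by (intro mult_right_mono mult_mono) auto
    finally show ?thesis by simp
  qed
  \<comment> \<open>Where the partial derivatives stay within \<epsilon> of those at p,
    \<open>increment_bound\<close> applies with the fixed matrix \<open>A\<close>.\<close>
  define D' where "D' = (\<Inter>j<n. \<Inter>i<m. {x \<in> D. \<bar>partial i (\<lambda>x. g x j) x - A j i\<bar> < \<epsilon>}) \<inter> D"
  have oD: "openin (Euclidean_space m) {x \<in> D. \<bar>partial i (\<lambda>x. g x j) x - A j i\<bar> < \<epsilon>}" if ij: "i < m" "j < n" for i j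
  proof -
    have c: "continuous_map (subtopology (Euclidean_space m) D) euclideanreal (partial i (\<lambda>x. g x j))"
      using C1[OF ij(2)] ij(1) by simp
    have "openin (subtopology (Euclidean_space m) D)
      {x \<in> topspace (subtopology (Euclidean_space m) D). partial i (\<lambda>x. g x j) x \<in> ball (A j i) \<epsilon>}"
      by (rule openin_continuous_map_preimage[OF c]) (simp add: open_openin[symmetric])
    moreover have "{x \<in> topspace (subtopology (Euclidean_space m) D). partial i (\<lambda>x. g x j) x \<in> ball (A j i) \<epsilon>} =
      {x \<in> D. \<bar>partial i (\<lambda>x. g x j) x - A j i\<bar> < \<epsilon>}"
      using openin_subset[OF D] by (auto simp: dist_real_def abs_minus_commute)
    ultimately show ?thesis using D openin_open_subtopology by metis
  qed
  have "openin (Euclidean_space m) D'"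
  proof -
    have "openin (Euclidean_space m) (\<Inter>(insert D ((\<lambda>(j,i). {x \<in> D. \<bar>partial i (\<lambda>x. g x j) x - A j i\<bar> < \<epsilon>}) ` ({..<n} \<times> {..<m}))))"
      using D oD by (intro openin_Inter) auto
    moreover have "(\<Inter>(insert D ((\<lambda>(j,i). {x \<in> D. \<bar>partial i (\<lambda>x. g x j) x - A j i\<bar> < \<epsilon>}) ` ({..<n} \<times> {..<m})))) = D'"
      unfolding D'_def by auto
    ultimately show ?thesis by simp
  qed
  moreover have "p \<in> D'" using p \<epsilon>0 by (auto simp: D'_def A_def)
  ultimately obtain \<delta> where \<delta>: "\<delta> > 0" "box_at m p \<delta> \<subseteq> D'" by (rule Euclidean_space_box)
  have boxD: "box_at m p \<delta> \<subseteq> D" using \<delta>(2) unfolding D'_def by blast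
  have inc: "\<bar>g y j - g x j - (\<Sum>i<m. A j i * (y i - x i))\<bar> \<le> \<epsilon> * (\<Sum>i<m. \<bar>y i - x i\<bar>)"
    if j: "j < n" and "x \<in> box_at m p \<delta>" "y \<in> box_at m p \<delta>" for j x y
  proof (rule increment_bound[where g="\<lambda>x. g x j", OF _ _ that(2,3)])
    fix x i assume x: "x \<in> box_at m p \<delta>" "i < m"
    show "(\<lambda>t. g (x(i := t)) j) differentiable (at (x i))" using C1[OF j] x boxD by auto
    have "x \<in> D'" using x \<delta>(2) by blast
    then have "\<bar>partial i (\<lambda>x. g x j) x - A j i\<bar> < \<epsilon>" using x(2) j unfolding D'_def by blast
    then show "\<bar>partial i (\<lambda>x. g x j) x - A j i\<bar> \<le> \<epsilon>" by simp
  qed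
  have p0: "p i = 0" if "i \<ge> m" for i
    using p openin_subset[OF D] that by (auto simp: topspace_Euclidean_space)
  \<comment> \<open>The initial residual r is then at most \<delta> / (4M). The iteration moves no
    coordinate by more than 2Mr, so it stays strictly inside the box.\<close>
  define \<eta> where "\<eta> = \<delta> / (4 * M * (real n + 1))"
  have "\<eta> > 0" unfolding \<eta>_def using \<delta> M1 by simp
  moreover have "\<exists>x\<in>D. \<forall>j<n. g x j = w j" if w: "\<forall>j<n. \<bar>w j - g p j\<bar> < \<eta>" for w
  proof -
    define e where "e x j = w j - g x j" for x j
    define r where "r = N (e p)"
    have r0: "r \<ge> 0" unfolding r_def by (rule N0)
    have "r \<le> (\<Sum>j<n. \<eta>)" unfolding r_def N_def e_def using w by (intro sum_mono) force
    then have "r \<le> real n * \<eta>" by simp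
    also have "\<dots> \<le> (real n + 1) * \<eta>" using \<open>\<eta> > 0\<close> by (simp add: algebra_simps)
    also have "\<dots> = \<delta> / (4 * M)" unfolding \<eta>_def using M1 by (simp add: divide_simps)
    finally have "r * (4 * M) \<le> \<delta>" using M1 by (simp add: pos_le_divide_eq)
    then have r\<delta>: "2 * M * r < \<delta>" using \<delta>(1) M1 r0 by (cases "r = 0") (auto simp: mult_ac)
    define X where "X = rec_nat p (\<lambda>_ x i. x i + B (e x) i)"
    have X: "X 0 = p" "X (Suc k) = (\<lambda>i. X k i + B (e (X k)) i)" for k unfolding X_def by simp_all
    \<comment> \<open>The bound on the coordinates is the partial geometric sum of the step sizes M
      * r / 2^k. It keeps the iterates in the box, which in turn allows the residual to be halved
      again.\<close>
    have inv: "(\<forall>i\<ge>m. X k i = 0) \<and> (\<forall>i<m. \<bar>X k i - p i\<bar> \<le> 2 * M * r * (1 - (1/2)^k)) \<and> N (e (X k)) \<le> r * (1/2)^k" for k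
    proof (induction k)
      case 0
      then show ?case using p0 by (simp add: X r_def)
    next
      case (Suc k)
      let ?d = "B (e (X k))"
      have d: "\<bar>?d i\<bar> \<le> M * (r * (1/2)^k)" if "i < m" for i
        using BN[OF that, of "e (X k)"] Suc M1 mult_left_mono[of "N (e (X k))" "r * (1/2)^k" M] by linarith
      have z: "\<forall>i\<ge>m. X (Suc k) i = 0" using Suc by (simp add: X B_def)
      have b: "\<bar>X (Suc k) i - p i\<bar> \<le> 2 * M * r * (1 - (1/2)^(Suc k))" if "i < m" for i
      proof -
        have "\<bar>X (Suc k) i - p i\<bar> \<le> \<bar>X k i - p i\<bar> + \<bar>?d i\<bar>" unfolding X by linarith
        also have "\<dots> \<le> 2 * M * r * (1 - (1/2)^k) + M * (r * (1/2)^k)" using Suc d[OF that] that by (intro add_mono) auto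
        also have "\<dots> = 2 * M * r * (1 - (1/2)^(Suc k))" by (simp add: algebra_simps)
        finally show ?thesis .
      qed
      have lt: "2 * M * r * (1 - (1/2)^l) < \<delta>" for l
      proof -
        have "2 * M * r * (1 - (1/2)^l) \<le> 2 * M * r * 1" using M1 r0 by (intro mult_left_mono) auto
        then show ?thesis using r\<delta> by simp
      qed
      have bx: "X k \<in> box_at m p \<delta>" "X (Suc k) \<in> box_at m p \<delta>"
        using Suc z b lt[of k] lt[of "Suc k"] by (auto intro: le_less_trans)
      have ej: "\<bar>e (X (Suc k)) j\<bar> \<le> \<epsilon> * (real m * (M * N (e (X k))))" if j: "j < n" for j
      proof -
        have "e (X (Suc k)) j = - (g (X (Suc k)) j - g (X k) j - (\<Sum>i<m. A j i * (X (Suc k) i - X k i)))"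
          using AB[OF j, of "e (X k)"] by (simp add: X e_def)
        then have "\<bar>e (X (Suc k)) j\<bar> \<le> \<epsilon> * (\<Sum>i<m. \<bar>X (Suc k) i - X k i\<bar>)"
          using inc[OF j bx] by simp
        also have "\<dots> \<le> \<epsilon> * (\<Sum>i<m. M * N (e (X k)))"
          using \<epsilon>0 BN by (intro mult_left_mono sum_mono) (auto simp: X)
        finally show ?thesis by simp
      qed
      have "N (e (X (Suc k))) \<le> (\<Sum>j<n. \<epsilon> * (real m * (M * N (e (X k)))))"
        unfolding N_def[of "e (X (Suc k))"] using ej by (intro sum_mono) auto
      also have "\<dots> \<le> N (e (X k)) / 2" using \<epsilon>n[OF N0[of "e (X k)"]] by simp
      also have "\<dots> \<le> r * (1/2)^(Suc k)" using Suc by simp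
      finally show ?case using z b by auto
    qed
    have "\<exists>l. (\<lambda>k. X k i) \<longlonglongrightarrow> l" for i
    proof (cases "i < m")
      case True
      have "summable (\<lambda>k. X (Suc k) i - X k i)"
      proof (rule summable_comparison_test')
        show "summable (\<lambda>k. (M * r) * (1/2::real)^k)" by (intro summable_mult summable_geometric) simp
        show "norm (X (Suc k) i - X k i) \<le> (M * r) * (1/2)^k" if "0 \<le> k" for k
        proof -
          have "\<bar>B (e (X k)) i\<bar> \<le> M * (r * (1/2)^k)"
            using inv[of k] M1 by (intro order.trans[OF BN[OF True] mult_left_mono]) auto
          then show ?thesis by (simp add: X mult.assoc)
        qed
      qed
      then have "(\<lambda>k. \<Sum>l<k. X (Suc l) i - X l i) \<longlonglongrightarrow> (\<Sum>l. X (Suc l) i - X l i)" by (rule summable_LIMSEQ)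
      then have "(\<lambda>k. X k i - X 0 i) \<longlonglongrightarrow> (\<Sum>l. X (Suc l) i - X l i)"
        by (simp add: sum_lessThan_telescope[of "\<lambda>l. X l i"])
      from tendsto_add[OF this tendsto_const[of "X 0 i"]] show ?thesis by auto
    next
      case False
      then show ?thesis using inv by (intro exI[of _ 0]) simp
    qed
    then obtain x where x: "\<And>i. (\<lambda>k. X k i) \<longlonglongrightarrow> x i" by metis
    have x0: "x i = 0" if "i \<ge> m" for i
      using LIMSEQ_unique[OF x[of i]] inv that by simp
    have xb: "\<bar>x i - p i\<bar> \<le> 2 * M * r" if i: "i < m" for i
    proof (rule LIMSEQ_le_const2)
      show "(\<lambda>k. \<bar>X k i - p i\<bar>) \<longlonglongrightarrow> \<bar>x i - p i\<bar>" by (intro tendsto_intros x)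
      have "\<bar>X k i - p i\<bar> \<le> 2 * M * r" for k
      proof -
        have "\<bar>X k i - p i\<bar> \<le> 2 * M * r * (1 - (1/2)^k)" using inv i by blast
        also have "\<dots> \<le> 2 * M * r * 1" using M1 r0 by (intro mult_left_mono) auto
        finally show ?thesis by simp
      qed
      then show "\<exists>N. \<forall>k\<ge>N. \<bar>X k i - p i\<bar> \<le> 2 * M * r" by blast
    qed
    have xbox: "x \<in> box_at m p \<delta>" using x0 xb r\<delta> by (auto intro: le_less_trans)
    have Xbox: "X k \<in> box_at m p \<delta>" for k
    proof -
      have "\<bar>X k i - p i\<bar> < \<delta>" if "i < m" for i
      proof -
        have "\<bar>X k i - p i\<bar> \<le> 2 * M * r * (1 - (1/2)^k)" using inv that by blast
        also have "\<dots> \<le> 2 * M * r * 1" using M1 r0 by (intro mult_left_mono) auto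
        finally show ?thesis using r\<delta> by simp
      qed
      then show ?thesis using inv by blast
    qed
    \<comment> \<open>Convergence of g along the iterates is read off from \<open>inc\<close>, so
      that g of the limit is the limit of the values, which is w.\<close>
    have "g x j = w j" if j: "j < n" for j
    proof -
      have "(\<lambda>k. g (X k) j - g x j) \<longlonglongrightarrow> 0"
      proof (rule Lim_null_comparison)
        show "\<forall>\<^sub>F k in sequentially. norm (g (X k) j - g x j) \<le>
          \<bar>\<Sum>i<m. A j i * (X k i - x i)\<bar> + \<epsilon> * (\<Sum>i<m. \<bar>X k i - x i\<bar>)"
        proof (intro always_eventually allI)
          fix k
          show "norm (g (X k) j - g x j) \<le>
            \<bar>\<Sum>i<m. A j i * (X k i - x i)\<bar> + \<epsilon> * (\<Sum>i<m. \<bar>X k i - x i\<bar>)"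
            using inc[OF j xbox Xbox[of k]] unfolding real_norm_def by linarith
        qed
        have "(\<lambda>k. \<bar>\<Sum>i<m. A j i * (X k i - x i)\<bar> + \<epsilon> * (\<Sum>i<m. \<bar>X k i - x i\<bar>)) \<longlonglongrightarrow>
          \<bar>\<Sum>i<m. A j i * (x i - x i)\<bar> + \<epsilon> * (\<Sum>i<m. \<bar>x i - x i\<bar>)"
          by (intro tendsto_intros x)
        then show "(\<lambda>k. \<bar>\<Sum>i<m. A j i * (X k i - x i)\<bar> + \<epsilon> * (\<Sum>i<m. \<bar>X k i - x i\<bar>)) \<longlonglongrightarrow> 0" by simp
      qed
      moreover have "(\<lambda>k. w j - g (X k) j) \<longlonglongrightarrow> 0"
      proof (rule Lim_null_comparison)
        show "\<forall>\<^sub>F k in sequentially. norm (w j - g (X k) j) \<le> r * (1/2)^k"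
        proof (intro always_eventually allI)
          fix k
          have "\<bar>e (X k) j\<bar> \<le> N (e (X k))" unfolding N_def using j by (intro member_le_sum) auto
          also have "\<dots> \<le> r * (1/2)^k" using inv by blast
          finally show "norm (w j - g (X k) j) \<le> r * (1/2)^k" by (simp add: e_def)
        qed
        show "(\<lambda>k. r * (1/2)^k) \<longlonglongrightarrow> 0" by (intro tendsto_mult_right_zero LIMSEQ_realpow_zero) auto
      qed
      ultimately have "(\<lambda>k. (g (X k) j - g x j) + (w j - g (X k) j)) \<longlonglongrightarrow> 0 + 0" by (rule tendsto_add)
      then have "(\<lambda>k::nat. w j - g x j) \<longlonglongrightarrow> 0" by simp
      then show ?thesis by (simp add: LIMSEQ_const_iff)
    qed
    then show ?thesis using xbox boxD by blast
  qed
  ultimately show thesis using that by blast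
qed

text \<open>Gaussian elimination: an equation with a nonzero coefficient at b eliminates the unknown
  b. The unknowns are indexed by an arbitrary finite set so that b can be removed from it.\<close>

lemma homogeneous_system:
  fixes A :: "'j \<Rightarrow> nat \<Rightarrow> real"
  assumes "finite J" "m < card J"
  shows "\<exists>w. (\<exists>j\<in>J. w j \<noteq> 0) \<and> (\<forall>i<m. (\<Sum>j\<in>J. A j i * w j) = 0)"
  using assms
proof (induction m arbitrary: J A)
  case 0
  then show ?case by (intro exI[of _ "\<lambda>_. 1"]) (auto simp: card_gt_0_iff)
next
  case (Suc m)
  show ?case
  proof (cases "\<forall>j\<in>J. A j m = 0")
    case True
    obtain w where w: "\<exists>j\<in>J. w j \<noteq> 0" "\<And>i. i < m \<Longrightarrow> (\<Sum>j\<in>J. A j i * w j) = 0"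
      using Suc.IH[of J A] Suc.prems by auto
    moreover have "(\<Sum>j\<in>J. A j m * w j) = 0" using True by simp
    ultimately show ?thesis by (intro exI[of _ w]) (auto simp: less_Suc_eq)
  next
    case False
    then obtain b where b: "b \<in> J" "A b m \<noteq> 0" by blast
    let ?J = "J - {b}"
    have "m < card ?J" using Suc.prems b by simp
    then obtain w where w: "\<exists>j\<in>?J. w j \<noteq> 0"
      "\<And>i. i < m \<Longrightarrow> (\<Sum>j\<in>?J. (A j i - A j m / A b m * A b i) * w j) = 0"
      using Suc.IH[of ?J "\<lambda>j i. A j i - A j m / A b m * A b i"] Suc.prems(1) by auto
    define c where "c = - (\<Sum>j\<in>?J. A j m * w j) / A b m"
    define w' where "w' = w(b := c)"
    have sum: "(\<Sum>j\<in>J. A j i * w' j) = A b i * c + (\<Sum>j\<in>?J. A j i * w j)" for i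
    proof -
      have "(\<Sum>j\<in>J. A j i * w' j) = A b i * w' b + (\<Sum>j\<in>?J. A j i * w' j)"
        using Suc.prems(1) b(1) by (rule sum.remove)
      then show ?thesis by (simp add: w'_def)
    qed
    have "(\<Sum>j\<in>J. A j i * w' j) = 0" if "i < Suc m" for i
    proof (cases "i = m")
      case True
      then show ?thesis using b(2) by (simp add: sum c_def)
    next
      case False
      then have "(\<Sum>j\<in>?J. (A j i - A j m / A b m * A b i) * w j) = 0" using w(2) that by simp
      moreover have "(\<Sum>j\<in>?J. A j i * w j) - (A b i / A b m) * (\<Sum>j\<in>?J. A j m * w j) =
        (\<Sum>j\<in>?J. (A j i - A j m / A b m * A b i) * w j)"
        unfolding sum_distrib_left sum_subtractf[symmetric] by (intro sum.cong) (auto simp: algebra_simps)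
      ultimately have "(\<Sum>j\<in>?J. A j i * w j) = (A b i / A b m) * (\<Sum>j\<in>?J. A j m * w j)" by simp
      then show ?thesis by (simp add: sum c_def)
    qed
    moreover have "\<exists>j\<in>J. w' j \<noteq> 0" using w(1) by (auto simp: w'_def)
    ultimately show ?thesis by blast
  qed
qed

text \<open>If n > m, the n rows satisfy a nontrivial linear relation w, so w is orthogonal to the
  image of the matrix. Being itself in the image, w is orthogonal to itself.\<close>

lemma surjective_matrix_dim_le:
  fixes A :: "nat \<Rightarrow> nat \<Rightarrow> real"
  assumes "\<And>w. \<exists>v. \<forall>j<n. (\<Sum>i<m. A j i * v i) = w j"
  shows "n \<le> m"
proof (rule ccontr)
  assume "\<not> n \<le> m"
  then obtain w where w: "\<exists>j<n. w j \<noteq> 0" "\<And>i. i < m \<Longrightarrow> (\<Sum>j<n. A j i * w j) = 0"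
    using homogeneous_system[of "{..<n}" m A] by auto
  obtain v where v: "\<And>j. j < n \<Longrightarrow> (\<Sum>i<m. A j i * v i) = w j" using assms by metis
  have "(\<Sum>j<n. w j * w j) = (\<Sum>j<n. w j * (\<Sum>i<m. A j i * v i))"
    using v by (intro sum.cong) auto
  also have "\<dots> = (\<Sum>j<n. \<Sum>i<m. v i * (A j i * w j))"
    by (simp add: sum_distrib_left mult_ac)
  also have "\<dots> = (\<Sum>i<m. \<Sum>j<n. v i * (A j i * w j))" by (rule sum.swap)
  also have "\<dots> = 0" using w(2) by (simp add: sum_distrib_left[symmetric])
  finally have "\<forall>j<n. w j * w j = 0" by (subst (asm) sum_nonneg_eq_0_iff) auto
  then show False using w(1) by auto
qed

text \<open>Openness is \<open>submersion_covers_box\<close> read in charts. Of the target charts it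
  is asked that their coordinates be continuous and separate points, which is readily checked for
  \<open>times_halfline_atlas\<close>. The dimension inequality is the source of the strict growth
  of dimension along a tube.\<close>

lemma smooth_submersion_open:
  assumes sub: "smooth_submersion m M A n N B f"
    and A: "\<And>U \<phi>. (U, \<phi>) \<in> A \<Longrightarrow> openin M U \<and> openin (Euclidean_space m) (\<phi> ` U) \<and>
        homeomorphic_map (subtopology M U) (subtopology (Euclidean_space m) (\<phi> ` U)) \<phi>"
    and Acov: "topspace M \<subseteq> (\<Union>(U, \<phi>)\<in>A. U)"
    and B: "\<And>V \<psi>. (V, \<psi>) \<in> B \<Longrightarrow> openin N V \<and> (\<forall>y\<in>V. \<forall>z\<in>V. (\<forall>j<n. \<psi> y j = \<psi> z j) \<longrightarrow> y = z) \<and>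
        (\<forall>j<n. continuous_map (subtopology N V) euclideanreal (\<lambda>y. \<psi> y j))"
    and Bcov: "topspace N \<subseteq> (\<Union>(V, \<psi>)\<in>B. V)"
  shows "openin M T \<Longrightarrow> openin N (f ` T)" and "topspace M \<noteq> {} \<Longrightarrow> n \<le> m"
proof -
  have cont: "continuous_map M N f" using sub unfolding smooth_submersion_def smooth_map_def by blast
  have charts: "\<exists>U \<phi> V \<psi>. (U, \<phi>) \<in> A \<and> (V, \<psi>) \<in> B \<and> p \<in> U \<and> f p \<in> V" if p: "p \<in> topspace M" for p
  proof -
    have "f p \<in> topspace N" using cont p unfolding continuous_map_def by auto
    then show ?thesis using Acov Bcov p by blast
  qed
  have surj: "\<exists>v. \<forall>j<n. (\<Sum>i<m. partial i (\<lambda>x. (\<psi> \<circ> f \<circ> inv_into U \<phi>) x j) (\<phi> p) * v i) = w j"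
    if "(U, \<phi>) \<in> A" "(V, \<psi>) \<in> B" "p \<in> U" "f p \<in> V" for U \<phi> V \<psi> p w
    using sub that unfolding smooth_submersion_def by blast
  show "n \<le> m" if "topspace M \<noteq> {}"
  proof -
    obtain p where "p \<in> topspace M" using \<open>topspace M \<noteq> {}\<close> by blast
    from charts[OF this] obtain U \<phi> V \<psi> where "(U, \<phi>) \<in> A" "(V, \<psi>) \<in> B" "p \<in> U" "f p \<in> V" by blast
    from surjective_matrix_dim_le[OF surj[OF this]] show ?thesis .
  qed
  show "openin N (f ` T)" if T: "openin M T"
  proof (subst openin_subopen, intro ballI)
    fix q assume "q \<in> f ` T"
    then obtain p where p: "p \<in> T" "q = f p" by blast
    then have pM: "p \<in> topspace M" using openin_subset[OF T] by blast
    obtain U \<phi> V \<psi> where c: "(U, \<phi>) \<in> A" "(V, \<psi>) \<in> B" "p \<in> U" "f p \<in> V" using charts[OF pM] by blast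
    note AU = A[OF c(1)] and BV = B[OF c(2)]
    define g where "g x j = (\<psi> \<circ> f \<circ> inv_into U \<phi>) x j" for x j
    define Q where "Q = {u \<in> U \<inter> T. f u \<in> V}"
    have UM: "U \<subseteq> topspace M" using AU openin_subset by blast
    have Q: "openin M Q"
    proof -
      have "openin M {u \<in> topspace M. f u \<in> V}"
        using BV by (intro openin_continuous_map_preimage[OF cont]) blast
      then have "openin M ((U \<inter> T) \<inter> {u \<in> topspace M. f u \<in> V})" using AU T by blast
      moreover have "(U \<inter> T) \<inter> {u \<in> topspace M. f u \<in> V} = Q" using UM unfolding Q_def by blast
      ultimately show ?thesis by simp
    qed
    have inj: "inj_on \<phi> U"
    proof -
      have "inj_on \<phi> (topspace (subtopology M U))" using AU homeomorphic_imp_injective_map by blast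
      then show ?thesis using UM by (simp add: Int_absorb1)
    qed
    have oD: "openin (Euclidean_space m) (\<phi> ` Q)"
    proof -
      have "open_map (subtopology M U) (subtopology (Euclidean_space m) (\<phi> ` U)) \<phi>"
        using AU homeomorphic_imp_open_map by blast
      moreover have "openin (subtopology M U) Q" using Q AU by (simp add: openin_open_subtopology Q_def)
      ultimately have "openin (subtopology (Euclidean_space m) (\<phi> ` U)) (\<phi> ` Q)" unfolding open_map_def by blast
      then show ?thesis using AU by (simp add: openin_open_subtopology)
    qed
    have C1: "Ck_on (Suc 0) m (\<phi> ` Q) (\<lambda>x. g x j)" if "j < n" for j
    proof (rule Ck_on_mono)
      have "smooth_on m n (\<phi> ` {u \<in> U. f u \<in> V}) (\<psi> \<circ> f \<circ> inv_into U \<phi>)"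
        using sub c unfolding smooth_submersion_def smooth_map_def by blast
      then show "Ck_on (Suc 0) m (\<phi> ` {u \<in> U. f u \<in> V}) (\<lambda>x. g x j)"
        using that unfolding smooth_on_def g_def by blast
      show "\<phi> ` Q \<subseteq> \<phi> ` {u \<in> U. f u \<in> V}" unfolding Q_def by blast
    qed
    have pQ: "\<phi> p \<in> \<phi> ` Q" using c p unfolding Q_def by blast
    have surj': "\<exists>v. \<forall>j<n. (\<Sum>i<m. partial i (\<lambda>x. g x j) (\<phi> p) * v i) = w j" for w
      using surj[OF c] unfolding g_def .
    obtain \<eta> where \<eta>: "\<eta> > 0" "\<And>w. (\<forall>j<n. \<bar>w j - g (\<phi> p) j\<bar> < \<eta>) \<Longrightarrow> \<exists>x\<in>\<phi> ` Q. \<forall>j<n. g x j = w j"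
      by (rule submersion_covers_box[where g=g, OF oD pQ C1 surj']) (assumption | (rule that, assumption, blast))+
    have gv: "g (\<phi> u) j = \<psi> (f u) j" if "u \<in> U" for u j
      using that inj by (simp add: g_def inv_into_f_f)
    \<comment> \<open>The box of attained values, pulled back along \<psi>. Since \<psi> separates
      points, equality of coordinates becomes f u = y.\<close>
    define R where "R = {y \<in> V. \<forall>j<n. \<bar>\<psi> y j - \<psi> q j\<bar> < \<eta>}"
    have "openin N R"
    proof -
      have VN: "V \<subseteq> topspace N" using BV openin_subset by blast
      have o: "openin N {y \<in> V. \<bar>\<psi> y j - \<psi> q j\<bar> < \<eta>}" if "j < n" for j
      proof -
        have "openin (subtopology N V) {y \<in> topspace (subtopology N V). \<psi> y j \<in> ball (\<psi> q j) \<eta>}"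
          using BV that by (intro openin_continuous_map_preimage[where Y=euclideanreal]) (auto simp: open_openin[symmetric])
        moreover have "{y \<in> topspace (subtopology N V). \<psi> y j \<in> ball (\<psi> q j) \<eta>} = {y \<in> V. \<bar>\<psi> y j - \<psi> q j\<bar> < \<eta>}"
          using VN by (auto simp: dist_real_def abs_minus_commute)
        ultimately show ?thesis using BV openin_open_subtopology by metis
      qed
      have "openin N (\<Inter>(insert V ((\<lambda>j. {y \<in> V. \<bar>\<psi> y j - \<psi> q j\<bar> < \<eta>}) ` {..<n})))"
        using o BV by (intro openin_Inter) auto
      moreover have "\<Inter>(insert V ((\<lambda>j. {y \<in> V. \<bar>\<psi> y j - \<psi> q j\<bar> < \<eta>}) ` {..<n})) = R" unfolding R_def by auto
      ultimately show ?thesis by simp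
    qed
    moreover have "q \<in> R" using c p \<eta>(1) unfolding R_def by simp
    moreover have "R \<subseteq> f ` T"
    proof
      fix y assume y: "y \<in> R"
      have "\<forall>j<n. \<bar>\<psi> y j - g (\<phi> p) j\<bar> < \<eta>" using y gv[OF c(3)] p unfolding R_def by simp
      then obtain u where u: "u \<in> Q" "\<forall>j<n. g (\<phi> u) j = \<psi> y j" using \<eta>(2) by blast
      have uU: "u \<in> U" "f u \<in> V" and yV: "y \<in> V" using u(1) y unfolding Q_def R_def by auto
      have "\<forall>j<n. \<psi> (f u) j = \<psi> y j" using u(2) gv[OF uU(1)] by simp
      then have "f u = y" using bspec[OF bspec[OF conjunct1[OF conjunct2[OF BV]] uU(2)] yV] by simp
      then show "y \<in> f ` T" using u unfolding Q_def by blast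
    qed
    ultimately show "\<exists>R. openin N R \<and> q \<in> R \<and> R \<subseteq> f ` T" by blast
  qed
qed

section \<open>Costalks\<close>

lemma costalk_iff:
  "s \<in> carrier (costalk X F x) \<longleftrightarrow> s \<in> (\<Pi>\<^sub>E U\<in>open_nbhds X x. carrier (at_open F U)) \<and>
     (\<forall>U\<in>open_nbhds X x. \<forall>V\<in>open_nbhds X x. U \<subseteq> V \<longrightarrow> arrow F U V (s U) = s V)"
  by (simp add: costalk_def prod_space_def)

lemma costalkD:
  assumes "s \<in> carrier (costalk X F x)" "openin X U" "x \<in> U"
  shows "s U \<in> carrier (at_open F U)"
    and "openin X V \<Longrightarrow> U \<subseteq> V \<Longrightarrow> arrow F U V (s U) = s V"
  using assms unfolding costalk_iff by (auto simp: PiE_iff)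

lemma costalk_eqI:
  assumes "s \<in> carrier (costalk X F x)" "s' \<in> carrier (costalk X F x)"
    "\<And>U. openin X U \<Longrightarrow> x \<in> U \<Longrightarrow> s U = s' U"
  shows "s = s'"
proof (rule PiE_ext)
  show "s \<in> (\<Pi>\<^sub>E U\<in>open_nbhds X x. carrier (at_open F U))" using assms(1) unfolding costalk_iff by simp
  show "s' \<in> (\<Pi>\<^sub>E U\<in>open_nbhds X x. carrier (at_open F U))" using assms(2) unfolding costalk_iff by simp
qed (use assms(3) in auto)

lemma costalk_ops:
  "U \<in> open_nbhds X x \<Longrightarrow> (s \<oplus>\<^bsub>costalk X F x\<^esub> s') U = s U \<oplus>\<^bsub>at_open F U\<^esub> s' U"
  "U \<in> open_nbhds X x \<Longrightarrow> (a \<odot>\<^bsub>costalk X F x\<^esub> s) U = a \<odot>\<^bsub>at_open F U\<^esub> s U"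
  "U \<in> open_nbhds X x \<Longrightarrow> \<zero>\<^bsub>costalk X F x\<^esub> U = \<zero>\<^bsub>at_open F U\<^esub>"
  by (simp_all add: costalk_def prod_space_def)

lemma vspace_costalk:
  assumes "Ring.field K" "precosheaf X K F"
  shows "vspace K (costalk X F x)"
proof -
  let ?A = "open_nbhds X x"
  let ?P = "prod_space ?A (at_open F)"
  note F = precosheafD[OF assms(2)]
  interpret K: field K by fact
  have D: "Module.module K (at_open F U)" if "U \<in> ?A" for U using that F(1) vspace_module by auto
  interpret P: module K ?P by (rule module_prod_space[OF K.is_cring D])
  let ?H = "{s \<in> carrier ?P. \<forall>U\<in>?A. \<forall>V\<in>?A. U \<subseteq> V \<longrightarrow> arrow F U V (s U) = s V}"
  have lin: "linear_map K (at_open F U) (at_open F V) (arrow F U V)" if "U \<in> ?A" "V \<in> ?A" "U \<subseteq> V" for U V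
    using that F(2) by auto
  have app: "s U \<in> carrier (at_open F U)" if "s \<in> carrier ?P" "U \<in> ?A" for s U
    using that by (rule direct_sum_simps(5))
  have ops: "(s \<oplus>\<^bsub>?P\<^esub> s') U = s U \<oplus>\<^bsub>at_open F U\<^esub> s' U" "(a \<odot>\<^bsub>?P\<^esub> s) U = a \<odot>\<^bsub>at_open F U\<^esub> s U"
    "\<zero>\<^bsub>?P\<^esub> U = \<zero>\<^bsub>at_open F U\<^esub>" if "U \<in> ?A" for s s' a U
    using that by (simp_all add: prod_space_def)
  have sm: "a \<odot>\<^bsub>?P\<^esub> s \<in> ?H" if "a \<in> carrier K" "s \<in> ?H" for a s
  proof (intro CollectI conjI ballI impI)
    show "a \<odot>\<^bsub>?P\<^esub> s \<in> carrier ?P" using that by simp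
    fix U V assume UV: "U \<in> ?A" "V \<in> ?A" "U \<subseteq> V"
    have "s U \<in> carrier (at_open F U)" "arrow F U V (s U) = s V" using that(2) UV app by auto
    then show "arrow F U V ((a \<odot>\<^bsub>?P\<^esub> s) U) = (a \<odot>\<^bsub>?P\<^esub> s) V"
      using linear_map_smult[OF lin[OF UV] that(1)] ops(2)[OF UV(1)] ops(2)[OF UV(2)] by simp
  qed
  have "submodule ?H K ?P"
  proof (rule P.submoduleI)
    show "\<zero>\<^bsub>?P\<^esub> \<in> ?H"
    proof (intro CollectI conjI ballI impI)
      fix U V assume UV: "U \<in> ?A" "V \<in> ?A" "U \<subseteq> V"
      show "arrow F U V (\<zero>\<^bsub>?P\<^esub> U) = \<zero>\<^bsub>?P\<^esub> V"
        using linear_map_zero[OF D[OF UV(1)] D[OF UV(2)] lin[OF UV]] ops(3)[OF UV(1)] ops(3)[OF UV(2)] by simp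
    qed simp
    show "s \<oplus>\<^bsub>?P\<^esub> s' \<in> ?H" if s: "s \<in> ?H" "s' \<in> ?H" for s s'
    proof (intro CollectI conjI ballI impI)
      show "s \<oplus>\<^bsub>?P\<^esub> s' \<in> carrier ?P" using s by simp
      fix U V assume UV: "U \<in> ?A" "V \<in> ?A" "U \<subseteq> V"
      have "s U \<in> carrier (at_open F U)" "arrow F U V (s U) = s V"
        "s' U \<in> carrier (at_open F U)" "arrow F U V (s' U) = s' V" using s UV app by auto
      then show "arrow F U V ((s \<oplus>\<^bsub>?P\<^esub> s') U) = (s \<oplus>\<^bsub>?P\<^esub> s') V"
        using linear_map_add[OF lin[OF UV]] ops(1)[OF UV(1)] ops(1)[OF UV(2)] by simp
    qed
    show "\<ominus>\<^bsub>?P\<^esub> s \<in> ?H" if s: "s \<in> ?H" for s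
    proof -
      have "s \<in> carrier ?P" using s by simp
      then have "\<ominus>\<^bsub>?P\<^esub> s = (\<ominus>\<^bsub>K\<^esub> \<one>\<^bsub>K\<^esub>) \<odot>\<^bsub>?P\<^esub> s" by (rule P.minus_eq_smult)
      then show ?thesis using sm[OF _ s, of "\<ominus>\<^bsub>K\<^esub> \<one>\<^bsub>K\<^esub>"] by simp
    qed
  qed (use sm in auto)
  then have "Module.module K (?P\<lparr>carrier := ?H\<rparr>)"
    by (rule submodule.submodule_is_module[OF _ P.module_axioms])
  then show ?thesis using assms(1) by (simp add: vspace_def costalk_def)
qed

lemma linear_map_costalk:
  assumes "openin X U" "x \<in> U"
  shows "linear_map K (costalk X F x) (at_open F U) (\<lambda>s. s U)"
  unfolding linear_map_def using costalkD(1)[OF _ assms] assms by (auto simp: costalk_ops)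

text \<open>A decreasing neighbourhood basis is cofinal, so the limit can be computed along
  it.\<close>

lemma costalk_of_sequence:
  assumes F: "precosheaf X K F"
    and W: "\<And>n. openin X (W n)" "\<And>n. x \<in> W n" "\<And>n. W (Suc n) \<subseteq> W n"
    and base: "\<And>U. openin X U \<Longrightarrow> x \<in> U \<Longrightarrow> \<exists>n. W n \<subseteq> U"
    and u: "\<And>n. u n \<in> carrier (at_open F (W n))" "\<And>n. arrow F (W (Suc n)) (W n) (u (Suc n)) = u n"
  obtains s where "s \<in> carrier (costalk X F x)" "\<And>n. s (W n) = u n"
proof -
  note F = precosheafD[OF F]
  have mono: "W m \<subseteq> W n" if "n \<le> m" for m n
    using that W(3) by (induction rule: dec_induct) auto
  have um: "arrow F (W m) (W n) (u m) = u n" if "n \<le> m" for m n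
    using that
  proof (induction rule: dec_induct)
    case base
    show ?case by (rule F(3)[OF W(1) u(1)])
  next
    case (step m)
    have "arrow F (W (Suc m)) (W n) (u (Suc m)) = arrow F (W m) (W n) (arrow F (W (Suc m)) (W m) (u (Suc m)))"
      using F(4)[OF W(1) W(1) W(1) W(3) mono[OF step(1)] u(1)] by simp
    then show ?case using u(2) step.IH by simp
  qed
  \<comment> \<open>\<open>LEAST\<close> merely fixes an index; the fact proved next shows that
    every admissible index gives the same value.\<close>
  define s where "s = (\<lambda>U\<in>open_nbhds X x. arrow F (W (LEAST n. W n \<subseteq> U)) U (u (LEAST n. W n \<subseteq> U)))"
  have s: "s U = arrow F (W n) U (u n)" if U: "openin X U" "x \<in> U" and n: "W n \<subseteq> U" for U n
  proof -
    let ?l = "LEAST n. W n \<subseteq> U"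
    have l: "W ?l \<subseteq> U" "?l \<le> n"
      using LeastI[of "\<lambda>n. W n \<subseteq> U", OF n] Least_le[of "\<lambda>n. W n \<subseteq> U", OF n] by simp_all
    have "arrow F (W n) U (u n) = arrow F (W ?l) U (arrow F (W n) (W ?l) (u n))"
      using F(4)[OF W(1) W(1) U(1) mono[OF l(2)] l(1) u(1)] by simp
    then show ?thesis using um[OF l(2)] U unfolding s_def by simp
  qed
  show thesis
  proof
    show "s \<in> carrier (costalk X F x)" unfolding costalk_iff
    proof (intro conjI ballI impI)
      show "s \<in> (\<Pi>\<^sub>E U\<in>open_nbhds X x. carrier (at_open F U))"
      proof (rule PiE_I)
        fix U assume U: "U \<in> open_nbhds X x"
        then obtain n where "W n \<subseteq> U" using base by blast
        then show "s U \<in> carrier (at_open F U)"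
          using s linear_map_closed[OF F(2)[OF W(1)] u(1)] U by auto
      qed (auto simp: s_def)
      fix U V assume UV: "U \<in> open_nbhds X x" "V \<in> open_nbhds X x" "U \<subseteq> V"
      then obtain n where n: "W n \<subseteq> U" using base by blast
      then have n': "W n \<subseteq> V" using UV by blast
      show "arrow F U V (s U) = s V"
        using F(4)[OF W(1) _ _ n UV(3) u(1)] UV s[OF _ _ n] s[OF _ _ n'] by simp
    qed
    show "s (W n) = u n" for n using s[OF W(1,2) subset_refl] F(3)[OF W(1) u(1)] by simp
  qed
qed

text \<open>The kernels of the projections to \<open>at_open F U\<close> shrink with U. By the chain
  condition there is a minimal one, and intersecting neighbourhoods shows that it is contained in
  all others. A family that vanishes on every neighbourhood is zero.\<close>

lemma costalk_injective_nbhd: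
  assumes K: "Ring.field K" and F: "precosheaf X K F" and fd: "fin_dim K (costalk X F x)" and x: "x \<in> topspace X"
  obtains U where "openin X U" "x \<in> U" "inj_on (\<lambda>s. s U) (carrier (costalk X F x))"
proof -
  let ?E = "costalk X F x"
  note P = precosheafD[OF F]
  have vs: "vspace K ?E" by (rule vspace_costalk[OF K F])
  interpret E: module K ?E by (rule vspace_module[OF vs])
  have FU: "Module.module K (at_open F U)" if "openin X U" for U using P(1)[OF that] by (rule vspace_module)
  let ?k = "\<lambda>U. {s \<in> carrier ?E. s U \<in> {\<zero>\<^bsub>at_open F U\<^esub>}}"
  obtain N0 where N0: "N0 \<in> ?k ` open_nbhds X x" "\<And>N. N \<in> ?k ` open_nbhds X x \<Longrightarrow> N \<subseteq> N0 \<Longrightarrow> N = N0"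
  proof (rule artinianD[OF fin_dim_imp_artinian[OF vs fd], of "?k ` open_nbhds X x"])
    show "?k ` open_nbhds X x \<noteq> {}" using x by auto
    show "submodule N K ?E" if "N \<in> ?k ` open_nbhds X x" for N
    proof -
      from that obtain U where U: "openin X U" "x \<in> U" "N = ?k U" by blast
      show ?thesis unfolding U(3)
        by (rule submodule_vimage[OF E.module_axioms FU[OF U(1)] linear_map_costalk[OF U(1,2)]
              module.submodule_zero[OF FU[OF U(1)]] E.carrier_is_submodule])
    qed
    show "N \<subseteq> carrier ?E" if "N \<in> ?k ` open_nbhds X x" for N using that by blast
  qed (rule that)
  obtain U where U: "openin X U" "x \<in> U" "N0 = ?k U" using N0(1) by blast
  have zero: "s = \<zero>\<^bsub>?E\<^esub>" if s: "s \<in> N0" for s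
  proof (rule costalk_eqI)
    show "s \<in> carrier ?E" using s U(3) by simp
    show "\<zero>\<^bsub>?E\<^esub> \<in> carrier ?E" by simp
    fix V assume V: "openin X V" "x \<in> V"
    have UV: "openin X (U \<inter> V)" "x \<in> U \<inter> V" using U V by auto
    have "?k (U \<inter> V) \<subseteq> N0"
    proof
      fix t assume t: "t \<in> ?k (U \<inter> V)"
      then have tE: "t \<in> carrier ?E" by simp
      have "t U = arrow F (U \<inter> V) U (t (U \<inter> V))" using costalkD(2)[OF tE UV U(1)] by simp
      also have "\<dots> = \<zero>\<^bsub>at_open F U\<^esub>"
        using t linear_map_zero[OF FU[OF UV(1)] FU[OF U(1)] P(2)[OF UV(1) U(1)]] by simp
      finally show "t \<in> N0" using tE U(3) by simp
    qed
    moreover have "?k (U \<inter> V) \<in> ?k ` open_nbhds X x" using UV by blast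
    ultimately have "?k (U \<inter> V) = N0" using N0(2) by blast
    then have sz: "s \<in> carrier ?E" "s (U \<inter> V) = \<zero>\<^bsub>at_open F (U \<inter> V)\<^esub>" using s by auto
    have "s V = arrow F (U \<inter> V) V (s (U \<inter> V))" using costalkD(2)[OF sz(1) UV V(1)] by simp
    also have "\<dots> = \<zero>\<^bsub>at_open F V\<^esub>"
      using sz linear_map_zero[OF FU[OF UV(1)] FU[OF V(1)] P(2)[OF UV(1) V(1)]] by simp
    finally show "s V = \<zero>\<^bsub>?E\<^esub> V" using V by (simp add: costalk_ops)
  qed
  have "inj_on (\<lambda>s. s U) (carrier ?E)"
  proof (rule inj_onI)
    fix s t assume st: "s \<in> carrier ?E" "t \<in> carrier ?E" "s U = t U"
    interpret U: module K "at_open F U" by (rule FU[OF U(1)])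
    have "(s \<ominus>\<^bsub>?E\<^esub> t) U = s U \<ominus>\<^bsub>at_open F U\<^esub> t U"
      by (rule linear_map_minus[OF E.module_axioms U.module_axioms linear_map_costalk[OF U(1,2)] st(1,2)])
    also have "\<dots> = \<zero>\<^bsub>at_open F U\<^esub>" using st(3) costalkD(1)[OF st(2) U(1,2)] by (simp add: U.M_minus_self)
    finally have "s \<ominus>\<^bsub>?E\<^esub> t \<in> N0" using st U(3) by simp
    then show "s = t" by (rule E.M.minus_eq_zeroD[OF zero st(1,2)])
  qed
  then show thesis using that U by blast
qed

text \<open>The pro-object of the spaces \<open>at_open F U\<close>, for U around x, has the costalk as its
  stable image.\<close>

definition costalk_stable :: "'x topology \<Rightarrow> ('x, 'k, 'v) open_diagram \<Rightarrow> 'x \<Rightarrow> bool" where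
  "costalk_stable X F x \<longleftrightarrow> (\<forall>U. openin X U \<and> x \<in> U \<longrightarrow> (\<exists>V. openin X V \<and> x \<in> V \<and> V \<subseteq> U \<and>
     (\<forall>v\<in>carrier (at_open F V). \<exists>s\<in>carrier (costalk X F x). s U = arrow F V U v)))"

text \<open>The Mittag-Leffler lemma is used twice. With the subspaces \<open>P n\<close> it shows
  that \<open>at_open F (W n)\<close> is \<open>P n\<close> plus the image of the costalk, hence
  satisfies the chain condition. The images of later terms in \<open>at_open F (W n)\<close>
  therefore stabilise, and with the kernels of the transition maps as subspaces the lemma lifts each
  stable element to the costalk.\<close>

lemma costalk_stableI:
  assumes K: "Ring.field K" and F: "precosheaf X K F" and fd: "fin_dim K (costalk X F x)"
    and W: "\<And>n. openin X (W n)" "\<And>n. x \<in> W n" "\<And>n. W (Suc n) \<subseteq> W n"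
    and base: "\<And>U. openin X U \<Longrightarrow> x \<in> U \<Longrightarrow> \<exists>n. W n \<subseteq> U"
    and P: "\<And>n. submodule (P n) K (at_open F (W n))" "\<And>n. artinian K (at_open F (W n)) (P n)"
    and eP: "\<And>m n p. n \<le> m \<Longrightarrow> p \<in> P m \<Longrightarrow> arrow F (W m) (W n) p \<in> P n"
    and gen: "\<And>n v. v \<in> carrier (at_open F (W n)) \<Longrightarrow>
      \<exists>w\<in>carrier (at_open F (W (Suc n))). arrow F (W (Suc n)) (W n) w \<ominus>\<^bsub>at_open F (W n)\<^esub> v \<in> P n"
  shows "costalk_stable X F x"
proof -
  let ?E = "costalk X F x"
  note Fd = precosheafD[OF F]
  have FU: "Module.module K (at_open F U)" if "openin X U" for U using Fd(1)[OF that] by (rule vspace_module)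
  have vs: "vspace K ?E" by (rule vspace_costalk[OF K F])
  interpret E: module K ?E by (rule vspace_module[OF vs])
  have mono: "W m \<subseteq> W n" if "n \<le> m" for m n
    using that W(3) by (induction rule: dec_induct) auto
  \<comment> \<open>The coset lemma for the sequence that starts at n, with its solution read as an
    element of the costalk.\<close>
  have lim: "\<exists>s\<in>carrier ?E. s (W n) \<ominus>\<^bsub>at_open F (W n)\<^esub> v 0 \<in> P' 0"
    if P': "\<And>k. submodule (P' k) K (at_open F (W (n + k)))" "\<And>k. artinian K (at_open F (W (n + k))) (P' k)"
      "\<And>l k p. k \<le> l \<Longrightarrow> p \<in> P' l \<Longrightarrow> arrow F (W (n + l)) (W (n + k)) p \<in> P' k"
    and v: "\<And>k. v k \<in> carrier (at_open F (W (n + k)))"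
      "\<And>k. arrow F (W (n + Suc k)) (W (n + k)) (v (Suc k)) \<ominus>\<^bsub>at_open F (W (n + k))\<^esub> v k \<in> P' k"
    for n P' v
  proof -
    obtain u where u: "\<And>k. u k \<in> carrier (at_open F (W (n + k)))"
      "\<And>k. arrow F (W (n + Suc k)) (W (n + k)) (u (Suc k)) = u k"
      "\<And>k. u k \<ominus>\<^bsub>at_open F (W (n + k))\<^esub> v k \<in> P' k"
    proof (rule inverse_sequence_cosets[where M="\<lambda>k. at_open F (W (n + k))" and P=P' and v=v
          and e="\<lambda>l k. arrow F (W (n + l)) (W (n + k))" and K=K])
      show "linear_map K (at_open F (W (n + l))) (at_open F (W (n + k))) (arrow F (W (n + l)) (W (n + k)))"
        if "k \<le> l" for l k by (rule Fd(2)[OF W(1) W(1) mono]) (use that in simp)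
      show "arrow F (W (n + k)) (W (n + k)) v = v" if "v \<in> carrier (at_open F (W (n + k)))" for k v
        by (rule Fd(3)[OF W(1) that])
      show "arrow F (W (n + m)) (W (n + k)) (arrow F (W (n + l)) (W (n + m)) v) = arrow F (W (n + l)) (W (n + k)) v"
        if "k \<le> m" "m \<le> l" "v \<in> carrier (at_open F (W (n + l)))" for l m k v
        by (rule Fd(4)[OF W(1) W(1) W(1) mono[of "n + m" "n + l"] mono[of "n + k" "n + m"] that(3)]) (use that(1,2) in simp_all)
      show "Module.module K (at_open F (W (n + k)))" for k by (rule FU[OF W(1)])
      show "submodule (P' k) K (at_open F (W (n + k)))" for k by (rule P'(1))
      show "artinian K (at_open F (W (n + k))) (P' k)" for k by (rule P'(2))
      show "arrow F (W (n + l)) (W (n + k)) p \<in> P' k" if "k \<le> l" "p \<in> P' l" for l k p by (rule P'(3)[OF that])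
      show "v k \<in> carrier (at_open F (W (n + k)))" for k by (rule v(1))
      show "arrow F (W (n + Suc k)) (W (n + k)) (v (Suc k)) \<ominus>\<^bsub>at_open F (W (n + k))\<^esub> v k \<in> P' k" for k by (rule v(2))
    qed (rule that)
    have "\<exists>m. W (n + m) \<subseteq> U" if U: "openin X U" "x \<in> U" for U
    proof -
      obtain m where "W m \<subseteq> U" using base[OF U] by blast
      moreover have "W (n + m) \<subseteq> W m" by (rule mono) simp
      ultimately show ?thesis by blast
    qed
    then obtain s where s: "s \<in> carrier ?E" "\<And>k. s (W (n + k)) = u k"
      using costalk_of_sequence[OF F, of "\<lambda>k. W (n + k)" x u] W u(1,2) by auto
    then show ?thesis using u(3)[of 0] s(2)[of 0] by (intro bexI[OF _ s(1)]) simp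
  qed
  let ?im = "\<lambda>n. (\<lambda>s. s (W n)) ` carrier ?E"
  have art: "artinian K (at_open F (W n)) (carrier (at_open F (W n)))" for n
  proof -
    interpret M: module K "at_open F (W n)" by (rule FU[OF W(1)])
    have im: "submodule (?im n) K (at_open F (W n))" "artinian K (at_open F (W n)) (?im n)"
      using submodule_image[OF E.module_axioms M.module_axioms linear_map_costalk[OF W(1,2)] E.carrier_is_submodule]
        artinian_image[OF E.module_axioms M.module_axioms linear_map_costalk[OF W(1,2)] E.carrier_is_submodule
          fin_dim_imp_artinian[OF vs fd]] by auto
    have "w \<in> P n <+>\<^bsub>at_open F (W n)\<^esub> ?im n" if w: "w \<in> carrier (at_open F (W n))" for w
    proof -
      \<comment> \<open>Iterating \<open>gen\<close> from w gives a sequence that is compatible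
        modulo \<open>P\<close>, to which \<open>lim\<close> applies.\<close>
      have "\<exists>v. \<forall>k. v k \<in> carrier (at_open F (W (n + k))) \<and> (k = 0 \<longrightarrow> v k = w) \<and>
        arrow F (W (n + Suc k)) (W (n + k)) (v (Suc k)) \<ominus>\<^bsub>at_open F (W (n + k))\<^esub> v k \<in> P (n + k)"
      proof (rule dependent_nat_choice[where P="\<lambda>k v. v \<in> carrier (at_open F (W (n + k))) \<and> (k = 0 \<longrightarrow> v = w)"
            and Q="\<lambda>k v v'. arrow F (W (n + Suc k)) (W (n + k)) v' \<ominus>\<^bsub>at_open F (W (n + k))\<^esub> v \<in> P (n + k)", simplified conj_assoc])
        show "\<exists>x. x \<in> carrier (at_open F (W (n + 0))) \<and> (0 = (0::nat) \<longrightarrow> x = w)" using w by auto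
        fix v k assume "v \<in> carrier (at_open F (W (n + k))) \<and> (k = 0 \<longrightarrow> v = w)"
        then show "\<exists>y. y \<in> carrier (at_open F (W (n + Suc k))) \<and> (Suc k = 0 \<longrightarrow> y = w) \<and>
          arrow F (W (n + Suc k)) (W (n + k)) y \<ominus>\<^bsub>at_open F (W (n + k))\<^esub> v \<in> P (n + k)"
          using gen[of v "n + k"] by auto
      qed
      then obtain v where v: "\<And>k. v k \<in> carrier (at_open F (W (n + k)))" "v 0 = w"
        "\<And>k. arrow F (W (n + Suc k)) (W (n + k)) (v (Suc k)) \<ominus>\<^bsub>at_open F (W (n + k))\<^esub> v k \<in> P (n + k)" by blast
      obtain s where s: "s \<in> carrier ?E" "s (W n) \<ominus>\<^bsub>at_open F (W n)\<^esub> w \<in> P n"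
        using lim[where n=n and P'="\<lambda>k. P (n + k)" and v=v] P eP v by auto
      have sW: "s (W n) \<in> carrier (at_open F (W n))" by (rule costalkD(1)[OF s(1) W(1,2)])
      have "w = (\<ominus>\<^bsub>at_open F (W n)\<^esub> (s (W n) \<ominus>\<^bsub>at_open F (W n)\<^esub> w)) \<oplus>\<^bsub>at_open F (W n)\<^esub> s (W n)"
        using w sW by (simp add: a_minus_def M.M.minus_add M.M.a_ac M.M.r_neg)
      then show ?thesis using set_addI[OF M.submoduleE(3)[OF P(1) s(2)] imageI[OF s(1), of "\<lambda>s. s (W n)"], of "at_open F (W n)"] by simp
    qed
    then show ?thesis
      using artinian_subset[OF M.artinian_set_add[OF P im]] by blast
  qed
  show ?thesis unfolding costalk_stable_def
  proof (intro allI impI, elim conjE)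
    fix U assume U: "openin X U" "x \<in> U"
    then obtain n where n: "W n \<subseteq> U" using base by blast
    interpret M: module K "at_open F (W n)" by (rule FU[OF W(1)])
    let ?I = "\<lambda>m. arrow F (W m) (W n) ` carrier (at_open F (W m))"
    obtain L0 where L0: "L0 \<in> ?I ` {n..}" "\<And>L. L \<in> ?I ` {n..} \<Longrightarrow> L \<subseteq> L0 \<Longrightarrow> L = L0"
    proof (rule artinianD[OF art[of n], of "?I ` {n..}"])
      show "submodule L K (at_open F (W n))" if "L \<in> ?I ` {n..}" for L
        using that submodule_image[OF FU[OF W(1)] FU[OF W(1)] Fd(2)[OF W(1) W(1) mono]
            module.carrier_is_submodule[OF FU[OF W(1)]]] by auto
      show "L \<subseteq> carrier (at_open F (W n))" if "L \<in> ?I ` {n..}" for L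
        using that linear_map_closed[OF Fd(2)[OF W(1) W(1) mono]] by auto
      show "?I ` {n..} \<noteq> {}" by simp
    qed (rule that)
    obtain m where m: "n \<le> m" "L0 = ?I m" using L0(1) by auto
    have comp: "arrow F (W k) (W n) (arrow F (W l) (W k) v) = arrow F (W l) (W n) v"
      if "n \<le> k" "k \<le> l" "v \<in> carrier (at_open F (W l))" for k l v
      by (rule Fd(4)[OF W(1) W(1) W(1) mono[OF that(2)] mono[OF that(1)] that(3)])
    have sub: "?I l \<subseteq> ?I k" if "n \<le> k" "k \<le> l" for k l
    proof
      fix y assume "y \<in> ?I l"
      then obtain v where v: "v \<in> carrier (at_open F (W l))" "y = arrow F (W l) (W n) v" by blast
      then have "y = arrow F (W k) (W n) (arrow F (W l) (W k) v)" using comp[OF that v(1)] by simp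
      then show "y \<in> ?I k" using linear_map_closed[OF Fd(2)[OF W(1) W(1) mono[OF that(2)]] v(1)] by blast
    qed
    have stable: "?I m \<subseteq> ?I k" if "n \<le> k" for k
    proof (cases "k \<le> m")
      case True
      then show ?thesis by (rule sub[OF that])
    next
      case False
      then have "?I k \<subseteq> L0" unfolding m(2) using sub[OF m(1), of k] by simp
      then show ?thesis using L0(2)[of "?I k"] that m(2) by auto
    qed
    show "\<exists>V. openin X V \<and> x \<in> V \<and> V \<subseteq> U \<and>
      (\<forall>v\<in>carrier (at_open F V). \<exists>s\<in>carrier ?E. s U = arrow F V U v)"
    proof (intro exI[of _ "W m"] conjI ballI)
      show WmU: "W m \<subseteq> U" using mono[OF m(1)] n by blast
      fix v assume v: "v \<in> carrier (at_open F (W m))"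
      let ?w = "arrow F (W m) (W n) v"
      have wc: "?w \<in> carrier (at_open F (W n))" by (rule linear_map_closed[OF Fd(2)[OF W(1) W(1) mono[OF m(1)]] v])
      have "?w \<in> ?I (n + k)" for k using stable[of "n + k"] v by auto
      \<comment> \<open>Stability provides a preimage of \<open>?w\<close> at every later level. Two
        such preimages differ by an element of the kernel \<open>?P\<close>, so they form compatible
        cosets.\<close>
      then have "\<forall>k. \<exists>z. z \<in> carrier (at_open F (W (n + k))) \<and> arrow F (W (n + k)) (W n) z = ?w" by force
      then obtain z where z: "\<And>k. z k \<in> carrier (at_open F (W (n + k)))" "\<And>k. arrow F (W (n + k)) (W n) (z k) = ?w"
        by metis
      let ?P = "\<lambda>k. {p \<in> carrier (at_open F (W (n + k))). arrow F (W (n + k)) (W n) p \<in> {\<zero>\<^bsub>at_open F (W n)\<^esub>}}"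
      have lin: "linear_map K (at_open F (W (n + k))) (at_open F (W n)) (arrow F (W (n + k)) (W n))" for k
        by (rule Fd(2)[OF W(1) W(1) mono]) simp
      have "\<exists>s\<in>carrier ?E. s (W n) \<ominus>\<^bsub>at_open F (W n)\<^esub> z 0 \<in> ?P 0"
      proof (rule lim[where n=n and P'="?P" and v=z])
        show "submodule (?P k) K (at_open F (W (n + k)))" for k
          by (rule submodule_vimage[OF FU[OF W(1)] M.module_axioms lin M.submodule_zero
                module.carrier_is_submodule[OF FU[OF W(1)]]])
        show "artinian K (at_open F (W (n + k))) (?P k)" for k
          by (rule artinian_subset[OF art]) auto
        show "arrow F (W (n + l)) (W (n + k)) p \<in> ?P k" if "k \<le> l" "p \<in> ?P l" for l k p
        proof -
          have "arrow F (W (n + k)) (W n) (arrow F (W (n + l)) (W (n + k)) p) = arrow F (W (n + l)) (W n) p"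
            by (rule comp) (use that in simp_all)
          moreover have "arrow F (W (n + l)) (W (n + k)) p \<in> carrier (at_open F (W (n + k)))"
            by (rule linear_map_closed[OF Fd(2)[OF W(1) W(1) mono[of "n + k" "n + l"]]]) (use that in simp_all)
          ultimately show ?thesis using that by simp
        qed
        show "z k \<in> carrier (at_open F (W (n + k)))" for k by (rule z(1))
        show "arrow F (W (n + Suc k)) (W (n + k)) (z (Suc k)) \<ominus>\<^bsub>at_open F (W (n + k))\<^esub> z k \<in> ?P k" for k
        proof -
          interpret Mk: module K "at_open F (W (n + k))" by (rule FU[OF W(1)])
          let ?y = "arrow F (W (n + Suc k)) (W (n + k)) (z (Suc k))"
          have y: "?y \<in> carrier (at_open F (W (n + k)))"
            by (rule linear_map_closed[OF Fd(2)[OF W(1) W(1) mono] z(1)]) simp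
          have "arrow F (W (n + k)) (W n) ?y = ?w"
            using comp[OF _ _ z(1), of "n + k" "Suc k"] z(2)[of "Suc k"] by simp
          then have "arrow F (W (n + k)) (W n) (?y \<ominus>\<^bsub>at_open F (W (n + k))\<^esub> z k) = \<zero>\<^bsub>at_open F (W n)\<^esub>"
            using linear_map_minus[OF Mk.module_axioms M.module_axioms lin y z(1)] z(2)[of k] wc
            by (simp add: M.M_minus_self)
          then show ?thesis using y z(1)[of k] by simp
        qed
      qed
      then obtain s where s: "s \<in> carrier ?E" "s (W n) \<ominus>\<^bsub>at_open F (W n)\<^esub> z 0 \<in> ?P 0" by blast
      have sW: "s (W n) \<in> carrier (at_open F (W n))" by (rule costalkD(1)[OF s(1) W(1,2)])
      have z0: "z 0 \<in> carrier (at_open F (W n))" using z(1)[of 0] by simp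
      have "arrow F (W n) (W n) (s (W n) \<ominus>\<^bsub>at_open F (W n)\<^esub> z 0) = \<zero>\<^bsub>at_open F (W n)\<^esub>" using s(2) by simp
      then have "s (W n) \<ominus>\<^bsub>at_open F (W n)\<^esub> z 0 = \<zero>\<^bsub>at_open F (W n)\<^esub>"
        using Fd(3)[OF W(1), of "s (W n) \<ominus>\<^bsub>at_open F (W n)\<^esub> z 0" n] sW z0 by simp
      then have "s (W n) = z 0" using sW z0 by (rule M.M.minus_eq_zeroD)
      moreover have "z 0 = ?w" using z(2)[of 0] Fd(3)[OF W(1) z0] by simp
      ultimately have "arrow F (W n) U (s (W n)) = arrow F (W m) U v"
        using Fd(4)[OF W(1) W(1) U(1) mono[OF m(1)] n v] by simp
      then have "s U = arrow F (W m) U v" using costalkD(2)[OF s(1) W(1,2) U(1) n] by simp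
      then show "\<exists>s\<in>carrier ?E. s U = arrow F (W m) U v" using s(1) by blast
    qed (use W in auto)
  qed
qed

section \<open>Functionals with vanishing germs\<close>

text \<open>The vanishing at z of the germ of \<phi> in the dual sheaf
  (\<open>germ_zero_iff\<close>), spelt out without the quotient.\<close>

definition zero_germ :: "'x topology \<Rightarrow> 'k ring \<Rightarrow> ('x, 'k, 'v) open_diagram \<Rightarrow> 'x set \<Rightarrow> ('v \<Rightarrow> 'k) \<Rightarrow> 'x \<Rightarrow> bool" where
  "zero_germ X K F U \<phi> z \<longleftrightarrow> (\<exists>V. openin X V \<and> z \<in> V \<and> V \<subseteq> U \<and>
     (\<forall>v\<in>carrier (at_open F V). \<phi> (arrow F V U v) = \<zero>\<^bsub>K\<^esub>))"

lemma openin_zero_germ: "openin X {z \<in> Q. zero_germ X K F U \<phi> z}" if "openin X Q"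
proof (subst openin_subopen, intro ballI)
  fix z assume "z \<in> {z \<in> Q. zero_germ X K F U \<phi> z}"
  then obtain V where V: "openin X V" "z \<in> V" "V \<subseteq> U" "\<forall>v\<in>carrier (at_open F V). \<phi> (arrow F V U v) = \<zero>\<^bsub>K\<^esub>"
    and z: "z \<in> Q" unfolding zero_germ_def by blast
  have "V \<inter> Q \<subseteq> {z \<in> Q. zero_germ X K F U \<phi> z}" using V unfolding zero_germ_def by blast
  then show "\<exists>T. openin X T \<and> z \<in> T \<and> T \<subseteq> {z \<in> Q. zero_germ X K F U \<phi> z}"
    using V(1,2) z that by (intro exI[of _ "V \<inter> Q"]) auto
qed

lemma dual_diagram_simps:
  "at_open (dual_diagram K F) U = dual_space K (at_open F U)"
  "arrow (dual_diagram K F) U V \<phi> = (\<lambda>v\<in>carrier (at_open F V). \<phi> (arrow F V U v))"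
  by (simp_all add: dual_diagram_def)

lemma germ_dual_eq_iff:
  assumes F: "precosheaf X K F"
    and U: "openin X U" "z \<in> U" "\<phi> \<in> carrier (dual_space K (at_open F U))"
    and U': "openin X U'" "z \<in> U'" "\<phi>' \<in> carrier (dual_space K (at_open F U'))"
  shows "germ X K (dual_diagram K F) z U \<phi> = germ X K (dual_diagram K F) z U' \<phi>' \<longleftrightarrow>
    (\<exists>V. openin X V \<and> z \<in> V \<and> V \<subseteq> U \<and> V \<subseteq> U' \<and>
      (\<forall>v\<in>carrier (at_open F V). \<phi> (arrow F V U v) = \<phi>' (arrow F V U' v)))"
proof -
  have "germ X K (dual_diagram K F) z U \<phi> = germ X K (dual_diagram K F) z U' \<phi>' \<longleftrightarrow>
    (\<exists>V\<in>open_nbhds X z. V \<subseteq> U \<and> V \<subseteq> U' \<and> arrow (dual_diagram K F) U V \<phi> = arrow (dual_diagram K F) U' V \<phi>')"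
    by (rule germ_eq_iff[OF presheaf_dual[OF F]]) (use U U' in \<open>simp_all add: dual_diagram_simps\<close>)
  also have "\<dots> \<longleftrightarrow> (\<exists>V. openin X V \<and> z \<in> V \<and> V \<subseteq> U \<and> V \<subseteq> U' \<and>
      (\<forall>v\<in>carrier (at_open F V). \<phi> (arrow F V U v) = \<phi>' (arrow F V U' v)))"
    unfolding dual_diagram_simps by (auto simp: fun_eq_iff restrict_def)
  finally show ?thesis .
qed

lemma zero_functional_closed: "vspace K M \<Longrightarrow> (\<lambda>v\<in>carrier M. \<zero>\<^bsub>K\<^esub>) \<in> carrier (dual_space K M)"
proof -
  assume "vspace K M"
  then interpret field K by (simp add: vspace_def)
  interpret M: module K M using \<open>vspace K M\<close> by (simp add: vspace_def)
  show ?thesis by (simp add: dual_iff)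
qed

lemma germ_zero_iff:
  assumes F: "precosheaf X K F" and U: "openin X U" "z \<in> U" "\<phi> \<in> carrier (dual_space K (at_open F U))"
  shows "germ X K (dual_diagram K F) z U \<phi> = germ X K (dual_diagram K F) z U (\<lambda>v\<in>carrier (at_open F U). \<zero>\<^bsub>K\<^esub>) \<longleftrightarrow>
    zero_germ X K F U \<phi> z"
proof -
  note P = precosheafD[OF F]
  have "arrow F V U v \<in> carrier (at_open F U)" if "openin X V" "V \<subseteq> U" "v \<in> carrier (at_open F V)" for V v
    using linear_map_closed[OF P(2)[OF that(1) U(1) that(2)] that(3)] .
  then show ?thesis
    unfolding germ_dual_eq_iff[OF F U U(1,2) zero_functional_closed[OF P(1)[OF U(1)]]] zero_germ_def by auto
qed

lemma functional_sections:
  assumes F: "precosheaf X K F" and U: "openin X U" "\<phi> \<in> carrier (dual_space K (at_open F U))" and "W \<subseteq> U"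
  shows "(\<lambda>w\<in>W. germ X K (dual_diagram K F) w U \<phi>) \<in> sections X K (dual_diagram K F) W"
  by (rule germ_in_sections[OF presheaf_dual[OF F] U(1) _ assms(4)]) (simp add: dual_diagram_simps U(2))

text \<open>Compares the section given by \<phi> with the zero section. This is how constructibility
  enters the control of supports.\<close>

lemma openin_nonzero_germ:
  assumes F: "precosheaf X K F" and lc: "locally_constant_on X K (dual_diagram K F) Z"
    and U: "openin X U" "\<phi> \<in> carrier (dual_space K (at_open F U))"
  shows "openin (subtopology X Z) {z \<in> Z \<inter> U. \<not> zero_germ X K F U \<phi> z}"
proof -
  let ?G = "dual_diagram K F" and ?z = "\<lambda>v\<in>carrier (at_open F U). \<zero>\<^bsub>K\<^esub>"
  have z: "?z \<in> carrier (dual_space K (at_open F U))" by (rule zero_functional_closed[OF precosheafD(1)[OF F U(1)]])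
  have ZU: "Z \<inter> U \<subseteq> U" by simp
  have "openin (subtopology X Z) {w \<in> Z \<inter> U. (\<lambda>w\<in>Z \<inter> U. germ X K ?G w U \<phi>) w \<noteq> (\<lambda>w\<in>Z \<inter> U. germ X K ?G w U ?z) w}"
    by (rule sections_disagree_open[OF presheaf_dual[OF F] lc openin_subtopology_Int2[OF U(1)]
          functional_sections[OF F U ZU] functional_sections[OF F U(1) z ZU]])
  moreover have "{w \<in> Z \<inter> U. (\<lambda>w\<in>Z \<inter> U. germ X K ?G w U \<phi>) w \<noteq> (\<lambda>w\<in>Z \<inter> U. germ X K ?G w U ?z) w} =
    {z \<in> Z \<inter> U. \<not> zero_germ X K F U \<phi> z}"
    using germ_zero_iff[OF F U(1) _ U(2)] by auto
  ultimately show ?thesis by simp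
qed

text \<open>Vanishing of a germ is an open condition in X, and by local constancy its failure is
  open in \<open>Z\<close>.\<close>

lemma zero_germ_connected:
  assumes F: "precosheaf X K F" and lc: "locally_constant_on X K (dual_diagram K F) Z"
    and U: "openin X U" "\<phi> \<in> carrier (dual_space K (at_open F U))"
    and C: "connectedin X C" "C \<subseteq> Z" "C \<subseteq> U" "y \<in> C" "y' \<in> C" and y: "zero_germ X K F U \<phi> y"
  shows "zero_germ X K F U \<phi> y'"
proof (rule ccontr)
  assume n: "\<not> zero_germ X K F U \<phi> y'"
  have cz: "connectedin (subtopology X Z) C" using C by (simp add: connectedin_subtopology)
  have "openin (subtopology X Z) (Z \<inter> {z \<in> U. zero_germ X K F U \<phi> z})"
    by (rule openin_subtopology_Int2[OF openin_zero_germ[OF U(1)]])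
  then have "\<exists>E1 E2. openin (subtopology X Z) E1 \<and> openin (subtopology X Z) E2 \<and> C \<subseteq> E1 \<union> E2 \<and>
    E1 \<inter> E2 \<inter> C = {} \<and> E1 \<inter> C \<noteq> {} \<and> E2 \<inter> C \<noteq> {}"
    by (intro exI[of _ "Z \<inter> {z \<in> U. zero_germ X K F U \<phi> z}"] exI[of _ "{z \<in> Z \<inter> U. \<not> zero_germ X K F U \<phi> z}"] conjI
        openin_nonzero_germ[OF F lc U])
      (use C y n in auto)
  then show False using cz unfolding connectedin by blast
qed

text \<open>The open sets from which \<phi> receives only zero cover U', and by the cosheaf
  condition they generate the space over U'. This is the separation property of the dual
  sheaf.\<close>

lemma zero_germs_imp_zero:
  assumes cosh: "cosheaf X K F" and U: "openin X U" "\<phi> \<in> carrier (dual_space K (at_open F U))"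
    and U': "openin X U'" "U' \<subseteq> U" "\<And>z. z \<in> U' \<Longrightarrow> zero_germ X K F U \<phi> z"
    and v: "v \<in> carrier (at_open F U')"
  shows "\<phi> (arrow F U' U v) = \<zero>\<^bsub>K\<^esub>"
proof -
  have F: "precosheaf X K F" using cosh unfolding cosheaf_def by simp
  note P = precosheafD[OF F]
  let ?Z = "{w \<in> carrier (at_open F U). \<phi> w = \<zero>\<^bsub>K\<^esub>}"
  let ?N = "{v \<in> carrier (at_open F U'). arrow F U' U v \<in> ?Z}"
  let ?\<U> = "{V. openin X V \<and> V \<subseteq> U' \<and> (\<forall>v\<in>carrier (at_open F V). \<phi> (arrow F V U v) = \<zero>\<^bsub>K\<^esub>)}"
  have "carrier (at_open F U') \<subseteq> ?N"
  proof (rule cosheaf_generated[OF cosh U'(1), of ?\<U>])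
    show "\<Union>?\<U> = U'"
    proof
      show "U' \<subseteq> \<Union>?\<U>"
      proof
        fix z assume z: "z \<in> U'"
        then obtain V where V: "openin X V" "z \<in> V" "V \<subseteq> U" "\<forall>v\<in>carrier (at_open F V). \<phi> (arrow F V U v) = \<zero>\<^bsub>K\<^esub>"
          using U'(3) unfolding zero_germ_def by blast
        have VU: "openin X (V \<inter> U')" using V U' by auto
        have "\<phi> (arrow F (V \<inter> U') U v) = \<zero>\<^bsub>K\<^esub>" if v: "v \<in> carrier (at_open F (V \<inter> U'))" for v
        proof -
          have "arrow F (V \<inter> U') U v = arrow F V U (arrow F (V \<inter> U') V v)"
            using P(4)[OF VU V(1) U(1) _ V(3) v] by simp
          then show ?thesis using V(4) linear_map_closed[OF P(2)[OF VU V(1)] v] by simp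
        qed
        then have "V \<inter> U' \<in> ?\<U>" using VU by simp
        then show "z \<in> \<Union>?\<U>" using z V(2) by blast
      qed
    qed blast
    show "submodule ?N K (at_open F U')"
      by (rule submodule_vimage[OF vspace_module[OF P(1)[OF U'(1)]] vspace_module[OF P(1)[OF U(1)]] P(2)[OF U'(1) U(1) U'(2)]
            dual_kernel[OF P(1)[OF U(1)] U(2)] module.carrier_is_submodule[OF vspace_module[OF P(1)[OF U'(1)]]]])
    fix V w assume V: "V \<in> ?\<U>" and w: "w \<in> carrier (at_open F V)"
    have V': "openin X V" "V \<subseteq> U'" "V \<subseteq> U" using V U'(2) by auto
    have "arrow F U' U (arrow F V U' w) = arrow F V U w" by (rule P(4)[OF V'(1) U'(1) U(1) V'(2) U'(2) w])
    then show "arrow F V U' w \<in> ?N"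
      using V w linear_map_closed[OF P(2)[OF V'(1) U'(1) V'(2)] w] linear_map_closed[OF P(2)[OF V'(1) U(1) V'(3)] w] by simp
  qed simp
  then show ?thesis using v by blast
qed

lemma costalk_stableE:
  assumes "costalk_stable X F y" "openin X U" "y \<in> U"
  obtains V where "openin X V" "y \<in> V" "V \<subseteq> U"
    "\<forall>v\<in>carrier (at_open F V). \<exists>s\<in>carrier (costalk X F y). s U = arrow F V U v"
  using mp[OF spec[OF assms(1)[unfolded costalk_stable_def], of U] conjI[OF assms(2,3)]]
  by (elim exE conjE) (rule that)

text \<open>The germ sees the images of small neighbourhoods, the right-hand side sees the image of
  the costalk. Stability says that these subspaces of \<open>at_open F U\<close> eventually agree,
  so germs of functionals can be tested on costalk elements.\<close>

lemma stable_zero_germ_iff: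
  assumes F: "precosheaf X K F" and st: "costalk_stable X F y"
    and U: "openin X U" "y \<in> U"
  shows "zero_germ X K F U \<phi> y \<longleftrightarrow> (\<forall>s\<in>carrier (costalk X F y). \<phi> (s U) = \<zero>\<^bsub>K\<^esub>)"
proof
  assume "zero_germ X K F U \<phi> y"
  then obtain V where V: "openin X V" "y \<in> V" "V \<subseteq> U" "\<forall>v\<in>carrier (at_open F V). \<phi> (arrow F V U v) = \<zero>\<^bsub>K\<^esub>"
    unfolding zero_germ_def by blast
  show "\<forall>s\<in>carrier (costalk X F y). \<phi> (s U) = \<zero>\<^bsub>K\<^esub>"
  proof
    fix s assume s: "s \<in> carrier (costalk X F y)"
    have "arrow F V U (s V) = s U" by (rule costalkD(2)[OF s V(1,2) U(1) V(3)])
    then show "\<phi> (s U) = \<zero>\<^bsub>K\<^esub>" using bspec[OF V(4) costalkD(1)[OF s V(1,2)]] by simp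
  qed
next
  assume z: "\<forall>s\<in>carrier (costalk X F y). \<phi> (s U) = \<zero>\<^bsub>K\<^esub>"
  obtain V where V: "openin X V" "y \<in> V" "V \<subseteq> U"
    "\<forall>v\<in>carrier (at_open F V). \<exists>s\<in>carrier (costalk X F y). s U = arrow F V U v"
    by (rule costalk_stableE[OF st U])
  have "\<phi> (arrow F V U v) = \<zero>\<^bsub>K\<^esub>" if v: "v \<in> carrier (at_open F V)" for v
  proof -
    obtain s where "s \<in> carrier (costalk X F y)" "s U = arrow F V U v" using bspec[OF V(4) v] by (elim bexE)
    then show ?thesis using bspec[OF z, of s] by simp
  qed
  then show "zero_germ X K F U \<phi> y" unfolding zero_germ_def using V(1-3) by blast
qed

section \<open>Local structure of Thom--Mather stratifications\<close>

lemma thom_matherD: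
  assumes "thom_mather X S"
  shows "Hausdorff_space X" "locally_compact_space X" "second_countable X" "decomposition X S"
    and "\<sigma> \<in> strata S \<Longrightarrow> smooth_manifold (sdim S \<sigma>) (subtopology X (stratum S \<sigma>)) (satlas S \<sigma>)"
    and "\<sigma> \<in> strata S \<Longrightarrow> openin X (tube S \<sigma>)" "\<sigma> \<in> strata S \<Longrightarrow> stratum S \<sigma> \<subseteq> tube S \<sigma>"
    and "\<sigma> \<in> strata S \<Longrightarrow> continuous_map (subtopology X (tube S \<sigma>)) (subtopology X (stratum S \<sigma>)) (retr S \<sigma>)"
    and "\<sigma> \<in> strata S \<Longrightarrow> x \<in> stratum S \<sigma> \<Longrightarrow> retr S \<sigma> x = x"
    and "\<sigma> \<in> strata S \<Longrightarrow> continuous_map (subtopology X (tube S \<sigma>)) (top_of_set {0..}) (tdist S \<sigma>)"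
    and "\<sigma> \<in> strata S \<Longrightarrow> {x \<in> tube S \<sigma>. tdist S \<sigma> x = 0} = stratum S \<sigma>"
    and "\<sigma> \<in> strata S \<Longrightarrow> \<tau> \<in> strata S \<Longrightarrow> \<sigma> \<noteq> \<tau> \<Longrightarrow>
        smooth_submersion
          (sdim S \<tau>) (subtopology X (tube S \<sigma> \<inter> stratum S \<tau>))
          (open_submanifold_atlas (tube S \<sigma>) (satlas S \<tau>))
          (Suc (sdim S \<sigma>)) (prod_topology (subtopology X (stratum S \<sigma>)) (top_of_set {0<..}))
          (times_halfline_atlas (sdim S \<sigma>) (satlas S \<sigma>))
          (\<lambda>x. (retr S \<sigma> x, tdist S \<sigma> x))"
proof -
  note d = assms[unfolded thom_mather_def]
  show "Hausdorff_space X" by (rule conjunct1[OF d])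
  show "locally_compact_space X" by (rule conjunct1[OF conjunct2[OF d]])
  show "second_countable X" by (rule conjunct1[OF conjunct2[OF conjunct2[OF d]]])
  show "decomposition X S" by (rule conjunct1[OF conjunct2[OF conjunct2[OF conjunct2[OF d]]]])
  note d5 = conjunct2[OF conjunct2[OF conjunct2[OF conjunct2[OF d]]]]
  show "\<sigma> \<in> strata S \<Longrightarrow> smooth_manifold (sdim S \<sigma>) (subtopology X (stratum S \<sigma>)) (satlas S \<sigma>)"
    by (rule bspec[OF conjunct1[OF d5]])
  note d6 = bspec[OF conjunct1[OF conjunct2[OF d5]]]
  show "\<sigma> \<in> strata S \<Longrightarrow> openin X (tube S \<sigma>)" by (rule conjunct1[OF d6])
  show "\<sigma> \<in> strata S \<Longrightarrow> stratum S \<sigma> \<subseteq> tube S \<sigma>" by (rule conjunct1[OF conjunct2[OF d6]])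
  show "\<sigma> \<in> strata S \<Longrightarrow> continuous_map (subtopology X (tube S \<sigma>)) (subtopology X (stratum S \<sigma>)) (retr S \<sigma>)"
    by (rule conjunct1[OF conjunct2[OF conjunct2[OF d6]]])
  show "\<sigma> \<in> strata S \<Longrightarrow> x \<in> stratum S \<sigma> \<Longrightarrow> retr S \<sigma> x = x"
    by (rule bspec[OF conjunct1[OF conjunct2[OF conjunct2[OF conjunct2[OF d6]]]]])
  show "\<sigma> \<in> strata S \<Longrightarrow> continuous_map (subtopology X (tube S \<sigma>)) (top_of_set {0..}) (tdist S \<sigma>)"
    by (rule conjunct1[OF conjunct2[OF conjunct2[OF conjunct2[OF conjunct2[OF d6]]]]])
  show "\<sigma> \<in> strata S \<Longrightarrow> {x \<in> tube S \<sigma>. tdist S \<sigma> x = 0} = stratum S \<sigma>"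
    by (rule conjunct2[OF conjunct2[OF conjunct2[OF conjunct2[OF conjunct2[OF d6]]]]])
  show "\<sigma> \<in> strata S \<Longrightarrow> \<tau> \<in> strata S \<Longrightarrow> \<sigma> \<noteq> \<tau> \<Longrightarrow>
        smooth_submersion
          (sdim S \<tau>) (subtopology X (tube S \<sigma> \<inter> stratum S \<tau>))
          (open_submanifold_atlas (tube S \<sigma>) (satlas S \<tau>))
          (Suc (sdim S \<sigma>)) (prod_topology (subtopology X (stratum S \<sigma>)) (top_of_set {0<..}))
          (times_halfline_atlas (sdim S \<sigma>) (satlas S \<sigma>))
          (\<lambda>x. (retr S \<sigma> x, tdist S \<sigma> x))"
    by (rule mp[OF bspec[OF bspec[OF conjunct1[OF conjunct2[OF conjunct2[OF d5]]]]]])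
qed

lemma decompositionD:
  assumes "decomposition X S"
  shows "x \<in> topspace X \<Longrightarrow> \<exists>\<sigma>\<in>strata S. x \<in> stratum S \<sigma>"
    and "\<sigma> \<in> strata S \<Longrightarrow> x \<in> stratum S \<sigma> \<Longrightarrow> x \<in> topspace X"
    and "\<sigma> \<in> strata S \<Longrightarrow> \<tau> \<in> strata S \<Longrightarrow> x \<in> stratum S \<sigma> \<Longrightarrow> x \<in> stratum S \<tau> \<Longrightarrow> \<sigma> = \<tau>"
    and "x \<in> topspace X \<Longrightarrow> \<exists>U. openin X U \<and> x \<in> U \<and> finite {\<sigma>\<in>strata S. stratum S \<sigma> \<inter> U \<noteq> {}}"
proof -
  note d = assms[unfolded decomposition_def]
  show "x \<in> topspace X \<Longrightarrow> \<exists>\<sigma>\<in>strata S. x \<in> stratum S \<sigma>"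
    unfolding conjunct1[OF d, symmetric] by (elim UN_E) (rule bexI)
  show "\<sigma> \<in> strata S \<Longrightarrow> x \<in> stratum S \<sigma> \<Longrightarrow> x \<in> topspace X"
    unfolding conjunct1[OF d, symmetric] by (rule UN_I)
  have dis: "\<forall>\<sigma>\<in>strata S. \<forall>\<tau>\<in>strata S. \<sigma> \<noteq> \<tau> \<longrightarrow> stratum S \<sigma> \<inter> stratum S \<tau> = {}"
    by (rule conjunct1[OF conjunct2[OF conjunct2[OF d]]])
  show "\<sigma> \<in> strata S \<Longrightarrow> \<tau> \<in> strata S \<Longrightarrow> x \<in> stratum S \<sigma> \<Longrightarrow> x \<in> stratum S \<tau> \<Longrightarrow> \<sigma> = \<tau>"
    using dis by blast
  show "x \<in> topspace X \<Longrightarrow> \<exists>U. openin X U \<and> x \<in> U \<and> finite {\<sigma>\<in>strata S. stratum S \<sigma> \<inter> U \<noteq> {}}"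
    by (rule bspec[OF conjunct1[OF conjunct2[OF conjunct2[OF conjunct2[OF conjunct2[OF d]]]]]])
qed

section \<open>Charts of the strata and the tube submersions\<close>

lemma manifold_chart:
  assumes "smooth_manifold n M A" "(U, \<phi>) \<in> A"
  shows "openin M U" "openin (Euclidean_space n) (\<phi> ` U)"
    "homeomorphic_map (subtopology M U) (subtopology (Euclidean_space n) (\<phi> ` U)) \<phi>"
  using assms unfolding smooth_manifold_def by blast+

lemma manifold_cover:
  assumes "smooth_manifold n M A" "x \<in> topspace M"
  shows "\<exists>(U, \<phi>)\<in>A. x \<in> U"
proof -
  have "x \<in> (\<Union>(U, \<phi>)\<in>A. U)" using assms unfolding smooth_manifold_def by blast
  then show ?thesis by blast
qed

lemma locally_connected_manifold:
  assumes M: "smooth_manifold n M A" and T: "openin M T" "y \<in> T"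
  obtains C where "openin M C" "connectedin M C" "y \<in> C" "C \<subseteq> T"
proof -
  have yM: "y \<in> topspace M" using T openin_subset by blast
  obtain U \<phi> where U: "(U, \<phi>) \<in> A" "y \<in> U" using manifold_cover[OF M yM] by blast
  note ch = manifold_chart[OF M U(1)]
  have "locally_connected_space (subtopology (Euclidean_space n) (\<phi> ` U))"
    using locally_path_connected_space_open_subset[OF locally_path_connected_Euclidean_space ch(2)]
    by (rule locally_path_connected_imp_locally_connected_space)
  moreover have "subtopology M U homeomorphic_space subtopology (Euclidean_space n) (\<phi> ` U)"
    using ch(3) by (rule homeomorphic_map_imp_homeomorphic_space)
  ultimately have lc: "locally_connected_space (subtopology M U)"
    using homeomorphic_locally_connected_space by blast
  have "openin (subtopology M U) (T \<inter> U)" using openin_subtopology_Int[OF T(1)] .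
  then obtain C where C: "openin (subtopology M U) C" "connectedin (subtopology M U) C" "y \<in> C" "C \<subseteq> T \<inter> U"
    using lc U(2) T(2) unfolding locally_connected_space by blast
  have "openin M C" using C(1) openin_open_subtopology[OF ch(1)] by blast
  moreover have "connectedin M C" using C(2) by (simp add: connectedin_subtopology)
  ultimately show thesis using that C(3,4) by blast
qed

text \<open>Checks the charts against \<open>smooth_submersion_open\<close>. The distance coordinate
  gives the target one dimension more than the stratum \<sigma>, which makes the inequality
  strict.\<close>

lemma stratum_submersion:
  assumes tm: "thom_mather X S" and st: "\<sigma> \<in> strata S" "\<tau> \<in> strata S" "\<sigma> \<noteq> \<tau>"
  shows "openin (subtopology X (tube S \<sigma> \<inter> stratum S \<tau>)) T \<Longrightarrow>
      openin (prod_topology (subtopology X (stratum S \<sigma>)) (top_of_set {0<..})) ((\<lambda>x. (retr S \<sigma> x, tdist S \<sigma> x)) ` T)"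
    and "tube S \<sigma> \<inter> stratum S \<tau> \<noteq> {} \<Longrightarrow> sdim S \<sigma> < sdim S \<tau>"
proof -
  let ?M = "subtopology X (tube S \<sigma> \<inter> stratum S \<tau>)" and ?A = "open_submanifold_atlas (tube S \<sigma>) (satlas S \<tau>)"
  let ?N = "prod_topology (subtopology X (stratum S \<sigma>)) (top_of_set {0::real<..})"
  let ?B = "times_halfline_atlas (sdim S \<sigma>) (satlas S \<sigma>)"
  note sub = thom_matherD(12)[OF tm st]
  note M\<sigma> = thom_matherD(5)[OF tm st(1)] and M\<tau> = thom_matherD(5)[OF tm st(2)]
  note dec = decompositionD[OF thom_matherD(4)[OF tm]]
  have top\<tau>: "topspace (subtopology X (stratum S \<tau>)) = stratum S \<tau>" using dec(2)[OF st(2)] by auto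
  have top\<sigma>: "topspace (subtopology X (stratum S \<sigma>)) = stratum S \<sigma>" using dec(2)[OF st(1)] by auto
  have topM: "topspace ?M = tube S \<sigma> \<inter> stratum S \<tau>" using dec(2)[OF st(2)] by auto
  have tube: "openin (subtopology X (stratum S \<tau>)) (tube S \<sigma> \<inter> stratum S \<tau>)"
    using openin_subtopology_Int[OF thom_matherD(6)[OF tm st(1)]] .
  have Meq: "?M = subtopology (subtopology X (stratum S \<tau>)) (tube S \<sigma>)"
    by (simp add: subtopology_subtopology Int_commute)
  have A: "openin ?M U \<and> openin (Euclidean_space (sdim S \<tau>)) (\<phi> ` U) \<and>
        homeomorphic_map (subtopology ?M U) (subtopology (Euclidean_space (sdim S \<tau>)) (\<phi> ` U)) \<phi>"
    if U\<phi>: "(U, \<phi>) \<in> ?A" for U \<phi>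
  proof -
    obtain U0 where U0: "(U0, \<phi>) \<in> satlas S \<tau>" "U = U0 \<inter> tube S \<sigma>"
      using U\<phi> unfolding open_submanifold_atlas_def by auto
    note ch = manifold_chart[OF M\<tau> U0(1)]
    have U0s: "U0 \<subseteq> stratum S \<tau>" using openin_subset[OF ch(1)] top\<tau> by simp
    have oU: "openin ?M U" unfolding Meq U0(2) by (rule openin_subtopology_Int[OF ch(1)])
    have oU0: "openin (subtopology (subtopology X (stratum S \<tau>)) U0) U"
    proof -
      have "U = U0 \<inter> (tube S \<sigma> \<inter> stratum S \<tau>)" using U0(2) U0s by auto
      then show ?thesis using openin_subtopology_Int2[OF tube, of U0] by simp
    qed
    have "open_map (subtopology (subtopology X (stratum S \<tau>)) U0) (subtopology (Euclidean_space (sdim S \<tau>)) (\<phi> ` U0)) \<phi>"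
      using ch(3) by (rule homeomorphic_imp_open_map)
    then have "openin (subtopology (Euclidean_space (sdim S \<tau>)) (\<phi> ` U0)) (\<phi> ` U)"
      using oU0 unfolding open_map_def by blast
    then have oE: "openin (Euclidean_space (sdim S \<tau>)) (\<phi> ` U)" using openin_open_subtopology[OF ch(2)] by blast
    have UU0: "U \<subseteq> U0" using U0(2) by simp
    have eq1: "subtopology ?M U = subtopology (subtopology (subtopology X (stratum S \<tau>)) U0) U"
      unfolding subtopology_subtopology using U0(2) U0s by (intro arg_cong[of _ _ "subtopology X"]) auto
    have eq2: "subtopology (Euclidean_space (sdim S \<tau>)) (\<phi> ` U) =
        subtopology (subtopology (Euclidean_space (sdim S \<tau>)) (\<phi> ` U0)) (\<phi> ` U)"
      unfolding subtopology_subtopology using UU0 by (intro arg_cong[of _ _ "subtopology _"]) auto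
    have tU0: "topspace (subtopology (subtopology X (stratum S \<tau>)) U0) = U0" using top\<tau> U0s by auto
    have im: "\<phi> ` U0 = topspace (subtopology (Euclidean_space (sdim S \<tau>)) (\<phi> ` U0))"
      using homeomorphic_imp_surjective_map[OF ch(3)] tU0 by simp
    have "homeomorphic_map (subtopology ?M U) (subtopology (Euclidean_space (sdim S \<tau>)) (\<phi> ` U)) \<phi>"
      unfolding eq1 eq2
    proof (rule homeomorphic_map_subtopologies[OF ch(3)])
      show "\<phi> ` (topspace (subtopology (subtopology X (stratum S \<tau>)) U0) \<inter> U) =
        topspace (subtopology (Euclidean_space (sdim S \<tau>)) (\<phi> ` U0)) \<inter> \<phi> ` U"
        unfolding tU0 im[symmetric] using UU0 by auto
    qed
    then show ?thesis using oU oE by blast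
  qed
  have Acov: "topspace ?M \<subseteq> (\<Union>(U, \<phi>)\<in>?A. U)"
  proof
    fix x assume x: "x \<in> topspace ?M"
    then have x': "x \<in> tube S \<sigma>" "x \<in> topspace (subtopology X (stratum S \<tau>))" unfolding topM top\<tau> by auto
    obtain U \<phi> where "(U, \<phi>) \<in> satlas S \<tau>" "x \<in> U" using manifold_cover[OF M\<tau> x'(2)] by blast
    then show "x \<in> (\<Union>(U, \<phi>)\<in>?A. U)" using x'(1) unfolding open_submanifold_atlas_def by force
  qed
  have B: "openin ?N V \<and> (\<forall>y\<in>V. \<forall>z\<in>V. (\<forall>j<Suc (sdim S \<sigma>). \<psi> y j = \<psi> z j) \<longrightarrow> y = z) \<and>
        (\<forall>j<Suc (sdim S \<sigma>). continuous_map (subtopology ?N V) euclideanreal (\<lambda>y. \<psi> y j))"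
    if V\<psi>: "(V, \<psi>) \<in> ?B" for V \<psi>
  proof (intro conjI)
    obtain U \<phi> where U: "(U, \<phi>) \<in> satlas S \<sigma>" "V = U \<times> {0<..}" "\<psi> = (\<lambda>(x, r). (\<phi> x)(sdim S \<sigma> := r))"
      using V\<psi> unfolding times_halfline_atlas_def by auto
    note ch = manifold_chart[OF M\<sigma> U(1)]
    have Us: "U \<subseteq> stratum S \<sigma>" using openin_subset[OF ch(1)] top\<sigma> by simp
    have tU: "topspace (subtopology (subtopology X (stratum S \<sigma>)) U) = U" using top\<sigma> Us by auto
    have inj: "inj_on \<phi> U" using homeomorphic_imp_injective_map[OF ch(3)] tU by simp
    \<comment> \<open>Chart values vanish from index \<open>sdim S \<sigma>\<close> on, so storing
      the distance at that index overwrites a zero and no information is lost.\<close>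
    have Ez: "\<phi> x j = 0" if "x \<in> U" "j \<ge> sdim S \<sigma>" for x j
      using openin_subset[OF ch(2)] that by (auto simp: topspace_Euclidean_space)
    show "openin ?N V" unfolding U(2) by (subst openin_prod_Times_iff) (use ch(1) in auto)
    show "\<forall>y\<in>V. \<forall>z\<in>V. (\<forall>j<Suc (sdim S \<sigma>). \<psi> y j = \<psi> z j) \<longrightarrow> y = z"
    proof (intro ballI impI)
      fix y z assume yz: "y \<in> V" "z \<in> V" "\<forall>j<Suc (sdim S \<sigma>). \<psi> y j = \<psi> z j"
      obtain a r b t where ab: "y = (a, r)" "z = (b, t)" by fastforce
      have "a \<in> U" "b \<in> U" using yz ab U(2) by auto
      have "r = t" using yz(3) ab U(3) by auto
      moreover have "\<phi> a = \<phi> b"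
      proof
        fix j
        show "\<phi> a j = \<phi> b j"
        proof (cases "j < sdim S \<sigma>")
          case True
          then have "\<psi> y j = \<psi> z j" using yz(3) by simp
          then show ?thesis using True ab U(3) by simp
        next
          case False
          then show ?thesis using Ez \<open>a \<in> U\<close> \<open>b \<in> U\<close> by simp
        qed
      qed
      ultimately show "y = z" using inj \<open>a \<in> U\<close> \<open>b \<in> U\<close> ab by (auto dest: inj_onD)
    qed
    show "\<forall>j<Suc (sdim S \<sigma>). continuous_map (subtopology ?N V) euclideanreal (\<lambda>y. \<psi> y j)"
    proof (intro allI impI)
      fix j assume "j < Suc (sdim S \<sigma>)"
      have c\<phi>: "continuous_map (subtopology (subtopology X (stratum S \<sigma>)) U) euclideanreal (\<lambda>x. \<phi> x j)"
      proof -
        have "continuous_map (subtopology (subtopology X (stratum S \<sigma>)) U) (Euclidean_space (sdim S \<sigma>)) \<phi>"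
          using homeomorphic_imp_continuous_map[OF ch(3)] by (simp add: continuous_map_in_subtopology)
        then have "continuous_map (subtopology (subtopology X (stratum S \<sigma>)) U) (powertop_real UNIV) \<phi>"
          unfolding Euclidean_space_def by (simp add: continuous_map_in_subtopology)
        then show ?thesis by (simp add: continuous_map_componentwise_UNIV)
      qed
      have Neq: "subtopology ?N V = prod_topology (subtopology (subtopology X (stratum S \<sigma>)) U) (subtopology (top_of_set {0<..}) {0<..})"
        unfolding U(2) by (rule subtopology_Times)
      show "continuous_map (subtopology ?N V) euclideanreal (\<lambda>y. \<psi> y j)"
      proof (cases "j = sdim S \<sigma>")
        case True
        then have "(\<lambda>y. \<psi> y j) = snd" unfolding U(3) by auto
        moreover have "continuous_map (subtopology ?N V) (top_of_set {0<..}) snd"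
          by (rule continuous_map_from_subtopology[OF continuous_map_snd])
        ultimately show ?thesis using continuous_map_into_fulltopology by metis
      next
        case False
        then have "(\<lambda>y. \<psi> y j) = (\<lambda>x. \<phi> x j) \<circ> fst" unfolding U(3) by auto
        moreover have "continuous_map (subtopology ?N V) (subtopology (subtopology X (stratum S \<sigma>)) U) fst"
          unfolding Neq by (rule continuous_map_fst)
        ultimately show ?thesis using continuous_map_compose[OF _ c\<phi>] by metis
      qed
    qed
  qed
  have Bcov: "topspace ?N \<subseteq> (\<Union>(V, \<psi>)\<in>?B. V)"
  proof
    fix z assume z: "z \<in> topspace ?N"
    then obtain b r where br: "z = (b, r)" "b \<in> topspace (subtopology X (stratum S \<sigma>))" "r > 0"
      by (cases z) auto
    obtain U \<phi> where "(U, \<phi>) \<in> satlas S \<sigma>" "b \<in> U" using manifold_cover[OF M\<sigma> br(2)] by blast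
    then show "z \<in> (\<Union>(V, \<psi>)\<in>?B. V)" using br unfolding times_halfline_atlas_def by force
  qed
  show "openin ?N ((\<lambda>x. (retr S \<sigma> x, tdist S \<sigma> x)) ` T)" if "openin ?M T"
    by (rule smooth_submersion_open(1)[OF sub A Acov B Bcov that])
  have "Suc (sdim S \<sigma>) \<le> sdim S \<tau>" if "topspace ?M \<noteq> {}"
    by (rule smooth_submersion_open(2)[OF sub A Acov B Bcov that])
  then show "sdim S \<sigma> < sdim S \<tau>" if "tube S \<sigma> \<inter> stratum S \<tau> \<noteq> {}" using that topM by simp
qed

text \<open>Properness of the pair of retraction and distance function over a compact set N.\<close>

lemma tube_shrink:
  assumes tm: "thom_mather X S" and \<sigma>: "\<sigma> \<in> strata S"
    and N: "compactin X N" "N \<subseteq> tube S \<sigma>" and b: "b \<in> stratum S \<sigma>"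
    and Z: "openin X Z" "\<And>q. q \<in> N \<Longrightarrow> retr S \<sigma> q = b \<Longrightarrow> tdist S \<sigma> q = r \<Longrightarrow> q \<in> Z"
  obtains B \<eta> where "openin (subtopology X (stratum S \<sigma>)) B" "b \<in> B" "\<eta> > 0"
    "\<And>q. q \<in> N \<Longrightarrow> retr S \<sigma> q \<in> B \<Longrightarrow> \<bar>tdist S \<sigma> q - r\<bar> < \<eta> \<Longrightarrow> q \<in> Z"
proof -
  let ?P = "prod_topology (subtopology X (stratum S \<sigma>)) euclideanreal"
  let ?f = "\<lambda>x. (retr S \<sigma> x, tdist S \<sigma> x)"
  have bX: "b \<in> topspace X" using decompositionD(2)[OF thom_matherD(4)[OF tm] \<sigma> b] .
  have haus: "Hausdorff_space ?P"
    using thom_matherD(1)[OF tm] Hausdorff_space_subtopology Hausdorff_space_euclidean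
    by (auto simp: Hausdorff_space_prod_topology)
  have d: "continuous_map (subtopology X (tube S \<sigma>)) euclideanreal (tdist S \<sigma>)"
    using thom_matherD(10)[OF tm \<sigma>] by (rule continuous_map_into_fulltopology)
  have f: "continuous_map (subtopology X (tube S \<sigma>)) ?P ?f"
    using thom_matherD(8)[OF tm \<sigma>] d by (rule continuous_map_paired[THEN iffD2, OF conjI])
  \<comment> \<open>The part of \<open>N\<close> outside \<open>Z\<close> has a compact, hence
    closed, image under retraction and distance, and this image misses (b, r).\<close>
  have "compactin X (N \<inter> (topspace X - Z))"
    using N(1) Z(1) by (intro compact_Int_closedin) auto
  then have "compactin (subtopology X (tube S \<sigma>)) (N \<inter> (topspace X - Z))"
    using N(2) by (auto simp: compactin_subtopology)
  then have "compactin ?P (?f ` (N \<inter> (topspace X - Z)))" by (rule image_compactin[OF _ f])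
  then have "closedin ?P (?f ` (N \<inter> (topspace X - Z)))" by (rule compactin_imp_closedin[OF haus])
  then have op: "openin ?P (topspace ?P - ?f ` (N \<inter> (topspace X - Z)))" by (rule openin_diff[OF openin_topspace])
  have "(b, r) \<in> topspace ?P - ?f ` (N \<inter> (topspace X - Z))" using Z(2) b bX by auto
  then obtain B V where BV: "openin (subtopology X (stratum S \<sigma>)) B" "openin euclideanreal V" "b \<in> B" "r \<in> V"
    "B \<times> V \<subseteq> topspace ?P - ?f ` (N \<inter> (topspace X - Z))"
    using op unfolding openin_prod_topology_alt by meson
  obtain \<eta> where \<eta>: "\<eta> > 0" "\<And>t. \<bar>t - r\<bar> < \<eta> \<Longrightarrow> t \<in> V"
    using BV(2,4) by (auto simp: open_openin[symmetric] open_dist dist_real_def)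
  have "q \<in> Z" if q: "q \<in> N" "retr S \<sigma> q \<in> B" "\<bar>tdist S \<sigma> q - r\<bar> < \<eta>" for q
  proof (rule ccontr)
    assume "q \<notin> Z"
    then have "q \<in> N \<inter> (topspace X - Z)" using q(1) compactin_subset_topspace[OF N(1)] by blast
    moreover have "?f q \<in> B \<times> V" using q \<eta>(2) by simp
    ultimately show False using BV(5) by blast
  qed
  then show thesis using that BV(1,3) \<eta>(1) by blast
qed

lemma tdist_nonneg:
  assumes tm: "thom_mather X S" and \<sigma>: "\<sigma> \<in> strata S" and q: "q \<in> tube S \<sigma>"
  shows "tdist S \<sigma> q \<ge> 0" and "retr S \<sigma> q \<in> stratum S \<sigma>" and "tdist S \<sigma> q = 0 \<longleftrightarrow> q \<in> stratum S \<sigma>"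
proof -
  have "q \<in> topspace (subtopology X (tube S \<sigma>))"
    using q openin_subset[OF thom_matherD(6)[OF tm \<sigma>]] by auto
  then show "tdist S \<sigma> q \<ge> 0" "retr S \<sigma> q \<in> stratum S \<sigma>"
    using continuous_map_image_subset_topspace[OF thom_matherD(10)[OF tm \<sigma>]]
      continuous_map_image_subset_topspace[OF thom_matherD(8)[OF tm \<sigma>]] by auto
  show "tdist S \<sigma> q = 0 \<longleftrightarrow> q \<in> stratum S \<sigma>" using thom_matherD(11)[OF tm \<sigma>] q by blast
qed

text \<open>The image of the support of a functional under retraction and distance is closed by
  properness and open because submersions are open, so a single fibre decides.\<close>

lemma zero_germ_off_stratum:
  assumes tm: "thom_mather X S" and F: "precosheaf X K F"
    and lc: "\<And>\<tau>. \<tau> \<in> strata S \<Longrightarrow> locally_constant_on X K (dual_diagram K F) (stratum S \<tau>)"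
    and \<sigma>: "\<sigma> \<in> strata S" and N: "compactin X N" "N \<subseteq> tube S \<sigma>"
    and U: "openin X U" "\<phi> \<in> carrier (dual_space K (at_open F U))"
    and B: "openin (subtopology X (stratum S \<sigma>)) B" "connectedin X B" "y \<in> B"
    and \<delta>: "0 < \<delta>" "\<delta> < \<epsilon>" and W: "W = {q \<in> N. retr S \<sigma> q \<in> B \<and> tdist S \<sigma> q < \<epsilon>}" "openin X W" "W \<subseteq> U"
    and fibre: "\<And>q. q \<in> N \<Longrightarrow> retr S \<sigma> q = y \<Longrightarrow> tdist S \<sigma> q = \<delta> \<Longrightarrow> zero_germ X K F U \<phi> q"
    and q: "q \<in> W" "q \<notin> stratum S \<sigma>"
  shows "zero_germ X K F U \<phi> q"
proof (rule ccontr)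
  assume nq: "\<not> zero_germ X K F U \<phi> q"
  let ?A = "subtopology X (stratum S \<sigma>)"
  let ?P = "prod_topology ?A euclideanreal"
  let ?f = "\<lambda>x. (retr S \<sigma> x, tdist S \<sigma> x)"
  note dec = decompositionD[OF thom_matherD(4)[OF tm]]
  note td = tdist_nonneg[OF tm \<sigma>]
  have Bs: "B \<subseteq> stratum S \<sigma>" using openin_subset[OF B(1)] by auto
  \<comment> \<open>The cylinder over \<open>B\<close>, connected because \<open>B\<close> and the
    interval are. The set \<open>E\<close> will be open and closed in it, and the hypothesis on one
    fibre says that (y, \<delta>) is outside \<open>E\<close>.\<close>
  define R where "R = B \<times> {0<..<\<epsilon>}"
  define E where "E = ?f ` {x \<in> W. x \<notin> stratum S \<sigma> \<and> \<not> zero_germ X K F U \<phi> x}"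
  have WN: "W \<subseteq> N" "W \<subseteq> tube S \<sigma>" using W(1) N(2) by auto
  have ER: "E \<subseteq> R"
  proof
    fix z assume "z \<in> E"
    then obtain x where x: "x \<in> W" "x \<notin> stratum S \<sigma>" "z = ?f x" unfolding E_def by blast
    then have "tdist S \<sigma> x \<noteq> 0" "tdist S \<sigma> x \<ge> 0" using td(1,3)[of x] WN(2) by auto
    then show "z \<in> R" using x W(1) unfolding R_def by auto
  qed
  \<comment> \<open>Off the stratum \<sigma>, the set W is the union of its parts in the other
    strata. In each of these the locus of nonzero germs is open, and the submersion is an open
    map.\<close>
  have oE: "openin ?P E"
  proof -
    have "openin ?P (?f ` {x \<in> W \<inter> stratum S \<tau>. \<not> zero_germ X K F U \<phi> x})" if \<tau>: "\<tau> \<in> strata S" "\<tau> \<noteq> \<sigma>" for \<tau>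
    proof -
      let ?T = "{x \<in> W \<inter> stratum S \<tau>. \<not> zero_germ X K F U \<phi> x}"
      have "openin (subtopology X (stratum S \<tau>)) ({z \<in> stratum S \<tau> \<inter> U. \<not> zero_germ X K F U \<phi> z} \<inter> (stratum S \<tau> \<inter> W))"
        by (intro openin_Int openin_nonzero_germ[OF F lc[OF \<tau>(1)] U] openin_subtopology_Int2[OF W(2)])
      moreover have "{z \<in> stratum S \<tau> \<inter> U. \<not> zero_germ X K F U \<phi> z} \<inter> (stratum S \<tau> \<inter> W) = ?T" using W(3) by auto
      ultimately have "openin (subtopology X (stratum S \<tau>)) ?T" by simp
      then have "openin (subtopology (subtopology X (stratum S \<tau>)) (tube S \<sigma>)) (?T \<inter> tube S \<sigma>)"
        by (rule openin_subtopology_Int)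
      moreover have "?T \<inter> tube S \<sigma> = ?T" using WN(2) by auto
      moreover have "subtopology (subtopology X (stratum S \<tau>)) (tube S \<sigma>) = subtopology X (tube S \<sigma> \<inter> stratum S \<tau>)"
        by (simp add: subtopology_subtopology Int_commute)
      ultimately have oT: "openin (subtopology X (tube S \<sigma> \<inter> stratum S \<tau>)) ?T" by simp
      have oi: "openin (prod_topology ?A (top_of_set {0<..})) (?f ` ?T)"
        by (rule stratum_submersion(1)[OF tm \<sigma> \<tau>(1) _ oT]) (use \<tau>(2) in auto)
      have top: "topspace ?A = stratum S \<sigma>" using dec(2)[OF \<sigma>] by auto
      \<comment> \<open>The submersion takes values over the half-line, an open subspace of the line
        used in \<open>?P\<close>.\<close>
      have eq: "prod_topology ?A (top_of_set {0<..}) = subtopology ?P (stratum S \<sigma> \<times> {0<..})"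
        by (simp add: subtopology_Times subtopology_subtopology)
      have oS: "openin ?P (stratum S \<sigma> \<times> {0<..})"
        using openin_topspace[of ?A] unfolding top by (subst openin_prod_Times_iff) auto
      show ?thesis using oi unfolding eq openin_open_subtopology[OF oS] by (rule conjunct1)
    qed
    then have "openin ?P (\<Union>\<tau>\<in>strata S - {\<sigma>}. ?f ` {x \<in> W \<inter> stratum S \<tau>. \<not> zero_germ X K F U \<phi> x})"
      by (intro openin_Union) auto
    moreover have "(\<Union>\<tau>\<in>strata S - {\<sigma>}. ?f ` {x \<in> W \<inter> stratum S \<tau>. \<not> zero_germ X K F U \<phi> x}) = E"
    proof
      show "E \<subseteq> (\<Union>\<tau>\<in>strata S - {\<sigma>}. ?f ` {x \<in> W \<inter> stratum S \<tau>. \<not> zero_germ X K F U \<phi> x})"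
      proof
        fix z assume "z \<in> E"
        then obtain x where x: "x \<in> W" "x \<notin> stratum S \<sigma>" "\<not> zero_germ X K F U \<phi> x" "z = ?f x" unfolding E_def by blast
        then obtain \<tau> where "\<tau> \<in> strata S" "x \<in> stratum S \<tau>" using dec(1)[of x] openin_subset[OF W(2)] by blast
        then show "z \<in> (\<Union>\<tau>\<in>strata S - {\<sigma>}. ?f ` {x \<in> W \<inter> stratum S \<tau>. \<not> zero_germ X K F U \<phi> x})" using x by blast
      qed
      show "(\<Union>\<tau>\<in>strata S - {\<sigma>}. ?f ` {x \<in> W \<inter> stratum S \<tau>. \<not> zero_germ X K F U \<phi> x}) \<subseteq> E"
      proof
        fix z assume "z \<in> (\<Union>\<tau>\<in>strata S - {\<sigma>}. ?f ` {x \<in> W \<inter> stratum S \<tau>. \<not> zero_germ X K F U \<phi> x})"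
        then obtain \<tau> x where x: "\<tau> \<in> strata S" "\<tau> \<noteq> \<sigma>" "x \<in> W" "x \<in> stratum S \<tau>" "\<not> zero_germ X K F U \<phi> x" "z = ?f x" by blast
        then have "x \<notin> stratum S \<sigma>" using dec(3)[OF x(1) \<sigma> x(4)] by blast
        then show "z \<in> E" using x unfolding E_def by blast
      qed
    qed
    ultimately show ?thesis by simp
  qed
  \<comment> \<open>If all germs on the fibre over (b, r) vanish, the vanishing locus is an open set
    around that fibre, and by properness it contains all nearby fibres.\<close>
  have oE2: "openin ?P (R - E)"
  proof (subst openin_subopen, intro ballI)
    fix z assume z: "z \<in> R - E"
    then obtain b r where br: "z = (b, r)" "b \<in> B" "0 < r" "r < \<epsilon>" unfolding R_def by auto
    let ?Z = "{z \<in> U. zero_germ X K F U \<phi> z}"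
    have "x \<in> ?Z" if x: "x \<in> N" "retr S \<sigma> x = b" "tdist S \<sigma> x = r" for x
    proof -
      have xW: "x \<in> W" using x br W(1) by simp
      have "x \<notin> stratum S \<sigma>" using td(3)[of x] x N(2) br(3) by auto
      then have "zero_germ X K F U \<phi> x" using z xW x br(1) unfolding E_def by force
      then show ?thesis using xW W(3) by blast
    qed
    then obtain B1 \<eta> where B1: "openin ?A B1" "b \<in> B1" "\<eta> > 0"
      "\<And>x. x \<in> N \<Longrightarrow> retr S \<sigma> x \<in> B1 \<Longrightarrow> \<bar>tdist S \<sigma> x - r\<bar> < \<eta> \<Longrightarrow> x \<in> ?Z"
      using tube_shrink[OF tm \<sigma> N _ openin_zero_germ[OF U(1)], of b r K F U \<phi>] br(2) Bs by blast
    let ?Q = "(B1 \<inter> B) \<times> ({r - \<eta><..<r + \<eta>} \<inter> {0<..<\<epsilon>})"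
    have "openin ?P ?Q" using B1(1) B(1) by (subst openin_prod_Times_iff) (auto intro: open_Int)
    moreover have "z \<in> ?Q" using br B1 by auto
    moreover have "?Q \<subseteq> R - E"
    proof
      fix p assume p: "p \<in> ?Q"
      have "p \<notin> E"
      proof
        assume "p \<in> E"
        then obtain x where x: "x \<in> W" "\<not> zero_germ X K F U \<phi> x" "p = ?f x" unfolding E_def by blast
        then have "x \<in> ?Z" using p WN(1) by (intro B1(4)) (auto simp: abs_less_iff)
        then show False using x(2) by blast
      qed
      then show "p \<in> R - E" using p unfolding R_def by auto
    qed
    ultimately show "\<exists>T. openin ?P T \<and> z \<in> T \<and> T \<subseteq> R - E" by blast
  qed
  have cR: "connectedin ?P R"
  proof -
    have "connectedin ?A B" using B(2) Bs by (simp add: connectedin_subtopology)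
    moreover have "connectedin euclideanreal {0<..<\<epsilon>}" by simp
    ultimately show ?thesis unfolding R_def by (simp add: connectedin_Times)
  qed
  have "(y, \<delta>) \<notin> E"
  proof
    assume "(y, \<delta>) \<in> E"
    then obtain x where "x \<in> W" "\<not> zero_germ X K F U \<phi> x" "retr S \<sigma> x = y" "tdist S \<sigma> x = \<delta>" unfolding E_def by auto
    then show False using fibre WN(1) by blast
  qed
  then have "(y, \<delta>) \<in> R - E" using B(3) \<delta> unfolding R_def by auto
  moreover have "?f q \<in> E" using q nq unfolding E_def by blast
  ultimately have ne: "E \<inter> R \<noteq> {}" "(R - E) \<inter> R \<noteq> {}" using ER by auto
  have "\<not> (\<exists>E1 E2. openin ?P E1 \<and> openin ?P E2 \<and> R \<subseteq> E1 \<union> E2 \<and> E1 \<inter> E2 \<inter> R = {} \<and> E1 \<inter> R \<noteq> {} \<and> E2 \<inter> R \<noteq> {})"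
    using cR unfolding connectedin by (rule conjunct2)
  moreover have "\<exists>E1 E2. openin ?P E1 \<and> openin ?P E2 \<and> R \<subseteq> E1 \<union> E2 \<and> E1 \<inter> E2 \<inter> R = {} \<and> E1 \<inter> R \<noteq> {} \<and> E2 \<inter> R \<noteq> {}"
    by (rule exI[of _ E], rule exI[of _ "R - E"], intro conjI oE oE2 ne) auto
  ultimately show False by (rule notE)
qed

section \<open>Stability of costalks by induction over the strata\<close>

lemma artinian_finite_sum:
  assumes "vspace K M" "finite I" "\<And>i. i \<in> I \<Longrightarrow> submodule (H i) K M" "\<And>i. i \<in> I \<Longrightarrow> artinian K M (H i)"
  obtains R where "submodule R K M" "artinian K M R" "\<And>i. i \<in> I \<Longrightarrow> H i \<subseteq> R"
proof -
  interpret M: module K M by (rule vspace_module[OF assms(1)])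
  have "\<exists>R. submodule R K M \<and> artinian K M R \<and> (\<forall>i\<in>I. H i \<subseteq> R)"
    using assms(2-4)
  proof (induction I)
    case empty
    have "{\<zero>\<^bsub>M\<^esub>} \<subseteq> {a \<odot>\<^bsub>M\<^esub> \<zero>\<^bsub>M\<^esub> |a. a \<in> carrier K}"
      using M.submodule_zero_in[OF M.submodule_singleton_span[OF M.zero_closed]] by simp
    then have "artinian K M {\<zero>\<^bsub>M\<^esub>}"
      by (rule artinian_subset[OF artinian_singleton_span[OF assms(1) M.zero_closed]])
    then show ?case using M.submodule_zero by (intro exI[of _ "{\<zero>\<^bsub>M\<^esub>}"]) simp
  next
    case (insert i I)
    then obtain R where R: "submodule R K M" "artinian K M R" "\<forall>i\<in>I. H i \<subseteq> R" by auto
    have Hi: "submodule (H i) K M" "artinian K M (H i)" using insert.prems by auto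
    show ?case
    proof (intro exI conjI)
      show "submodule (H i <+>\<^bsub>M\<^esub> R) K M" by (rule M.submodule_set_add[OF Hi(1) R(1)])
      show "artinian K M (H i <+>\<^bsub>M\<^esub> R)" by (rule M.artinian_set_add[OF Hi R(1,2)])
      show "\<forall>j\<in>insert i I. H j \<subseteq> H i <+>\<^bsub>M\<^esub> R"
        using M.subset_set_add[OF Hi(1) R(1)] R(3) by blast
    qed
  qed
  then obtain R where "submodule R K M" "artinian K M R" "\<forall>i\<in>I. H i \<subseteq> R" by (elim exE conjE)
  then show thesis using that[of R] by simp
qed

lemma locally_compact_nbhd:
  assumes "Hausdorff_space X" "locally_compact_space X" "openin X U" "y \<in> U"
  obtains V N where "openin X V" "compactin X N" "y \<in> V" "V \<subseteq> N" "N \<subseteq> U"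
proof -
  have "neighbourhood_base_of (compactin X) X"
    using assms(1,2) locally_compact_regular_space_neighbourhood_base locally_compact_Hausdorff_imp_regular_space
    by (metis (mono_tags, lifting) locally_compact_space_neighbourhood_base neighbourhood_base_of_mono)
  then show thesis using that assms(3,4) unfolding neighbourhood_base_of by blast
qed

text \<open>The space over a small neighbourhood of y is generated by elements from a still smaller
  neighbourhood and elements from off the stratum. The latter contribute an artinian subspace: a
  functional that kills the image of a neighbourhood of one compact fibre has zero germs everywhere
  off the stratum. These two facts are the input of \<open>costalk_stableI\<close>.\<close>

lemma costalk_stable_step:
  assumes K: "Ring.field K" and tm: "thom_mather X S" and cosh: "cosheaf X K F"
    and fd: "\<And>x. x \<in> topspace X \<Longrightarrow> fin_dim K (costalk X F x)"
    and lc: "\<And>\<tau>. \<tau> \<in> strata S \<Longrightarrow> locally_constant_on X K (dual_diagram K F) (stratum S \<tau>)"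
    and \<sigma>: "\<sigma> \<in> strata S" "y \<in> stratum S \<sigma>" and Q: "openin X Q" "y \<in> Q"
    and IH: "\<And>\<tau> q. \<tau> \<in> strata S \<Longrightarrow> sdim S \<sigma> < sdim S \<tau> \<Longrightarrow> q \<in> stratum S \<tau> \<Longrightarrow> q \<in> Q \<Longrightarrow> costalk_stable X F q"
  shows "costalk_stable X F y"
proof -
  have F: "precosheaf X K F" using cosh unfolding cosheaf_def by simp
  note P = precosheafD[OF F]
  note dec = decompositionD[OF thom_matherD(4)[OF tm]]
  have FU: "Module.module K (at_open F U)" if "openin X U" for U using P(1)[OF that] by (rule vspace_module)
  have yX: "y \<in> topspace X" by (rule dec(2)[OF \<sigma>])
  let ?T = "tube S \<sigma>" and ?\<pi> = "retr S \<sigma>" and ?d = "tdist S \<sigma>" and ?X = "stratum S \<sigma>"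
  let ?A = "subtopology X ?X"
  have T: "openin X ?T" "?X \<subseteq> ?T" using thom_matherD(6,7)[OF tm \<sigma>(1)] by auto
  note td = tdist_nonneg[OF tm \<sigma>(1)]
  have oTQ: "openin X (?T \<inter> Q)" using T(1) Q(1) by auto
  have yTQ: "y \<in> ?T \<inter> Q" using \<sigma>(2) T(2) Q(2) by auto
  \<comment> \<open>Compactness of \<open>N\<close> makes the tube map proper; placing
    \<open>N\<close> inside \<open>Q\<close> keeps all its points within reach of
    \<open>IH\<close>.\<close>
  obtain V0 N where V0: "openin X V0" "compactin X N" "y \<in> V0" "V0 \<subseteq> N" "N \<subseteq> ?T \<inter> Q"
    by (rule locally_compact_nbhd[OF thom_matherD(1,2)[OF tm] oTQ yTQ])
  have NT: "N \<subseteq> ?T" using V0(5) by blast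
  have fib: "q = y" if "q \<in> N" "?\<pi> q = y" "?d q = 0" for q
    using that td(3)[of q] NT thom_matherD(9)[OF tm \<sigma>(1), of q] by auto
  have fibV: "q \<in> V0" if "q \<in> N" "?\<pi> q = y" "?d q = 0" for q
    using fib[OF that] V0(3) by simp
  define Wt where "Wt B \<epsilon> = {q \<in> N. ?\<pi> q \<in> B \<and> ?d q < \<epsilon>}" for B \<epsilon>
  \<comment> \<open>Limits the pieces \<open>Wt B \<epsilon>\<close> to the open set
    \<open>V0\<close>, away from the boundary of \<open>N\<close>; this is what makes them open in
    \<open>gW\<close>.\<close>
  obtain B0 \<epsilon>0 where B0: "openin ?A B0" "y \<in> B0" "\<epsilon>0 > 0"
    "\<And>q. q \<in> N \<Longrightarrow> ?\<pi> q \<in> B0 \<Longrightarrow> \<bar>?d q - 0\<bar> < \<epsilon>0 \<Longrightarrow> q \<in> V0"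
    by (rule tube_shrink[OF tm \<sigma>(1) V0(2) NT \<sigma>(2) V0(1), of 0]) (simp_all add: fibV)
  \<comment> \<open>Connectedness of B is used twice: for the base of the cylinder off the stratum
    in \<open>PPart\<close>, and for the trace of W on the stratum, which is B, in
    \<open>gen\<close>.\<close>
  define good where "good W \<longleftrightarrow> (\<exists>B \<epsilon>. W = Wt B \<epsilon> \<and> openin ?A B \<and> connectedin X B \<and> y \<in> B \<and> B \<subseteq> B0 \<inter> V0 \<and> 0 < \<epsilon> \<and> \<epsilon> \<le> \<epsilon>0)" for W
  have \<pi>c: "continuous_map (subtopology X ?T) ?A ?\<pi>" by (rule thom_matherD(8)[OF tm \<sigma>(1)])
  have dc: "continuous_map (subtopology X ?T) euclideanreal ?d"
    using thom_matherD(10)[OF tm \<sigma>(1)] by (rule continuous_map_into_fulltopology)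
  have topT: "topspace (subtopology X ?T) = ?T" using openin_subset[OF T(1)] by auto
  have openT: "openin X {q \<in> ?T. ?d q \<in> D}" if "open D" for D
  proof -
    have "openin (subtopology X ?T) {q \<in> topspace (subtopology X ?T). ?d q \<in> D}"
      by (rule openin_continuous_map_preimage[OF dc]) (use that in \<open>simp add: open_openin[symmetric]\<close>)
    then show ?thesis unfolding topT using openin_open_subtopology[OF T(1)] by blast
  qed
  have gW: "openin X W \<and> y \<in> W \<and> W \<subseteq> V0 \<and> W \<inter> ?X = B"
    if W: "W = Wt B \<epsilon>" "openin ?A B" "y \<in> B" "B \<subseteq> B0 \<inter> V0" "0 < \<epsilon>" "\<epsilon> \<le> \<epsilon>0" for W B \<epsilon>
  proof (intro conjI)
    have WV: "W \<subseteq> V0"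
    proof
      fix q assume q: "q \<in> W"
      then have "q \<in> N" "?\<pi> q \<in> B0" "?d q < \<epsilon>0" using W(1,4,6) by (auto simp: Wt_def)
      then show "q \<in> V0" using td(1)[of q] NT by (intro B0(4)) auto
    qed
    then show "W \<subseteq> V0" .
    have "openin (subtopology X ?T) {q \<in> topspace (subtopology X ?T). ?\<pi> q \<in> B}"
      by (rule openin_continuous_map_preimage[OF \<pi>c W(2)])
    then have o1: "openin X {q \<in> ?T. ?\<pi> q \<in> B}" unfolding topT using openin_open_subtopology[OF T(1)] by blast
    have o2: "openin X {q \<in> ?T. ?d q \<in> {..<\<epsilon>}}" by (rule openT) simp
    have "W = V0 \<inter> {q \<in> ?T. ?\<pi> q \<in> B} \<inter> {q \<in> ?T. ?d q \<in> {..<\<epsilon>}}"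
      using WV V0(4) NT unfolding W(1) Wt_def by auto
    then show "openin X W" using o1 o2 V0(1) by auto
    have str: "?\<pi> q = q" "?d q = 0" if "q \<in> ?X" for q
      using thom_matherD(9)[OF tm \<sigma>(1) that] td(3)[of q] that T(2) by auto
    have BX: "B \<subseteq> ?X" using openin_subset[OF W(2)] by auto
    show "W \<inter> ?X = B"
      using str BX W(4,5) V0(4) unfolding W(1) Wt_def by auto
    then show "y \<in> W" using W(3) by auto
  qed
  \<comment> \<open>Properness again: the fibre of \<open>N\<close> over y at distance 0 is y alone,
    so a sufficiently thin piece lies in U.\<close>
  have good_small: "\<exists>W. good W \<and> W \<subseteq> U" if U: "openin X U" "y \<in> U" for U
  proof -
    have fibU: "q \<in> U" if "q \<in> N" "?\<pi> q = y" "?d q = 0" for q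
      using fib[OF that] U(2) by simp
    obtain B1 \<epsilon>1 where B1: "openin ?A B1" "y \<in> B1" "\<epsilon>1 > 0"
      "\<And>q. q \<in> N \<Longrightarrow> ?\<pi> q \<in> B1 \<Longrightarrow> \<bar>?d q - 0\<bar> < \<epsilon>1 \<Longrightarrow> q \<in> U"
      by (rule tube_shrink[OF tm \<sigma>(1) V0(2) NT \<sigma>(2) U(1), of 0]) (simp_all add: fibU)
    have oB: "openin ?A (B1 \<inter> B0 \<inter> (?X \<inter> V0))"
      by (intro openin_Int B1(1) B0(1) openin_subtopology_Int2 V0(1))
    have yB: "y \<in> B1 \<inter> B0 \<inter> (?X \<inter> V0)" using B1(2) B0(2) V0(3) \<sigma>(2) by auto
    obtain B where B: "openin ?A B" "connectedin ?A B" "y \<in> B" "B \<subseteq> B1 \<inter> B0 \<inter> (?X \<inter> V0)"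
      by (rule locally_connected_manifold[OF thom_matherD(5)[OF tm \<sigma>(1)] oB yB])
    have "good (Wt B (min \<epsilon>0 \<epsilon>1))" unfolding good_def
      using B B0(3) B1(3) by (intro exI[of _ B] exI[of _ "min \<epsilon>0 \<epsilon>1"]) (auto simp: connectedin_subtopology)
    moreover have "Wt B (min \<epsilon>0 \<epsilon>1) \<subseteq> U"
    proof
      fix q assume "q \<in> Wt B (min \<epsilon>0 \<epsilon>1)"
      then have "q \<in> N" "?\<pi> q \<in> B1" "?d q < \<epsilon>1" using B(4) by (auto simp: Wt_def)
      then show "q \<in> U" using td(1)[of q] NT by (intro B1(4)) auto
    qed
    ultimately show ?thesis by blast
  qed
  define off where "off W = W - ?X" for W
  have good1: "openin X W" "y \<in> W" "W \<subseteq> V0" "openin X (off W)" "off W \<subseteq> W" if gd: "good W" for W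
  proof -
    obtain B \<epsilon> where W: "W = Wt B \<epsilon>" "openin ?A B" "y \<in> B" "B \<subseteq> B0 \<inter> V0" "0 < \<epsilon>" "\<epsilon> \<le> \<epsilon>0"
      using gd unfolding good_def by blast
    show g: "openin X W" "y \<in> W" "W \<subseteq> V0" using gW[OF W] by auto
    have "off W = W \<inter> {q \<in> ?T. ?d q \<in> {0<..}}"
      using g(3) V0(4) NT td(1,3) unfolding off_def by (force simp: less_le)
    moreover have "openin X {q \<in> ?T. ?d q \<in> {0<..}}" by (rule openT) simp
    ultimately show "openin X (off W)" using g(1) by auto
    show "off W \<subseteq> W" unfolding off_def by auto
  qed
  \<comment> \<open>The image of the neighbourhood with the stratum removed; it takes the part of
    \<open>P\<close> in \<open>costalk_stableI\<close>.\<close>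
  define PP where "PP W = arrow F (off W) W ` carrier (at_open F (off W))" for W
  have PPs: "submodule (PP W) K (at_open F W)" if "good W" for W unfolding PP_def
    by (rule submodule_image[OF FU[OF good1(4)[OF that]] FU[OF good1(1)[OF that]] P(2)[OF good1(4)[OF that] good1(1)[OF that] good1(5)[OF that]]
          module.carrier_is_submodule[OF FU[OF good1(4)[OF that]]]])
  have PPmap: "arrow F W' W p \<in> PP W" if W: "good W" "good W'" "W' \<subseteq> W" and p: "p \<in> PP W'" for W W' p
  proof -
    note g = good1[OF W(1)] and g' = good1[OF W(2)]
    obtain v where v: "v \<in> carrier (at_open F (off W'))" "p = arrow F (off W') W' v" using p unfolding PP_def by blast
    have oo: "off W' \<subseteq> off W" using W(3) unfolding off_def by auto
    have "arrow F W' W p = arrow F (off W') W v" unfolding v(2) by (rule P(4)[OF g'(4,1) g(1) g'(5) W(3) v(1)])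
    also have "\<dots> = arrow F (off W) W (arrow F (off W') (off W) v)"
      by (rule P(4)[OF g'(4) g(4,1) oo g(5) v(1), symmetric])
    finally show ?thesis unfolding PP_def using linear_map_closed[OF P(2)[OF g'(4) g(4) oo] v(1)] by blast
  qed
  have PPart: "artinian K (at_open F W) (PP W)" if W: "good W" for W
  proof -
    note g = good1[OF W]
    interpret M: module K "at_open F W" by (rule FU[OF g(1)])
    obtain B \<epsilon> where B: "W = Wt B \<epsilon>" "openin ?A B" "connectedin X B" "y \<in> B" "B \<subseteq> B0 \<inter> V0" "0 < \<epsilon>" "\<epsilon> \<le> \<epsilon>0"
      using W unfolding good_def by blast
    \<comment> \<open>One compact fibre of the tube map over y. Any level strictly between 0 and
      \<epsilon> would serve.\<close>
    define Kf where "Kf = {q \<in> N. ?\<pi> q = y \<and> ?d q = \<epsilon> / 2}"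
    have Kc: "compactin X Kf"
    proof -
      have hA: "Hausdorff_space ?A" by (rule Hausdorff_space_subtopology[OF thom_matherD(1)[OF tm]])
      have yA: "y \<in> topspace ?A" using yX \<sigma>(2) by simp
      have c1: "closedin (subtopology X ?T) {q \<in> topspace (subtopology X ?T). ?\<pi> q \<in> {y}}"
        by (rule closedin_continuous_map_preimage[OF \<pi>c]) (use closedin_Hausdorff_singleton[OF hA yA] in simp)
      have c2: "closedin (subtopology X ?T) {q \<in> topspace (subtopology X ?T). ?d q \<in> {\<epsilon> / 2}}"
        by (rule closedin_continuous_map_preimage[OF dc]) simp
      have "compactin (subtopology X ?T) N" using V0(2) NT by (simp add: compactin_subtopology)
      then have "compactin (subtopology X ?T) (N \<inter> ({q \<in> topspace (subtopology X ?T). ?\<pi> q \<in> {y}} \<inter>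
          {q \<in> topspace (subtopology X ?T). ?d q \<in> {\<epsilon> / 2}}))"
        by (rule compact_Int_closedin[OF _ closedin_Int[OF c1 c2]])
      moreover have "N \<inter> ({q \<in> topspace (subtopology X ?T). ?\<pi> q \<in> {y}} \<inter>
          {q \<in> topspace (subtopology X ?T). ?d q \<in> {\<epsilon> / 2}}) = Kf" unfolding Kf_def topT using NT by auto
      ultimately show ?thesis by (simp add: compactin_subtopology)
    qed
    have KW: "Kf \<subseteq> W" unfolding Kf_def B(1) Wt_def using B(4,6) by auto
    \<comment> \<open>Points of the fibre lie in the tube but off the stratum, hence in strata of
      larger dimension, where stability is known.\<close>
    have stq: "costalk_stable X F q" if q: "q \<in> Kf" for q
    proof -
      have qN: "q \<in> N" "?d q \<noteq> 0" using q B(6) unfolding Kf_def by auto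
      then have qX: "q \<notin> ?X" using td(3)[of q] NT by auto
      have "q \<in> topspace X" using qN compactin_subset_topspace[OF V0(2)] by blast
      then obtain \<tau> where \<tau>: "\<tau> \<in> strata S" "q \<in> stratum S \<tau>" using dec(1) by blast
      then have "\<tau> \<noteq> \<sigma>" using qX by blast
      moreover have "tube S \<sigma> \<inter> stratum S \<tau> \<noteq> {}" using qN NT \<tau> by blast
      ultimately have "sdim S \<sigma> < sdim S \<tau>" using stratum_submersion(2)[OF tm \<sigma>(1) \<tau>(1)] by blast
      then show ?thesis using IH[OF \<tau>(1) _ \<tau>(2)] qN \<open>N \<subseteq> ?T \<inter> Q\<close> by blast
    qed
    let ?good = "\<lambda>q V. openin X V \<and> q \<in> V \<and> V \<subseteq> W \<and>
      (\<forall>v\<in>carrier (at_open F V). \<exists>s\<in>carrier (costalk X F q). s W = arrow F V W v)"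
    have "\<exists>V. ?good q V" if q: "q \<in> Kf" for q
    proof -
      have qW: "q \<in> W" using q KW by blast
      show ?thesis
        by (rule mp[OF spec[OF stq[OF q, unfolded costalk_stable_def], of W] conjI[OF g(1) qW]])
    qed
    then have "\<exists>V. \<forall>q\<in>Kf. ?good q (V q)" by (intro bchoice ballI)
    then obtain V where VK: "\<forall>q\<in>Kf. ?good q (V q)" by (rule exE)
    note V = conjunct1[OF bspec[OF VK]] conjunct1[OF conjunct2[OF bspec[OF VK]]]
      conjunct1[OF conjunct2[OF conjunct2[OF bspec[OF VK]]]]
      bspec[OF conjunct2[OF conjunct2[OF conjunct2[OF bspec[OF VK]]]]]
    have "\<exists>\<F>. finite \<F> \<and> \<F> \<subseteq> V ` Kf \<and> Kf \<subseteq> \<Union>\<F>"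
    proof -
      have "(\<forall>U\<in>V ` Kf. openin X U) \<and> Kf \<subseteq> \<Union>(V ` Kf)" using V(1,2) by blast
      then show ?thesis using Kc unfolding compactin_def by simp
    qed
    then obtain \<F> where \<F>: "finite \<F>" "\<F> \<subseteq> V ` Kf" "Kf \<subseteq> \<Union>\<F>" by (elim exE conjE)
    obtain I where "I \<subseteq> Kf" "finite I" "\<F> = V ` I" using finite_subset_image[OF \<F>(1,2)] by (elim exE conjE)
    then have I: "finite I" "I \<subseteq> Kf" "Kf \<subseteq> (\<Union>q\<in>I. V q)" using \<F>(3) by simp_all
    let ?H = "\<lambda>q. (\<lambda>s. s W) ` carrier (costalk X F q)"
    have lin: "linear_map K (costalk X F q) (at_open F W) (\<lambda>s. s W)" if "q \<in> I" for q
      by (rule linear_map_costalk[OF g(1)]) (use that I(2) KW in blast)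
    have vsq: "vspace K (costalk X F q)" for q by (rule vspace_costalk[OF K F])
    note mq = vspace_module[OF vsq]
    have cq: "submodule (carrier (costalk X F q)) K (costalk X F q)" for q by (rule module.carrier_is_submodule[OF mq])
    have fdq: "fin_dim K (costalk X F q)" if "q \<in> I" for q
      using fd that I(2) KW openin_subset[OF g(1)] by blast
    \<comment> \<open>The costalks at the finitely many points chosen by compactness are
      finite-dimensional, so their images in \<open>at_open F W\<close> lie in one artinian
      subspace.\<close>
    obtain R where R: "submodule R K (at_open F W)" "artinian K (at_open F W) R" "\<And>q. q \<in> I \<Longrightarrow> ?H q \<subseteq> R"
    proof (rule artinian_finite_sum[OF P(1)[OF g(1)] I(1), of ?H])
      show "submodule (?H q) K (at_open F W)" if "q \<in> I" for q
        by (rule submodule_image[OF mq M.module_axioms lin[OF that] cq])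
      show "artinian K (at_open F W) (?H q)" if "q \<in> I" for q
        by (rule artinian_image[OF mq M.module_axioms lin[OF that] cq fin_dim_imp_artinian[OF vsq fdq[OF that]]])
    qed (rule that)
    \<comment> \<open>Otherwise a functional separates some element of \<open>PP W\<close> from
      \<open>R\<close>. It kills the images of the covering sets \<open>V p\<close>, so its germs
      vanish on the fibre, hence on all of \<open>off W\<close>, and then it kills
      \<open>PP W\<close>.\<close>
    have "PP W \<subseteq> R"
    proof
      fix x assume x: "x \<in> PP W"
      then obtain v where v: "v \<in> carrier (at_open F (off W))" "x = arrow F (off W) W v" unfolding PP_def by blast
      have xM: "x \<in> carrier (at_open F W)" using linear_map_closed[OF P(2)[OF g(4,1,5)] v(1)] v(2) by simp
      show "x \<in> R"
      proof (rule ccontr)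
        assume "x \<notin> R"
        then obtain \<phi> where \<phi>: "\<phi> \<in> carrier (dual_space K (at_open F W))" "\<forall>n\<in>R. \<phi> n = \<zero>\<^bsub>K\<^esub>" "\<phi> x = \<one>\<^bsub>K\<^esub>"
          by (rule dual_separates[OF P(1)[OF g(1)] R(1) xM])
        have zf: "zero_germ X K F W \<phi> q" if q: "q \<in> N" "?\<pi> q = y" "?d q = \<epsilon> / 2" for q
        proof -
          have "q \<in> Kf" using q unfolding Kf_def by simp
          then obtain p where p: "p \<in> I" "q \<in> V p" using I(3) by blast
          then have pK: "p \<in> Kf" using I(2) by blast
          have "\<phi> (arrow F (V p) W w) = \<zero>\<^bsub>K\<^esub>" if w: "w \<in> carrier (at_open F (V p))" for w
          proof -
            obtain s where s: "s \<in> carrier (costalk X F p)" "s W = arrow F (V p) W w" using V(4)[OF pK w] by (elim bexE)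
            have "s W \<in> R" using R(3)[OF p(1)] s(1) by blast
            then show ?thesis using \<phi>(2) s(2) by simp
          qed
          then show ?thesis unfolding zero_germ_def
            by (intro exI[of _ "V p"] conjI V(1)[OF pK] p(2) V(3)[OF pK] ballI)
        qed
        have "\<phi> (arrow F (off W) W v) = \<zero>\<^bsub>K\<^esub>"
        proof (rule zero_germs_imp_zero[OF cosh g(1) \<phi>(1) g(4,5) _ v(1)])
          fix z assume z: "z \<in> off W"
          show "zero_germ X K F W \<phi> z"
          proof (rule zero_germ_off_stratum[OF tm F lc \<sigma>(1) V0(2) NT g(1) \<phi>(1) B(2,3,4), of "\<epsilon> / 2" \<epsilon> W])
            show "W = {q \<in> N. ?\<pi> q \<in> B \<and> ?d q < \<epsilon>}" unfolding B(1) Wt_def ..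
          qed (use z B(6) g(1) zf in \<open>auto simp: off_def\<close>)
        qed
        then have "\<one>\<^bsub>K\<^esub> = \<zero>\<^bsub>K\<^esub>" using \<phi>(3) v(2) by simp
        then show False using K domain.one_not_zero field.axioms(1) by blast
      qed
    qed
    then show ?thesis by (rule artinian_subset[OF R(2)])
  qed
  \<comment> \<open>A functional killing both \<open>PP W\<close> and the image of W' has zero germs
    off the stratum and zero germ at y. Connectedness of B spreads the latter over the trace of W on
    the stratum. With all germs zero, the functional is zero.\<close>
  have gen: "\<exists>w\<in>carrier (at_open F W'). arrow F W' W w \<ominus>\<^bsub>at_open F W\<^esub> v \<in> PP W"
    if W: "good W" "good W'" "W' \<subseteq> W" and v: "v \<in> carrier (at_open F W)" for W W' v
  proof -
    note g = good1[OF W(1)] and g' = good1[OF W(2)]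
    interpret M: module K "at_open F W" by (rule FU[OF g(1)])
    let ?I = "arrow F W' W ` carrier (at_open F W')"
    have Is: "submodule ?I K (at_open F W)"
      by (rule submodule_image[OF FU[OF g'(1)] M.module_axioms P(2)[OF g'(1) g(1) W(3)] module.carrier_is_submodule[OF FU[OF g'(1)]]])
    note sum = M.submodule_set_add[OF PPs[OF W(1)] Is] and incl = M.subset_set_add[OF PPs[OF W(1)] Is]
    have "v \<in> PP W <+>\<^bsub>at_open F W\<^esub> ?I"
    proof (rule ccontr)
      assume "v \<notin> PP W <+>\<^bsub>at_open F W\<^esub> ?I"
      then obtain \<phi> where \<phi>: "\<phi> \<in> carrier (dual_space K (at_open F W))"
        "\<forall>n\<in>PP W <+>\<^bsub>at_open F W\<^esub> ?I. \<phi> n = \<zero>\<^bsub>K\<^esub>" "\<phi> v = \<one>\<^bsub>K\<^esub>"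
        by (rule dual_separates[OF P(1)[OF g(1)] sum v])
      obtain B \<epsilon> where B: "W = Wt B \<epsilon>" "openin ?A B" "connectedin X B" "y \<in> B" "B \<subseteq> B0 \<inter> V0" "0 < \<epsilon>" "\<epsilon> \<le> \<epsilon>0"
        using W(1) unfolding good_def by blast
      have WB: "W \<inter> ?X = B" using gW[OF B(1,2,4-7)] by blast
      have zy: "zero_germ X K F W \<phi> y" unfolding zero_germ_def
        using g'(1,2) W(3) \<phi>(2) incl(2) by (intro exI[of _ W']) blast
      have "zero_germ X K F W \<phi> z" if z: "z \<in> W" for z
      proof (cases "z \<in> ?X")
        case True
        then have zB: "z \<in> B" using z WB by blast
        show ?thesis
          by (rule zero_germ_connected[OF F lc[OF \<sigma>(1)] g(1) \<phi>(1) B(3) _ _ B(4) zB zy]) (use WB in auto)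
      next
        case False
        then show ?thesis unfolding zero_germ_def
          using g(4,5) z \<phi>(2) incl(1) unfolding PP_def by (intro exI[of _ "off W"]) (auto simp: off_def)
      qed
      then have "\<phi> (arrow F W W v) = \<zero>\<^bsub>K\<^esub>" by (rule zero_germs_imp_zero[OF cosh g(1) \<phi>(1) g(1) subset_refl _ v])
      then have "\<one>\<^bsub>K\<^esub> = \<zero>\<^bsub>K\<^esub>" using \<phi>(3) P(3)[OF g(1) v] by simp
      then show False using K domain.one_not_zero field.axioms(1) by blast
    qed
    then obtain p i where pi: "p \<in> PP W" "i \<in> ?I" "v = p \<oplus>\<^bsub>at_open F W\<^esub> i" by (rule set_addE)
    have pM: "p \<in> carrier (at_open F W)" "i \<in> carrier (at_open F W)"
      using pi(1,2) M.submoduleE(1)[OF PPs[OF W(1)]] M.submoduleE(1)[OF Is] by auto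
    have "i \<ominus>\<^bsub>at_open F W\<^esub> v = \<ominus>\<^bsub>at_open F W\<^esub> p"
      unfolding pi(3) using pM by (simp add: a_minus_def M.M.minus_add M.M.a_ac M.M.r_neg1 M.M.r_neg2 M.M.r_neg)
    then have "i \<ominus>\<^bsub>at_open F W\<^esub> v \<in> PP W" using M.submoduleE(3)[OF PPs[OF W(1)] pi(1)] by simp
    then show ?thesis using pi(2) by blast
  qed
  \<comment> \<open>Second countability supplies a countable basis at y, from which a decreasing
    sequence of good neighbourhoods is chosen.\<close>
  obtain \<B> where \<B>0: "countable \<B>" "\<forall>V\<in>\<B>. openin X V"
    "\<forall>U x. openin X U \<and> x \<in> U \<longrightarrow> (\<exists>V\<in>\<B>. x \<in> V \<and> V \<subseteq> U)"
    using thom_matherD(3)[OF tm] unfolding second_countable_def by (elim exE conjE) (rule that)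
  note \<B> = \<B>0(1) bspec[OF \<B>0(2)] mp[OF spec[OF spec[OF \<B>0(3)]], OF conjI]
  define \<B>y where "\<B>y = {V \<in> \<B>. y \<in> V}"
  have "\<B>y \<noteq> {}" using \<B>(3)[OF openin_topspace yX] unfolding \<B>y_def by blast
  moreover have "countable \<B>y" using \<B>(1) unfolding \<B>y_def by simp
  ultimately have rng: "range (from_nat_into \<B>y) = \<B>y" by (rule range_from_nat_into)
  define Vn where "Vn = from_nat_into \<B>y"
  have Vn: "openin X (Vn n)" "y \<in> Vn n" for n
    using rng \<B>(2) unfolding Vn_def \<B>y_def by auto
  have "\<exists>W. \<forall>n. (good (W n) \<and> W n \<subseteq> Vn n) \<and> W (Suc n) \<subseteq> W n"
  proof (rule dependent_nat_choice)
    show "\<exists>W. good W \<and> W \<subseteq> Vn 0" using good_small[OF Vn] .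
    fix W n assume W: "good W \<and> W \<subseteq> Vn n"
    have "openin X (W \<inter> Vn (Suc n))" "y \<in> W \<inter> Vn (Suc n)" using good1(1,2)[of W] W Vn[of "Suc n"] by auto
    then obtain W' where "good W'" "W' \<subseteq> W \<inter> Vn (Suc n)" using good_small by blast
    then show "\<exists>W'. (good W' \<and> W' \<subseteq> Vn (Suc n)) \<and> W' \<subseteq> W" by blast
  qed
  then obtain W where W: "\<And>n. good (W n)" "\<And>n. W n \<subseteq> Vn n" "\<And>n. W (Suc n) \<subseteq> W n" by blast
  have mono: "W m \<subseteq> W n" if "n \<le> m" for m n
    using that W(3) by (induction rule: dec_induct) auto
  show ?thesis
  proof (rule costalk_stableI[OF K F fd[OF yX], of W "\<lambda>n. PP (W n)"])
    show "openin X (W n)" "y \<in> W n" "W (Suc n) \<subseteq> W n" for n using good1(1,2)[OF W(1)] W(3) by auto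
    show "\<exists>n. W n \<subseteq> U" if U: "openin X U" "y \<in> U" for U
    proof -
      obtain V where V: "V \<in> \<B>y" "V \<subseteq> U" using \<B>(3)[OF U] unfolding \<B>y_def by blast
      then obtain n where "V = Vn n" using rng unfolding Vn_def by blast
      then show ?thesis using W(2)[of n] V(2) by blast
    qed
    show "submodule (PP (W n)) K (at_open F (W n))" for n by (rule PPs[OF W(1)])
    show "artinian K (at_open F (W n)) (PP (W n))" for n by (rule PPart[OF W(1)])
    show "arrow F (W m) (W n) p \<in> PP (W n)" if "n \<le> m" "p \<in> PP (W m)" for m n p
      by (rule PPmap[OF W(1) W(1) mono[OF that(1)] that(2)])
    show "\<exists>w\<in>carrier (at_open F (W (Suc n))). arrow F (W (Suc n)) (W n) w \<ominus>\<^bsub>at_open F (W n)\<^esub> v \<in> PP (W n)"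
      if "v \<in> carrier (at_open F (W n))" for n v by (rule gen[OF W(1) W(1) W(3) that])
  qed
qed

text \<open>Downward induction on the dimension of the stratum. It terminates because only finitely
  many strata occur near x, so that \<open>D\<close> bounds their dimensions there.\<close>

lemma costalk_stable:
  assumes K: "Ring.field K" and tm: "thom_mather X S" and cosh: "cosheaf X K F"
    and fd: "\<And>x. x \<in> topspace X \<Longrightarrow> fin_dim K (costalk X F x)"
    and lc: "\<And>\<tau>. \<tau> \<in> strata S \<Longrightarrow> locally_constant_on X K (dual_diagram K F) (stratum S \<tau>)"
    and x: "x \<in> topspace X"
  shows "costalk_stable X F x"
proof -
  note dec = decompositionD[OF thom_matherD(4)[OF tm]]
  obtain Q where Q: "openin X Q" "x \<in> Q" "finite {\<sigma>\<in>strata S. stratum S \<sigma> \<inter> Q \<noteq> {}}" using dec(4)[OF x] by blast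
  define D where "D = Max (insert 0 (sdim S ` {\<sigma>\<in>strata S. stratum S \<sigma> \<inter> Q \<noteq> {}}))"
  have D: "sdim S \<sigma> \<le> D" if "\<sigma> \<in> strata S" "y \<in> stratum S \<sigma>" "y \<in> Q" for \<sigma> y
    unfolding D_def using Q(3) that by (intro Max_ge) auto
  have *: "costalk_stable X F y" if "\<sigma> \<in> strata S" "y \<in> stratum S \<sigma>" "y \<in> Q" for \<sigma> y
    using that
  proof (induction "D - sdim S \<sigma>" arbitrary: \<sigma> y rule: less_induct)
    case less
    show ?case
    proof (rule costalk_stable_step[OF K tm cosh fd lc less.prems(1,2) Q(1) less.prems(3)])
      fix \<tau> q assume \<tau>: "\<tau> \<in> strata S" "sdim S \<sigma> < sdim S \<tau>" "q \<in> stratum S \<tau>" "q \<in> Q"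
      have "D - sdim S \<tau> < D - sdim S \<sigma>" using \<tau>(2) D[OF \<tau>(1,3,4)] by linarith
      then show "costalk_stable X F q" using less.hyps[OF _ \<tau>(1,3,4)] by blast
    qed
  qed
  obtain \<sigma> where "\<sigma> \<in> strata S" "x \<in> stratum S \<sigma>" using dec(1)[OF x] by blast
  then show ?thesis using * Q(2) by blast
qed

section \<open>Costalks along a stratum\<close>

text \<open>Choose u with \<psi> u = c nonzero. By injectivity f u lies outside the image of the
  kernel of \<psi>, so a functional separates it from that image; this functional agrees with \<psi>
  up to the factor c.\<close>

lemma dual_extend:
  assumes M: "vspace K M" and N: "vspace K N" and f: "linear_map K M N f" and inj: "inj_on f (carrier M)"
    and \<psi>: "\<psi> \<in> carrier (dual_space K M)"
  obtains \<phi> where "\<phi> \<in> carrier (dual_space K N)" "\<forall>r\<in>carrier M. \<phi> (f r) = \<psi> r"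
proof (cases "\<forall>r\<in>carrier M. \<psi> r = \<zero>\<^bsub>K\<^esub>")
  case True
  have "\<forall>r\<in>carrier M. (\<lambda>v\<in>carrier N. \<zero>\<^bsub>K\<^esub>) (f r) = \<psi> r" using True linear_map_closed[OF f] by simp
  then show thesis by (rule that[OF zero_functional_closed[OF N]])
next
  case False
  interpret field K using M by (simp add: vspace_def)
  interpret M: module K M by (rule vspace_module[OF M])
  interpret N: module K N by (rule vspace_module[OF N])
  from False obtain u where u: "u \<in> carrier M" "\<psi> u \<noteq> \<zero>\<^bsub>K\<^esub>" by auto
  define c where "c = \<psi> u"
  have c: "c \<in> carrier K" "c \<noteq> \<zero>\<^bsub>K\<^esub>" using u dualD(1)[OF \<psi>] unfolding c_def by auto
  then have ic: "inv\<^bsub>K\<^esub> c \<in> carrier K" "inv\<^bsub>K\<^esub> c \<otimes>\<^bsub>K\<^esub> c = \<one>\<^bsub>K\<^esub>" "c \<otimes>\<^bsub>K\<^esub> inv\<^bsub>K\<^esub> c = \<one>\<^bsub>K\<^esub>" using field_Units by auto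
  let ?k = "{r \<in> carrier M. \<psi> r = \<zero>\<^bsub>K\<^esub>}"
  have sub: "submodule (f ` ?k) K N"
    by (rule submodule_image[OF M.module_axioms N.module_axioms f dual_kernel[OF M \<psi>]])
  have fu: "f u \<in> carrier N" by (rule linear_map_closed[OF f u(1)])
  have "f u \<notin> f ` ?k"
  proof
    assume "f u \<in> f ` ?k"
    then obtain r where "r \<in> carrier M" "\<psi> r = \<zero>\<^bsub>K\<^esub>" "f u = f r" by auto
    then show False using inj_onD[OF inj, of u r] u by simp
  qed
  then obtain \<phi> where \<phi>: "\<phi> \<in> carrier (dual_space K N)" "\<forall>n\<in>f ` ?k. \<phi> n = \<zero>\<^bsub>K\<^esub>" "\<phi> (f u) = \<one>\<^bsub>K\<^esub>"
    by (rule dual_separates[OF N sub fu])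
  have val: "\<phi> (f r) = \<psi> r \<otimes>\<^bsub>K\<^esub> inv\<^bsub>K\<^esub> c" if r: "r \<in> carrier M" for r
  proof -
    let ?a = "\<psi> r \<otimes>\<^bsub>K\<^esub> inv\<^bsub>K\<^esub> c"
    let ?r = "r \<ominus>\<^bsub>M\<^esub> ?a \<odot>\<^bsub>M\<^esub> u"
    have \<psi>r: "\<psi> r \<in> carrier K" by (rule dualD(1)[OF \<psi> r])
    then have a: "?a \<in> carrier K" using ic by simp
    have au: "?a \<odot>\<^bsub>M\<^esub> u \<in> carrier M" using a u by simp
    have "\<psi> (?a \<odot>\<^bsub>M\<^esub> u) = ?a \<otimes>\<^bsub>K\<^esub> c" using dualD(3)[OF \<psi> a u(1)] by (simp add: c_def)
    then have "\<psi> ?r = \<psi> r \<ominus>\<^bsub>K\<^esub> ?a \<otimes>\<^bsub>K\<^esub> c" using dual_zero_neg(3)[OF M \<psi> r au] by simp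
    also have "?a \<otimes>\<^bsub>K\<^esub> c = \<psi> r" using \<psi>r ic c by (simp add: m_assoc)
    finally have "\<psi> ?r = \<zero>\<^bsub>K\<^esub>" using \<psi>r by (simp add: a_minus_def r_neg)
    then have "\<phi> (f ?r) = \<zero>\<^bsub>K\<^esub>" using \<phi>(2) r au by simp
    moreover have "f ?r = f r \<ominus>\<^bsub>N\<^esub> ?a \<odot>\<^bsub>N\<^esub> f u"
      using linear_map_minus[OF M.module_axioms N.module_axioms f r au] linear_map_smult[OF f a u(1)] by simp
    moreover have "\<phi> (f r \<ominus>\<^bsub>N\<^esub> ?a \<odot>\<^bsub>N\<^esub> f u) = \<phi> (f r) \<ominus>\<^bsub>K\<^esub> ?a"
      using dual_zero_neg(3)[OF N \<phi>(1), of "f r" "?a \<odot>\<^bsub>N\<^esub> f u"] dualD(3)[OF \<phi>(1) a fu] \<phi>(3) a fu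
        linear_map_closed[OF f r] by simp
    ultimately have "\<phi> (f r) \<ominus>\<^bsub>K\<^esub> ?a = \<zero>\<^bsub>K\<^esub>" by simp
    then show ?thesis
      by (rule abelian_group.minus_eq_zeroD[OF abelian_group_axioms _ dualD(1)[OF \<phi>(1) linear_map_closed[OF f r]] a])
  qed
  interpret D: module K "dual_space K N" by (rule vspace_module[OF vspace_dual_space[OF N]])
  show thesis
  proof (rule that)
    show "c \<odot>\<^bsub>dual_space K N\<^esub> \<phi> \<in> carrier (dual_space K N)" using c \<phi>(1) by simp
    show "\<forall>r\<in>carrier M. (c \<odot>\<^bsub>dual_space K N\<^esub> \<phi>) (f r) = \<psi> r"
    proof
      fix r assume r: "r \<in> carrier M"
      have "c \<otimes>\<^bsub>K\<^esub> (\<psi> r \<otimes>\<^bsub>K\<^esub> inv\<^bsub>K\<^esub> c) = \<psi> r"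
        using dualD(1)[OF \<psi> r] c ic m_lcomm[of c "\<psi> r" "inv\<^bsub>K\<^esub> c"] by simp
      then show "(c \<odot>\<^bsub>dual_space K N\<^esub> \<phi>) (f r) = \<psi> r"
        using dual_ops(2)[OF linear_map_closed[OF f r]] val[OF r] by simp
    qed
  qed
qed

locale constructible_cosheaf_on_strata =
  fixes X :: "'x topology" and S :: "('i, 'x) stratification"
    and K :: "'k ring" and F :: "('x, 'k, 'v) open_diagram"
  assumes K_field: "Ring.field K"
    and tm: "thom_mather X S"
    and cosh: "cosheaf X K F"
    and fin: "\<And>x. x \<in> topspace X \<Longrightarrow> fin_dim K (costalk X F x)"
    and lc: "\<And>\<sigma>. \<sigma> \<in> strata S \<Longrightarrow> locally_constant_on X K (dual_diagram K F) (stratum S \<sigma>)"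
begin

abbreviation E :: "'x \<Rightarrow> ('x set \<Rightarrow> 'v) set" where
  "E x \<equiv> carrier (costalk X F x)"

lemma F: "precosheaf X K F"
  using cosh unfolding cosheaf_def by simp

lemmas P = precosheafD[OF F]
lemmas dec = decompositionD[OF thom_matherD(4)[OF tm]]

lemma stable: "x \<in> topspace X \<Longrightarrow> costalk_stable X F x"
  by (rule costalk_stable[OF K_field tm cosh fin lc])

lemmas vspace_E = vspace_costalk[OF K_field F]

lemma one_neq_zero: "\<one>\<^bsub>K\<^esub> \<noteq> \<zero>\<^bsub>K\<^esub>"
  using K_field domain.one_not_zero field.axioms(1) by blast

text \<open>If the image of the costalk at y' missed \<open>s U\<close>, a functional separating
  them would have zero germ at y' by stability, hence zero germ at y along the connected set, and
  would then kill \<open>s U\<close>.\<close>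

lemma costalk_image_along_stratum:
  assumes U: "openin X U" and C: "connectedin X C" "C \<subseteq> stratum S \<sigma>" "C \<subseteq> U" "y \<in> C" "y' \<in> C"
    and \<sigma>: "\<sigma> \<in> strata S" and s: "s \<in> E y"
  shows "\<exists>s'\<in>E y'. s' U = s U"
proof (rule ccontr)
  assume n: "\<not> (\<exists>s'\<in>E y'. s' U = s U)"
  have yU: "y \<in> U" "y' \<in> U" using C by auto
  have yX: "y \<in> topspace X" "y' \<in> topspace X" using yU openin_subset[OF U] by auto
  have sub: "submodule ((\<lambda>s. s U) ` E y') K (at_open F U)"
    by (rule submodule_image[OF vspace_module[OF vspace_E] vspace_module[OF P(1)[OF U]] linear_map_costalk[OF U yU(2)]
          module.carrier_is_submodule[OF vspace_module[OF vspace_E]]])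
  have "s U \<notin> (\<lambda>s. s U) ` E y'" using n by force
  then obtain \<phi> where \<phi>: "\<phi> \<in> carrier (dual_space K (at_open F U))" "\<forall>n\<in>(\<lambda>s. s U) ` E y'. \<phi> n = \<zero>\<^bsub>K\<^esub>" "\<phi> (s U) = \<one>\<^bsub>K\<^esub>"
    by (rule dual_separates[OF P(1)[OF U] sub costalkD(1)[OF s U yU(1)]])
  have "zero_germ X K F U \<phi> y'"
    using \<phi>(2) by (subst stable_zero_germ_iff[OF F stable[OF yX(2)] U yU(2)]) simp
  then have "zero_germ X K F U \<phi> y" by (rule zero_germ_connected[OF F lc[OF \<sigma>] U \<phi>(1) C(1,2,3,5,4)])
  then have "\<phi> (s U) = \<zero>\<^bsub>K\<^esub>" using s unfolding stable_zero_germ_iff[OF F stable[OF yX(1)] U yU(1)] by blast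
  then show False using \<phi>(3) one_neq_zero by simp
qed

text \<open>A costalk element at y' that dies in U pairs non-trivially with some germ at y'. Local
  constancy moves this germ to y, where it extends to U because the costalk at y injects.\<close>

lemma costalk_injective_along_stratum:
  assumes \<sigma>: "\<sigma> \<in> strata S" and y: "y \<in> stratum S \<sigma>" and U: "openin X U" "y \<in> U"
    and inj: "inj_on (\<lambda>s. s U) (E y)"
  obtains W where "openin X W" "y \<in> W" "W \<subseteq> U" "connectedin X (W \<inter> stratum S \<sigma>)"
    "\<forall>y'\<in>W \<inter> stratum S \<sigma>. inj_on (\<lambda>s. s U) (E y')"
proof -
  let ?G = "dual_diagram K F" and ?Z = "stratum S \<sigma>"
  have yX: "y \<in> topspace X" by (rule dec(2)[OF \<sigma> y])
  note G = presheaf_dual[OF F]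
  obtain W0 where W0: "openin (subtopology X ?Z) W0" "y \<in> W0"
    "\<And>z Q s. openin (subtopology X ?Z) Q \<Longrightarrow> z \<in> Q \<Longrightarrow> Q \<subseteq> W0 \<Longrightarrow> s \<in> sections X K ?G Q \<Longrightarrow>
      \<exists>s'\<in>sections X K ?G W0. s' z = s z"
    by (rule sections_extend[OF lc[OF \<sigma>] y yX]) (rule that, assumption, assumption, blast)
  have o: "openin (subtopology X ?Z) (W0 \<inter> (?Z \<inter> U))"
    by (intro openin_Int W0(1) openin_subtopology_Int2 U(1))
  have yo: "y \<in> W0 \<inter> (?Z \<inter> U)" using W0(2) y U(2) by simp
  obtain C where C: "openin (subtopology X ?Z) C" "connectedin (subtopology X ?Z) C" "y \<in> C" "C \<subseteq> W0 \<inter> (?Z \<inter> U)"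
    by (rule locally_connected_manifold[OF thom_matherD(5)[OF tm \<sigma>] o yo])
  obtain T where T: "openin X T" "C = T \<inter> ?Z" using C(1) unfolding openin_subtopology by (elim exE conjE)
  have cC: "connectedin X C" using C(2) by (simp add: connectedin_subtopology)
  define W where "W = T \<inter> U"
  have WC: "W \<inter> ?Z = C" using T C(4) unfolding W_def by auto
  have "inj_on (\<lambda>s. s U) (E y')" if y': "y' \<in> C" for y'
  proof (rule inj_onI, rule ccontr)
    fix a b assume ab: "a \<in> E y'" "b \<in> E y'" "a U = b U" "a \<noteq> b"
    have y'U: "y' \<in> U" using y' C(4) by auto
    have "\<not> (\<forall>V. openin X V \<and> y' \<in> V \<longrightarrow> a V = b V)" using costalk_eqI[OF ab(1,2)] ab(4) by auto
    then obtain V where V: "openin X V" "y' \<in> V" "a V \<noteq> b V" by auto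
    interpret V: module K "at_open F V" by (rule vspace_module[OF P(1)[OF V(1)]])
    have abV: "a V \<in> carrier (at_open F V)" "b V \<in> carrier (at_open F V)"
      using costalkD(1)[OF ab(1) V(1,2)] costalkD(1)[OF ab(2) V(1,2)] by auto
    have dV: "a V \<ominus>\<^bsub>at_open F V\<^esub> b V \<in> carrier (at_open F V)" using abV by simp
    have "a V \<ominus>\<^bsub>at_open F V\<^esub> b V \<notin> {\<zero>\<^bsub>at_open F V\<^esub>}" using V.M.minus_eq_zeroD[OF _ abV] V(3) by auto
    then obtain \<phi> where \<phi>: "\<phi> \<in> carrier (dual_space K (at_open F V))"
      "\<forall>n\<in>{\<zero>\<^bsub>at_open F V\<^esub>}. \<phi> n = \<zero>\<^bsub>K\<^esub>" "\<phi> (a V \<ominus>\<^bsub>at_open F V\<^esub> b V) = \<one>\<^bsub>K\<^esub>"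
      by (rule dual_separates[OF P(1)[OF V(1)] V.submodule_zero dV])
    have CV: "openin (subtopology X ?Z) (C \<inter> (?Z \<inter> V))" "y' \<in> C \<inter> (?Z \<inter> V)" "C \<inter> (?Z \<inter> V) \<subseteq> W0" "C \<inter> (?Z \<inter> V) \<subseteq> V"
      using C(1,4) openin_subtopology_Int2[OF V(1)] y' V(2) by auto
    \<comment> \<open>Local constancy carries the germ of \<phi> at y' to a section over all of
      \<open>W0\<close>, and so to y.\<close>
    obtain s' where s': "s' \<in> sections X K ?G W0" "s' y' = (\<lambda>w\<in>C \<inter> (?Z \<inter> V). germ X K ?G w V \<phi>) y'"
      using W0(3)[OF CV(1-3) functional_sections[OF F V(1) \<phi>(1) CV(4)]] by (elim bexE)
    have s'y': "s' y' = germ X K ?G y' V \<phi>" using s'(2) CV(2) by simp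
    have loc: "\<forall>z\<in>W0. \<exists>U t. openin X U \<and> z \<in> U \<and> t \<in> carrier (at_open ?G U) \<and> (\<forall>w\<in>U \<inter> W0. s' w = germ X K ?G w U t)"
      using s'(1) unfolding sections_iff by (rule conjunct2)
    obtain U2 \<phi>2 where U2: "openin X U2" "y \<in> U2" "\<phi>2 \<in> carrier (at_open ?G U2)" "\<forall>w\<in>U2 \<inter> W0. s' w = germ X K ?G w U2 \<phi>2"
      using bspec[OF loc W0(2)] by (elim exE conjE)
    have \<phi>2: "\<phi>2 \<in> carrier (dual_space K (at_open F U2))" using U2(3) by (simp add: dual_diagram_simps)
    have FU2: "vspace K (at_open F U2)" by (rule P(1)[OF U2(1)])
    let ?\<psi> = "\<lambda>r\<in>E y. \<phi>2 (r U2)"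
    have "?\<psi> \<in> carrier (dual_space K (costalk X F y))"
      by (rule linear_map_closed[OF linear_map_dual[OF vspace_module[OF vspace_E] vspace_module[OF FU2] linear_map_costalk[OF U2(1,2)]] \<phi>2])
    \<comment> \<open>Since the costalk at y embeds into \<open>at_open F U\<close>, the functional
      that \<phi>2 induces on the costalk extends to all of \<open>at_open F U\<close>.\<close>
    then obtain \<theta> where \<theta>: "\<theta> \<in> carrier (dual_space K (at_open F U))" "\<forall>r\<in>E y. \<theta> (r U) = ?\<psi> r"
      by (rule dual_extend[OF vspace_E P(1)[OF U(1)] linear_map_costalk[OF U] inj])
    \<comment> \<open>By stability at y, functionals that agree on the costalk have the same
      germ.\<close>
    have gy: "germ X K ?G y U \<theta> = germ X K ?G y U2 \<phi>2"
    proof -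
      have o3: "openin X (U \<inter> U2)" "y \<in> U \<inter> U2" using U U2 by auto
      obtain V3 where V3: "openin X V3" "y \<in> V3" "V3 \<subseteq> U \<inter> U2"
        "\<forall>v\<in>carrier (at_open F V3). \<exists>s\<in>E y. s (U \<inter> U2) = arrow F V3 (U \<inter> U2) v"
        by (rule costalk_stableE[OF stable[OF yX] o3])
      have "\<theta> (arrow F V3 U v) = \<phi>2 (arrow F V3 U2 v)" if v: "v \<in> carrier (at_open F V3)" for v
      proof -
        obtain r where r: "r \<in> E y" "r (U \<inter> U2) = arrow F V3 (U \<inter> U2) v" using bspec[OF V3(4) v] by (elim bexE)
        have "arrow F V3 U v = arrow F (U \<inter> U2) U (r (U \<inter> U2))" "arrow F V3 U2 v = arrow F (U \<inter> U2) U2 (r (U \<inter> U2))"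
          using P(4)[OF V3(1) o3(1) U(1) V3(3) _ v] P(4)[OF V3(1) o3(1) U2(1) V3(3) _ v] r(2) by auto
        then have "arrow F V3 U v = r U" "arrow F V3 U2 v = r U2"
          using costalkD(2)[OF r(1) o3 U(1)] costalkD(2)[OF r(1) o3 U2(1)] by auto
        then show ?thesis using \<theta>(2) r(1) by simp
      qed
      then show ?thesis unfolding germ_dual_eq_iff[OF F U \<theta>(1) U2(1,2) \<phi>2]
        using V3(1-3) by (intro exI[of _ V3]) simp
    qed
    have CU: "C \<subseteq> U" "C \<subseteq> W0" using C(4) by auto
    \<comment> \<open>The two sections agree at y, hence along the connected set up to y'. So the
      germ of \<phi> at y' comes from a functional on \<open>at_open F U\<close>, which cannot tell
      a from b.\<close>
    have "restrict s' C y' = (\<lambda>w\<in>C. germ X K ?G w U \<theta>) y'"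
    proof (rule sections_agree_connected[OF G lc[OF \<sigma>] C(1) restrict_in_sections[OF s'(1) CU(2)]
          functional_sections[OF F U(1) \<theta>(1) CU(1)] cC subset_refl C(3) y'])
      show "restrict s' C y = (\<lambda>w\<in>C. germ X K ?G w U \<theta>) y" using gy U2(2,4) W0(2) C(3) by simp
    qed
    then have "germ X K ?G y' U \<theta> = germ X K ?G y' V \<phi>" using y' s'y' by simp
    then obtain V4 where V4: "openin X V4" "y' \<in> V4" "V4 \<subseteq> U" "V4 \<subseteq> V"
      "\<forall>v\<in>carrier (at_open F V4). \<theta> (arrow F V4 U v) = \<phi> (arrow F V4 V v)"
      unfolding germ_dual_eq_iff[OF F U(1) y'U \<theta>(1) V(1,2) \<phi>(1)] by (elim exE conjE)
    have eq: "\<theta> (r U) = \<phi> (r V)" if r: "r \<in> E y'" for r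
      using bspec[OF V4(5) costalkD(1)[OF r V4(1,2)]] costalkD(2)[OF r V4(1,2) U(1) V4(3)] costalkD(2)[OF r V4(1,2) V(1) V4(4)]
      by simp
    have "\<phi> (a V) = \<phi> (b V)" using eq[OF ab(1)] eq[OF ab(2)] ab(3) by simp
    then have "\<phi> (a V \<ominus>\<^bsub>at_open F V\<^esub> b V) = \<zero>\<^bsub>K\<^esub>"
      using dual_zero_neg(3)[OF P(1)[OF V(1)] \<phi>(1) abV] dualD(1)[OF \<phi>(1) abV(2)] K_field
      by (simp add: a_minus_def abelian_group.r_neg[OF ring.is_abelian_group[OF cring.axioms(1)[OF domain.axioms(1)[OF field.axioms(1)]]]])
    then show False using \<phi>(3) one_neq_zero by simp
  qed
  then show thesis using that[of W] T(1) U C(3) T(2) cC WC unfolding W_def by auto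
qed

text \<open>Comparing values in \<open>at_open F U\<close> sends the costalks at points of W to the
  costalk at y, and within the stratum of y this comparison is bijective. It runs from nearby points
  towards y, as entrance paths do.\<close>

lemma transport_nbhd:
  assumes y: "y \<in> topspace X" and \<sigma>: "\<sigma> \<in> strata S" "y \<in> stratum S \<sigma>"
  obtains U W where "openin X U" "openin X W" "y \<in> W" "W \<subseteq> U" "inj_on (\<lambda>s. s U) (E y)"
    "\<forall>y'\<in>W. \<forall>s'\<in>E y'. \<exists>s\<in>E y. s U = s' U"
    "\<forall>y'\<in>W \<inter> stratum S \<sigma>. inj_on (\<lambda>s. s U) (E y')"
    "\<forall>y'\<in>W \<inter> stratum S \<sigma>. \<forall>s\<in>E y. \<exists>s'\<in>E y'. s' U = s U"
proof -
  obtain U where U: "openin X U" "y \<in> U" "inj_on (\<lambda>s. s U) (E y)"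
    by (rule costalk_injective_nbhd[OF K_field F fin[OF y] y])
  obtain V where V: "openin X V" "y \<in> V" "V \<subseteq> U" "\<forall>v\<in>carrier (at_open F V). \<exists>s\<in>E y. s U = arrow F V U v"
    by (rule costalk_stableE[OF stable[OF y] U(1,2)])
  obtain W where W: "openin X W" "y \<in> W" "W \<subseteq> U" "connectedin X (W \<inter> stratum S \<sigma>)"
    "\<forall>y'\<in>W \<inter> stratum S \<sigma>. inj_on (\<lambda>s. s U) (E y')"
    by (rule costalk_injective_along_stratum[OF \<sigma> U])
  have 1: "\<exists>s\<in>E y. s U = s' U" if y': "y' \<in> W \<inter> V" and s': "s' \<in> E y'" for y' s'
  proof -
    have y'V: "y' \<in> V" using y' by simp
    show ?thesis using bspec[OF V(4) costalkD(1)[OF s' V(1) y'V]] costalkD(2)[OF s' V(1) y'V U(1) V(3)] by simp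
  qed
  have 2: "\<exists>s'\<in>E y'. s' U = s U" if y': "y' \<in> W \<inter> stratum S \<sigma>" and s: "s \<in> E y" for y' s
    by (rule costalk_image_along_stratum[OF U(1) W(4) _ _ _ y' \<sigma>(1) s]) (use W(2,3) \<sigma>(2) in auto)
  show thesis
  proof (rule that[of U "W \<inter> V"])
    show "openin X (W \<inter> V)" using W V by auto
    show "\<forall>y'\<in>W \<inter> V. \<forall>s'\<in>E y'. \<exists>s\<in>E y. s U = s' U" using 1 by blast
    show "\<forall>y'\<in>W \<inter> V \<inter> stratum S \<sigma>. inj_on (\<lambda>s. s U) (E y')" using W(5) by blast
    show "\<forall>y'\<in>W \<inter> V \<inter> stratum S \<sigma>. \<forall>s\<in>E y. \<exists>s'\<in>E y'. s' U = s U" using 2 by blast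
  qed (use U W V in auto)
qed

text \<open>One U on which the costalk at y injects controls the values in every other neighbourhood
  U1: by stability s agrees on U \<inter> U1 with some q in the costalk at y, and injectivity forces
  q = r.\<close>

lemma costalk_eq_nearby:
  assumes U: "openin X U" "y \<in> U" and inj: "inj_on (\<lambda>s. s U) (E y)" and U1: "openin X U1" "y \<in> U1" and r: "r \<in> E y"
  obtains V where "openin X V" "y \<in> V" "V \<subseteq> U \<inter> U1" "\<forall>y'\<in>V. \<forall>s\<in>E y'. s U = r U \<longrightarrow> s U1 = r U1"
proof -
  have yX: "y \<in> topspace X" using U openin_subset by blast
  have o: "openin X (U \<inter> U1)" "y \<in> U \<inter> U1" using U U1 by auto
  obtain V where V: "openin X V" "y \<in> V" "V \<subseteq> U \<inter> U1"
    "\<forall>v\<in>carrier (at_open F V). \<exists>s\<in>E y. s (U \<inter> U1) = arrow F V (U \<inter> U1) v"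
    by (rule costalk_stableE[OF stable[OF yX] o])
  have "s U1 = r U1" if y': "y' \<in> V" and s: "s \<in> E y'" "s U = r U" for y' s
  proof -
    have y'o: "y' \<in> U \<inter> U1" using y' V(3) by blast
    obtain q where q: "q \<in> E y" "q (U \<inter> U1) = arrow F V (U \<inter> U1) (s V)"
      using bspec[OF V(4) costalkD(1)[OF s(1) V(1) y']] by (elim bexE)
    then have qs: "q (U \<inter> U1) = s (U \<inter> U1)" using costalkD(2)[OF s(1) V(1) y' o(1) V(3)] by simp
    have "q U = s U" using costalkD(2)[OF q(1) o U(1)] costalkD(2)[OF s(1) o(1) y'o U(1)] qs by simp
    then have "q = r" using inj_onD[OF inj _ q(1) r] s(2) by simp
    moreover have "q U1 = s U1" using costalkD(2)[OF q(1) o U1(1)] costalkD(2)[OF s(1) o(1) y'o U1(1)] qs by simp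
    ultimately show ?thesis by simp
  qed
  then show thesis using that V(1-3) by blast
qed

end

section \<open>Transport along entrance paths\<close>

text \<open>The infimum of the counterexamples would violate \<open>step\<close>. The step has to
  cover t0 itself and a little beyond it, so passing to suprema needs no separate condition.\<close>

lemma real_interval_induct:
  fixes a b :: real
  assumes step: "\<And>t0. t0 \<in> {a..b} \<Longrightarrow> (\<And>t. a \<le> t \<Longrightarrow> t < t0 \<Longrightarrow> P t) \<Longrightarrow>
      \<exists>\<epsilon>>0. \<forall>t\<in>{a..b}. t0 \<le> t \<and> t < t0 + \<epsilon> \<longrightarrow> P t"
    and t: "t \<in> {a..b}"
  shows "P t"
proof (rule ccontr)
  assume "\<not> P t"
  define A where "A = {t \<in> {a..b}. \<not> P t}"
  have ne: "A \<noteq> {}" using t \<open>\<not> P t\<close> unfolding A_def by blast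
  have bd: "bdd_below A" unfolding A_def by (rule bdd_belowI[of _ a]) auto
  define m where "m = Inf A"
  have am: "a \<le> m" unfolding m_def using ne by (intro cInf_greatest) (auto simp: A_def)
  have mle: "m \<le> x" if "x \<in> A" for x unfolding m_def by (rule cInf_lower[OF that bd])
  have "t \<in> A" using t \<open>\<not> P t\<close> unfolding A_def by blast
  then have mb: "m \<le> b" using mle[of t] t by auto
  have below: "P x" if "a \<le> x" "x < m" for x
  proof (rule ccontr)
    assume "\<not> P x"
    then have "x \<in> A" using that mb unfolding A_def by auto
    then show False using mle that by fastforce
  qed
  obtain \<epsilon> where \<epsilon>: "\<epsilon> > 0" "\<forall>t\<in>{a..b}. m \<le> t \<and> t < m + \<epsilon> \<longrightarrow> P t"
    using step[of m] am mb below by auto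
  obtain x where "x \<in> A" "x < m + \<epsilon>" using cInf_lessD[OF ne, of "m + \<epsilon>"] \<epsilon>(1) unfolding m_def by auto
  then show False using \<epsilon>(2) mle[of x] unfolding A_def by auto
qed

lemma pathin_nbhd:
  assumes "pathin X \<gamma>" "t \<in> {0..1}" "openin X U" "\<gamma> t \<in> U"
  obtains \<epsilon> where "\<epsilon> > 0" "\<forall>t'\<in>{0..1}. \<bar>t' - t\<bar> < \<epsilon> \<longrightarrow> \<gamma> t' \<in> U"
proof -
  have "openin (top_of_set {0..1}) {x \<in> topspace (top_of_set {0..1}). \<gamma> x \<in> U}"
    using assms(1) openin_continuous_map_preimage assms(3) unfolding pathin_def by blast
  then have "\<exists>e>0. \<forall>x'\<in>{0..1}. dist x' t < e \<longrightarrow> x' \<in> {x \<in> topspace (top_of_set {0..1}). \<gamma> x \<in> U}"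
    unfolding openin_euclidean_subtopology_iff using assms(2,4) by auto
  then obtain e where "e > 0" "\<forall>x'\<in>{0..1}. dist x' t < e \<longrightarrow> x' \<in> {x \<in> topspace (top_of_set {0..1}). \<gamma> x \<in> U}"
    by blast
  then show thesis using that[of e] by (auto simp: dist_real_def)
qed

section \<open>Flat families of costalk elements along a path\<close>

context constructible_cosheaf_on_strata
begin

text \<open>Continuity of a lift of \<gamma> to the costalks. Costalks at different times consist of
  families over different neighbourhoods, so constancy is tested in \<open>at_open F U\<close> for
  each U around the point, with a radius that may depend on U.\<close>

definition flat_on :: "(real \<Rightarrow> 'x) \<Rightarrow> real set \<Rightarrow> (real \<Rightarrow> 'x set \<Rightarrow> 'v) \<Rightarrow> bool" where
  "flat_on \<gamma> T s \<longleftrightarrow> (\<forall>t\<in>T. s t \<in> E (\<gamma> t)) \<and>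
     (\<forall>t\<in>T. \<forall>U. openin X U \<and> \<gamma> t \<in> U \<longrightarrow> (\<exists>\<epsilon>>0. \<forall>t'\<in>T. \<bar>t' - t\<bar> < \<epsilon> \<longrightarrow> s t' U = s t U))"

lemma flat_onD: "flat_on \<gamma> T s \<Longrightarrow> t \<in> T \<Longrightarrow> s t \<in> E (\<gamma> t)"
  unfolding flat_on_def by blast

lemma flat_onE:
  assumes "flat_on \<gamma> T s" "t \<in> T" "openin X U" "\<gamma> t \<in> U"
  obtains \<epsilon> where "\<epsilon> > 0" "\<forall>t'\<in>T. \<bar>t' - t\<bar> < \<epsilon> \<longrightarrow> s t' U = s t U"
  using assms unfolding flat_on_def by blast

lemma flat_on_subset: "flat_on \<gamma> T s \<Longrightarrow> T' \<subseteq> T \<Longrightarrow> flat_on \<gamma> T' s"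
  unfolding flat_on_def by (meson subsetD)

text \<open>Local constancy spreads along an interval that \<gamma> keeps inside U.\<close>

lemma flat_on_const:
  assumes s: "flat_on \<gamma> T s" and T: "{c..d} \<subseteq> T" and U: "openin X U" "\<gamma> ` {c..d} \<subseteq> U" and t: "t \<in> {c..d}"
  shows "s t U = s c U"
  using t
proof (rule real_interval_induct[rotated])
  fix t0 assume t0: "t0 \<in> {c..d}" and IH: "\<And>t. c \<le> t \<Longrightarrow> t < t0 \<Longrightarrow> s t U = s c U"
  have "t0 \<in> T" "\<gamma> t0 \<in> U" using t0 T U(2) by auto
  then obtain \<epsilon> where \<epsilon>: "\<epsilon> > 0" "\<forall>t'\<in>T. \<bar>t' - t0\<bar> < \<epsilon> \<longrightarrow> s t' U = s t0 U"
    using flat_onE[OF s _ U(1)] by blast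
  \<comment> \<open>A time slightly before t0, or c itself, at which the claim is already known. The
    same device recurs in the later inductions along an interval.\<close>
  define t1 where "t1 = max c (t0 - \<epsilon> / 2)"
  have t1: "t1 \<in> T" "\<bar>t1 - t0\<bar> < \<epsilon>" using t0 T \<epsilon>(1) unfolding t1_def by (auto simp: subset_iff)
  have "s t1 U = s c U"
  proof (cases "t0 = c")
    case True
    then have "t1 = c" using \<epsilon>(1) unfolding t1_def by simp
    then show ?thesis by simp
  next
    case False
    then have "c \<le> t1" "t1 < t0" using t0 \<epsilon>(1) unfolding t1_def by auto
    then show ?thesis by (rule IH)
  qed
  then have "s t0 U = s c U" using \<epsilon>(2) t1 by auto
  then have "\<forall>t\<in>{c..d}. t0 \<le> t \<and> t < t0 + \<epsilon> \<longrightarrow> s t U = s c U" using \<epsilon>(2) T by (auto simp: subset_iff)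
  then show "\<exists>\<epsilon>>0. \<forall>t\<in>{c..d}. t0 \<le> t \<and> t < t0 + \<epsilon> \<longrightarrow> s t U = s c U" using \<epsilon>(1) by blast
qed

text \<open>Flatness at t is checked in one U on which the costalk injects;
  \<open>costalk_eq_nearby\<close> passes to all other neighbourhoods.\<close>

lemma flat_at_injective:
  assumes \<gamma>: "pathin X \<gamma>" and T: "T \<subseteq> {0..1}" "t \<in> T"
    and U: "openin X U" "\<gamma> t \<in> U" "inj_on (\<lambda>s. s U) (E (\<gamma> t))" and s: "s t \<in> E (\<gamma> t)"
    and near: "\<epsilon> > 0" "\<forall>t'\<in>T. \<bar>t' - t\<bar> < \<epsilon> \<longrightarrow> s t' \<in> E (\<gamma> t') \<and> s t' U = s t U"
    and U1: "openin X U1" "\<gamma> t \<in> U1"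
  shows "\<exists>\<epsilon>>0. \<forall>t'\<in>T. \<bar>t' - t\<bar> < \<epsilon> \<longrightarrow> s t' U1 = s t U1"
proof -
  obtain V where V: "openin X V" "\<gamma> t \<in> V" "V \<subseteq> U \<inter> U1" "\<forall>y'\<in>V. \<forall>q\<in>E y'. q U = s t U \<longrightarrow> q U1 = s t U1"
    by (rule costalk_eq_nearby[OF U U1 s])
  have "t \<in> {0..1}" using T by blast
  then obtain \<delta> where \<delta>: "\<delta> > 0" "\<forall>t'\<in>{0..1}. \<bar>t' - t\<bar> < \<delta> \<longrightarrow> \<gamma> t' \<in> V"
    by (rule pathin_nbhd[OF \<gamma> _ V(1,2)])
  have "\<forall>t'\<in>T. \<bar>t' - t\<bar> < min \<epsilon> \<delta> \<longrightarrow> s t' U1 = s t U1"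
    using near(2) \<delta>(2) V(4) T(1) by (auto simp: subset_iff)
  then show ?thesis using near(1) \<delta>(1) by (intro exI[of _ "min \<epsilon> \<delta>"]) simp
qed

lemma entrance_pathD:
  assumes "entrance_path X S x y \<gamma>"
  shows "pathin X \<gamma>" "\<gamma> 0 = x" "\<gamma> 1 = y" "t \<in> {0..1} \<Longrightarrow> \<gamma> t \<in> topspace X"
proof -
  show "pathin X \<gamma>" "\<gamma> 0 = x" "\<gamma> 1 = y" using assms unfolding entrance_path_def by simp_all
  then show "t \<in> {0..1} \<Longrightarrow> \<gamma> t \<in> topspace X"
    unfolding pathin_def using continuous_map_image_subset_topspace by fastforce
qed

text \<open>Nearby strata meeting the tube have larger dimension, so an entrance path cannot leave
  a stratum immediately.\<close>

lemma stays_in_stratum: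
  assumes \<gamma>: "entrance_path X S x y \<gamma>" and t: "t \<in> {0..1}" and \<sigma>: "\<sigma> \<in> strata S" "\<gamma> t \<in> stratum S \<sigma>"
  obtains \<epsilon> where "\<epsilon> > 0" "\<forall>t'\<in>{0..1}. t \<le> t' \<and> t' < t + \<epsilon> \<longrightarrow> \<gamma> t' \<in> stratum S \<sigma>"
proof -
  have tube: "openin X (tube S \<sigma>)" "\<gamma> t \<in> tube S \<sigma>" using thom_matherD(6,7)[OF tm \<sigma>(1)] \<sigma>(2) by auto
  obtain \<epsilon> where \<epsilon>: "\<epsilon> > 0" "\<forall>t'\<in>{0..1}. \<bar>t' - t\<bar> < \<epsilon> \<longrightarrow> \<gamma> t' \<in> tube S \<sigma>"
    by (rule pathin_nbhd[OF entrance_pathD(1)[OF \<gamma>] t tube])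
  have "\<gamma> t' \<in> stratum S \<sigma>" if t': "t' \<in> {0..1}" "t \<le> t'" "t' < t + \<epsilon>" for t'
  proof -
    have tu: "\<gamma> t' \<in> tube S \<sigma>" using \<epsilon>(2) t' by auto
    obtain \<tau> where \<tau>: "\<tau> \<in> strata S" "\<gamma> t' \<in> stratum S \<tau>" using dec(1)[OF entrance_pathD(4)[OF \<gamma> t'(1)]] by blast
    have "sdim S \<tau> \<le> sdim S \<sigma>" using \<gamma> t t'(1,2) \<sigma> \<tau> unfolding entrance_path_def by blast
    then have "\<sigma> = \<tau>" using stratum_submersion(2)[OF tm \<sigma>(1) \<tau>(1)] tu \<tau>(2) by fastforce
    then show ?thesis using \<tau>(2) by simp
  qed
  then show thesis using that \<epsilon>(1) by blast
qed

text \<open>The comparison in U is bijective to the right of t, where the path has not yet left the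
  stratum of its point at t; from the left it may only just have entered that stratum.\<close>

lemma transport_nbhd_path:
  assumes \<gamma>: "entrance_path X S x y \<gamma>" and t: "t \<in> {0..1}"
  obtains U W \<epsilon> where "openin X U" "openin X W" "\<gamma> t \<in> W" "W \<subseteq> U" "\<epsilon> > 0"
    "\<forall>t'\<in>{0..1}. \<bar>t' - t\<bar> < \<epsilon> \<longrightarrow> \<gamma> t' \<in> W"
    "\<forall>t'\<in>{0..1}. t \<le> t' \<and> t' < t + \<epsilon> \<longrightarrow> inj_on (\<lambda>s. s U) (E (\<gamma> t'))"
    "\<forall>y'\<in>W. \<forall>s'\<in>E y'. \<exists>s\<in>E (\<gamma> t). s U = s' U"
    "\<forall>t'\<in>{0..1}. t \<le> t' \<and> t' < t + \<epsilon> \<longrightarrow> (\<forall>s\<in>E (\<gamma> t). \<exists>s'\<in>E (\<gamma> t'). s' U = s U)"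
proof -
  have y: "\<gamma> t \<in> topspace X" by (rule entrance_pathD(4)[OF \<gamma> t])
  obtain \<sigma> where \<sigma>: "\<sigma> \<in> strata S" "\<gamma> t \<in> stratum S \<sigma>" using dec(1)[OF y] by blast
  obtain U W where U: "openin X U" "openin X W" "\<gamma> t \<in> W" "W \<subseteq> U" "inj_on (\<lambda>s. s U) (E (\<gamma> t))"
    "\<forall>y'\<in>W. \<forall>s'\<in>E y'. \<exists>s\<in>E (\<gamma> t). s U = s' U"
    "\<forall>y'\<in>W \<inter> stratum S \<sigma>. inj_on (\<lambda>s. s U) (E y')"
    "\<forall>y'\<in>W \<inter> stratum S \<sigma>. \<forall>s\<in>E (\<gamma> t). \<exists>s'\<in>E y'. s' U = s U"
    by (rule transport_nbhd[OF y \<sigma>])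
  obtain \<epsilon>1 where 1: "\<epsilon>1 > 0" "\<forall>t'\<in>{0..1}. \<bar>t' - t\<bar> < \<epsilon>1 \<longrightarrow> \<gamma> t' \<in> W"
    by (rule pathin_nbhd[OF entrance_pathD(1)[OF \<gamma>] t U(2,3)])
  obtain \<epsilon>2 where 2: "\<epsilon>2 > 0" "\<forall>t'\<in>{0..1}. t \<le> t' \<and> t' < t + \<epsilon>2 \<longrightarrow> \<gamma> t' \<in> stratum S \<sigma>"
    by (rule stays_in_stratum[OF \<gamma> t \<sigma>])
  have in_both: "\<gamma> t' \<in> W \<inter> stratum S \<sigma>" if "t' \<in> {0..1}" "t \<le> t'" "t' < t + min \<epsilon>1 \<epsilon>2" for t'
    using that 1(2) 2(2) by auto
  show thesis
  proof (rule that[of U W "min \<epsilon>1 \<epsilon>2"])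
    show "\<forall>t'\<in>{0..1}. t \<le> t' \<and> t' < t + min \<epsilon>1 \<epsilon>2 \<longrightarrow> inj_on (\<lambda>s. s U) (E (\<gamma> t'))"
      using in_both U(7) by blast
    show "\<forall>t'\<in>{0..1}. t \<le> t' \<and> t' < t + min \<epsilon>1 \<epsilon>2 \<longrightarrow> (\<forall>s\<in>E (\<gamma> t). \<exists>s'\<in>E (\<gamma> t'). s' U = s U)"
      using in_both U(8) by blast
    show "\<forall>t'\<in>{0..1}. \<bar>t' - t\<bar> < min \<epsilon>1 \<epsilon>2 \<longrightarrow> \<gamma> t' \<in> W" using 1(2) by simp
  qed (use U(1-4,6) 1(1) 2(1) in auto)
qed

text \<open>At t0 the two families have equal values in U because they agree just before; from t0
  on, injectivity in the same U turns this into equality.\<close>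

lemma flat_unique:
  assumes \<gamma>: "entrance_path X S x y \<gamma>" and b: "b \<le> 1"
    and s: "flat_on \<gamma> {0..b} s" "flat_on \<gamma> {0..b} s'" "s 0 = s' 0" and t: "t \<in> {0..b}"
  shows "s t = s' t"
  using t
proof (rule real_interval_induct[rotated])
  fix t0 assume t0: "t0 \<in> {0..b}" and IH: "\<And>t. 0 \<le> t \<Longrightarrow> t < t0 \<Longrightarrow> s t = s' t"
  have t01: "t0 \<in> {0..1}" using t0 b by auto
  obtain U W \<epsilon> where U: "openin X U" "openin X W" "\<gamma> t0 \<in> W" "W \<subseteq> U" "\<epsilon> > 0"
    "\<forall>t'\<in>{0..1}. \<bar>t' - t0\<bar> < \<epsilon> \<longrightarrow> \<gamma> t' \<in> W"
    "\<forall>t'\<in>{0..1}. t0 \<le> t' \<and> t' < t0 + \<epsilon> \<longrightarrow> inj_on (\<lambda>s. s U) (E (\<gamma> t'))"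
    "\<forall>y'\<in>W. \<forall>s'\<in>E y'. \<exists>s\<in>E (\<gamma> t0). s U = s' U"
    "\<forall>t'\<in>{0..1}. t0 \<le> t' \<and> t' < t0 + \<epsilon> \<longrightarrow> (\<forall>s\<in>E (\<gamma> t0). \<exists>s'\<in>E (\<gamma> t'). s' U = s U)"
    by (rule transport_nbhd_path[OF \<gamma> t01])
  have yU: "\<gamma> t0 \<in> U" using U(3,4) by blast
  obtain \<epsilon>1 where 1: "\<epsilon>1 > 0" "\<forall>t'\<in>{0..b}. \<bar>t' - t0\<bar> < \<epsilon>1 \<longrightarrow> s t' U = s t0 U"
    by (rule flat_onE[OF s(1) t0 U(1) yU])
  obtain \<epsilon>2 where 2: "\<epsilon>2 > 0" "\<forall>t'\<in>{0..b}. \<bar>t' - t0\<bar> < \<epsilon>2 \<longrightarrow> s' t' U = s' t0 U"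
    by (rule flat_onE[OF s(2) t0 U(1) yU])
  define \<delta> where "\<delta> = min \<epsilon> (min \<epsilon>1 \<epsilon>2)"
  have \<delta>: "\<delta> > 0" "\<delta> \<le> \<epsilon>" "\<delta> \<le> \<epsilon>1" "\<delta> \<le> \<epsilon>2" using U(5) 1(1) 2(1) unfolding \<delta>_def by auto
  define t1 where "t1 = max 0 (t0 - \<delta> / 2)"
  have t1: "t1 \<in> {0..b}" "\<bar>t1 - t0\<bar> < \<delta>" using t0 \<delta>(1) unfolding t1_def by auto
  have "s t1 = s' t1"
  proof (cases "t0 = 0")
    case True
    then show ?thesis using s(3) \<delta>(1) unfolding t1_def by simp
  next
    case False
    then show ?thesis using t0 \<delta>(1) unfolding t1_def by (intro IH) auto
  qed
  then have eqU: "s t0 U = s' t0 U" using 1(2) 2(2) t1 \<delta> by (metis less_le_trans)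
  have "s t = s' t" if t: "t \<in> {0..b}" "t0 \<le> t" "t < t0 + \<delta>" for t
  proof -
    have "\<bar>t - t0\<bar> < \<epsilon>1" "\<bar>t - t0\<bar> < \<epsilon>2" using t \<delta> by auto
    then have "s t U = s' t U" using 1(2) 2(2) t(1) eqU by metis
    moreover have "inj_on (\<lambda>s. s U) (E (\<gamma> t))" using U(7) t \<delta>(2) b by auto
    ultimately show ?thesis
      using inj_onD[of "\<lambda>s. s U" "E (\<gamma> t)" "s t" "s' t"] flat_onD[OF s(1) t(1)] flat_onD[OF s(2) t(1)] by blast
  qed
  then show "\<exists>\<epsilon>>0. \<forall>t\<in>{0..b}. t0 \<le> t \<and> t < t0 + \<epsilon> \<longrightarrow> s t = s' t" using \<delta>(1) by blast
qed

text \<open>To pass t0, the families on shorter intervals are fitted together by uniqueness. Their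
  common value in U is realised in the costalk at t0, since nearby costalks map to it, and from
  there in the costalks to the right.\<close>

lemma flat_exists:
  assumes \<gamma>: "entrance_path X S x y \<gamma>" and a: "a \<in> E x"
  obtains s where "flat_on \<gamma> {0..1} s" "s 0 = a"
proof -
  have "\<exists>s. flat_on \<gamma> {0..1} s \<and> s 0 = a"
  proof (rule real_interval_induct[where a=0 and b=1 and t=1 and P="\<lambda>b. \<exists>s. flat_on \<gamma> {0..b} s \<and> s 0 = a"])
    fix t0 :: real assume t0: "t0 \<in> {0..1}" and IH: "\<And>t. 0 \<le> t \<Longrightarrow> t < t0 \<Longrightarrow> \<exists>s. flat_on \<gamma> {0..t} s \<and> s 0 = a"
    \<comment> \<open>One family for each shorter interval; \<open>s\<close> is their diagonal, and
      \<open>s_eq\<close> says that it restricts to each of them.\<close>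
    define fam where "fam t = (SOME s. flat_on \<gamma> {0..t} s \<and> s 0 = a)" for t
    have fam: "flat_on \<gamma> {0..t} (fam t)" "fam t 0 = a" if "0 \<le> t" "t < t0" for t
      using someI_ex[OF IH[OF that]] unfolding fam_def by auto
    define s where "s t = fam t t" for t
    have s_eq: "s t = fam t' t" if "0 \<le> t" "t \<le> t'" "t' < t0" for t t'
    proof -
      have t: "t < t0" "0 \<le> t'" using that by auto
      show ?thesis unfolding s_def
        by (rule flat_unique[OF \<gamma> _ fam(1)[OF that(1) t(1)] flat_on_subset[OF fam(1)[OF t(2) that(3)]]])
          (use that t0 fam(2) in auto)
    qed
    have sE: "s t \<in> E (\<gamma> t)" if "0 \<le> t" "t < t0" for t
      unfolding s_def by (rule flat_onD[OF fam(1)[OF that]]) (use that in auto)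
    obtain U W \<epsilon> where U: "openin X U" "openin X W" "\<gamma> t0 \<in> W" "W \<subseteq> U" "\<epsilon> > 0"
      "\<forall>t'\<in>{0..1}. \<bar>t' - t0\<bar> < \<epsilon> \<longrightarrow> \<gamma> t' \<in> W"
      "\<forall>t'\<in>{0..1}. t0 \<le> t' \<and> t' < t0 + \<epsilon> \<longrightarrow> inj_on (\<lambda>s. s U) (E (\<gamma> t'))"
      "\<forall>y'\<in>W. \<forall>s'\<in>E y'. \<exists>s\<in>E (\<gamma> t0). s U = s' U"
      "\<forall>t'\<in>{0..1}. t0 \<le> t' \<and> t' < t0 + \<epsilon> \<longrightarrow> (\<forall>s\<in>E (\<gamma> t0). \<exists>s'\<in>E (\<gamma> t'). s' U = s U)"
      by (rule transport_nbhd_path[OF \<gamma> t0])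
    \<comment> \<open>\<open>r\<close> is the prospective value at t0: the given a if t0 = 0, and
      otherwise an element matching the value in U just before t0.\<close>
    have "\<exists>r t1. r \<in> E (\<gamma> t0) \<and> (t0 > 0 \<longrightarrow> t1 < t0) \<and> (t0 = 0 \<longrightarrow> r = a) \<and> (\<forall>t. 0 \<le> t \<and> t1 \<le> t \<and> t < t0 \<longrightarrow> s t U = r U)"
    proof (cases "t0 = 0")
      case True
      then show ?thesis using a entrance_pathD(2)[OF \<gamma>] by (intro exI[of _ a]) auto
    next
      case False
      define t1 where "t1 = max 0 (t0 - \<epsilon> / 2)"
      have t1: "0 \<le> t1" "t1 < t0" "t0 - t1 < \<epsilon>" using False t0 U(5) unfolding t1_def by auto
      have "\<gamma> t1 \<in> W" using U(6) t1 t0 by auto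
      then obtain r where r: "r \<in> E (\<gamma> t0)" "r U = s t1 U" using U(8) sE[OF t1(1,2)] by blast
      have "s t U = r U" if t: "t1 \<le> t" "t < t0" for t
      proof -
        have t0t: "0 \<le> t" using t t1 by simp
        have "fam t t U = fam t t1 U"
        proof (rule flat_on_const[OF fam(1)[OF t0t t(2)] _ U(1)])
          show "{t1..t} \<subseteq> {0..t}" using t1 by auto
          show "\<gamma> ` {t1..t} \<subseteq> U" using U(4,6) t1 t t0 by auto
          show "t \<in> {t1..t}" using t by simp
        qed
        moreover have "s t1 = fam t t1" by (rule s_eq) (use t1 t in auto)
        ultimately show ?thesis using r(2) by (simp add: s_def)
      qed
      then show ?thesis using r(1) t1 False by (intro exI[of _ r] exI[of _ t1]) auto
    qed
    then obtain r t1 where r: "r \<in> E (\<gamma> t0)" "t0 > 0 \<longrightarrow> t1 < t0" "t0 = 0 \<longrightarrow> r = a"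
      "\<forall>t. 0 \<le> t \<and> t1 \<le> t \<and> t < t0 \<longrightarrow> s t U = r U" by blast
    \<comment> \<open>The second branch includes t0. There the choice is determined, since U
      separates the elements of the costalks from t0 on.\<close>
    define q where "q t = (if t < t0 then s t else (SOME s'. s' \<in> E (\<gamma> t) \<and> s' U = r U))" for t
    have q: "q t \<in> E (\<gamma> t)" "q t U = r U" if t: "t \<in> {0..1}" "t0 \<le> t" "t < t0 + \<epsilon>" for t
    proof -
      have "\<exists>s'. s' \<in> E (\<gamma> t) \<and> s' U = r U" using U(9) r(1) t by blast
      from someI_ex[OF this] t show "q t \<in> E (\<gamma> t)" "q t U = r U" unfolding q_def by auto
    qed
    have q_left: "q t = s t" if "t < t0" for t using that unfolding q_def by simp
    have q0: "q 0 = a"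
    proof (cases "t0 = 0")
      case True
      then have "q 0 \<in> E (\<gamma> 0)" "q 0 U = a U" "inj_on (\<lambda>s. s U) (E (\<gamma> 0))" using q[of 0] r(3) U(5,7) by auto
      then show ?thesis using inj_onD[of "\<lambda>s. s U" "E (\<gamma> 0)" "q 0" a] a entrance_pathD(2)[OF \<gamma>] by auto
    next
      case False
      then show ?thesis using q_left[of 0] t0 fam(2)[of 0] unfolding s_def by auto
    qed
    have "flat_on \<gamma> {0..b} q" if b: "b \<in> {0..1}" "t0 \<le> b" "b < t0 + \<epsilon>" for b
      unfolding flat_on_def
    proof (intro conjI ballI allI impI; (elim conjE)?)
      have qE: "q t \<in> E (\<gamma> t)" if "t \<in> {0..b}" for t
        using that b sE q(1) q_left by (cases "t < t0") auto
      then show "q t \<in> E (\<gamma> t)" if "t \<in> {0..b}" for t using that .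
      fix t U1 assume t: "t \<in> {0..b}" and U1: "openin X U1" "\<gamma> t \<in> U1"
      show "\<exists>\<epsilon>>0. \<forall>t'\<in>{0..b}. \<bar>t' - t\<bar> < \<epsilon> \<longrightarrow> q t' U1 = q t U1"
      proof (cases "t < t0")
        case True
        \<comment> \<open>A family on a slightly longer interval is taken, so that flatness at t is
          seen from the right as well.\<close>
        define t2 where "t2 = (t + t0) / 2"
        have t2: "0 \<le> t2" "t2 < t0" "t < t2" using t True unfolding t2_def by auto
        have tt: "t \<in> {0..t2}" using t t2 by auto
        obtain \<epsilon>' where \<epsilon>': "\<epsilon>' > 0" "\<forall>t'\<in>{0..t2}. \<bar>t' - t\<bar> < \<epsilon>' \<longrightarrow> fam t2 t' U1 = fam t2 t U1"
          by (rule flat_onE[OF fam(1)[OF t2(1,2)] tt U1])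
        have "q t' U1 = q t U1" if t': "t' \<in> {0..b}" "\<bar>t' - t\<bar> < min \<epsilon>' (t2 - t)" for t'
        proof -
          have "t' \<in> {0..t2}" "t' < t0" using t' t2 by auto
          moreover from this have "q t' = fam t2 t'" using q_left s_eq[of t' t2] t2(2) by auto
          moreover have "q t = fam t2 t" using q_left[OF True] s_eq[of t t2] t2 tt by auto
          ultimately show ?thesis using \<epsilon>'(2) t'(2) by auto
        qed
        then show ?thesis using \<epsilon>'(1) t2(3) by (intro exI[of _ "min \<epsilon>' (t2 - t)"]) auto
      next
        case False
        have t01: "t \<in> {0..1}" "t0 \<le> t" "t < t0 + \<epsilon>" using t b False by auto
        \<comment> \<open>Keeps t' where the value in U is known: to the right of t0 if t > t0, and
          not before \<open>t1\<close> if t = t0 > 0.\<close>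
        define \<delta> where "\<delta> = (if t0 < t then t - t0 else if t0 = 0 then 1 else t0 - t1)"
        have "\<delta> > 0" using r(2) t01 t0 unfolding \<delta>_def by auto
        have near: "q t' U = q t U" if t': "t' \<in> {0..b}" "\<bar>t' - t\<bar> < \<delta>" for t'
        proof (cases "t' < t0")
          case True
          then have "t = t0" "t1 \<le> t'" using t' t01 unfolding \<delta>_def by (auto split: if_splits)
          then show ?thesis using r(4) True t'(1) q_left[OF True] q(2)[OF t01] by auto
        next
          case False
          then have "t' \<in> {0..1}" "t0 \<le> t'" "t' < t0 + \<epsilon>" using t' b by auto
          from q(2)[OF this] show ?thesis using q(2)[OF t01] by simp
        qed
        have b01: "{0..b} \<subseteq> {0..1}" using b by auto
        have "\<gamma> t \<in> U" using U(4,6) t01 by auto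
        moreover have "inj_on (\<lambda>s. s U) (E (\<gamma> t))" using U(7) t01 by blast
        ultimately show ?thesis
          by (rule flat_at_injective[where \<gamma>=\<gamma> and s=q and t=t and U=U and \<epsilon>=\<delta>, OF entrance_pathD(1)[OF \<gamma>] b01 t U(1) _ _ qE[OF t] \<open>\<delta> > 0\<close> _ U1])
            (use near qE in blast)
      qed
    qed
    then show "\<exists>\<epsilon>>0. \<forall>b\<in>{0..1}. t0 \<le> b \<and> b < t0 + \<epsilon> \<longrightarrow> (\<exists>s. flat_on \<gamma> {0..b} s \<and> s 0 = a)"
      using U(5) q0 by blast
  qed simp
  then show thesis using that by blast
qed

section \<open>Transport of costalk elements and its invariance\<close>

definition transports :: "(real \<Rightarrow> 'x) \<Rightarrow> ('x set \<Rightarrow> 'v) \<Rightarrow> ('x set \<Rightarrow> 'v) \<Rightarrow> bool" where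
  "transports \<gamma> a b \<longleftrightarrow> (\<exists>s. flat_on \<gamma> {0..1} s \<and> s 0 = a \<and> s 1 = b)"

lemma transports_exists:
  assumes "entrance_path X S x y \<gamma>" "a \<in> E x"
  obtains b where "b \<in> E y" "transports \<gamma> a b"
proof -
  obtain s where s: "flat_on \<gamma> {0..1} s" "s 0 = a" by (rule flat_exists[OF assms])
  have "s 1 \<in> E (\<gamma> 1)" by (rule flat_onD[OF s(1)]) simp
  then show thesis using that[of "s 1"] s entrance_pathD(3)[OF assms(1)] unfolding transports_def by auto
qed

lemma transports_unique:
  assumes "entrance_path X S x y \<gamma>" "transports \<gamma> a b" "transports \<gamma> a b'"
  shows "b = b'"
proof -
  obtain s where s: "flat_on \<gamma> {0..1} s" "s 0 = a" "s 1 = b" using assms(2) unfolding transports_def by blast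
  obtain s' where s': "flat_on \<gamma> {0..1} s'" "s' 0 = a" "s' 1 = b'" using assms(3) unfolding transports_def by blast
  have "s 1 = s' 1" by (rule flat_unique[OF assms(1) _ s(1) s'(1)]) (use s s' in auto)
  then show ?thesis using s s' by simp
qed

lemma transports_add:
  assumes \<gamma>: "entrance_path X S x y \<gamma>" and "transports \<gamma> a b" "transports \<gamma> a' b'"
  shows "transports \<gamma> (a \<oplus>\<^bsub>costalk X F x\<^esub> a') (b \<oplus>\<^bsub>costalk X F y\<^esub> b')"
proof -
  obtain s where s: "flat_on \<gamma> {0..1} s" "s 0 = a" "s 1 = b" using assms(2) unfolding transports_def by blast
  obtain s' where s': "flat_on \<gamma> {0..1} s'" "s' 0 = a'" "s' 1 = b'" using assms(3) unfolding transports_def by blast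
  let ?q = "\<lambda>t. s t \<oplus>\<^bsub>costalk X F (\<gamma> t)\<^esub> s' t"
  have "flat_on \<gamma> {0..1} ?q" unfolding flat_on_def
  proof (intro conjI ballI allI impI; (elim conjE)?)
    fix t :: real assume t: "t \<in> {0..1}"
    interpret M: module K "costalk X F (\<gamma> t)" by (rule vspace_module[OF vspace_E])
    show "?q t \<in> E (\<gamma> t)" using flat_onD[OF s(1) t] flat_onD[OF s'(1) t] by (rule M.M.a_closed)
    fix U assume U: "openin X U" "\<gamma> t \<in> U"
    obtain \<epsilon>0 where 0: "\<epsilon>0 > 0" "\<forall>t'\<in>{0..1}. \<bar>t' - t\<bar> < \<epsilon>0 \<longrightarrow> \<gamma> t' \<in> U"
      by (rule pathin_nbhd[OF entrance_pathD(1)[OF \<gamma>] t U])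
    obtain \<epsilon>1 where 1: "\<epsilon>1 > 0" "\<forall>t'\<in>{0..1}. \<bar>t' - t\<bar> < \<epsilon>1 \<longrightarrow> s t' U = s t U" by (rule flat_onE[OF s(1) t U])
    obtain \<epsilon>2 where 2: "\<epsilon>2 > 0" "\<forall>t'\<in>{0..1}. \<bar>t' - t\<bar> < \<epsilon>2 \<longrightarrow> s' t' U = s' t U" by (rule flat_onE[OF s'(1) t U])
    have "?q t' U = ?q t U" if t': "t' \<in> {0..1}" "\<bar>t' - t\<bar> < min \<epsilon>0 (min \<epsilon>1 \<epsilon>2)" for t'
    proof -
      have "\<gamma> t' \<in> U" "s t' U = s t U" "s' t' U = s' t U" using 0 1 2 t' by auto
      then show ?thesis using U by (simp add: costalk_ops)
    qed
    then show "\<exists>\<epsilon>>0. \<forall>t'\<in>{0..1}. \<bar>t' - t\<bar> < \<epsilon> \<longrightarrow> ?q t' U = ?q t U"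
      using 0(1) 1(1) 2(1) by (intro exI[of _ "min \<epsilon>0 (min \<epsilon>1 \<epsilon>2)"]) simp
  qed
  then show ?thesis unfolding transports_def using s s' entrance_pathD(2,3)[OF \<gamma>] by (intro exI[of _ ?q]) simp
qed

lemma transports_smult:
  assumes \<gamma>: "entrance_path X S x y \<gamma>" and "transports \<gamma> a b" and c: "c \<in> carrier K"
  shows "transports \<gamma> (c \<odot>\<^bsub>costalk X F x\<^esub> a) (c \<odot>\<^bsub>costalk X F y\<^esub> b)"
proof -
  obtain s where s: "flat_on \<gamma> {0..1} s" "s 0 = a" "s 1 = b" using assms(2) unfolding transports_def by blast
  let ?q = "\<lambda>t. c \<odot>\<^bsub>costalk X F (\<gamma> t)\<^esub> s t"
  have "flat_on \<gamma> {0..1} ?q" unfolding flat_on_def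
  proof (intro conjI ballI allI impI; (elim conjE)?)
    fix t :: real assume t: "t \<in> {0..1}"
    interpret M: module K "costalk X F (\<gamma> t)" by (rule vspace_module[OF vspace_E])
    show "?q t \<in> E (\<gamma> t)" using c flat_onD[OF s(1) t] by (rule M.smult_closed)
    fix U assume U: "openin X U" "\<gamma> t \<in> U"
    obtain \<epsilon>0 where 0: "\<epsilon>0 > 0" "\<forall>t'\<in>{0..1}. \<bar>t' - t\<bar> < \<epsilon>0 \<longrightarrow> \<gamma> t' \<in> U"
      by (rule pathin_nbhd[OF entrance_pathD(1)[OF \<gamma>] t U])
    obtain \<epsilon>1 where 1: "\<epsilon>1 > 0" "\<forall>t'\<in>{0..1}. \<bar>t' - t\<bar> < \<epsilon>1 \<longrightarrow> s t' U = s t U" by (rule flat_onE[OF s(1) t U])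
    have "?q t' U = ?q t U" if t': "t' \<in> {0..1}" "\<bar>t' - t\<bar> < min \<epsilon>0 \<epsilon>1" for t'
    proof -
      have "\<gamma> t' \<in> U" "s t' U = s t U" using 0 1 t' by auto
      then show ?thesis using U by (simp add: costalk_ops)
    qed
    then show "\<exists>\<epsilon>>0. \<forall>t'\<in>{0..1}. \<bar>t' - t\<bar> < \<epsilon> \<longrightarrow> ?q t' U = ?q t U"
      using 0(1) 1(1) by (intro exI[of _ "min \<epsilon>0 \<epsilon>1"]) simp
  qed
  then show ?thesis unfolding transports_def using s entrance_pathD(2,3)[OF \<gamma>] by (intro exI[of _ ?q]) simp
qed

lemma transports_const: "a \<in> E x \<Longrightarrow> transports (\<lambda>t. x) a a"
  unfolding transports_def flat_on_def by (intro exI[of _ "\<lambda>t. a"]) (auto intro: exI[of _ 1])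

lemma transports_within:
  assumes \<gamma>: "entrance_path X S x y \<gamma>" and "transports \<gamma> a b" and U: "openin X U" "\<gamma> ` {0..1} \<subseteq> U"
  shows "b U = a U"
proof -
  obtain s where s: "flat_on \<gamma> {0..1} s" "s 0 = a" "s 1 = b" using assms(2) unfolding transports_def by blast
  have "s 1 U = s 0 U" by (rule flat_on_const[OF s(1) subset_refl U]) simp
  then show ?thesis using s by simp
qed

lemma transports_concat:
  assumes \<gamma>: "entrance_path X S x y \<gamma>" and \<delta>: "entrance_path X S y z \<delta>"
    and t1: "transports \<gamma> a b" and t2: "transports \<delta> b c"
  shows "transports (concat_path \<gamma> \<delta>) a c"
proof -
  obtain s where s: "flat_on \<gamma> {0..1} s" "s 0 = a" "s 1 = b" using t1 unfolding transports_def by blast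
  obtain s' where s': "flat_on \<delta> {0..1} s'" "s' 0 = b" "s' 1 = c" using t2 unfolding transports_def by blast
  let ?q = "\<lambda>t::real. if t \<le> 1/2 then s (2 * t) else s' (2 * t - 1)"
  let ?c = "concat_path \<gamma> \<delta>"
  have glue: "\<gamma> 1 = \<delta> 0" "s 1 = s' 0" using entrance_pathD(3)[OF \<gamma>] entrance_pathD(2)[OF \<delta>] s s' by auto
  have q_right: "?q t = s' (2 * t - 1)" "?c t = \<delta> (2 * t - 1)" if "t \<ge> 1/2" for t
  proof -
    have "?q t = s' (2 * t - 1) \<and> ?c t = \<delta> (2 * t - 1)"
    proof (cases "t \<le> 1/2")
      case True
      then have t: "t = 1/2" using that by simp
      show ?thesis unfolding t using glue by (simp add: concat_path_def)
    qed (simp add: concat_path_def)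
    then show "?q t = s' (2 * t - 1)" "?c t = \<delta> (2 * t - 1)" by auto
  qed
  have "flat_on ?c {0..1} ?q" unfolding flat_on_def
  proof (intro conjI ballI allI impI; (elim conjE)?)
    fix t :: real assume t: "t \<in> {0..1}"
    show "?q t \<in> E (?c t)"
      using flat_onD[OF s(1), of "2 * t"] flat_onD[OF s'(1), of "2 * t - 1"] t by (auto simp: concat_path_def)
    fix U assume U: "openin X U" "?c t \<in> U"
    \<comment> \<open>Constancy near t is proved separately on each half of the interval; at t = 1/2
      both statements apply, and \<open>glue\<close> identifies the values.\<close>
    have left: "\<exists>\<epsilon>>0. \<forall>t'\<in>{0..1}. t' \<le> 1/2 \<and> \<bar>t' - t\<bar> < \<epsilon> \<longrightarrow> ?q t' U = ?q t U"
    proof (cases "t \<le> 1/2")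
      case True
      have tt: "2 * t \<in> {0..1}" "\<gamma> (2 * t) \<in> U" using True t U(2) by (auto simp: concat_path_def)
      obtain \<epsilon> where \<epsilon>: "\<epsilon> > 0" "\<forall>t'\<in>{0..1}. \<bar>t' - 2 * t\<bar> < \<epsilon> \<longrightarrow> s t' U = s (2 * t) U"
        by (rule flat_onE[OF s(1) tt(1) U(1) tt(2)])
      have "?q t' U = ?q t U" if t': "t' \<in> {0..1}" "t' \<le> 1/2" "\<bar>t' - t\<bar> < \<epsilon> / 2" for t'
      proof -
        have "2 * t' \<in> {0..1}" using t' by auto
        moreover have "\<bar>2 * t' - 2 * t\<bar> < \<epsilon>" using t'(3) by linarith
        ultimately have "s (2 * t') U = s (2 * t) U" using \<epsilon>(2) by blast
        then show ?thesis using True t'(2) by simp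
      qed
      then show ?thesis using \<epsilon>(1) by (intro exI[of _ "\<epsilon> / 2"]) auto
    next
      case False
      then show ?thesis by (intro exI[of _ "t - 1/2"]) auto
    qed
    have right: "\<exists>\<epsilon>>0. \<forall>t'\<in>{0..1}. t' \<ge> 1/2 \<and> \<bar>t' - t\<bar> < \<epsilon> \<longrightarrow> ?q t' U = ?q t U"
    proof (cases "t \<ge> 1/2")
      case True
      have tt: "2 * t - 1 \<in> {0..1}" "\<delta> (2 * t - 1) \<in> U" using True t U(2) q_right(2)[OF True] by auto
      obtain \<epsilon> where \<epsilon>: "\<epsilon> > 0" "\<forall>t'\<in>{0..1}. \<bar>t' - (2 * t - 1)\<bar> < \<epsilon> \<longrightarrow> s' t' U = s' (2 * t - 1) U"
        by (rule flat_onE[OF s'(1) tt(1) U(1) tt(2)])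
      have "?q t' U = ?q t U" if t': "t' \<in> {0..1}" "t' \<ge> 1/2" "\<bar>t' - t\<bar> < \<epsilon> / 2" for t'
      proof -
        have "2 * t' - 1 \<in> {0..1}" using t' by auto
        moreover have "\<bar>(2 * t' - 1) - (2 * t - 1)\<bar> < \<epsilon>" using t'(3) by linarith
        ultimately have "s' (2 * t' - 1) U = s' (2 * t - 1) U" using \<epsilon>(2) by blast
        then show ?thesis unfolding q_right(1)[OF True] q_right(1)[OF t'(2)] .
      qed
      moreover have "\<epsilon> / 2 > 0" using \<epsilon>(1) by simp
      ultimately show ?thesis by (intro exI[of _ "\<epsilon> / 2"] conjI ballI impI) blast+
    next
      case False
      then show ?thesis by (intro exI[of _ "1/2 - t"]) auto
    qed
    obtain \<epsilon>1 where 1: "\<epsilon>1 > 0" "\<forall>t'\<in>{0..1}. t' \<le> 1/2 \<and> \<bar>t' - t\<bar> < \<epsilon>1 \<longrightarrow> ?q t' U = ?q t U" using left by blast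
    obtain \<epsilon>2 where 2: "\<epsilon>2 > 0" "\<forall>t'\<in>{0..1}. t' \<ge> 1/2 \<and> \<bar>t' - t\<bar> < \<epsilon>2 \<longrightarrow> ?q t' U = ?q t U" using right by blast
    have "?q t' U = ?q t U" if t': "t' \<in> {0..1}" "\<bar>t' - t\<bar> < min \<epsilon>1 \<epsilon>2" for t'
    proof (cases "t' \<le> 1/2")
      case True
      then show ?thesis using 1(2) t' by simp
    next
      case False
      then have "t' \<ge> 1/2" "\<bar>t' - t\<bar> < \<epsilon>2" using t' by auto
      then show ?thesis using 2(2) t'(1) by blast
    qed
    then show "\<exists>\<epsilon>>0. \<forall>t'\<in>{0..1}. \<bar>t' - t\<bar> < \<epsilon> \<longrightarrow> ?q t' U = ?q t U"
      using 1(1) 2(1) by (intro exI[of _ "min \<epsilon>1 \<epsilon>2"]) simp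
  qed
  then show ?thesis unfolding transports_def using s s' by (intro exI[of _ ?q]) simp
qed

text \<open>A flat family \<open>u s\<close> is chosen on every path of the homotopy. By induction
  on t, its value at t is locally constant in s when tested in any U. At t = 1 all paths end at y,
  so the values lie in one fixed costalk and are constant.\<close>

lemma transports_homotopic:
  assumes hom: "entrance_homotopic X S x y \<gamma> \<delta>" and a: "a \<in> E x" and tr: "transports \<gamma> a b"
  shows "transports \<delta> a b"
proof -
  let ?I = "top_of_set {0..1::real}"
  obtain h where h: "continuous_map (prod_topology ?I ?I) X h" "\<forall>t. h (0, t) = \<gamma> t" "\<forall>t. h (1, t) = \<delta> t"
    "\<forall>s\<in>{0..1}. entrance_path X S x y (\<lambda>t. h (s, t))"
    using hom unfolding entrance_homotopic_def homotopic_with_def by (elim exE conjE)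
  note path = bspec[OF h(4)]
  have nbhd: "\<exists>\<epsilon>>0. \<forall>s\<in>{0..1}. \<forall>t\<in>{0..1}. \<bar>s - s0\<bar> < \<epsilon> \<and> \<bar>t - t0\<bar> < \<epsilon> \<longrightarrow> h (s, t) \<in> U"
    if st: "s0 \<in> {0..1}" "t0 \<in> {0..1}" and U: "openin X U" "h (s0, t0) \<in> U" for s0 t0 U
  proof -
    have op: "openin (prod_topology ?I ?I) {z \<in> topspace (prod_topology ?I ?I). h z \<in> U}"
      by (rule openin_continuous_map_preimage[OF h(1) U(1)])
    have "(s0, t0) \<in> {z \<in> topspace (prod_topology ?I ?I). h z \<in> U}" using st U(2) by simp
    then have "\<exists>A B. openin ?I A \<and> openin ?I B \<and> s0 \<in> A \<and> t0 \<in> B \<and> A \<times> B \<subseteq> {z \<in> topspace (prod_topology ?I ?I). h z \<in> U}"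
      using op[unfolded openin_prod_topology_alt] by blast
    then obtain A B where AB: "openin ?I A" "openin ?I B" "s0 \<in> A" "t0 \<in> B"
      "A \<times> B \<subseteq> {z \<in> topspace (prod_topology ?I ?I). h z \<in> U}" by (elim exE conjE)
    obtain e1 where 1: "e1 > 0" "\<forall>s\<in>{0..1}. dist s s0 < e1 \<longrightarrow> s \<in> A"
      using AB(1,3) unfolding openin_euclidean_subtopology_iff by blast
    obtain e2 where 2: "e2 > 0" "\<forall>t\<in>{0..1}. dist t t0 < e2 \<longrightarrow> t \<in> B"
      using AB(2,4) unfolding openin_euclidean_subtopology_iff by blast
    have "h (s, t) \<in> U" if "s \<in> {0..1}" "t \<in> {0..1}" "\<bar>s - s0\<bar> < min e1 e2" "\<bar>t - t0\<bar> < min e1 e2" for s t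
    proof -
      have "s \<in> A" "t \<in> B" using 1(2) 2(2) that by (auto simp: dist_real_def)
      then show ?thesis using AB(5) by blast
    qed
    then show ?thesis using 1(1) 2(1) by (intro exI[of _ "min e1 e2"]) simp
  qed
  define u where "u s = (SOME f. flat_on (\<lambda>t. h (s, t)) {0..1} f \<and> f 0 = a)" for s
  have u: "flat_on (\<lambda>t. h (s, t)) {0..1} (u s)" "u s 0 = a" if "s \<in> {0..1}" for s
  proof -
    have "\<exists>f. flat_on (\<lambda>t. h (s, t)) {0..1} f \<and> f 0 = a"
      by (rule flat_exists[OF path[OF that] a]) (rule exI, rule conjI)
    from someI_ex[OF this] show "flat_on (\<lambda>t. h (s, t)) {0..1} (u s)" "u s 0 = a" unfolding u_def by auto
  qed
  have uconst: "u s t U = u s c U"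
    if "s \<in> {0..1}" "openin X U" "0 \<le> c" "c \<le> t" "t \<le> 1" "\<And>t'. c \<le> t' \<Longrightarrow> t' \<le> t \<Longrightarrow> h (s, t') \<in> U" for s t c U
    by (rule flat_on_const[OF u(1)[OF that(1)], of c t U t]) (use that in auto)
  have cont: "\<forall>U. openin X U \<and> h (s0, t) \<in> U \<longrightarrow> (\<exists>\<epsilon>>0. \<forall>s\<in>{0..1}. \<bar>s - s0\<bar> < \<epsilon> \<longrightarrow> u s t U = u s0 t U)"
    if s0: "s0 \<in> {0..1}" and t: "t \<in> {0..1}" for s0 t
    using t
  proof (rule real_interval_induct[rotated])
    let ?P = "\<lambda>t. \<forall>U. openin X U \<and> h (s0, t) \<in> U \<longrightarrow> (\<exists>\<epsilon>>0. \<forall>s\<in>{0..1}. \<bar>s - s0\<bar> < \<epsilon> \<longrightarrow> u s t U = u s0 t U)"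
    fix t0 :: real assume t0: "t0 \<in> {0..1}" and IH: "\<And>t. 0 \<le> t \<Longrightarrow> t < t0 \<Longrightarrow> ?P t"
    \<comment> \<open>Flatness along each path carries the claim from a slightly earlier time t1 to
      t0, uniformly for s near s0.\<close>
    have at_t0: "\<exists>\<epsilon>>0. \<forall>s\<in>{0..1}. \<bar>s - s0\<bar> < \<epsilon> \<longrightarrow> u s t0 U = u s0 t0 U" if U: "openin X U" "h (s0, t0) \<in> U" for U
    proof -
      obtain \<epsilon>1 where 1: "\<epsilon>1 > 0" "\<forall>s\<in>{0..1}. \<forall>t\<in>{0..1}. \<bar>s - s0\<bar> < \<epsilon>1 \<and> \<bar>t - t0\<bar> < \<epsilon>1 \<longrightarrow> h (s, t) \<in> U"
        using nbhd[OF s0 t0 U] by blast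
      define t1 where "t1 = max 0 (t0 - \<epsilon>1 / 2)"
      have t1: "0 \<le> t1" "t1 \<le> t0" "t0 - t1 < \<epsilon>1" using t0 1(1) unfolding t1_def by auto
      have "\<exists>\<epsilon>>0. \<forall>s\<in>{0..1}. \<bar>s - s0\<bar> < \<epsilon> \<longrightarrow> u s t1 U = u s0 t1 U"
      proof (cases "t0 = 0")
        case True
        then have "t1 = 0" using t1 by simp
        then show ?thesis using u(2) s0 by (intro exI[of _ 1]) simp
      next
        case False
        then have "t1 < t0" using t0 1(1) unfolding t1_def by auto
        moreover have "h (s0, t1) \<in> U" using 1 s0 t0 t1 by auto
        ultimately show ?thesis using IH[OF t1(1)] U(1) by blast
      qed
      then obtain \<epsilon>2 where 2: "\<epsilon>2 > 0" "\<forall>s\<in>{0..1}. \<bar>s - s0\<bar> < \<epsilon>2 \<longrightarrow> u s t1 U = u s0 t1 U" by blast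
      have along: "u s t0 U = u s t1 U" if s: "s \<in> {0..1}" "\<bar>s - s0\<bar> < \<epsilon>1" for s
        by (rule uconst[OF s(1) U(1) t1(1,2)]) (use t0 t1 1(2) s in auto)
      have "u s t0 U = u s0 t0 U" if s: "s \<in> {0..1}" "\<bar>s - s0\<bar> < min \<epsilon>1 \<epsilon>2" for s
        using along[of s] along[OF s0] 2(2) s 1(1) by simp
      then show ?thesis using 1(1) 2(1) by (intro exI[of _ "min \<epsilon>1 \<epsilon>2"]) simp
    qed
    obtain U W \<epsilon> where U: "openin X U" "openin X W" "h (s0, t0) \<in> W" "W \<subseteq> U" "\<epsilon> > 0"
      "\<forall>t'\<in>{0..1}. \<bar>t' - t0\<bar> < \<epsilon> \<longrightarrow> h (s0, t') \<in> W"
      "\<forall>t'\<in>{0..1}. t0 \<le> t' \<and> t' < t0 + \<epsilon> \<longrightarrow> inj_on (\<lambda>s. s U) (E (h (s0, t')))"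
      "\<forall>y'\<in>W. \<forall>s'\<in>E y'. \<exists>s\<in>E (h (s0, t0)). s U = s' U"
      "\<forall>t'\<in>{0..1}. t0 \<le> t' \<and> t' < t0 + \<epsilon> \<longrightarrow> (\<forall>s\<in>E (h (s0, t0)). \<exists>s'\<in>E (h (s0, t')). s' U = s U)"
      by (rule transport_nbhd_path[OF path[OF s0] t0])
    have hU: "h (s0, t0) \<in> U" using U(3,4) by blast
    obtain \<epsilon>1 where 1: "\<epsilon>1 > 0" "\<forall>s\<in>{0..1}. \<forall>t\<in>{0..1}. \<bar>s - s0\<bar> < \<epsilon>1 \<and> \<bar>t - t0\<bar> < \<epsilon>1 \<longrightarrow> h (s, t) \<in> U"
      using nbhd[OF s0 t0 U(1) hU] by blast
    obtain \<epsilon>2 where 2: "\<epsilon>2 > 0" "\<forall>s\<in>{0..1}. \<bar>s - s0\<bar> < \<epsilon>2 \<longrightarrow> u s t0 U = u s0 t0 U" using at_t0[OF U(1) hU] by blast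
    have along: "u s t U = u s t0 U" if "s \<in> {0..1}" "\<bar>s - s0\<bar> < \<epsilon>1" "t0 \<le> t" "t < t0 + \<epsilon>1" "t \<le> 1" for s t
      by (rule uconst[OF that(1) U(1) _ that(3,5)]) (use t0 1(2) that in auto)
    have "?P t" if t: "t \<in> {0..1}" "t0 \<le> t" "t < t0 + min \<epsilon> \<epsilon>1" for t
    proof (intro allI impI, elim conjE)
      fix U1 assume U1: "openin X U1" "h (s0, t) \<in> U1"
      have inj: "inj_on (\<lambda>s. s U) (E (h (s0, t)))" using U(7) t by auto
      have htU: "h (s0, t) \<in> U" using U(4,6) t by auto
      have us: "u s t \<in> E (h (s, t))" if "s \<in> {0..1}" for s using flat_onD[OF u(1)[OF that] t(1)] by simp
      \<comment> \<open>The value in U propagates from t0 to t along all nearby paths; a general U1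
        is then reached through \<open>costalk_eq_nearby\<close>.\<close>
      obtain V where V: "openin X V" "h (s0, t) \<in> V" "V \<subseteq> U \<inter> U1"
        "\<forall>y'\<in>V. \<forall>s\<in>E y'. s U = u s0 t U \<longrightarrow> s U1 = u s0 t U1"
        by (rule costalk_eq_nearby[OF U(1) htU inj U1 us[OF s0]])
      obtain \<epsilon>3 where 3: "\<epsilon>3 > 0" "\<forall>s\<in>{0..1}. \<forall>t'\<in>{0..1}. \<bar>s - s0\<bar> < \<epsilon>3 \<and> \<bar>t' - t\<bar> < \<epsilon>3 \<longrightarrow> h (s, t') \<in> V"
        using nbhd[OF s0 t(1) V(1,2)] by blast
      have "u s t U1 = u s0 t U1" if s: "s \<in> {0..1}" "\<bar>s - s0\<bar> < min \<epsilon>1 (min \<epsilon>2 \<epsilon>3)" for s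
      proof -
        have "u s t U = u s t0 U" by (rule along) (use s t in auto)
        also have "\<dots> = u s0 t0 U" using 2(2) s by simp
        also have "\<dots> = u s0 t U" by (rule along[symmetric]) (use s0 t 1(1) in auto)
        finally have "u s t U = u s0 t U" .
        moreover have "h (s, t) \<in> V" using 3 s t(1) by simp
        ultimately show ?thesis using V(4) us[OF s(1)] by blast
      qed
      then show "\<exists>\<epsilon>>0. \<forall>s\<in>{0..1}. \<bar>s - s0\<bar> < \<epsilon> \<longrightarrow> u s t U1 = u s0 t U1"
        using 1(1) 2(1) 3(1) by (intro exI[of _ "min \<epsilon>1 (min \<epsilon>2 \<epsilon>3)"]) simp
    qed
    then show "\<exists>\<epsilon>>0. \<forall>t\<in>{0..1}. t0 \<le> t \<and> t < t0 + \<epsilon> \<longrightarrow> ?P t"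
      using U(5) 1(1) by (intro exI[of _ "min \<epsilon> \<epsilon>1"] conjI ballI impI) auto
  qed
  \<comment> \<open>In the costalk at y a single injective U decides equality, so local constancy in
    U is local constancy of the element itself.\<close>
  have end_const: "u s 1 = u 0 1" if "s \<in> {0..1}" for s
    using that
  proof (rule real_interval_induct[rotated])
    fix s0 :: real assume s0: "s0 \<in> {0..1}" and IH: "\<And>s. 0 \<le> s \<Longrightarrow> s < s0 \<Longrightarrow> u s 1 = u 0 1"
    have h1: "h (s, 1) = y" if "s \<in> {0..1}" for s using entrance_pathD(3)[OF path[OF that]] .
    have yX: "y \<in> topspace X" using entrance_pathD(4)[OF path[OF s0], of 1] h1[OF s0] by simp
    obtain U where U: "openin X U" "y \<in> U" "inj_on (\<lambda>s. s U) (E y)"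
      by (rule costalk_injective_nbhd[OF K_field F fin[OF yX] yX])
    obtain \<epsilon> where \<epsilon>: "\<epsilon> > 0" "\<forall>s\<in>{0..1}. \<bar>s - s0\<bar> < \<epsilon> \<longrightarrow> u s 1 U = u s0 1 U"
      using cont[OF s0, of 1] U(1,2) h1[OF s0] by auto
    have uE: "u s 1 \<in> E y" if "s \<in> {0..1}" for s using flat_onD[OF u(1)[OF that], of 1] h1[OF that] by simp
    have eq: "u s 1 = u s0 1" if "s \<in> {0..1}" "\<bar>s - s0\<bar> < \<epsilon>" for s
      using \<epsilon>(2) that inj_onD[OF U(3) _ uE[OF that(1)] uE[OF s0]] by blast
    define s1 where "s1 = max 0 (s0 - \<epsilon> / 2)"
    have "u s1 1 = u 0 1"
    proof (cases "s0 = 0")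
      case True
      then show ?thesis using \<epsilon>(1) unfolding s1_def by simp
    next
      case False
      then show ?thesis using s0 \<epsilon>(1) unfolding s1_def by (intro IH) auto
    qed
    moreover have "s1 \<in> {0..1}" "\<bar>s1 - s0\<bar> < \<epsilon>" using s0 \<epsilon>(1) unfolding s1_def by auto
    ultimately have "u s0 1 = u 0 1" using eq[of s1] by simp
    then show "\<exists>\<epsilon>>0. \<forall>s\<in>{0..1}. s0 \<le> s \<and> s < s0 + \<epsilon> \<longrightarrow> u s 1 = u 0 1"
      using \<epsilon>(1) eq by (intro exI[of _ \<epsilon>]) auto
  qed
  have z: "(0::real) \<in> {0..1}" "(1::real) \<in> {0..1}" by auto
  have h\<gamma>: "(\<lambda>t. h (0, t)) = \<gamma>" "(\<lambda>t. h (1, t)) = \<delta>" using h(2,3) by auto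
  have "transports \<gamma> a (u 0 1)" unfolding transports_def using u[OF z(1)] unfolding h\<gamma> by blast
  then have "u 0 1 = b" using transports_unique[OF path[OF z(1), unfolded h\<gamma>] _ tr] by blast
  moreover have "transports \<delta> a (u 1 1)" unfolding transports_def using u[OF z(2)] unfolding h\<gamma> by blast
  ultimately show ?thesis using end_const[OF z(2)] by simp
qed

end

section \<open>The entrance path category\<close>

lemma entrance_pathI:
  assumes "pathin X \<gamma>" "\<gamma> 0 = x" "\<gamma> 1 = y"
    "\<And>s t \<sigma> \<tau>. s \<in> {0..1} \<Longrightarrow> t \<in> {0..1} \<Longrightarrow> \<sigma> \<in> strata S \<Longrightarrow> \<tau> \<in> strata S \<Longrightarrow> s \<le> t \<Longrightarrow>
      \<gamma> s \<in> stratum S \<sigma> \<Longrightarrow> \<gamma> t \<in> stratum S \<tau> \<Longrightarrow> sdim S \<tau> \<le> sdim S \<sigma>"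
  shows "entrance_path X S x y \<gamma>"
  using assms unfolding entrance_path_def by blast

lemma entrance_path_dim:
  assumes "entrance_path X S x y \<gamma>" "s \<in> {0..1}" "t \<in> {0..1}" "\<sigma> \<in> strata S" "\<tau> \<in> strata S" "s \<le> t"
    "\<gamma> s \<in> stratum S \<sigma>" "\<gamma> t \<in> stratum S \<tau>"
  shows "sdim S \<tau> \<le> sdim S \<sigma>"
  using assms unfolding entrance_path_def by blast

text \<open>Monotonicity preserves the entrance condition, and these maps form a convex set
  (\<open>reparam_affine\<close>), so two of them with common end values yield paths joined by a
  straight-line homotopy of parameters. All category laws are obtained in this way.\<close>

definition reparam :: "(real \<Rightarrow> real) \<Rightarrow> bool" where
  "reparam \<theta> \<longleftrightarrow> continuous_on {0..1} \<theta> \<and> \<theta> ` {0..1} \<subseteq> {0..1} \<and> mono_on {0..1} \<theta>"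

lemma reparam_in: "reparam \<theta> \<Longrightarrow> t \<in> {0..1} \<Longrightarrow> \<theta> t \<in> {0..1}"
  unfolding reparam_def by blast

lemma reparam_mono: "reparam \<theta> \<Longrightarrow> s \<in> {0..1} \<Longrightarrow> t \<in> {0..1} \<Longrightarrow> s \<le> t \<Longrightarrow> \<theta> s \<le> \<theta> t"
  unfolding reparam_def by (blast dest: mono_onD)

lemma reparam_affine:
  assumes "reparam \<theta>1" "reparam \<theta>2" "s \<in> {0..1}"
  shows "reparam (\<lambda>t. (1 - s) * \<theta>1 t + s * \<theta>2 t)"
proof -
  have 1: "(1 - s) * a + s * b \<in> {0..1}" if "a \<in> {0..1}" "b \<in> {0..1}" for a b :: real
  proof -
    have "(1 - s) * a + s * b \<le> (1 - s) * 1 + s * 1" using assms(3) that by (intro add_mono mult_left_mono) auto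
    moreover have "0 \<le> (1 - s) * a + s * b" using assms(3) that by simp
    ultimately show ?thesis by simp
  qed
  show ?thesis unfolding reparam_def
  proof (intro conjI)
    show "continuous_on {0..1} (\<lambda>t. (1 - s) * \<theta>1 t + s * \<theta>2 t)"
      using assms(1,2) unfolding reparam_def by (intro continuous_intros) auto
    show "(\<lambda>t. (1 - s) * \<theta>1 t + s * \<theta>2 t) ` {0..1} \<subseteq> {0..1}"
      using 1 reparam_in[OF assms(1)] reparam_in[OF assms(2)] by blast
    show "mono_on {0..1} (\<lambda>t. (1 - s) * \<theta>1 t + s * \<theta>2 t)"
    proof (rule mono_onI)
      fix r t :: real assume rt: "r \<in> {0..1}" "t \<in> {0..1}" "r \<le> t"
      have "\<theta>1 r \<le> \<theta>1 t" "\<theta>2 r \<le> \<theta>2 t"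
        using reparam_mono[OF assms(1) rt] reparam_mono[OF assms(2) rt] .
      then show "(1 - s) * \<theta>1 r + s * \<theta>2 r \<le> (1 - s) * \<theta>1 t + s * \<theta>2 t"
        using assms(3) by (intro add_mono mult_left_mono) auto
    qed
  qed
qed

lemma entrance_path_reparam:
  assumes \<gamma>: "entrance_path X S x y \<gamma>" and \<theta>: "reparam \<theta>"
  shows "entrance_path X S (\<gamma> (\<theta> 0)) (\<gamma> (\<theta> 1)) (\<lambda>t. \<gamma> (\<theta> t))"
proof (rule entrance_pathI)
  have "continuous_map (top_of_set {0..1}) (top_of_set {0..1}) \<theta>"
    using \<theta> unfolding reparam_def by (auto simp: continuous_map_subtopology_eu)
  moreover have "continuous_map (top_of_set {0..1}) X \<gamma>" using \<gamma> unfolding entrance_path_def pathin_def by blast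
  ultimately have "continuous_map (top_of_set {0..1}) X (\<gamma> \<circ> \<theta>)" by (rule continuous_map_compose)
  then show "pathin X (\<lambda>t. \<gamma> (\<theta> t))" unfolding pathin_def by (simp add: comp_def)
  fix s t \<sigma> \<tau> assume st: "s \<in> {0..1}" "t \<in> {0..1}" "\<sigma> \<in> strata S" "\<tau> \<in> strata S" "s \<le> t"
    "\<gamma> (\<theta> s) \<in> stratum S \<sigma>" "\<gamma> (\<theta> t) \<in> stratum S \<tau>"
  have "\<theta> s \<le> \<theta> t" by (rule reparam_mono[OF \<theta> st(1,2,5)])
  then show "sdim S \<tau> \<le> sdim S \<sigma>"
    by (rule entrance_path_dim[OF \<gamma> reparam_in[OF \<theta> st(1)] reparam_in[OF \<theta> st(2)] st(3,4) _ st(6,7)])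
qed simp_all

lemma reparam_homotopic:
  assumes \<gamma>: "entrance_path X S x y \<gamma>" and \<theta>: "reparam \<theta>1" "reparam \<theta>2" "\<theta>1 0 = \<theta>2 0" "\<theta>1 1 = \<theta>2 1"
  shows "entrance_homotopic X S (\<gamma> (\<theta>1 0)) (\<gamma> (\<theta>1 1)) (\<lambda>t. \<gamma> (\<theta>1 t)) (\<lambda>t. \<gamma> (\<theta>2 t))"
  unfolding entrance_homotopic_def homotopic_with_def
proof (intro exI conjI ballI allI)
  let ?I = "{0..1::real}"
  let ?k = "\<lambda>z. (1 - fst z) * \<theta>1 (snd z) + fst z * \<theta>2 (snd z)"
  have "continuous_on (?I \<times> ?I) ?k"
  proof -
    have "continuous_on (?I \<times> ?I) (\<lambda>z. \<theta>1 (snd z))" "continuous_on (?I \<times> ?I) (\<lambda>z. \<theta>2 (snd z))"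
      using \<theta>(1,2) unfolding reparam_def by (auto intro!: continuous_on_compose2[OF _ continuous_on_snd] continuous_intros)
    then show ?thesis by (intro continuous_intros)
  qed
  moreover have "?k ` (?I \<times> ?I) \<subseteq> ?I"
    using reparam_in[OF reparam_affine[OF \<theta>(1,2)]] by auto
  ultimately have "continuous_map (prod_topology (top_of_set ?I) (top_of_set ?I)) (top_of_set ?I) ?k"
    by (auto simp: continuous_map_subtopology_eu)
  moreover have "continuous_map (top_of_set {0..1}) X \<gamma>" using \<gamma> unfolding entrance_path_def pathin_def by blast
  ultimately have "continuous_map (prod_topology (top_of_set ?I) (top_of_set ?I)) X (\<gamma> \<circ> ?k)" by (rule continuous_map_compose)
  then show "continuous_map (prod_topology (top_of_set ?I) (top_of_set ?I)) X (\<lambda>z. \<gamma> (?k z))" by (simp add: comp_def)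
  show "entrance_path X S (\<gamma> (\<theta>1 0)) (\<gamma> (\<theta>1 1)) (\<lambda>t. \<gamma> (?k (s, t)))" if s: "s \<in> ?I" for s
  proof -
    have "(1 - s) * \<theta>1 0 + s * \<theta>2 0 = \<theta>1 0" "(1 - s) * \<theta>1 1 + s * \<theta>2 1 = \<theta>1 1"
      using \<theta>(3,4) by (simp_all add: algebra_simps)
    then show ?thesis using entrance_path_reparam[OF \<gamma> reparam_affine[OF \<theta>(1,2) s]] by simp
  qed
qed simp_all

section \<open>Homotopy classes, concatenation and the category laws\<close>

lemma entrance_homotopicD:
  "entrance_homotopic X S x y \<gamma> \<delta> \<Longrightarrow> entrance_path X S x y \<gamma>"
  "entrance_homotopic X S x y \<gamma> \<delta> \<Longrightarrow> entrance_path X S x y \<delta>"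
  unfolding entrance_homotopic_def using homotopic_with_imp_property by blast+

lemma entrance_homotopic_refl: "entrance_path X S x y \<gamma> \<Longrightarrow> entrance_homotopic X S x y \<gamma> \<gamma>"
  unfolding entrance_homotopic_def by (simp add: entrance_path_def pathin_def)

lemma entrance_homotopic_sym: "entrance_homotopic X S x y \<gamma> \<delta> \<Longrightarrow> entrance_homotopic X S x y \<delta> \<gamma>"
  unfolding entrance_homotopic_def by (rule homotopic_with_symD)

lemma entrance_homotopic_trans:
  "entrance_homotopic X S x y \<gamma> \<delta> \<Longrightarrow> entrance_homotopic X S x y \<delta> \<eta> \<Longrightarrow> entrance_homotopic X S x y \<gamma> \<eta>"
  unfolding entrance_homotopic_def by (rule homotopic_with_trans)

lemma entrance_class_eq:
  "entrance_homotopic X S x y \<gamma> \<delta> \<Longrightarrow> entrance_class X S x y \<gamma> = entrance_class X S x y \<delta>"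
  unfolding entrance_class_def
  by (intro Collect_cong iffI) (erule entrance_homotopic_trans[OF entrance_homotopic_sym] entrance_homotopic_trans, assumption)+

lemma continuous_map_concat:
  assumes p: "continuous_map Z euclideanreal p"
    and f: "continuous_map (subtopology Z {z \<in> topspace Z. p z \<le> 1/2}) X f"
    and g: "continuous_map (subtopology Z {z \<in> topspace Z. 1/2 \<le> p z}) X g"
    and eq: "\<And>z. z \<in> topspace Z \<Longrightarrow> p z = 1/2 \<Longrightarrow> f z = g z"
  shows "continuous_map Z X (\<lambda>z. if p z \<le> 1/2 then f z else g z)"
proof (rule continuous_map_cases_le[OF p _ f g eq])
  show "continuous_map Z euclideanreal (\<lambda>z. 1/2)" by simp
qed

lemma pathin_concat:
  assumes "pathin X \<gamma>" "pathin X \<delta>" "\<gamma> 1 = \<delta> 0"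
  shows "pathin X (concat_path \<gamma> \<delta>)"
proof -
  let ?I = "top_of_set {0..1::real}"
  have \<gamma>: "continuous_map ?I X \<gamma>" and \<delta>: "continuous_map ?I X \<delta>" using assms unfolding pathin_def by auto
  have "continuous_map ?I X (\<lambda>t. if t \<le> 1/2 then \<gamma> (2 * t) else \<delta> (2 * t - 1))"
  proof (rule continuous_map_concat)
    show "continuous_map ?I euclideanreal (\<lambda>t. t)" by (intro continuous_map_from_subtopology) simp
    have "continuous_map (subtopology ?I {z \<in> topspace ?I. z \<le> 1/2}) ?I (\<lambda>t. 2 * t)"
      by (auto simp: subtopology_subtopology continuous_map_subtopology_eu intro!: continuous_intros)
    from continuous_map_compose[OF this \<gamma>]
    show "continuous_map (subtopology ?I {z \<in> topspace ?I. z \<le> 1/2}) X (\<lambda>t. \<gamma> (2 * t))" by (simp add: comp_def)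
    have "continuous_map (subtopology ?I {z \<in> topspace ?I. 1/2 \<le> z}) ?I (\<lambda>t. 2 * t - 1)"
      by (auto simp: subtopology_subtopology continuous_map_subtopology_eu intro!: continuous_intros)
    from continuous_map_compose[OF this \<delta>]
    show "continuous_map (subtopology ?I {z \<in> topspace ?I. 1/2 \<le> z}) X (\<lambda>t. \<delta> (2 * t - 1))" by (simp add: comp_def)
  next
    fix t :: real assume "t = 1/2"
    show "\<gamma> (2 * t) = \<delta> (2 * t - 1)" unfolding \<open>t = 1/2\<close> using assms(3) by simp
  qed
  then show ?thesis unfolding pathin_def by (simp add: concat_path_def[abs_def])
qed

lemma entrance_path_concat:
  assumes dec: "decomposition X S" and \<gamma>: "entrance_path X S x y \<gamma>" and \<delta>: "entrance_path X S y z \<delta>"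
  shows "entrance_path X S x z (concat_path \<gamma> \<delta>)"
proof (rule entrance_pathI)
  have e: "\<gamma> 0 = x" "\<gamma> 1 = y" "\<delta> 0 = y" "\<delta> 1 = z" "pathin X \<gamma>" "pathin X \<delta>"
    using \<gamma> \<delta> unfolding entrance_path_def by auto
  show "pathin X (concat_path \<gamma> \<delta>)" using e by (intro pathin_concat) auto
  show "concat_path \<gamma> \<delta> 0 = x" "concat_path \<gamma> \<delta> 1 = z" using e by (auto simp: concat_path_def)
  have "\<gamma> 1 \<in> topspace X" using e(5) unfolding pathin_def continuous_map_def by auto
  then obtain \<rho> where \<rho>: "\<rho> \<in> strata S" "y \<in> stratum S \<rho>" using decompositionD(1)[OF dec] e(2) by blast
  fix s t \<sigma> \<tau> assume st: "s \<in> {0..1}" "t \<in> {0..1}" "\<sigma> \<in> strata S" "\<tau> \<in> strata S" "s \<le> t"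
    "concat_path \<gamma> \<delta> s \<in> stratum S \<sigma>" "concat_path \<gamma> \<delta> t \<in> stratum S \<tau>"
  consider "t \<le> 1/2" | "s \<le> 1/2" "\<not> t \<le> 1/2" | "\<not> s \<le> 1/2" "\<not> t \<le> 1/2" using st(5) by linarith
  then show "sdim S \<tau> \<le> sdim S \<sigma>"
  proof cases
    case 1
    then show ?thesis using st by (intro entrance_path_dim[OF \<gamma>, of "2 * s" "2 * t"]) (auto simp: concat_path_def)
  next
    case 2
    have "sdim S \<rho> \<le> sdim S \<sigma>"
      using st 2 \<rho> e by (intro entrance_path_dim[OF \<gamma>, of "2 * s" 1]) (auto simp: concat_path_def)
    moreover have "sdim S \<tau> \<le> sdim S \<rho>"
      using st 2 \<rho> e by (intro entrance_path_dim[OF \<delta>, of 0 "2 * t - 1"]) (auto simp: concat_path_def)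
    ultimately show ?thesis by simp
  next
    case 3
    then show ?thesis using st by (intro entrance_path_dim[OF \<delta>, of "2 * s - 1" "2 * t - 1"]) (auto simp: concat_path_def)
  qed
qed

lemma concat_homotopic:
  assumes dec: "decomposition X S" and h1: "entrance_homotopic X S x y \<gamma> \<gamma>'" and h2: "entrance_homotopic X S y z \<delta> \<delta>'"
  shows "entrance_homotopic X S x z (concat_path \<gamma> \<delta>) (concat_path \<gamma>' \<delta>')"
proof -
  let ?I = "top_of_set {0..1::real}"
  obtain h where h: "continuous_map (prod_topology ?I ?I) X h" "\<forall>t. h (0, t) = \<gamma> t" "\<forall>t. h (1, t) = \<gamma>' t"
    "\<forall>s\<in>{0..1}. entrance_path X S x y (\<lambda>t. h (s, t))"
    using h1 unfolding entrance_homotopic_def homotopic_with_def by (elim exE conjE)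
  obtain k where k: "continuous_map (prod_topology ?I ?I) X k" "\<forall>t. k (0, t) = \<delta> t" "\<forall>t. k (1, t) = \<delta>' t"
    "\<forall>s\<in>{0..1}. entrance_path X S y z (\<lambda>t. k (s, t))"
    using h2 unfolding entrance_homotopic_def homotopic_with_def by (elim exE conjE)
  let ?Z = "prod_topology ?I ?I"
  let ?c = "\<lambda>z. if snd z \<le> 1/2 then h (fst z, 2 * snd z) else k (fst z, 2 * snd z - 1)"
  have Z: "?Z = top_of_set ({0..1} \<times> {0..1})" by simp
  have "continuous_map ?Z X ?c"
  proof (rule continuous_map_concat)
    show "continuous_map ?Z euclideanreal snd"
      unfolding Z by (auto intro: continuous_intros)
    have "continuous_map (subtopology ?Z {z \<in> topspace ?Z. snd z \<le> 1/2}) ?Z (\<lambda>z. (fst z, 2 * snd z))"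
      unfolding Z by (auto simp: subtopology_subtopology continuous_map_subtopology_eu intro!: continuous_intros)
    from continuous_map_compose[OF this h(1)]
    show "continuous_map (subtopology ?Z {z \<in> topspace ?Z. snd z \<le> 1/2}) X (\<lambda>z. h (fst z, 2 * snd z))" by (simp add: comp_def)
    have "continuous_map (subtopology ?Z {z \<in> topspace ?Z. 1/2 \<le> snd z}) ?Z (\<lambda>z. (fst z, 2 * snd z - 1))"
      unfolding Z by (auto simp: subtopology_subtopology continuous_map_subtopology_eu intro!: continuous_intros)
    from continuous_map_compose[OF this k(1)]
    show "continuous_map (subtopology ?Z {z \<in> topspace ?Z. 1/2 \<le> snd z}) X (\<lambda>z. k (fst z, 2 * snd z - 1))" by (simp add: comp_def)
    fix z assume z: "z \<in> topspace ?Z" "snd z = 1/2"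
    then have "fst z \<in> {0..1}" by auto
    then have "h (fst z, 1) = y" "k (fst z, 0) = y"
      using bspec[OF h(4), of "fst z"] bspec[OF k(4), of "fst z"] unfolding entrance_path_def by auto
    then show "h (fst z, 2 * snd z) = k (fst z, 2 * snd z - 1)" unfolding z(2) by simp
  qed
  moreover have "?c (0, t) = concat_path \<gamma> \<delta> t" "?c (1, t) = concat_path \<gamma>' \<delta>' t" for t
    using h(2,3) k(2,3) by (simp_all add: concat_path_def)
  moreover have "entrance_path X S x z (\<lambda>t. ?c (s, t))" if s: "s \<in> {0..1}" for s
    using entrance_path_concat[OF dec bspec[OF h(4) s] bspec[OF k(4) s]] unfolding concat_path_def[abs_def] fst_conv snd_conv .
  ultimately show ?thesis
    unfolding entrance_homotopic_def homotopic_with_def by (intro exI[of _ ?c] conjI allI ballI)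
qed

lemma entrance_category_simps:
  "Obj (entrance_category X S) = topspace X"
  "Hom (entrance_category X S) x y = entrance_class X S x y ` {\<gamma>. entrance_path X S x y \<gamma>}"
  "Idn (entrance_category X S) x = entrance_class X S x x (\<lambda>t. x)"
  by (simp_all add: entrance_category_def)

text \<open>The composite is a union over all pairs of representatives; by
  \<open>concat_homotopic\<close> every term of this union is the same class.\<close>

lemma entrance_Cmp:
  assumes dec: "decomposition X S" and \<gamma>: "entrance_path X S x y \<gamma>" and \<delta>: "entrance_path X S y z \<delta>"
  shows "Cmp (entrance_category X S) (entrance_class X S x y \<gamma>) (entrance_class X S y z \<delta>) =
    entrance_class X S x z (concat_path \<gamma> \<delta>)"
proof -
  have eq: "entrance_class X S (\<gamma>' 0) (\<delta>' 1) (concat_path \<gamma>' \<delta>') = entrance_class X S x z (concat_path \<gamma> \<delta>)"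
    if "\<gamma>' \<in> entrance_class X S x y \<gamma>" "\<delta>' \<in> entrance_class X S y z \<delta>" for \<gamma>' \<delta>'
  proof -
    have h: "entrance_homotopic X S x y \<gamma> \<gamma>'" "entrance_homotopic X S y z \<delta> \<delta>'"
      using that unfolding entrance_class_def by auto
    have "\<gamma>' 0 = x" "\<delta>' 1 = z"
      using entrance_homotopicD(2)[OF h(1)] entrance_homotopicD(2)[OF h(2)] unfolding entrance_path_def by auto
    then show ?thesis using entrance_class_eq[OF concat_homotopic[OF dec h]] by simp
  qed
  have "\<gamma> \<in> entrance_class X S x y \<gamma>" "\<delta> \<in> entrance_class X S y z \<delta>"
    using entrance_homotopic_refl \<gamma> \<delta> unfolding entrance_class_def by auto
  then show ?thesis using eq unfolding entrance_category_def by auto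
qed

lemma entrance_path_const: "x \<in> topspace X \<Longrightarrow> decomposition X S \<Longrightarrow> entrance_path X S x x (\<lambda>t. x)"
  by (rule entrance_pathI) (auto simp: pathin_def dest: decompositionD(3))

lemma concat_const_left:
  assumes \<gamma>: "entrance_path X S x y \<gamma>"
  shows "entrance_homotopic X S x y (concat_path (\<lambda>t. x) \<gamma>) \<gamma>"
proof -
  have e: "\<gamma> 0 = x" "\<gamma> 1 = y" using \<gamma> unfolding entrance_path_def by auto
  \<comment> \<open>Waiting at x for the first half amounts to running \<gamma> with a parameter
    clamped at 0.\<close>
  have "reparam (\<lambda>t. max 0 (2 * t - 1))" "reparam (\<lambda>t. t)"
    unfolding reparam_def by (auto intro!: continuous_intros mono_onI)
  from reparam_homotopic[OF \<gamma> this]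
  have "entrance_homotopic X S x y (\<lambda>t. \<gamma> (max 0 (2 * t - 1))) \<gamma>" using e by simp
  moreover have "(\<lambda>t. \<gamma> (max 0 (2 * t - 1))) = concat_path (\<lambda>t. x) \<gamma>"
  proof
    fix t :: real
    have "max 0 (2 * t - 1) = (if t \<le> 1/2 then 0 else 2 * t - 1)" by (simp add: max_def)
    then show "\<gamma> (max 0 (2 * t - 1)) = concat_path (\<lambda>t. x) \<gamma> t" using e by (simp add: concat_path_def)
  qed
  ultimately show ?thesis by simp
qed

lemma concat_const_right:
  assumes \<gamma>: "entrance_path X S x y \<gamma>"
  shows "entrance_homotopic X S x y (concat_path \<gamma> (\<lambda>t. y)) \<gamma>"
proof -
  have e: "\<gamma> 0 = x" "\<gamma> 1 = y" using \<gamma> unfolding entrance_path_def by auto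
  have "reparam (\<lambda>t. min 1 (2 * t))" "reparam (\<lambda>t. t)"
    unfolding reparam_def by (auto intro!: continuous_intros mono_onI)
  from reparam_homotopic[OF \<gamma> this]
  have "entrance_homotopic X S x y (\<lambda>t. \<gamma> (min 1 (2 * t))) \<gamma>" using e by simp
  moreover have "(\<lambda>t. \<gamma> (min 1 (2 * t))) = concat_path \<gamma> (\<lambda>t. y)"
  proof
    fix t :: real
    have "min 1 (2 * t) = (if t \<le> 1/2 then 2 * t else 1)" by (simp add: min_def)
    then show "\<gamma> (min 1 (2 * t)) = concat_path \<gamma> (\<lambda>t. y) t" using e by (simp add: concat_path_def)
  qed
  ultimately show ?thesis by simp
qed

lemma concat_assoc:
  assumes dec: "decomposition X S" and f: "entrance_path X S w x f" and g: "entrance_path X S x y g"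
    and k: "entrance_path X S y z k"
  shows "entrance_homotopic X S w z (concat_path (concat_path f g) k) (concat_path f (concat_path g k))"
proof -
  let ?G = "concat_path f (concat_path g k)"
  have G: "entrance_path X S w z ?G" by (rule entrance_path_concat[OF dec f entrance_path_concat[OF dec g k]])
  have e: "?G 0 = w" "?G 1 = z" using G unfolding entrance_path_def by auto
  \<comment> \<open>The change of parameter has slopes 2, 1 and 1/2 on successive pieces. Being
    concave it is the minimum of three lines, a form in which continuity and monotonicity are
    immediate.\<close>
  let ?\<theta> = "\<lambda>t::real. min (2 * t) (min (t + 1/4) ((t + 1) / 2))"
  have "reparam ?\<theta>" "reparam (\<lambda>t. t)"
    unfolding reparam_def by (auto intro!: continuous_intros mono_onI min.mono simp: min_le_iff_disj)
  from reparam_homotopic[OF G this]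
  have "entrance_homotopic X S w z (\<lambda>t. ?G (?\<theta> t)) ?G" using e by (simp add: min_def)
  moreover have "?G (?\<theta> t) = concat_path (concat_path f g) k t" for t
  proof -
    consider "t \<le> 1/4" | "1/4 < t" "t \<le> 1/2" | "1/2 < t" by linarith
    then show ?thesis
    proof cases
      case 1
      then have "?\<theta> t = 2 * t" by (auto simp: min_def)
      then show ?thesis using 1 by (simp add: concat_path_def)
    next
      case 2
      then have \<theta>: "?\<theta> t = t + 1/4" by (auto simp: min_def)
      have "2 * (2 * (t + 1/4) - 1) = 2 * (2 * t) - 1" by simp
      then show ?thesis unfolding \<theta> using 2 by (simp add: concat_path_def)
    next
      case 3
      then have \<theta>: "?\<theta> t = t / 2 + 1 / 2" by (auto simp: min_def)
      have "2 * (2 * (t / 2 + 1 / 2) - 1) - 1 = 2 * t - 1" by simp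
      then show ?thesis unfolding \<theta> using 3 by (simp add: concat_path_def add_divide_distrib)
    qed
  qed
  ultimately show ?thesis by (simp add: fun_eq_iff)
qed

lemma is_category_entrance:
  assumes dec: "decomposition X S"
  shows "is_category (entrance_category X S)"
  unfolding is_category_def entrance_category_simps
proof (intro conjI ballI)
  fix x assume x: "x \<in> topspace X"
  show "entrance_class X S x x (\<lambda>t. x) \<in> entrance_class X S x x ` {\<gamma>. entrance_path X S x x \<gamma>}"
    using entrance_path_const[OF x dec] by blast
next
  fix x y z f g assume "f \<in> entrance_class X S x y ` {\<gamma>. entrance_path X S x y \<gamma>}"
    "g \<in> entrance_class X S y z ` {\<gamma>. entrance_path X S y z \<gamma>}"
  then obtain \<gamma> \<delta> where \<gamma>\<delta>: "entrance_path X S x y \<gamma>" "f = entrance_class X S x y \<gamma>"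
    "entrance_path X S y z \<delta>" "g = entrance_class X S y z \<delta>" by blast
  show "Cmp (entrance_category X S) f g \<in> entrance_class X S x z ` {\<gamma>. entrance_path X S x z \<gamma>}"
    unfolding \<gamma>\<delta>(2,4) entrance_Cmp[OF dec \<gamma>\<delta>(1,3)] using entrance_path_concat[OF dec \<gamma>\<delta>(1,3)] by blast
next
  fix x y f assume x: "x \<in> topspace X" "y \<in> topspace X" and "f \<in> entrance_class X S x y ` {\<gamma>. entrance_path X S x y \<gamma>}"
  then obtain \<gamma> where \<gamma>: "entrance_path X S x y \<gamma>" "f = entrance_class X S x y \<gamma>" by blast
  show "Cmp (entrance_category X S) (entrance_class X S x x (\<lambda>t. x)) f = f"
    unfolding \<gamma>(2) entrance_Cmp[OF dec entrance_path_const[OF x(1) dec] \<gamma>(1)]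
    by (rule entrance_class_eq[OF concat_const_left[OF \<gamma>(1)]])
  show "Cmp (entrance_category X S) f (entrance_class X S y y (\<lambda>t. y)) = f"
    unfolding \<gamma>(2) entrance_Cmp[OF dec \<gamma>(1) entrance_path_const[OF x(2) dec]]
    by (rule entrance_class_eq[OF concat_const_right[OF \<gamma>(1)]])
next
  fix w x y z f g k assume "f \<in> entrance_class X S w x ` {\<gamma>. entrance_path X S w x \<gamma>}"
    "g \<in> entrance_class X S x y ` {\<gamma>. entrance_path X S x y \<gamma>}"
    "k \<in> entrance_class X S y z ` {\<gamma>. entrance_path X S y z \<gamma>}"
  then obtain a b c where p: "entrance_path X S w x a" "entrance_path X S x y b" "entrance_path X S y z c"
    and e: "f = entrance_class X S w x a" "g = entrance_class X S x y b" "k = entrance_class X S y z c" by blast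
  note ab = entrance_path_concat[OF dec p(1,2)] and bc = entrance_path_concat[OF dec p(2,3)]
  show "Cmp (entrance_category X S) (Cmp (entrance_category X S) f g) k =
    Cmp (entrance_category X S) f (Cmp (entrance_category X S) g k)"
    unfolding e entrance_Cmp[OF dec p(1,2)] entrance_Cmp[OF dec p(2,3)] entrance_Cmp[OF dec ab p(3)] entrance_Cmp[OF dec p(1) bc]
    by (rule entrance_class_eq[OF concat_assoc[OF dec p]])
qed

section \<open>Segments of a path\<close>

definition path_segment :: "real \<Rightarrow> real \<Rightarrow> (real \<Rightarrow> 'x) \<Rightarrow> real \<Rightarrow> 'x" where
  "path_segment c d \<gamma> u = \<gamma> (c + (d - c) * u)"

lemma reparam_segment: "0 \<le> c \<Longrightarrow> c \<le> d \<Longrightarrow> d \<le> 1 \<Longrightarrow> reparam (\<lambda>u. c + (d - c) * u)"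
  unfolding reparam_def
proof (intro conjI)
  assume cd: "0 \<le> c" "c \<le> d" "d \<le> 1"
  show "(\<lambda>u. c + (d - c) * u) ` {0..1} \<subseteq> {0..1}"
  proof
    fix v assume "v \<in> (\<lambda>u. c + (d - c) * u) ` {0..1}"
    then obtain u where u: "0 \<le> u" "u \<le> 1" "v = c + (d - c) * u" by auto
    have "(d - c) * u \<le> (d - c) * 1" using cd u by (intro mult_left_mono) auto
    then show "v \<in> {0..1}" using cd u by auto
  qed
  show "mono_on {0..1} (\<lambda>u. c + (d - c) * u)" using cd by (intro mono_onI) (auto intro: mult_left_mono)
qed (auto intro!: continuous_intros)

lemma entrance_path_segment:
  assumes "entrance_path X S x y \<gamma>" "0 \<le> c" "c \<le> d" "d \<le> 1"
  shows "entrance_path X S (\<gamma> c) (\<gamma> d) (path_segment c d \<gamma>)"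
  using entrance_path_reparam[OF assms(1) reparam_segment[OF assms(2-4)]] unfolding path_segment_def[abs_def] by simp

lemma segment_concat_homotopic:
  assumes \<gamma>: "entrance_path X S x y \<gamma>" and cde: "0 \<le> c" "c \<le> d" "d \<le> e" "e \<le> 1"
  shows "entrance_homotopic X S (\<gamma> c) (\<gamma> e) (concat_path (path_segment c d \<gamma>) (path_segment d e \<gamma>)) (path_segment c e \<gamma>)"
proof -
  \<comment> \<open>Runs from c to d in the first half and from d to e in the second; the clamped
    terms replace a case distinction.\<close>
  let ?\<theta> = "\<lambda>u. c + (d - c) * min (2 * u) 1 + (e - d) * max (2 * u - 1) 0"
  have "reparam ?\<theta>" unfolding reparam_def
  proof (intro conjI)
    show "continuous_on {0..1} ?\<theta>" by (intro continuous_intros)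
    show "mono_on {0..1} ?\<theta>"
      using cde by (intro mono_onI add_mono mult_left_mono) auto
    show "?\<theta> ` {0..1} \<subseteq> {0..1}"
    proof
      fix v assume "v \<in> ?\<theta> ` {0..1}"
      then obtain u where u: "0 \<le> u" "u \<le> 1" "v = ?\<theta> u" by auto
      have "(d - c) * min (2 * u) 1 \<le> (d - c) * 1" "(e - d) * max (2 * u - 1) 0 \<le> (e - d) * 1"
        using cde u by (intro mult_left_mono; simp)+
      moreover have "0 \<le> (d - c) * min (2 * u) 1" "0 \<le> (e - d) * max (2 * u - 1) 0" using cde u by auto
      ultimately show "v \<in> {0..1}" using cde u(3) by auto
    qed
  qed
  moreover have "reparam (\<lambda>u. c + (e - c) * u)" using cde by (intro reparam_segment) auto
  ultimately have "entrance_homotopic X S (\<gamma> (?\<theta> 0)) (\<gamma> (?\<theta> 1)) (\<lambda>t. \<gamma> (?\<theta> t)) (\<lambda>u. \<gamma> (c + (e - c) * u))"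
    by (rule reparam_homotopic[OF \<gamma>]) simp_all
  moreover have "(\<lambda>t. \<gamma> (?\<theta> t)) = concat_path (path_segment c d \<gamma>) (path_segment d e \<gamma>)"
  proof
    fix t :: real
    show "\<gamma> (?\<theta> t) = concat_path (path_segment c d \<gamma>) (path_segment d e \<gamma>) t"
    proof (cases "t \<le> 1/2")
      case True
      then have "min (2 * t) 1 = 2 * t" "max (2 * t - 1) 0 = 0" by auto
      then show ?thesis using True by (simp add: concat_path_def path_segment_def)
    next
      case False
      then have "min (2 * t) 1 = 1" "max (2 * t - 1) 0 = 2 * t - 1" by auto
      then show ?thesis using False by (simp add: concat_path_def path_segment_def)
    qed
  qed
  ultimately show ?thesis unfolding path_segment_def[abs_def] by simp
qed

section \<open>The representation and its uniqueness\<close>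

context constructible_cosheaf_on_strata
begin

lemmas decomp = thom_matherD(4)[OF tm]

text \<open>Two choices are made, of a path in the class and of an end value. The first is harmless
  by \<open>transports_homotopic\<close>, the second by \<open>transports_unique\<close>.\<close>

definition monodromy :: "'x \<Rightarrow> 'x \<Rightarrow> (real \<Rightarrow> 'x) set \<Rightarrow> ('x set \<Rightarrow> 'v) \<Rightarrow> 'x set \<Rightarrow> 'v" where
  "monodromy x y f a = (SOME b. transports (SOME \<gamma>. \<gamma> \<in> f) a b)"

lemma transports_monodromy:
  assumes \<gamma>: "entrance_path X S x y \<gamma>" and a: "a \<in> E x"
  shows "transports \<gamma> a (monodromy x y (entrance_class X S x y \<gamma>) a)"
proof -
  define g where "g = (SOME \<gamma>'. \<gamma>' \<in> entrance_class X S x y \<gamma>)"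
  have "\<gamma> \<in> entrance_class X S x y \<gamma>" using entrance_homotopic_refl[OF \<gamma>] unfolding entrance_class_def by simp
  then have "g \<in> entrance_class X S x y \<gamma>" unfolding g_def by (rule someI[of "\<lambda>\<gamma>'. \<gamma>' \<in> entrance_class X S x y \<gamma>"])
  then have h: "entrance_homotopic X S x y \<gamma> g" unfolding entrance_class_def by simp
  obtain b where "transports g a b" by (rule transports_exists[OF entrance_homotopicD(2)[OF h] a])
  then have "transports g a (SOME b. transports g a b)" by (rule someI[of "transports g a"])
  then have "transports \<gamma> a (SOME b. transports g a b)" by (rule transports_homotopic[OF entrance_homotopic_sym[OF h] a])
  then show ?thesis unfolding monodromy_def g_def .
qed

lemma monodromy_eqI:
  assumes "entrance_path X S x y \<gamma>" "a \<in> E x" "transports \<gamma> a b"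
  shows "monodromy x y (entrance_class X S x y \<gamma>) a = b"
  by (rule transports_unique[OF assms(1) transports_monodromy[OF assms(1,2)] assms(3)])

lemma transports_closed:
  assumes "entrance_path X S x y \<gamma>" "a \<in> E x" "transports \<gamma> a b"
  shows "b \<in> E y"
proof -
  obtain b' where "b' \<in> E y" "transports \<gamma> a b'" by (rule transports_exists[OF assms(1,2)])
  then show ?thesis using transports_unique[OF assms(1,3)] by simp
qed

lemma monodromy_representation: "vect_representation (entrance_category X S) K (costalk X F) monodromy"
  unfolding vect_representation_def entrance_category_simps
proof (intro conjI ballI)
  show "is_category (entrance_category X S)" by (rule is_category_entrance[OF decomp])
next
  fix x assume "x \<in> topspace X"
  then show "vspace K (costalk X F x)" "fin_dim K (costalk X F x)" using vspace_E fin by auto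
next
  fix x y f assume "f \<in> entrance_class X S x y ` {\<gamma>. entrance_path X S x y \<gamma>}"
  then obtain \<gamma> where \<gamma>: "entrance_path X S x y \<gamma>" "f = entrance_class X S x y \<gamma>" by blast
  interpret M: module K "costalk X F x" by (rule vspace_module[OF vspace_E])
  show "linear_map K (costalk X F x) (costalk X F y) (monodromy x y f)"
    unfolding linear_map_def \<gamma>(2)
  proof (intro conjI ballI)
    note tr = transports_monodromy[OF \<gamma>(1)]
    show "monodromy x y (entrance_class X S x y \<gamma>) \<in> E x \<rightarrow> E y"
      using transports_closed[OF \<gamma>(1) _ tr] by blast
    fix v assume v: "v \<in> E x"
    show "monodromy x y (entrance_class X S x y \<gamma>) (v \<oplus>\<^bsub>costalk X F x\<^esub> w) =
      monodromy x y (entrance_class X S x y \<gamma>) v \<oplus>\<^bsub>costalk X F y\<^esub> monodromy x y (entrance_class X S x y \<gamma>) w"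
      if w: "w \<in> E x" for w
      by (rule monodromy_eqI[OF \<gamma>(1) M.M.a_closed[OF v w] transports_add[OF \<gamma>(1) tr[OF v] tr[OF w]]])
    show "monodromy x y (entrance_class X S x y \<gamma>) (a \<odot>\<^bsub>costalk X F x\<^esub> v) =
      a \<odot>\<^bsub>costalk X F y\<^esub> monodromy x y (entrance_class X S x y \<gamma>) v" if a: "a \<in> carrier K" for a
      by (rule monodromy_eqI[OF \<gamma>(1) M.smult_closed[OF a v] transports_smult[OF \<gamma>(1) tr[OF v] a]])
  qed
next
  fix x v assume "x \<in> topspace X" "v \<in> E x"
  then show "monodromy x x (entrance_class X S x x (\<lambda>t. x)) v = v"
    using monodromy_eqI[OF entrance_path_const[OF _ decomp] _ transports_const] by blast
next
  fix x y z f g v assume "f \<in> entrance_class X S x y ` {\<gamma>. entrance_path X S x y \<gamma>}"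
    "g \<in> entrance_class X S y z ` {\<gamma>. entrance_path X S y z \<gamma>}" and v: "v \<in> E x"
  then obtain \<gamma> \<delta> where p: "entrance_path X S x y \<gamma>" "entrance_path X S y z \<delta>"
    and e: "f = entrance_class X S x y \<gamma>" "g = entrance_class X S y z \<delta>" by blast
  note t1 = transports_monodromy[OF p(1) v]
  note t2 = transports_monodromy[OF p(2) transports_closed[OF p(1) v t1]]
  show "monodromy x z (Cmp (entrance_category X S) f g) v = monodromy y z g (monodromy x y f v)"
    unfolding e entrance_Cmp[OF decomp p]
    by (rule monodromy_eqI[OF entrance_path_concat[OF decomp p] v transports_concat[OF p t1 t2]])
qed

lemma monodromy_induced: "induced_by_cosheaf X S F monodromy"
  unfolding induced_by_cosheaf_def
proof (intro allI impI ballI; elim conjE)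
  fix x y \<gamma> U s assume "entrance_path X S x y \<gamma>" "openin X U" "\<gamma> ` {0..1} \<subseteq> U" and s: "s \<in> E x"
  then show "monodromy x y (entrance_class X S x y \<gamma>) s U = s U"
    using transports_within[OF _ transports_monodromy] by blast
qed

text \<open>The images of an element under the initial segments of a path form a flat family.\<close>

lemma representation_transports:
  assumes rep: "vect_representation (entrance_category X S) K (costalk X F) \<rho>"
    and ind: "induced_by_cosheaf X S F \<rho>"
    and \<gamma>: "entrance_path X S x y \<gamma>" and a: "a \<in> E x"
  shows "transports \<gamma> a (\<rho> x y (entrance_class X S x y \<gamma>) a)"
proof -
  note r = rep[unfolded vect_representation_def entrance_category_simps]
  have e: "\<gamma> 0 = x" "\<gamma> 1 = y" using \<gamma> unfolding entrance_path_def by auto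
  have top: "\<gamma> t \<in> topspace X" if "t \<in> {0..1}" for t by (rule entrance_pathD(4)[OF \<gamma> that])
  let ?c = "\<lambda>c d. entrance_class X S (\<gamma> c) (\<gamma> d) (path_segment c d \<gamma>)"
  let ?q = "\<lambda>t. \<rho> x (\<gamma> t) (?c 0 t) a"
  have lin: "linear_map K (costalk X F u) (costalk X F v) (\<rho> u v (entrance_class X S u v \<delta>))"
    if "u \<in> topspace X" "v \<in> topspace X" "entrance_path X S u v \<delta>" for u v \<delta>
    using r that by blast
  have qE: "?q t \<in> E (\<gamma> t)" if t: "t \<in> {0..1}" for t
  proof -
    have "entrance_path X S x (\<gamma> t) (path_segment 0 t \<gamma>)" using entrance_path_segment[OF \<gamma>, of 0 t] t e by auto
    from linear_map_closed[OF lin[OF _ top[OF t] this] a] show ?thesis using top[of 0] e by simp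
  qed
  \<comment> \<open>Functoriality of \<rho>, since the segment from 0 to d is homotopic to the
    concatenation of its parts up to c and from c on.\<close>
  have step: "?q d = \<rho> (\<gamma> c) (\<gamma> d) (?c c d) (?q c)" if cd: "0 \<le> c" "c \<le> d" "d \<le> 1" for c d
  proof -
    have p: "entrance_path X S x (\<gamma> c) (path_segment 0 c \<gamma>)" "entrance_path X S (\<gamma> c) (\<gamma> d) (path_segment c d \<gamma>)"
      using entrance_path_segment[OF \<gamma>, of 0 c] entrance_path_segment[OF \<gamma>, of c d] cd e by auto
    have "?c 0 d = entrance_class X S (\<gamma> 0) (\<gamma> d) (concat_path (path_segment 0 c \<gamma>) (path_segment c d \<gamma>))"
      by (rule entrance_class_eq[OF segment_concat_homotopic[OF \<gamma> order_refl cd], symmetric])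
    also have "\<dots> = Cmp (entrance_category X S) (?c 0 c) (?c c d)"
      using entrance_Cmp[OF decomp p] e by simp
    finally have "\<rho> x (\<gamma> d) (?c 0 d) a = \<rho> x (\<gamma> d) (Cmp (entrance_category X S) (?c 0 c) (?c c d)) a" by simp
    also have "\<dots> = \<rho> (\<gamma> c) (\<gamma> d) (?c c d) (\<rho> x (\<gamma> c) (?c 0 c) a)"
    proof -
      have h: "?c 0 c \<in> entrance_class X S x (\<gamma> c) ` {\<delta>. entrance_path X S x (\<gamma> c) \<delta>}"
        "?c c d \<in> entrance_class X S (\<gamma> c) (\<gamma> d) ` {\<delta>. entrance_path X S (\<gamma> c) (\<gamma> d) \<delta>}"
        using p e by auto
      have t: "x \<in> topspace X" "\<gamma> c \<in> topspace X" "\<gamma> d \<in> topspace X" using top[of 0] top[of c] top[of d] cd e by auto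
      show ?thesis
        using r t h a by blast
    qed
    finally show ?thesis .
  qed
  \<comment> \<open>On a segment inside U the compatibility of \<rho> with the projections makes the
    value in U constant, which is the flatness of the family.\<close>
  have within: "?q d U = ?q c U" if cd: "0 \<le> c" "c \<le> d" "d \<le> 1" and U: "openin X U" "\<gamma> ` {c..d} \<subseteq> U" for c d U
  proof -
    have p: "entrance_path X S (\<gamma> c) (\<gamma> d) (path_segment c d \<gamma>)" using entrance_path_segment[OF \<gamma> cd] .
    have "path_segment c d \<gamma> ` {0..1} \<subseteq> U"
    proof
      fix z assume "z \<in> path_segment c d \<gamma> ` {0..1}"
      then obtain u where "u \<in> {0..1}" "z = path_segment c d \<gamma> u" by blast
      then have u: "0 \<le> u" "u \<le> 1" "z = \<gamma> (c + (d - c) * u)" unfolding path_segment_def by auto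
      have "(d - c) * u \<le> (d - c) * 1" using cd u by (intro mult_left_mono) auto
      then have "c + (d - c) * u \<in> {c..d}" using cd u by auto
      then show "z \<in> U" using U(2) u(3) by blast
    qed
    then have "\<rho> (\<gamma> c) (\<gamma> d) (?c c d) (?q c) U = ?q c U"
      using ind p U(1) qE[of c] cd unfolding induced_by_cosheaf_def by auto
    then show ?thesis unfolding step[OF cd] .
  qed
  have "flat_on \<gamma> {0..1} ?q" unfolding flat_on_def
  proof (intro conjI ballI allI impI; (elim conjE)?)
    fix t :: real assume t: "t \<in> {0..1}"
    show "?q t \<in> E (\<gamma> t)" by (rule qE[OF t])
    fix U assume U: "openin X U" "\<gamma> t \<in> U"
    obtain \<epsilon> where \<epsilon>: "\<epsilon> > 0" "\<forall>t'\<in>{0..1}. \<bar>t' - t\<bar> < \<epsilon> \<longrightarrow> \<gamma> t' \<in> U"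
      by (rule pathin_nbhd[OF entrance_pathD(1)[OF \<gamma>] t U])
    have "?q t' U = ?q t U" if t': "t' \<in> {0..1}" "\<bar>t' - t\<bar> < \<epsilon>" for t'
    proof (cases "t' \<le> t")
      case True
      have "?q t U = ?q t' U" by (rule within[OF _ True _ U(1)]) (use t t' \<epsilon>(2) in auto)
      then show ?thesis by simp
    next
      case False
      then have "t \<le> t'" by simp
      then show ?thesis by (rule within[OF _ _ _ U(1), rotated]) (use t t' \<epsilon>(2) in auto)
    qed
    then show "\<exists>\<epsilon>>0. \<forall>t'\<in>{0..1}. \<bar>t' - t\<bar> < \<epsilon> \<longrightarrow> ?q t' U = ?q t U" using \<epsilon>(1) by blast
  qed
  moreover have "?q 0 = a"
  proof -
    have "path_segment 0 0 \<gamma> = (\<lambda>t. x)" using e by (simp add: path_segment_def fun_eq_iff)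
    moreover have "\<rho> x x (entrance_class X S x x (\<lambda>t. x)) a = a" using r a top[of 0] e by auto
    ultimately show ?thesis using e by simp
  qed
  moreover have "?q 1 = \<rho> x y (entrance_class X S x y \<gamma>) a"
  proof -
    have "path_segment 0 1 \<gamma> = \<gamma>" by (simp add: path_segment_def fun_eq_iff)
    then show ?thesis using e by simp
  qed
  ultimately show ?thesis unfolding transports_def by blast
qed

lemma monodromy_unique:
  assumes "vect_representation (entrance_category X S) K (costalk X F) \<rho>" "induced_by_cosheaf X S F \<rho>"
    "f \<in> Hom (entrance_category X S) x y" "s \<in> E x"
  shows "\<rho> x y f s = monodromy x y f s"
proof -
  obtain \<gamma> where \<gamma>: "entrance_path X S x y \<gamma>" "f = entrance_class X S x y \<gamma>"
    using assms(3) unfolding entrance_category_simps by blast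
  show ?thesis unfolding \<gamma>(2)
    by (rule monodromy_eqI[OF \<gamma>(1) assms(4) representation_transports[OF assms(1,2) \<gamma>(1) assms(4)], symmetric])
qed

end

text \<open>That the cosheaf determines the representation is made precise by
  \<open>induced_by_cosheaf\<close>: objects go to their costalks, and compatibility with the
  projections pins down the maps. Uniqueness is stated on the carriers, outside of which HOL
  functions are arbitrary.\<close>

theorem theorem11p2p16:
  fixes X :: "'x topology" and S :: "('i, 'x) stratification"
    and K :: "'k ring" and F :: "('x, 'k, 'v) open_diagram"
  assumes "Ring.field K"
    and "thom_mather X S"
    and "cosheaf X K F"
    and "\<forall>x\<in>topspace X. fin_dim K (costalk X F x)"
    and "constructible_cosheaf X S K F"
  shows "\<exists>\<rho>. vect_representation (entrance_category X S) K (costalk X F) \<rho> \<and>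
           induced_by_cosheaf X S F \<rho> \<and>
           (\<forall>\<rho>'. vect_representation (entrance_category X S) K (costalk X F) \<rho>' \<and>
              induced_by_cosheaf X S F \<rho>' \<longrightarrow>
              (\<forall>x\<in>topspace X. \<forall>y\<in>topspace X. \<forall>f\<in>Hom (entrance_category X S) x y.
                 \<forall>s\<in>carrier (costalk X F x). \<rho>' x y f s = \<rho> x y f s))"
proof -
  interpret constructible_cosheaf_on_strata X S K F
    by (rule constructible_cosheaf_on_strata.intro[OF assms(1-3)])
      (use assms(4,5) in \<open>simp_all add: constructible_cosheaf_def constructible_sheaf_def\<close>)
  show ?thesis
    by (intro exI[of _ monodromy] conjI allI impI ballI monodromy_representation monodromy_induced; (elim conjE)?;
        rule monodromy_unique)
qed

end
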